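(* Let $\gamma\in\mathbb{R}$ and let $V\in C^\infty([0,\infty))$ be real-valued with $\int_0^\infty(1+x)|V(x)|\,dx<\infty$ and such that for some $\rho\in(1,2]$ and constants $C_j$ one has $|V^{(j)}(x)|\le C_j(1+x)^{-\rho-j}$ for all $x\ge0$ and $j=0,1,2,\dots$. Let $\lambda_1,\dots,\lambda_N$ be the negative eigenvalues of the operator $H=-\frac{d^2}{dx^2}+V$ in $L_2(0,\infty)$ with boundary condition $u'(0)=\gamma u(0)$, and let $a(k)$, $\eta(k)$ be the limit amplitude and limit phase. Then $$\sum_{j=1}^N|\lambda_j|^{1/2}-M_{1/2}(\gamma)-\frac1\pi\int_0^\infty\ln a(k)\,dk=-\frac14\int_0^\infty V(x)\,dx,$$ $$\sum_{j=1}^N|\lambda_j|-M_1(\gamma)-\frac2\pi\int_0^\infty\Big(\eta(k)-\frac{\int_0^\infty V(x)\,dx}{2k}\Big)k\,dk=-\frac14V(0),$$ $$\sum_{j=1}^N|\lambda_j|^{3/2}-M_{3/2}(\gamma)+\frac3\pi\int_0^\infty\Big(\ln a(k)+\frac{V(0)}{(2k)^2}\Big)k^2\,dk=\frac3{16}\Big(\int_0^\infty V^2(x)\,dx-V'(0)+4\gamma V(0)\Big),$$ $$\sum_{j=1}^N|\lambda_j|^2-M_2(\gamma)+\frac4\pi\int_0^\infty\Big(\eta(k)-\frac{\int_0^\infty V(x)\,dx}{2k}-\frac{\int_0^\infty V^2(x)\,dx+4\gamma V(0)-V'(0)}{(2k)^3}\Big)k^3\,dk=-\frac18\ell_4,$$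 where $\ell_4=V''(0)+8\gamma^2V(0)-4\gamma V'(0)-2V^2(0)$.
   Context: The operator $H$ is defined through the quadratic form $\int_0^\infty(|u'|^2+V|u|^2)\,dx+\gamma|u(0)|^2$ with form domain $H^1(0,\infty)$; under the moment condition it has only finitely many ($N$) negative eigenvalues. For $\zeta\neq0$, $\operatorname{Im}\zeta\ge0$, the Jost solution $\theta(x,\zeta)$ is the unique solution of $-u''+Vu=\zeta^2u$ on $x>0$ with $\theta(x,\zeta)=e^{i\zeta x}(1+o(1))$, $\theta'(x,\zeta)=i\zeta e^{i\zeta x}(1+o(1))$ as $x\to\infty$ (prime $=d/dx$). The Jost function is $w(\zeta)=\gamma\theta(0,\zeta)-\theta'(0,\zeta)$; it does not vanish at real $k>0$ and $w(\zeta)/(\gamma-i\zeta)\to1$ as $|\zeta|\to\infty$. The limit amplitude $a(k)>0$ and limit phase $\eta(k)\in\mathbb{R}$, $k>0$, are defined by $w(k)=a(k)e^{i\eta(k)}(\gamma-ik)$, i.e. $a(k)=|w(k)|/\sqrt{\gamma^2+k^2}$, where $\eta$ is the continuous branch on $(0,\infty)$ with $\eta(k)\to0$ as $k\to\infty$. For $s\in\mathbb{C}$ set $M_s(\gamma)=(-\gamma)^{2s}$ if $\gamma<0$ and $M_s(\gamma)=0$ if $\gamma\ge0$. *)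

theory Defs
  imports "HOL-Analysis.Analysis"
begin

text \<open>
  Functions on the half-line \<open>[0,\<infinity>)\<close> are represented by functions on \<open>real\<close>; their values
  at negative arguments are irrelevant. Accordingly, derivatives are taken within \<open>[0,\<infinity>)\<close>,
  i.e. they are one-sided at \<open>0\<close>.
\<close>

definition hderiv :: "(real \<Rightarrow> 'a::real_normed_vector) \<Rightarrow> real \<Rightarrow> 'a" where
  "hderiv f x = vector_derivative f (at x within {0..})"

definition smooth_half_line :: "(real \<Rightarrow> 'a::real_normed_vector) \<Rightarrow> bool" where
  "smooth_half_line f \<longleftrightarrow>
     (\<forall>j. \<forall>x\<ge>0. (hderiv ^^ j) f differentiable (at x within {0..}))"


subsection \<open>The operator \<open>H\<close>\<close>

definition L2_half :: "(real \<Rightarrow> complex) set" where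
  "L2_half = {u. set_borel_measurable lborel {0<..} u \<and>
                 set_integrable lborel {0<..} (\<lambda>x. (cmod (u x))\<^sup>2)}"

text \<open>
  The Sobolev space \<open>H\<^sup>1(0,\<infinity>)\<close>, through the absolutely continuous representatives, for which
  \<open>u 0\<close> is meaningful; \<open>g\<close> is the derivative of \<open>u\<close>, which is unique almost everywhere.
\<close>

definition H1_deriv :: "(real \<Rightarrow> complex) \<Rightarrow> (real \<Rightarrow> complex) \<Rightarrow> bool" where
  "H1_deriv u g \<longleftrightarrow> u \<in> L2_half \<and> g \<in> L2_half \<and>
     (\<forall>x\<ge>0. u x = u 0 + (LINT t:{0..x}|lborel. g t))"

definition H1_half :: "(real \<Rightarrow> complex) set" where
  "H1_half = {u. \<exists>g. H1_deriv u g}"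

definition weak_deriv :: "(real \<Rightarrow> complex) \<Rightarrow> real \<Rightarrow> complex" where
  "weak_deriv u = (SOME g. H1_deriv u g)"

text \<open>
  The sesquilinear form whose diagonal is
  \<open>\<integral>(\<bar>u'\<bar>\<^sup>2 + V \<bar>u\<bar>\<^sup>2) dx + \<gamma> \<bar>u(0)\<bar>\<^sup>2\<close>, with form domain \<^const>\<open>H1_half\<close>.
\<close>

definition H_form ::
    "(real \<Rightarrow> real) \<Rightarrow> real \<Rightarrow> (real \<Rightarrow> complex) \<Rightarrow> (real \<Rightarrow> complex) \<Rightarrow> complex" where
  "H_form V \<gamma> u v =
     (LINT x:{0<..}|lborel. weak_deriv u x * cnj (weak_deriv v x)
                            + of_real (V x) * u x * cnj (v x))
     + of_real \<gamma> * u 0 * cnj (v 0)"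

text \<open>
  The graph of the operator associated with the form (first representation theorem). The boundary
  condition \<open>u'(0) = \<gamma> u(0)\<close> is the natural one and need not be imposed.
\<close>

definition H_graph ::
    "(real \<Rightarrow> real) \<Rightarrow> real \<Rightarrow> ((real \<Rightarrow> complex) \<times> (real \<Rightarrow> complex)) set" where
  "H_graph V \<gamma> = {(u, f). u \<in> H1_half \<and> f \<in> L2_half \<and>
     (\<forall>v\<in>H1_half. H_form V \<gamma> u v = (LINT x:{0<..}|lborel. f x * cnj (v x)))}"

definition H_eigenvalue :: "(real \<Rightarrow> real) \<Rightarrow> real \<Rightarrow> real \<Rightarrow> bool" where
  "H_eigenvalue V \<gamma> \<mu> \<longleftrightarrow>
     (\<exists>u. (u, \<lambda>x. of_real \<mu> * u x) \<in> H_graph V \<gamma> \<and> \<not> (AE x in lborel. 0 < x \<longrightarrow> u x = 0))"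

text \<open>A set suffices, with no multiplicities: every eigenvalue of \<open>H\<close> is simple.\<close>

definition neg_eigenvalues :: "(real \<Rightarrow> real) \<Rightarrow> real \<Rightarrow> real set" where
  "neg_eigenvalues V \<gamma> = {\<mu>. \<mu> < 0 \<and> H_eigenvalue V \<gamma> \<mu>}"


subsection \<open>Jost solution, limit amplitude and limit phase\<close>

text \<open>
  For \<open>V\<close> continuous on \<open>[0,\<infinity>)\<close> a solution on \<open>x > 0\<close> extends uniquely to a solution on
  \<open>x \<ge> 0\<close>, so that the values at \<open>0\<close> below are the boundary values of the solution on \<open>x > 0\<close>.
\<close>

definition is_jost_solution ::
    "(real \<Rightarrow> real) \<Rightarrow> complex \<Rightarrow> (real \<Rightarrow> complex) \<Rightarrow> bool" where
  "is_jost_solution V \<zeta> u \<longleftrightarrow>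
     (\<forall>x\<ge>0. u differentiable (at x within {0..}) \<and>
            hderiv u differentiable (at x within {0..}) \<and>
            - hderiv (hderiv u) x + of_real (V x) * u x = \<zeta>\<^sup>2 * u x) \<and>
     ((\<lambda>x. u x / exp (\<i> * \<zeta> * of_real x)) \<longlongrightarrow> 1) at_top \<and>
     ((\<lambda>x. hderiv u x / (\<i> * \<zeta> * exp (\<i> * \<zeta> * of_real x))) \<longlongrightarrow> 1) at_top"

text \<open>
  Meaningful for \<open>\<zeta> \<noteq> 0\<close>, \<open>Im \<zeta> \<ge> 0\<close>. The vanishing for negative arguments only makes the function
  on \<open>real\<close> unique; likewise for \<open>k \<le> 0\<close> in \<open>limit_phase\<close>.
\<close>

definition jost_solution :: "(real \<Rightarrow> real) \<Rightarrow> complex \<Rightarrow> real \<Rightarrow> complex" where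
  "jost_solution V \<zeta> = (THE u. is_jost_solution V \<zeta> u \<and> (\<forall>x<0. u x = 0))"

definition jost_function :: "(real \<Rightarrow> real) \<Rightarrow> real \<Rightarrow> complex \<Rightarrow> complex" where
  "jost_function V \<gamma> \<zeta> =
     of_real \<gamma> * jost_solution V \<zeta> 0 - hderiv (jost_solution V \<zeta>) 0"

definition limit_amplitude :: "(real \<Rightarrow> real) \<Rightarrow> real \<Rightarrow> real \<Rightarrow> real" where
  "limit_amplitude V \<gamma> k = cmod (jost_function V \<gamma> (of_real k)) / sqrt (\<gamma>\<^sup>2 + k\<^sup>2)"

definition is_limit_phase :: "(real \<Rightarrow> real) \<Rightarrow> real \<Rightarrow> (real \<Rightarrow> real) \<Rightarrow> bool" where
  "is_limit_phase V \<gamma> \<eta> \<longleftrightarrow>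
     continuous_on {0<..} \<eta> \<and> (\<eta> \<longlongrightarrow> 0) at_top \<and>
     (\<forall>k>0. jost_function V \<gamma> (of_real k) =
        of_real (limit_amplitude V \<gamma> k) * exp (\<i> * of_real (\<eta> k)) * (of_real \<gamma> - \<i> * of_real k))"

definition limit_phase :: "(real \<Rightarrow> real) \<Rightarrow> real \<Rightarrow> real \<Rightarrow> real" where
  "limit_phase V \<gamma> = (THE \<eta>. is_limit_phase V \<gamma> \<eta> \<and> (\<forall>k\<le>0. \<eta> k = 0))"

text \<open>Polymorphic, so as to cover both complex and real \<open>s\<close>.\<close>

definition M_term :: "'a::ln \<Rightarrow> real \<Rightarrow> 'a" where
  "M_term s \<gamma> = (if \<gamma> < 0 then of_real (- \<gamma>) powr (2 * s) else 0)"

end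

theory Submission
  imports Defs "HOL-Complex_Analysis.Complex_Analysis" "HOL-Real_Asymp.Real_Asymp"
begin

text \<open>
  Let \<open>E\<close> be the Jost function \<open>w\<close> divided by \<open>\<bar>\<gamma>\<bar> - \<i> \<zeta>\<close> and by the Blaschke product over its zeros
  \<open>\<i> \<kappa>\<close> in the upper half plane; these zeros are simple and correspond to the eigenvalues \<open>- \<kappa>\<^sup>2\<close>.
  Then \<open>log E\<close> is holomorphic in the upper half plane, has at most a logarithmic singularity at \<open>0\<close>, and
  a WKB comparison gives its asymptotic expansion in powers of \<open>1 / \<zeta>\<close>, whose coefficients involve
  \<open>V\<close> and the moments of the zeros. Cauchy's theorem for \<open>\<zeta>\<^sup>n log E(\<zeta>)\<close> on large half discs turns these
  coefficients into integrals of \<open>log E\<close> over the half-line. On the real axis the Blaschke factors have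
  modulus \<open>1\<close> and phase \<open>2 arctan (\<kappa> / k)\<close>, and the integrals of these phases supply the missing powers
  of the eigenvalues.
\<close>

section \<open>Integrals over half-lines\<close>

text \<open>The point \<zeta> = 0 shapes the proof: w may vanish there, and so does \<gamma> - \<i>
  \<zeta> if \<gamma> = 0. No expansion of w at 0 is used; a rough control suffices, namely a linear
  lower bound for |w| and a bounded argument of w. Both, as well as the position and the simplicity
  of the zeros, come from one source, the Lagrange identity for the Wronskian of two Jost solutions:
  it expresses w through an integral of their product, which can be bounded from below. At infinity
  all factors are compared multiplicatively with 1 + O(1 / |\<zeta>|^5), and the logarithm is taken
  only once, normalised to vanish at infinity. The logarithm of a Blaschke factor is odd in 1 /
  \<zeta>, so only the odd coefficients of the expansion contain moments of the zeros; these yield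
  the eigenvalue sums of order 1/2 and 3/2. The sums of order 1 and 2 come from the integrated
  phases alone.\<close>

lemma set_integrable_continuous_bound:
  fixes f :: "real \<Rightarrow> 'a::euclidean_space" and g :: "real \<Rightarrow> real"
  assumes "continuous_on A f" "A \<in> sets borel" "set_integrable lborel A g"
    and "\<And>x. x \<in> A \<Longrightarrow> norm (f x) \<le> g x"
  shows "set_integrable lborel A f"
proof -
  have "set_borel_measurable lborel A f"
    unfolding set_borel_measurable_def using borel_measurable_continuous_on_indicator[OF assms(2,1)] by simp
  then show ?thesis
    by (rule set_integrable_bound[OF assms(3)]) (use assms(4) in \<open>auto intro!: AE_I2 order_trans[OF _ abs_ge_self]\<close>)
qed

lemma set_integrable_continuous_extend:
  fixes f :: "real \<Rightarrow> 'a::euclidean_space"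
  assumes "continuous_on UNIV f" "set_integrable lborel {a..} f"
  shows "set_integrable lborel {b..} f"
proof -
  have "set_integrable lborel ({b..a} \<union> {a..}) f"
    by (intro set_integrable_Un assms borel_integrable_atLeastAtMost')
      (auto intro: continuous_on_subset[OF assms(1)])
  then show ?thesis
    by (rule set_integrable_subset) auto
qed

lemma set_integral_norm_le:
  fixes f :: "'b \<Rightarrow> 'a::{banach,second_countable_topology}" and g :: "'b \<Rightarrow> real"
  assumes "set_integrable M A f" "set_integrable M A g" "\<And>x. x \<in> A \<Longrightarrow> norm (f x) \<le> g x"
  shows "norm (LINT x:A|M. f x) \<le> (LINT x:A|M. g x)"
proof -
  have "norm (LINT x:A|M. f x) \<le> (LINT x:A|M. norm (f x))"
    using set_integral_norm_bound[OF assms(1)] .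
  also have "\<dots> \<le> (LINT x:A|M. g x)"
    by (rule set_integral_mono) (use assms set_integrable_norm in auto)
  finally show ?thesis .
qed

lemma set_integral_FTC_atLeast:
  fixes u :: "real \<Rightarrow> 'a::euclidean_space"
  assumes u: "\<And>x. a \<le> x \<Longrightarrow> (u has_vector_derivative u' x) (at x within {a..})"
    and "continuous_on {a..} u'" "set_integrable lborel {a..} u'" "(u \<longlongrightarrow> l) at_top"
  shows "(LINT x:{a..}|lborel. u' x) = l - u a"
proof -
  have eq: "(LINT x:{a..b}|lborel. u' x) = u b - u a" if "a \<le> b" for b
  proof -
    have "set_integrable lborel {a..b} u'"
      using assms(3) by (rule set_integrable_subset) auto
    then have "(LINT x:{a..b}|lborel. u' x) = integral {a..b} u'"
      by (rule set_borel_integral_eq_integral)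
    also have "\<dots> = u b - u a"
      by (intro integral_unique fundamental_theorem_of_calculus that)
        (auto intro: has_vector_derivative_within_subset[OF u])
    finally show ?thesis .
  qed
  have "((\<lambda>b. LINT x:{a..b}|lborel. u' x) \<longlongrightarrow> (LINT x:{a..}|lborel. u' x)) at_top"
    by (intro tendsto_set_lebesgue_integral_at_top assms) auto
  moreover have "((\<lambda>b. LINT x:{a..b}|lborel. u' x) \<longlongrightarrow> l - u a) at_top"
    by (rule Lim_transform_eventually[OF tendsto_diff[OF assms(4) tendsto_const]])
      (use eq in \<open>auto intro!: eventually_mono[OF eventually_ge_at_top[of a]]\<close>)
  ultimately show ?thesis
    using tendsto_unique trivial_limit_at_top_linorder by blast
qed

text \<open>For a nonnegative integrand the limit of the antiderivative already forces
  integrability, which the signed version has to assume.\<close>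

lemma set_integral_FTC_atLeast_nonneg:
  fixes f F :: "real \<Rightarrow> real"
  assumes "continuous_on UNIV f" "\<And>x. a \<le> x \<Longrightarrow> DERIV F x :> f x"
    and "\<And>x. a \<le> x \<Longrightarrow> 0 \<le> f x" and "(F \<longlongrightarrow> T) at_top"
  shows "set_integrable lborel {a..} f" "(LINT x:{a..}|lborel. f x) = T - F a"
proof -
  have meas: "f \<in> borel_measurable borel"
    using assms(1) by (rule borel_measurable_continuous_onI)
  have "(\<integral>\<^sup>+x. ennreal (f x) * indicator {a..} x \<partial>lborel) = ennreal (T - F a)"
    by (rule nn_integral_FTC_atLeast) (use assms meas in auto)
  then have nn: "(\<integral>\<^sup>+x. ennreal (indicator {a..} x *\<^sub>R f x) \<partial>lborel) = ennreal (T - F a)"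
    by (simp add: ennreal_indicator[symmetric] ennreal_mult'' mult.commute)
  show int: "set_integrable lborel {a..} f"
    unfolding set_integrable_def
    by (rule integrableI_nonneg)
      (use meas assms(3) nn in \<open>auto split: split_indicator intro!: AE_I2\<close>)
  show "(LINT x:{a..}|lborel. f x) = T - F a"
  proof (rule set_integral_FTC_atLeast[OF _ _ int assms(4)])
    show "(F has_vector_derivative f x) (at x within {a..})" if "a \<le> x" for x
      using assms(2)[OF that]
      by (auto simp: has_real_derivative_iff_has_vector_derivative
          intro: has_vector_derivative_at_within)
  qed (use assms(1) continuous_on_subset in auto)
qed

section \<open>Tail integrals\<close>

definition tail_integral :: "(real \<Rightarrow> 'a::euclidean_space) \<Rightarrow> real \<Rightarrow> 'a" where
  "tail_integral f x = (LINT t:{x..}|lborel. f t)"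

text \<open>Near x the tail differs from the fixed integral over {x - 1..} by an integral over a
  bounded interval, to which the fundamental theorem applies. Continuity on the whole line makes the
  derivative two-sided, also at 0; this is why potentials are later continued to negative
  arguments.\<close>

lemma tail_integral_has_vector_derivative:
  fixes f :: "real \<Rightarrow> 'a::euclidean_space"
  assumes cont: "continuous_on UNIV f" and int: "\<And>x. set_integrable lborel {x..} f"
  shows "(tail_integral f has_vector_derivative - f x) (at x)"
proof -
  let ?a = "x - 1" and ?b = "x + 1"
  have cs: "continuous_on A f" for A
    using cont continuous_on_subset by blast
  have eq: "tail_integral f ?a - integral {?a..u} f = tail_integral f u" if "u \<in> {?a<..<?b}" for u
  proof -
    have s: "{?a..} = {?a..u} \<union> {u<..}" using that by auto
    have i1: "set_integrable lborel {?a..u} f" "set_integrable lborel {u<..} f"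
      using int[of ?a] that by (auto intro: set_integrable_subset)
    have "tail_integral f ?a = (LINT t:{?a..u}|lborel. f t) + (LINT t:{u<..}|lborel. f t)"
      unfolding tail_integral_def s by (rule set_integral_Un) (use i1 in auto)
    also have "(LINT t:{?a..u}|lborel. f t) = integral {?a..u} f"
      by (rule set_borel_integral_eq_integral) fact
    also have "(LINT t:{u<..}|lborel. f t) = tail_integral f u"
      unfolding tail_integral_def
    proof (rule set_integral_cong_set[symmetric])
      show "set_borel_measurable lborel {u<..} f" "set_borel_measurable lborel {u..} f"
        using i1(2) int[of u] unfolding set_integrable_def set_borel_measurable_def by auto
      show "AE x in lborel. (x \<in> {u<..}) = (x \<in> {u..})"
        using AE_lborel_singleton[of u] by eventually_elim auto
    qed
    finally show ?thesis by simp
  qed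
  have "((\<lambda>u. integral {?a..u} f) has_vector_derivative f x) (at x within {?a..?b})"
    by (rule integral_has_vector_derivative[OF cs]) auto
  then have "((\<lambda>u. integral {?a..u} f) has_vector_derivative f x) (at x)"
    by (subst (asm) at_within_Icc_at) auto
  then have "((\<lambda>u. tail_integral f ?a - integral {?a..u} f) has_vector_derivative - f x) (at x)"
    by (auto intro!: derivative_eq_intros)
  then show ?thesis
    by (rule has_vector_derivative_transform_within_open[of _ _ _ "{?a<..<?b}"]) (use eq in auto)
qed

lemma tail_integral_tendsto_0:
  fixes f :: "real \<Rightarrow> 'a::euclidean_space"
  assumes int: "\<And>x. set_integrable lborel {x..} f"
  shows "(tail_integral f \<longlongrightarrow> 0) at_top"
proof -
  let ?a = "0::real"
  have "((\<lambda>x. LINT t|lborel. indicator {x..} t *\<^sub>R f t) \<longlongrightarrow> (LINT t|(lborel::real measure). 0::'a)) at_top"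
  proof (rule integral_dominated_convergence_at_top[where w = "\<lambda>t. norm (indicator {?a..} t *\<^sub>R f t)"])
    show "integrable lborel (\<lambda>t. norm (indicator {?a..} t *\<^sub>R f t))"
      using int[of ?a] unfolding set_integrable_def by (rule integrable_norm)
    show "\<forall>\<^sub>F x in at_top. AE t in lborel. norm (indicator {x..} t *\<^sub>R f t) \<le> norm (indicator {?a..} t *\<^sub>R f t)"
      using eventually_ge_at_top[of ?a] by eventually_elim (auto split: split_indicator)
    show "AE t in lborel. ((\<lambda>x. indicator {x..} t *\<^sub>R f t) \<longlongrightarrow> 0) at_top"
    proof (rule AE_I2)
      fix t
      show "((\<lambda>x. indicator {x..} t *\<^sub>R f t) \<longlongrightarrow> 0) at_top"
        by (rule tendsto_eventually) (use eventually_gt_at_top[of t] in eventually_elim, auto)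
    qed
    show "(\<lambda>t. indicator {x..} t *\<^sub>R f t) \<in> borel_measurable lborel" for x
      using int[of x] unfolding set_integrable_def by auto
  qed auto
  then show ?thesis
    by (simp add: tail_integral_def[abs_def] set_lebesgue_integral_def)
qed

section \<open>Integrals depending on a complex parameter\<close>

lemma continuous_on_LINT_dominated:
  fixes f :: "'a::metric_space \<Rightarrow> 'b \<Rightarrow> 'c::{banach,second_countable_topology}"
  assumes "\<And>t. t \<in> space M \<Longrightarrow> continuous_on S (\<lambda>z. f z t)"
    and "\<And>z. z \<in> S \<Longrightarrow> f z \<in> borel_measurable M" "integrable M g"
    and "\<And>z t. z \<in> S \<Longrightarrow> t \<in> space M \<Longrightarrow> norm (f z t) \<le> g t"
  shows "continuous_on S (\<lambda>z. LINT t|M. f z t)"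
  unfolding continuous_on_sequentially
proof safe
  fix x a assume *: "a \<in> S" "\<forall>n. x n \<in> S" "x \<longlonglongrightarrow> a"
  show "((\<lambda>z. LINT t|M. f z t) \<circ> x) \<longlonglongrightarrow> (LINT t|M. f a t)"
    unfolding o_def
  proof (rule integral_dominated_convergence[where w = g])
    show "AE t in M. (\<lambda>n. f (x n) t) \<longlonglongrightarrow> f a t"
    proof (rule AE_I2)
      fix t assume "t \<in> space M"
      from assms(1)[OF this, unfolded continuous_on_sequentially] * show "(\<lambda>n. f (x n) t) \<longlonglongrightarrow> f a t"
        by (auto simp: o_def)
    qed
  qed (use assms * in auto)
qed

text \<open>Cauchy's inequality on discs of radius \<open>h\<close> bounds the derivative of the
  integrand by \<open>g t / h\<close>, hence also all difference quotients near \<open>a\<close>;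
  dominated convergence then exchanges derivative and integral. Measurability of the derivative is
  inherited from the difference quotients.\<close>

lemma holomorphic_on_LINT_dominated:
  fixes f :: "complex \<Rightarrow> 'b \<Rightarrow> complex"
  assumes "open S" and hol: "\<And>t. t \<in> space M \<Longrightarrow> (\<lambda>z. f z t) holomorphic_on S"
    and meas: "\<And>z. z \<in> S \<Longrightarrow> f z \<in> borel_measurable M" and g: "integrable M g"
    and bound: "\<And>z t. z \<in> S \<Longrightarrow> t \<in> space M \<Longrightarrow> norm (f z t) \<le> g t"
  shows "(\<lambda>z. LINT t|M. f z t) holomorphic_on S"
  unfolding holomorphic_on_open[OF \<open>open S\<close>]
proof
  fix a assume "a \<in> S"
  then obtain r where r: "r > 0" "cball a r \<subseteq> S"
    using \<open>open S\<close> open_contains_cball by blast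
  define h where "h = r / 2"
  have h: "h > 0" "2 * h = r" using r by (auto simp: h_def)
  have int: "integrable M (f z)" if "z \<in> S" for z
    by (rule Bochner_Integration.integrable_bound[OF g meas[OF that]])
       (use bound[OF that] in \<open>auto intro!: AE_I2 order_trans[OF _ abs_ge_self]\<close>)
  have db: "norm (deriv (\<lambda>z. f z t) z) \<le> g t / h" if "z \<in> ball a h" "t \<in> space M" for z t
  proof -
    have sub: "cball z h \<subseteq> S"
    proof
      fix y assume "y \<in> cball z h"
      then have "dist a y \<le> r" using that(1) h dist_triangle[of a y z] by auto
      then show "y \<in> S" using r by auto
    qed
    have "norm ((deriv ^^ 1) (\<lambda>z. f z t) z) \<le> fact 1 * g t / h ^ 1"
    proof (rule Cauchy_inequality)
      show "(\<lambda>z. f z t) holomorphic_on ball z h"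
        using hol[OF that(2)] sub ball_subset_cball holomorphic_on_subset by (metis order_trans)
      show "continuous_on (cball z h) (\<lambda>z. f z t)"
        using hol[OF that(2)] sub holomorphic_on_imp_continuous_on holomorphic_on_subset by blast
      show "norm (f x t) \<le> g t" if "norm (z - x) = h" for x
        using that bound sub \<open>t \<in> space M\<close> by (auto simp: dist_norm subset_iff)
    qed fact
    then show ?thesis by simp
  qed
  have lip: "norm (f z t - f a t) \<le> g t / h * norm (z - a)" if "z \<in> ball a h" "t \<in> space M" for z t
  proof (rule field_differentiable_bound[of "ball a h"])
    show "((\<lambda>z. f z t) has_field_derivative deriv (\<lambda>z. f z t) w) (at w within ball a h)"
      if "w \<in> ball a h" for w
    proof -
      have "w \<in> S" using that r h by (auto simp: subset_iff)
      then show ?thesis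
        using hol[OF \<open>t \<in> space M\<close>] \<open>open S\<close> holomorphic_derivI DERIV_subset by (metis top_greatest)
    qed
  qed (use that h db in auto)
  have "((\<lambda>z. LINT t|M. f z t) has_field_derivative (LINT t|M. deriv (\<lambda>z. f z t) a)) (at a)"
    unfolding has_field_derivative_iff tendsto_at_iff_sequentially
  proof safe
    fix X :: "nat \<Rightarrow> complex" assume X: "\<forall>i. X i \<in> UNIV - {a}" "X \<longlonglongrightarrow> a"
    then have "\<forall>\<^sub>F n in sequentially. X n \<in> ball a h"
      using h by (intro topological_tendstoD) auto
    \<comment> \<open>Only a tail of the sequence lies in the disc where the Lipschitz bound holds;
      the shift by \<open>N\<close> is undone at the end.\<close>
    then obtain N where N: "\<And>n. X (n + N) \<in> ball a h"
      by (metis eventually_sequentially le_add2)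
    have inS: "X (n + N) \<in> S" for n
      using N[of n] h r by (auto simp: subset_iff)
    have ne: "X n \<noteq> a" for n using X(1) by auto
    have lim: "(\<lambda>n. (f (X n) t - f a t) / (X n - a)) \<longlonglongrightarrow> deriv (\<lambda>z. f z t) a" if "t \<in> space M" for t
    proof -
      have "((\<lambda>z. f z t) has_field_derivative deriv (\<lambda>z. f z t) a) (at a)"
        using hol[OF that] \<open>open S\<close> \<open>a \<in> S\<close> holomorphic_derivI by blast
      then show ?thesis
        using X unfolding has_field_derivative_iff tendsto_at_iff_sequentially
        by (auto simp: o_def)
    qed
    have "(\<lambda>n. LINT t|M. (f (X (n + N)) t - f a t) / (X (n + N) - a)) \<longlonglongrightarrow> (LINT t|M. deriv (\<lambda>z. f z t) a)"
    proof (rule integral_dominated_convergence[where w = "\<lambda>t. g t / h"])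
      have m: "(\<lambda>t. (f (X (n + N)) t - f a t) / (X (n + N) - a)) \<in> borel_measurable M" for n
        using meas[OF inS[of n]] meas[OF \<open>a \<in> S\<close>] by measurable
      then show "(\<lambda>t. (f (X (n + N)) t - f a t) / (X (n + N) - a)) \<in> borel_measurable M" for n .
      show "(\<lambda>t. deriv (\<lambda>z. f z t) a) \<in> borel_measurable M"
        by (rule borel_measurable_LIMSEQ_metric[OF m]) (rule LIMSEQ_ignore_initial_segment[OF lim])
      show "AE t in M. (\<lambda>n. (f (X (n + N)) t - f a t) / (X (n + N) - a)) \<longlonglongrightarrow> deriv (\<lambda>z. f z t) a"
        by (rule AE_I2, rule LIMSEQ_ignore_initial_segment[OF lim])
      show "AE t in M. norm ((f (X (n + N)) t - f a t) / (X (n + N) - a)) \<le> g t / h" for n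
        using lip[OF N] ne[of "n + N"] by (auto intro!: AE_I2 simp: norm_divide divide_simps)
    qed (use g in auto)
    also have "(\<lambda>n. LINT t|M. (f (X (n + N)) t - f a t) / (X (n + N) - a))
        = (\<lambda>n. ((\<lambda>z. ((LINT t|M. f z t) - (LINT t|M. f a t)) / (z - a)) \<circ> X) (n + N))"
      by (simp add: Bochner_Integration.integral_diff int inS \<open>a \<in> S\<close>)
    finally show "((\<lambda>z. ((LINT t|M. f z t) - (LINT t|M. f a t)) / (z - a)) \<circ> X)
        \<longlonglongrightarrow> (LINT t|M. deriv (\<lambda>z. f z t) a)"
      by (rule LIMSEQ_offset)
  qed
  then show "\<exists>f'. ((\<lambda>z. LINT t|M. f z t) has_field_derivative f') (at a)" by blast
qed

section \<open>The Jost solution\<close>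

abbreviation "closed_uhp \<equiv> {\<zeta>::complex. 0 \<le> Im \<zeta>}"
abbreviation "open_uhp \<equiv> {\<zeta>::complex. 0 < Im \<zeta>}"

lemma open_open_uhp: "open open_uhp"
  by (rule open_halfspace_Im_gt)

lemma convex_closed_uhp: "convex closed_uhp" and convex_open_uhp: "convex open_uhp"
  using convex_halfspace_Im_ge[of 0] convex_halfspace_Im_gt[of 0] by auto

text \<open>V lives on the whole line so that derivatives are two-sided everywhere; the results
  concern its values on the half-line. The weight 1 + x makes all estimates uniform in \<zeta> down
  to \<zeta> = 0.\<close>

locale jost_potential =
  fixes V :: "real \<Rightarrow> real"
  assumes cont_V: "continuous_on UNIV V"
    and moment_V: "set_integrable lborel {0..} (\<lambda>x. (1 + x) * \<bar>V x\<bar>)"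
begin

lemma cont_V' [continuous_intros]:
  "continuous_on A f \<Longrightarrow> continuous_on A (\<lambda>x. V (f x))"
  by (rule continuous_on_compose2[OF cont_V]) auto

lemma int_abs_V: "set_integrable lborel {x..} (\<lambda>t. \<bar>V t\<bar>)"
  and int_t_abs_V: "set_integrable lborel {x..} (\<lambda>t. t * \<bar>V t\<bar>)"
proof -
  have *: "\<bar>V t\<bar> \<le> (1 + t) * \<bar>V t\<bar>" "\<bar>t * \<bar>V t\<bar>\<bar> \<le> (1 + t) * \<bar>V t\<bar>" if "0 \<le> t" for t
    using that by (auto simp: algebra_simps abs_mult)
  have "set_integrable lborel {0..} (\<lambda>t. \<bar>V t\<bar>)"
    "set_integrable lborel {0..} (\<lambda>t. t * \<bar>V t\<bar>)"
    by (rule set_integrable_continuous_bound[OF _ _ moment_V]; use * in \<open>force intro!: continuous_intros\<close>)+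
  then show "set_integrable lborel {x..} (\<lambda>t. \<bar>V t\<bar>)"
    "set_integrable lborel {x..} (\<lambda>t. t * \<bar>V t\<bar>)"
    by (auto intro!: set_integrable_continuous_extend[where a = 0] continuous_intros)
qed

definition tailV :: "real \<Rightarrow> real" where
  "tailV = tail_integral (\<lambda>t. \<bar>V t\<bar>)"

text \<open>This is the integral of (t - x) |V t| over t \<ge> x. Split into two tails, its
  derivative is seen to be \<open>- tailV\<close>.\<close>

definition moment1 :: "real \<Rightarrow> real" where
  "moment1 x = tail_integral (\<lambda>t. t * \<bar>V t\<bar>) x - x * tailV x"

text \<open>A norm in which the integral operator of the Jost equation contracts by the factor \<open>1/2\<close>,
  so that the Neumann series is dominated by a geometric series.\<close>

definition weight :: "real \<Rightarrow> real" where
  "weight x = exp (2 * moment1 x)"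

lemma tailV_nonneg: "0 \<le> tailV x"
  by (simp add: tailV_def tail_integral_def set_lebesgue_integral_def)

lemma DERIV_tailV: "DERIV tailV x :> - \<bar>V x\<bar>"
  unfolding tailV_def has_real_derivative_iff_has_vector_derivative
  by (rule tail_integral_has_vector_derivative) (intro continuous_intros int_abs_V)+

lemma DERIV_moment1: "DERIV moment1 x :> - tailV x"
proof -
  have "DERIV (tail_integral (\<lambda>t. t * \<bar>V t\<bar>)) x :> - (x * \<bar>V x\<bar>)"
    unfolding has_real_derivative_iff_has_vector_derivative
    by (rule tail_integral_has_vector_derivative) (intro continuous_intros int_t_abs_V)+
  from DERIV_diff[OF this DERIV_mult[OF DERIV_ident DERIV_tailV]] show ?thesis
    unfolding moment1_def[abs_def] by simp
qed

lemma cont_tailV [continuous_intros]: "continuous_on A f \<Longrightarrow> continuous_on A (\<lambda>x. tailV (f x))"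
  and cont_moment1: "continuous_on B moment1"
  by (auto intro!: continuous_on_compose2[of UNIV tailV] DERIV_continuous_on
      DERIV_subset[OF DERIV_tailV] DERIV_subset[OF DERIV_moment1])

lemma moment1_nonneg: "0 \<le> moment1 x"
proof -
  have "moment1 x = (LINT t:{x..}|lborel. (t - x) * \<bar>V t\<bar>)"
    unfolding moment1_def tailV_def tail_integral_def left_diff_distrib
    using int_t_abs_V[of x] int_abs_V[of x] by (simp add: set_integral_diff)
  also have "\<dots> \<ge> 0"
    by (auto simp: set_lebesgue_integral_def intro!: integral_nonneg_AE AE_I2 split: split_indicator)
  finally show ?thesis .
qed

lemma moment1_tendsto_0: "(moment1 \<longlongrightarrow> 0) at_top"
proof (rule tendsto_sandwich[where f = "\<lambda>_. 0"])
  show "\<forall>\<^sub>F x in at_top. moment1 x \<le> tail_integral (\<lambda>t. t * \<bar>V t\<bar>) x"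
    using eventually_ge_at_top[of 0] by eventually_elim (simp add: moment1_def tailV_nonneg)
  show "(tail_integral (\<lambda>t. t * \<bar>V t\<bar>) \<longlongrightarrow> 0) at_top"
    by (rule tail_integral_tendsto_0[OF int_t_abs_V])
qed (use moment1_nonneg in auto)

lemma moment1_antimono: "x \<le> y \<Longrightarrow> moment1 y \<le> moment1 x"
  by (rule DERIV_nonpos_imp_nonincreasing) (use DERIV_moment1 tailV_nonneg in \<open>auto intro!: exI\<close>)

lemma tailV_antimono: "x \<le> y \<Longrightarrow> tailV y \<le> tailV x"
  by (rule DERIV_nonpos_imp_nonincreasing) (use DERIV_tailV in \<open>auto intro!: exI\<close>)

lemma weight_antimono: "x \<le> y \<Longrightarrow> weight y \<le> weight x"
  by (simp add: weight_def moment1_antimono)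

lemma weight_ge_1: "1 \<le> weight x" and weight_pos: "0 < weight x"
  by (simp_all add: weight_def moment1_nonneg)

lemma weight_tendsto: "(weight \<longlongrightarrow> 1) at_top"
proof -
  have "((\<lambda>x. exp (2 * moment1 x)) \<longlongrightarrow> exp (2 * 0)) at_top"
    by (intro tendsto_intros moment1_tendsto_0)
  then show ?thesis by (simp add: weight_def[abs_def])
qed

lemma cont_weight [continuous_intros]: "continuous_on A f \<Longrightarrow> continuous_on A (\<lambda>x. weight (f x))"
  unfolding weight_def
  by (intro continuous_intros continuous_on_compose2[OF cont_moment1]) auto

text \<open>The factor 2 in the exponent of \<open>weight\<close> is spent here: - weight / 2 is an
  antiderivative of weight times \<open>tailV\<close>, and this 1/2 becomes the contraction factor
  of the integral operator.\<close>

lemma weight_tailV: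
  "set_integrable lborel {x..} (\<lambda>t. weight t * tailV t)"
  "tail_integral (\<lambda>t. weight t * tailV t) x = (weight x - 1) / 2"
proof -
  have d: "DERIV (\<lambda>t. - weight t / 2) t :> weight t * tailV t" for t
    unfolding weight_def by (auto intro!: derivative_eq_intros DERIV_moment1)
  have l: "((\<lambda>t. - weight t / 2) \<longlongrightarrow> - 1 / 2) at_top"
    by (intro tendsto_intros weight_tendsto) auto
  have c: "continuous_on UNIV (\<lambda>t. weight t * tailV t)"
    by (intro continuous_intros)
  have nn: "0 \<le> weight t * tailV t" for t
    using weight_pos[of t] tailV_nonneg[of t] by simp
  show "set_integrable lborel {x..} (\<lambda>t. weight t * tailV t)"
    by (rule set_integral_FTC_atLeast_nonneg(1)[OF c d nn l])
  show "tail_integral (\<lambda>t. weight t * tailV t) x = (weight x - 1) / 2"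
    unfolding tail_integral_def set_integral_FTC_atLeast_nonneg(2)[OF c d nn l]
    by (simp add: field_simps)
qed

lemma int_V_weight: "set_integrable lborel {x..} (\<lambda>t. \<bar>V t\<bar> * (c * weight t))"
proof (rule set_integrable_continuous_bound)
  show "set_integrable lborel {x..} (\<lambda>t. \<bar>V t\<bar> * (\<bar>c\<bar> * weight x))"
    using int_abs_V by simp
  show "norm (\<bar>V t\<bar> * (c * weight t)) \<le> \<bar>V t\<bar> * (\<bar>c\<bar> * weight x)" if "t \<in> {x..}" for t
    using weight_antimono[of x t] weight_pos[of t] that
    by (auto simp: abs_mult intro!: mult_left_mono)
qed (auto intro!: continuous_intros)

lemma tail_V_weight_le:
  assumes "0 \<le> c"
  shows "tail_integral (\<lambda>t. \<bar>V t\<bar> * (c * weight t)) x \<le> c * weight x * tailV x"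
proof -
  have "tail_integral (\<lambda>t. \<bar>V t\<bar> * (c * weight t)) x \<le> tail_integral (\<lambda>t. \<bar>V t\<bar> * (c * weight x)) x"
    unfolding tail_integral_def
    by (rule set_integral_mono[OF int_V_weight])
      (use int_abs_V weight_antimono assms in \<open>auto intro!: mult_left_mono\<close>)
  also have "\<dots> = c * weight x * tailV x"
    by (simp add: tail_integral_def tailV_def set_integral_mult_left)
  finally show ?thesis .
qed

section \<open>The integral operators of the Jost equation and their Neumann series\<close>

definition weighted :: "real \<Rightarrow> (real \<Rightarrow> complex) \<Rightarrow> bool" where
  "weighted c f \<longleftrightarrow> 0 \<le> c \<and> continuous_on UNIV f \<and> (\<forall>t. norm (f t) \<le> c * weight t)"

text \<open>For u = exp(\<i> \<zeta> x) m the equation reads m'' + 2 \<i> \<zeta> m' = V m.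
  \<open>Kp\<close> recovers m' from m, and \<open>Km\<close> integrates once more, both from
  infinity. Two successive integrations avoid the kernel (exp(2 \<i> \<zeta> (t - x)) - 1) / (2 \<i>
  \<zeta>) with its division by \<zeta>, so \<zeta> = 0 is included without a separate
  argument.\<close>

definition Kp :: "complex \<Rightarrow> (real \<Rightarrow> complex) \<Rightarrow> real \<Rightarrow> complex" where
  "Kp \<zeta> f s = - tail_integral (\<lambda>t. exp (2 * \<i> * \<zeta> * complex_of_real (t - s)) * V t * f t) s"

definition Km :: "complex \<Rightarrow> (real \<Rightarrow> complex) \<Rightarrow> real \<Rightarrow> complex" where
  "Km \<zeta> f x = - tail_integral (Kp \<zeta> f) x"

lemma norm_exp_le_1: "0 \<le> Im \<zeta> \<Longrightarrow> s \<le> t \<Longrightarrow> norm (exp (2 * \<i> * \<zeta> * complex_of_real (t - s))) \<le> 1"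
  by (simp add: mult_nonneg_nonneg)

lemma norm_kernel_le:
  assumes "0 \<le> Im \<zeta>" "s \<le> t" "norm (f t) \<le> c"
  shows "norm (exp (2 * \<i> * \<zeta> * complex_of_real (t - s)) * V t * f t) \<le> \<bar>V t\<bar> * c"
proof -
  have "norm (exp (2 * \<i> * \<zeta> * complex_of_real (t - s)) * V t * f t) \<le> 1 * \<bar>V t\<bar> * c"
    unfolding norm_mult
    by (intro mult_mono norm_exp_le_1 assms) auto
  then show ?thesis by simp
qed

context
  fixes \<zeta> :: complex and c :: real and f :: "real \<Rightarrow> complex"
  assumes Im: "0 \<le> Im \<zeta>" and f: "weighted c f"
begin

lemma int_kernel:
  "set_integrable lborel {x..} (\<lambda>t. exp (2 * \<i> * \<zeta> * complex_of_real (t - s)) * V t * f t)"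
proof -
  have *: "set_integrable lborel {s..} (\<lambda>t. exp (2 * \<i> * \<zeta> * complex_of_real (t - s)) * V t * f t)"
    by (rule set_integrable_continuous_bound[OF _ _ int_V_weight[of s c]])
      (use f Im in \<open>auto simp: weighted_def simp del: of_real_diff
         intro!: continuous_intros norm_kernel_le intro: continuous_on_subset\<close>)
  show ?thesis
    by (rule set_integrable_continuous_extend[OF _ *]) (use f in \<open>auto simp: weighted_def intro!: continuous_intros\<close>)
qed

text \<open>Splitting the exponential frees the integrand of the lower limit, so that the product
  rule applies. The first factor grows with s if Im \<zeta> > 0; the form is therefore used for
  differentiation, not for estimates.\<close>

lemma Kp_eq:
  "Kp \<zeta> f s = - exp (- 2 * \<i> * \<zeta> * s) * tail_integral (\<lambda>t. exp (2 * \<i> * \<zeta> * t) * V t * f t) s"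
proof -
  have "exp (2 * \<i> * \<zeta> * complex_of_real (t - s)) * V t * f t
      = exp (- 2 * \<i> * \<zeta> * s) * (exp (2 * \<i> * \<zeta> * t) * V t * f t)" for t
    by (simp add: exp_diff exp_minus field_simps)
  then show ?thesis
    unfolding Kp_def tail_integral_def by (simp only: set_integral_mult_right minus_mult_left)
qed

lemma Kp_has_vector_derivative:
  "(Kp \<zeta> f has_vector_derivative (V s * f s - 2 * \<i> * \<zeta> * Kp \<zeta> f s)) (at s)"
proof -
  let ?h = "\<lambda>t::real. exp (2 * \<i> * \<zeta> * t) * V t * f t"
  have T: "(tail_integral ?h has_vector_derivative - ?h s) (at s)"
    by (rule tail_integral_has_vector_derivative)
      (use int_kernel[of _ 0] f in \<open>auto simp: weighted_def intro!: continuous_intros\<close>)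
  have E: "((\<lambda>s::real. - exp (- 2 * \<i> * \<zeta> * s)) has_vector_derivative
      2 * \<i> * \<zeta> * exp (- 2 * \<i> * \<zeta> * s)) (at s)"
    by (rule has_vector_derivative_real_field) (auto intro!: derivative_eq_intros)
  have "exp (- 2 * \<i> * \<zeta> * s) * exp (2 * \<i> * \<zeta> * s) = 1"
    by (simp flip: exp_add)
  then have "exp (- 2 * \<i> * \<zeta> * s) * ?h s = V s * f s"
    by (simp add: mult.assoc[symmetric])
  then have "V s * f s - 2 * \<i> * \<zeta> * Kp \<zeta> f s
      = - exp (- 2 * \<i> * \<zeta> * s) * - ?h s + 2 * \<i> * \<zeta> * exp (- 2 * \<i> * \<zeta> * s) * tail_integral ?h s"
    unfolding Kp_eq by simp
  with has_vector_derivative_mult[OF E T] show ?thesis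
    unfolding Kp_eq[abs_def] by metis
qed

lemma cont_Kp: "continuous_on A (Kp \<zeta> f)"
  by (meson Kp_has_vector_derivative continuous_at_imp_continuous_on has_vector_derivative_continuous)

lemma norm_Kp_le: "norm (Kp \<zeta> f s) \<le> c * (weight s * tailV s)"
proof -
  have "norm (Kp \<zeta> f s) \<le> tail_integral (\<lambda>t. \<bar>V t\<bar> * (c * weight t)) s"
    unfolding Kp_def tail_integral_def norm_minus_cancel
    by (rule set_integral_norm_le[OF int_kernel int_V_weight])
      (use f Im in \<open>auto simp: weighted_def simp del: of_real_diff intro!: norm_kernel_le\<close>)
  also have "\<dots> \<le> c * (weight s * tailV s)"
    using tail_V_weight_le[of c s] f by (simp add: weighted_def mult.assoc)
  finally show ?thesis .
qed

lemma int_Kp: "set_integrable lborel {x..} (Kp \<zeta> f)"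
  by (rule set_integrable_continuous_bound[OF cont_Kp, where g = "\<lambda>s. c * (weight s * tailV s)"])
    (use weight_tailV norm_Kp_le in auto)

lemma Km_has_vector_derivative: "(Km \<zeta> f has_vector_derivative Kp \<zeta> f x) (at x)"
  using has_vector_derivative_minus[OF tail_integral_has_vector_derivative[OF cont_Kp int_Kp]]
  unfolding Km_def[abs_def] by simp

lemma norm_Km_le: "norm (Km \<zeta> f x) \<le> c * (weight x - 1) / 2"
proof -
  have "norm (Km \<zeta> f x) \<le> tail_integral (\<lambda>s. c * (weight s * tailV s)) x"
    unfolding Km_def tail_integral_def norm_minus_cancel
    by (rule set_integral_norm_le[OF int_Kp]) (use weight_tailV norm_Kp_le in auto)
  also have "\<dots> = c * (weight x - 1) / 2"
    using weight_tailV(2)[of x] by (simp add: tail_integral_def)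
  finally show ?thesis .
qed

lemma weighted_Km: "weighted (c / 2) (Km \<zeta> f)"
proof -
  have "norm (Km \<zeta> f x) \<le> c / 2 * weight x" for x
  proof (rule order_trans[OF norm_Km_le])
    show "c * (weight x - 1) / 2 \<le> c / 2 * weight x"
      using f by (simp add: weighted_def field_simps)
  qed
  moreover have "continuous_on UNIV (Km \<zeta> f)"
    by (meson Km_has_vector_derivative continuous_at_imp_continuous_on has_vector_derivative_continuous)
  ultimately show ?thesis using f by (auto simp: weighted_def)
qed

end

lemma weighted_add: "weighted c f \<Longrightarrow> weighted d g \<Longrightarrow> weighted (c + d) (\<lambda>t. f t + g t)"
  by (auto simp: weighted_def distrib_right intro!: continuous_intros norm_triangle_mono)

lemma Kp_add:
  assumes "0 \<le> Im \<zeta>" "weighted c f" "weighted d g"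
  shows "Kp \<zeta> (\<lambda>t. f t + g t) s = Kp \<zeta> f s + Kp \<zeta> g s"
  unfolding Kp_def tail_integral_def distrib_left
  using int_kernel[OF assms(1,2)] int_kernel[OF assms(1,3)]
  by (simp add: set_integral_add)

lemma Km_add:
  assumes "0 \<le> Im \<zeta>" "weighted c f" "weighted d g"
  shows "Km \<zeta> (\<lambda>t. f t + g t) s = Km \<zeta> f s + Km \<zeta> g s"
  unfolding Km_def tail_integral_def Kp_add[OF assms, abs_def]
  using int_Kp[OF assms(1,2)] int_Kp[OF assms(1,3)]
  by (simp add: set_integral_add)

definition jost_term :: "nat \<Rightarrow> complex \<Rightarrow> real \<Rightarrow> complex" where
  "jost_term n \<zeta> = (Km \<zeta> ^^ n) (\<lambda>_. 1)"

lemma weighted_jost_term: "0 \<le> Im \<zeta> \<Longrightarrow> weighted ((1/2) ^ n) (jost_term n \<zeta>)"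
proof (induction n)
  case 0
  then show ?case using weight_ge_1 by (auto simp: weighted_def jost_term_def)
next
  case (Suc n)
  then show ?case using weighted_Km[of \<zeta> "(1/2)^n" "jost_term n \<zeta>"] by (simp add: jost_term_def)
qed

lemma norm_jost_term_le: "0 \<le> Im \<zeta> \<Longrightarrow> norm (jost_term n \<zeta> x) \<le> (1/2) ^ n * weight x"
  using weighted_jost_term[of \<zeta> n] by (auto simp: weighted_def)

text \<open>The Jost solution is \<open>exp (\<i> \<zeta> x) * jm \<zeta> x\<close>, and \<open>jp \<zeta>\<close> is the derivative of \<open>jm \<zeta>\<close>.\<close>

definition jm :: "complex \<Rightarrow> real \<Rightarrow> complex" where
  "jm \<zeta> x = (\<Sum>n. jost_term n \<zeta> x)"

definition jp :: "complex \<Rightarrow> real \<Rightarrow> complex" where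
  "jp \<zeta> = Kp \<zeta> (jm \<zeta>)"

lemma geometric_weight_sums: "(\<lambda>n. (1/2) ^ n * weight x) sums (2 * weight x)"
  using sums_mult2[OF geometric_sums[of "1/2 :: real"]] by simp

lemma summable_jost_term: "0 \<le> Im \<zeta> \<Longrightarrow> summable (\<lambda>n. jost_term n \<zeta> x)"
  by (rule summable_comparison_test'[OF sums_summable[OF geometric_weight_sums]])
     (use norm_jost_term_le in auto)

lemma norm_jm_diff_le:
  assumes "0 \<le> Im \<zeta>"
  shows "norm (jm \<zeta> x - (\<Sum>n<N. jost_term n \<zeta> x)) \<le> 2 * (1/2) ^ N * weight x"
proof -
  have "jm \<zeta> x - (\<Sum>n<N. jost_term n \<zeta> x) = (\<Sum>n. jost_term (n + N) \<zeta> x)"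
    unfolding jm_def using suminf_minus_initial_segment[OF summable_jost_term[OF assms, of x], of N] by simp
  also have "norm \<dots> \<le> (\<Sum>n. (1/2) ^ N * ((1/2) ^ n * weight x))"
  proof (rule norm_suminf_le)
    show "norm (jost_term (n + N) \<zeta> x) \<le> (1/2) ^ N * ((1/2) ^ n * weight x)" for n
      using norm_jost_term_le[OF assms, of "n + N" x] by (simp only: power_add mult_ac)
  qed (rule summable_mult[OF sums_summable[OF geometric_weight_sums]])
  also have "\<dots> = 2 * (1/2) ^ N * weight x"
    using sums_unique[OF sums_mult[OF geometric_weight_sums[of x], of "(1/2)^N"]] by (simp add: mult_ac)
  finally show ?thesis .
qed

lemma cont_jm:
  assumes "0 \<le> Im \<zeta>"
  shows "continuous_on UNIV (jm \<zeta>)"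
proof -
  have "isCont (jm \<zeta>) x" for x
  proof -
    \<comment> \<open>\<open>weight\<close> is decreasing and may be unbounded towards minus
      infinity, hence uniform convergence only to the right of \<open>x - 1\<close>.\<close>
    have "uniform_limit {x - 1..} (\<lambda>N t. \<Sum>n<N. jost_term n \<zeta> t) (\<lambda>t. \<Sum>n. jost_term n \<zeta> t) sequentially"
    proof (rule Weierstrass_m_test)
      show "norm (jost_term n \<zeta> t) \<le> (1/2) ^ n * weight (x - 1)" if "t \<in> {x - 1..}" for n t
        using norm_jost_term_le[OF assms, of n t] weight_antimono[of "x - 1" t] that
        by (auto intro: order_trans mult_left_mono)
    qed (rule sums_summable[OF geometric_weight_sums])
    then have "continuous_on {x - 1..} (jm \<zeta>)"
      unfolding jm_def[abs_def]
      by (rule uniform_limit_theorem[rotated])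
        (use weighted_jost_term[OF assms] in
          \<open>auto intro!: continuous_on_sum always_eventually intro: continuous_on_subset simp: weighted_def\<close>)
    then show ?thesis
      by (rule continuous_on_interior) auto
  qed
  then show ?thesis by (simp add: continuous_at_imp_continuous_on)
qed

lemma norm_jm_le: "0 \<le> Im \<zeta> \<Longrightarrow> norm (jm \<zeta> x) \<le> 2 * weight x"
  using norm_jm_diff_le[of \<zeta> x 0] by simp

lemma weighted_jm: "0 \<le> Im \<zeta> \<Longrightarrow> weighted 2 (jm \<zeta>)"
  by (simp add: weighted_def cont_jm norm_jm_le)

lemma norm_jp_le: "0 \<le> Im \<zeta> \<Longrightarrow> norm (jp \<zeta> x) \<le> 2 * (weight x * tailV x)"
  unfolding jp_def using norm_Kp_le weighted_jm by blast

lemma jost_partial_sum: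
  assumes "0 \<le> Im \<zeta>"
  shows "weighted 2 (\<lambda>t. \<Sum>n<N. jost_term n \<zeta> t)"
    and "Km \<zeta> (\<lambda>t. \<Sum>n<N. jost_term n \<zeta> t) x = (\<Sum>n<N. jost_term (Suc n) \<zeta> x)"
proof -
  have w: "weighted (\<Sum>n<N. (1/2) ^ n) (\<lambda>t. \<Sum>n<N. jost_term n \<zeta> t)" for N
    by (induction N) (use weighted_add weighted_jost_term[OF assms] in \<open>auto simp: weighted_def[of 0]\<close>)
  have "(\<Sum>n<N. (1/2) ^ n) \<le> (2::real)"
    by (simp add: geometric_sum)
  then show "weighted 2 (\<lambda>t. \<Sum>n<N. jost_term n \<zeta> t)"
    using w[of N] weight_pos by (auto simp: weighted_def intro: order_trans mult_right_mono)
  show "Km \<zeta> (\<lambda>t. \<Sum>n<N. jost_term n \<zeta> t) x = (\<Sum>n<N. jost_term (Suc n) \<zeta> x)"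
  proof (induction N)
    case 0
    then show ?case by (simp add: Km_def Kp_def[abs_def] tail_integral_def)
  next
    case (Suc N)
    then show ?case
      using Km_add[OF assms w[of N] weighted_jost_term[OF assms, of N], of x] by (simp add: jost_term_def)
  qed
qed

lemma weighted_jm_diff:
  assumes "0 \<le> Im \<zeta>"
  shows "weighted (2 * (1/2) ^ N) (\<lambda>x. jm \<zeta> x - (\<Sum>n<N. jost_term n \<zeta> x))"
  using norm_jm_diff_le[OF assms] continuous_on_diff[OF cont_jm[OF assms]] jost_partial_sum(1)[OF assms]
  by (auto simp: weighted_def)

text \<open>Additivity of \<open>Km\<close> is available for two summands, so \<open>jm\<close> is
  split into a partial sum, on which \<open>Km\<close> shifts the index, and a remainder of weighted
  norm 2 / 2^N, which \<open>Km\<close> keeps small. The defect is O(2^-N) for every N, hence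
  zero.\<close>

lemma jm_fixpoint:
  assumes "0 \<le> Im \<zeta>"
  shows "jm \<zeta> x = 1 + Km \<zeta> (jm \<zeta>) x"
proof -
  have le: "norm (jm \<zeta> x - (1 + Km \<zeta> (jm \<zeta>) x)) \<le> 3 * weight x * (1/2) ^ N" for N
  proof -
    let ?S = "\<lambda>x. \<Sum>n<N. jost_term n \<zeta> x" and ?R = "\<lambda>x. jm \<zeta> x - (\<Sum>n<N. jost_term n \<zeta> x)"
    have "Km \<zeta> (jm \<zeta>) x = Km \<zeta> ?S x + Km \<zeta> ?R x"
      using Km_add[OF assms jost_partial_sum(1)[OF assms] weighted_jm_diff[OF assms, of N], of N x]
      by simp
    moreover have "1 + Km \<zeta> ?S x = (\<Sum>n<Suc N. jost_term n \<zeta> x)"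
      unfolding jost_partial_sum(2)[OF assms] sum.lessThan_Suc_shift
      by (simp add: jost_term_def)
    ultimately have "jm \<zeta> x - (1 + Km \<zeta> (jm \<zeta>) x)
        = (jm \<zeta> x - (\<Sum>n<Suc N. jost_term n \<zeta> x)) - Km \<zeta> ?R x"
      by (simp add: algebra_simps)
    also have "norm \<dots> \<le> 2 * (1/2) ^ Suc N * weight x + 2 * (1/2) ^ N / 2 * weight x"
      by (intro norm_triangle_le_diff add_mono norm_jm_diff_le assms)
        (use weighted_Km[OF assms weighted_jm_diff[OF assms, of N]] in \<open>simp add: weighted_def\<close>)
    also have "\<dots> \<le> 3 * weight x * (1/2) ^ N"
      using weight_pos[of x] by simp
    finally show ?thesis .
  qed
  have "(\<lambda>N. 3 * weight x * (1/2) ^ N) \<longlonglongrightarrow> 3 * weight x * 0"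
    by (intro tendsto_intros LIMSEQ_realpow_zero) auto
  then have "norm (jm \<zeta> x - (1 + Km \<zeta> (jm \<zeta>) x)) \<le> 0"
    using LIMSEQ_le_const le by fastforce
  then show ?thesis by simp
qed

lemma norm_jm_minus_1_le: "0 \<le> Im \<zeta> \<Longrightarrow> norm (jm \<zeta> x - 1) \<le> weight x - 1"
  using jm_fixpoint[of \<zeta> x] norm_Km_le[OF _ weighted_jm, of \<zeta> \<zeta> x] by simp

lemma jm_has_vector_derivative:
  assumes "0 \<le> Im \<zeta>"
  shows "(jm \<zeta> has_vector_derivative jp \<zeta> x) (at x)"
proof -
  have "((\<lambda>x. 1 + Km \<zeta> (jm \<zeta>) x) has_vector_derivative 0 + jp \<zeta> x) (at x)"
    unfolding jp_def
    by (intro has_vector_derivative_add has_vector_derivative_const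
        Km_has_vector_derivative[OF assms weighted_jm[OF assms]])
  moreover have "(\<lambda>x. 1 + Km \<zeta> (jm \<zeta>) x) = jm \<zeta>"
    using jm_fixpoint[OF assms] by (intro ext) metis
  ultimately show ?thesis by simp
qed

lemma jp_has_vector_derivative:
  "0 \<le> Im \<zeta> \<Longrightarrow> (jp \<zeta> has_vector_derivative (V x * jm \<zeta> x - 2 * \<i> * \<zeta> * jp \<zeta> x)) (at x)"
  unfolding jp_def using Kp_has_vector_derivative weighted_jm by blast

lemma cont_jp: "0 \<le> Im \<zeta> \<Longrightarrow> continuous_on A (jp \<zeta>)"
  unfolding jp_def using cont_Kp weighted_jm by blast

lemma jm_tendsto_1: "0 \<le> Im \<zeta> \<Longrightarrow> (jm \<zeta> \<longlongrightarrow> 1) at_top"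
proof -
  assume "0 \<le> Im \<zeta>"
  have "((\<lambda>x. weight x - 1) \<longlongrightarrow> 1 - 1) at_top"
    by (intro tendsto_intros weight_tendsto)
  then have "((\<lambda>x. weight x - 1) \<longlongrightarrow> 0) at_top" by simp
  then have "((\<lambda>x. jm \<zeta> x - 1) \<longlongrightarrow> 0) at_top"
    by (rule Lim_null_comparison[rotated]) (use norm_jm_minus_1_le[OF \<open>0 \<le> Im \<zeta>\<close>] in simp)
  then show ?thesis by (rule LIM_zero_cancel)
qed

lemma tailV_tendsto_0: "(tailV \<longlongrightarrow> 0) at_top"
  unfolding tailV_def by (rule tail_integral_tendsto_0[OF int_abs_V])

lemma jp_tendsto_0: "0 \<le> Im \<zeta> \<Longrightarrow> (jp \<zeta> \<longlongrightarrow> 0) at_top"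
proof -
  assume "0 \<le> Im \<zeta>"
  have "((\<lambda>x. 2 * (weight x * tailV x)) \<longlongrightarrow> 2 * (1 * 0)) at_top"
    by (intro tendsto_intros weight_tendsto tailV_tendsto_0)
  then have "((\<lambda>x. 2 * (weight x * tailV x)) \<longlongrightarrow> 0) at_top" by simp
  then show ?thesis
    by (rule Lim_null_comparison[rotated]) (use norm_jp_le[OF \<open>0 \<le> Im \<zeta>\<close>] in simp)
qed

section \<open>Continuity and holomorphy in the spectral parameter\<close>

lemma regular_Kp:
  assumes w: "\<And>\<zeta>. 0 \<le> Im \<zeta> \<Longrightarrow> weighted c (f \<zeta>)"
    and c: "\<And>t. continuous_on closed_uhp (\<lambda>\<zeta>. f \<zeta> t)" and h: "\<And>t. (\<lambda>\<zeta>. f \<zeta> t) holomorphic_on open_uhp"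
  shows "continuous_on closed_uhp (\<lambda>\<zeta>. Kp \<zeta> (f \<zeta>) s)" "(\<lambda>\<zeta>. Kp \<zeta> (f \<zeta>) s) holomorphic_on open_uhp"
proof -
  let ?F = "\<lambda>\<zeta> t. indicator {s..} t *\<^sub>R (exp (2 * \<i> * \<zeta> * complex_of_real (t - s)) * V t * f \<zeta> t)"
  have eq: "Kp \<zeta> (f \<zeta>) s = - (LINT t|lborel. ?F \<zeta> t)" for \<zeta>
    by (simp add: Kp_def tail_integral_def set_lebesgue_integral_def)
  have m: "?F \<zeta> \<in> borel_measurable lborel" if "0 \<le> Im \<zeta>" for \<zeta>
    using int_kernel[OF that w[OF that], of s s] unfolding set_integrable_def by auto
  have b: "norm (?F \<zeta> t) \<le> indicator {s..} t *\<^sub>R (\<bar>V t\<bar> * (c * weight t))" if "0 \<le> Im \<zeta>" for \<zeta> t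
    using norm_kernel_le[OF that, of s t "f \<zeta>" "c * weight t"] w[OF that]
    by (auto simp: weighted_def split: split_indicator)
  have g: "integrable lborel (\<lambda>t. indicator {s..} t *\<^sub>R (\<bar>V t\<bar> * (c * weight t)))"
    using int_V_weight[of s c] unfolding set_integrable_def .
  show "continuous_on closed_uhp (\<lambda>\<zeta>. Kp \<zeta> (f \<zeta>) s)"
    unfolding eq
  proof (intro continuous_on_minus continuous_on_LINT_dominated[OF _ _ g])
    show "continuous_on closed_uhp (\<lambda>\<zeta>. ?F \<zeta> t)" for t
      by (intro continuous_intros c)
    show "?F \<zeta> \<in> borel_measurable lborel" if "\<zeta> \<in> closed_uhp" for \<zeta>
      by (rule m) (use that in simp)
    show "norm (?F \<zeta> t) \<le> indicator {s..} t *\<^sub>R (\<bar>V t\<bar> * (c * weight t))" if "\<zeta> \<in> closed_uhp" for \<zeta> t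
      by (rule b) (use that in simp)
  qed
  show "(\<lambda>\<zeta>. Kp \<zeta> (f \<zeta>) s) holomorphic_on open_uhp"
    unfolding eq
  proof (intro holomorphic_on_minus holomorphic_on_LINT_dominated[OF open_open_uhp _ _ g])
    show "(\<lambda>\<zeta>. ?F \<zeta> t) holomorphic_on open_uhp" for t
      unfolding scaleR_conv_of_real by (intro holomorphic_intros h)
    show "?F \<zeta> \<in> borel_measurable lborel" if "\<zeta> \<in> open_uhp" for \<zeta>
      by (rule m) (use that in simp)
    show "norm (?F \<zeta> t) \<le> indicator {s..} t *\<^sub>R (\<bar>V t\<bar> * (c * weight t))" if "\<zeta> \<in> open_uhp" for \<zeta> t
      by (rule b) (use that in simp)
  qed
qed

lemma regular_Km:
  assumes w: "\<And>\<zeta>. 0 \<le> Im \<zeta> \<Longrightarrow> weighted c (f \<zeta>)"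
    and c: "\<And>t. continuous_on closed_uhp (\<lambda>\<zeta>. f \<zeta> t)" and h: "\<And>t. (\<lambda>\<zeta>. f \<zeta> t) holomorphic_on open_uhp"
  shows "continuous_on closed_uhp (\<lambda>\<zeta>. Km \<zeta> (f \<zeta>) s)" "(\<lambda>\<zeta>. Km \<zeta> (f \<zeta>) s) holomorphic_on open_uhp"
proof -
  let ?F = "\<lambda>\<zeta> t. indicator {s..} t *\<^sub>R Kp \<zeta> (f \<zeta>) t"
  have eq: "Km \<zeta> (f \<zeta>) s = - (LINT t|lborel. ?F \<zeta> t)" for \<zeta>
    by (simp add: Km_def tail_integral_def set_lebesgue_integral_def)
  have m: "?F \<zeta> \<in> borel_measurable lborel" if "0 \<le> Im \<zeta>" for \<zeta>
    using int_Kp[OF that w[OF that], of s] unfolding set_integrable_def by auto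
  have b: "norm (?F \<zeta> t) \<le> indicator {s..} t *\<^sub>R (c * (weight t * tailV t))" if "0 \<le> Im \<zeta>" for \<zeta> t
    using norm_Kp_le[OF that w[OF that], of t]
    by (auto simp: weighted_def split: split_indicator)
  have g: "integrable lborel (\<lambda>t. indicator {s..} t *\<^sub>R (c * (weight t * tailV t)))"
    using weight_tailV(1)[of s, THEN set_integrable_mult_right, of c] unfolding set_integrable_def by simp
  show "continuous_on closed_uhp (\<lambda>\<zeta>. Km \<zeta> (f \<zeta>) s)"
    unfolding eq
  proof (intro continuous_on_minus continuous_on_LINT_dominated[OF _ _ g])
    show "continuous_on closed_uhp (\<lambda>\<zeta>. ?F \<zeta> t)" for t
      by (intro continuous_intros regular_Kp[OF assms])
    show "?F \<zeta> \<in> borel_measurable lborel" if "\<zeta> \<in> closed_uhp" for \<zeta>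
      by (rule m) (use that in simp)
    show "norm (?F \<zeta> t) \<le> indicator {s..} t *\<^sub>R (c * (weight t * tailV t))" if "\<zeta> \<in> closed_uhp" for \<zeta> t
      by (rule b) (use that in simp)
  qed
  show "(\<lambda>\<zeta>. Km \<zeta> (f \<zeta>) s) holomorphic_on open_uhp"
    unfolding eq
  proof (intro holomorphic_on_minus holomorphic_on_LINT_dominated[OF open_open_uhp _ _ g])
    show "(\<lambda>\<zeta>. ?F \<zeta> t) holomorphic_on open_uhp" for t
      unfolding scaleR_conv_of_real by (intro holomorphic_intros regular_Kp[OF assms])
    show "?F \<zeta> \<in> borel_measurable lborel" if "\<zeta> \<in> open_uhp" for \<zeta>
      by (rule m) (use that in simp)
    show "norm (?F \<zeta> t) \<le> indicator {s..} t *\<^sub>R (c * (weight t * tailV t))" if "\<zeta> \<in> open_uhp" for \<zeta> t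
      by (rule b) (use that in simp)
  qed
qed

lemma regular_jost_term:
  "continuous_on closed_uhp (\<lambda>\<zeta>. jost_term n \<zeta> x) \<and> (\<lambda>\<zeta>. jost_term n \<zeta> x) holomorphic_on open_uhp"
proof (induction n arbitrary: x)
  case (Suc n)
  then show ?case
    using regular_Km[of "(1/2)^n" "jost_term n" x] weighted_jost_term by (simp add: jost_term_def)
qed (simp add: jost_term_def)

lemma uniform_limit_jost_term:
  "uniform_limit closed_uhp (\<lambda>N \<zeta>. \<Sum>n<N. jost_term n \<zeta> x) (\<lambda>\<zeta>. \<Sum>n. jost_term n \<zeta> x) sequentially"
  by (rule Weierstrass_m_test[OF _ sums_summable[OF geometric_weight_sums[of x]]]) (simp add: norm_jost_term_le)

lemma continuous_jm: "continuous_on closed_uhp (\<lambda>\<zeta>. jm \<zeta> x)"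
  unfolding jm_def
  by (rule uniform_limit_theorem[OF _ uniform_limit_jost_term])
    (use regular_jost_term in \<open>auto intro!: continuous_on_sum always_eventually\<close>)

lemma holomorphic_jm: "(\<lambda>\<zeta>. jm \<zeta> x) holomorphic_on open_uhp"
proof (rule holomorphic_uniform_sequence[OF open_open_uhp, where f = "\<lambda>N \<zeta>. \<Sum>n<N. jost_term n \<zeta> x"])
  show "(\<lambda>\<zeta>. \<Sum>n<N. jost_term n \<zeta> x) holomorphic_on open_uhp" for N
    using regular_jost_term by (auto intro!: holomorphic_intros)
  fix \<zeta> assume "\<zeta> \<in> open_uhp"
  then obtain d where "d > 0" "cball \<zeta> d \<subseteq> open_uhp"
    using open_open_uhp open_contains_cball by blast
  moreover from this have "uniform_limit (cball \<zeta> d) (\<lambda>N \<zeta>. \<Sum>n<N. jost_term n \<zeta> x) (\<lambda>\<zeta>. jm \<zeta> x) sequentially"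
    unfolding jm_def by (intro uniform_limit_on_subset[OF uniform_limit_jost_term]) auto
  ultimately show "\<exists>d>0. cball \<zeta> d \<subseteq> open_uhp \<and>
      uniform_limit (cball \<zeta> d) (\<lambda>N \<zeta>. \<Sum>n<N. jost_term n \<zeta> x) (\<lambda>\<zeta>. jm \<zeta> x) sequentially"
    by blast
qed

lemma continuous_jp: "continuous_on closed_uhp (\<lambda>\<zeta>. jp \<zeta> x)"
  and holomorphic_jp: "(\<lambda>\<zeta>. jp \<zeta> x) holomorphic_on open_uhp"
  unfolding jp_def by (rule regular_Kp[OF weighted_jm continuous_jm holomorphic_jm]; assumption)+

text \<open>As V is real, conjugating the integral only replaces \<zeta> by - cnj \<zeta>, its
  reflection in the imaginary axis. Carried along the Neumann series this gives the symmetry of the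
  Jost function.\<close>

lemma Kp_cnj: "Kp (- cnj \<zeta>) (\<lambda>t. cnj (f t)) s = cnj (Kp \<zeta> f s)"
proof -
  have "exp (2 * \<i> * (- cnj \<zeta>) * complex_of_real (t - s)) * V t * cnj (f t)
      = cnj (exp (2 * \<i> * \<zeta> * complex_of_real (t - s)) * V t * f t)" for t
    by (simp add: exp_cnj)
  then show ?thesis
    unfolding Kp_def tail_integral_def set_lebesgue_integral_def
    by (simp only: complex_cnj_minus complex_cnj_scaleR flip: Bochner_Integration.integral_cnj)
qed

lemma Km_cnj: "Km (- cnj \<zeta>) (\<lambda>t. cnj (f t)) s = cnj (Km \<zeta> f s)"
  unfolding Km_def tail_integral_def set_lebesgue_integral_def Kp_cnj[abs_def]
  by (simp add: scaleR_conv_of_real flip: Bochner_Integration.integral_cnj)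

lemma jost_term_cnj: "jost_term n (- cnj \<zeta>) = (\<lambda>x. cnj (jost_term n \<zeta> x))"
proof (induction n)
  case (Suc n)
  then show ?case by (auto simp: jost_term_def Km_cnj)
qed (simp add: jost_term_def)

lemma jm_cnj:
  assumes "0 \<le> Im \<zeta>"
  shows "jm (- cnj \<zeta>) = (\<lambda>x. cnj (jm \<zeta> x))"
proof
  fix x
  have "(\<lambda>n. cnj (jost_term n \<zeta> x)) sums cnj (jm \<zeta> x)"
    unfolding sums_cnj jm_def using summable_jost_term[OF assms] by (rule summable_sums)
  then show "jm (- cnj \<zeta>) x = cnj (jm \<zeta> x)"
    unfolding jm_def jost_term_cnj by (simp add: sums_iff jm_def)
qed

lemma jp_cnj: "0 \<le> Im \<zeta> \<Longrightarrow> jp (- cnj \<zeta>) s = cnj (jp \<zeta> s)"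
  unfolding jp_def jm_cnj by (rule Kp_cnj)

section \<open>The Jost solution and the Jost function\<close>

definition theta :: "complex \<Rightarrow> real \<Rightarrow> complex" where
  "theta \<zeta> x = exp (\<i> * \<zeta> * x) * jm \<zeta> x"

definition dtheta :: "complex \<Rightarrow> real \<Rightarrow> complex" where
  "dtheta \<zeta> x = exp (\<i> * \<zeta> * x) * (jp \<zeta> x + \<i> * \<zeta> * jm \<zeta> x)"

text \<open>The Jost function through \<open>jm\<close> and \<open>jp\<close>. It makes sense on the
  whole closed half plane, including \<zeta> = 0, where the normalisation in
  \<open>is_jost_solution\<close> degenerates.\<close>

definition jostw :: "real \<Rightarrow> complex \<Rightarrow> complex" where
  "jostw \<gamma> \<zeta> = \<gamma> * jm \<zeta> 0 - (jp \<zeta> 0 + \<i> * \<zeta> * jm \<zeta> 0)"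

lemma jostw_eq: "jostw \<gamma> \<zeta> = \<gamma> * theta \<zeta> 0 - dtheta \<zeta> 0"
  by (simp add: jostw_def theta_def dtheta_def)

lemma continuous_jostw: "continuous_on closed_uhp (jostw \<gamma>)"
  unfolding jostw_def by (intro continuous_intros continuous_jm continuous_jp)

lemma holomorphic_jostw: "jostw \<gamma> holomorphic_on open_uhp"
  unfolding jostw_def by (intro holomorphic_intros holomorphic_jm holomorphic_jp)

lemma theta_cnj: "0 \<le> Im \<zeta> \<Longrightarrow> theta (- cnj \<zeta>) x = cnj (theta \<zeta> x)"
  and jostw_cnj: "0 \<le> Im \<zeta> \<Longrightarrow> jostw \<gamma> (- cnj \<zeta>) = cnj (jostw \<gamma> \<zeta>)"
  by (simp_all add: theta_def dtheta_def jostw_def jm_cnj jp_cnj exp_cnj)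

lemma theta_has_vector_derivative:
  assumes "0 \<le> Im \<zeta>"
  shows "(theta \<zeta> has_vector_derivative dtheta \<zeta> x) (at x)"
    and "(dtheta \<zeta> has_vector_derivative (of_real (V x) - \<zeta>\<^sup>2) * theta \<zeta> x) (at x)"
proof -
  have E: "((\<lambda>x::real. exp (\<i> * \<zeta> * x)) has_vector_derivative \<i> * \<zeta> * exp (\<i> * \<zeta> * x)) (at x)"
    by (rule has_vector_derivative_real_field) (auto intro!: derivative_eq_intros)
  show "(theta \<zeta> has_vector_derivative dtheta \<zeta> x) (at x)"
    using has_vector_derivative_mult[OF E jm_has_vector_derivative[OF assms]]
    unfolding theta_def[abs_def] dtheta_def by (simp add: algebra_simps)
  have "((\<lambda>x. jp \<zeta> x + \<i> * \<zeta> * jm \<zeta> x) has_vector_derivative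
      (V x * jm \<zeta> x - 2 * \<i> * \<zeta> * jp \<zeta> x) + \<i> * \<zeta> * jp \<zeta> x) (at x)"
    by (intro has_vector_derivative_add has_vector_derivative_mult_right
        jp_has_vector_derivative jm_has_vector_derivative assms)
  from has_vector_derivative_mult[OF E this]
  show "(dtheta \<zeta> has_vector_derivative (of_real (V x) - \<zeta>\<^sup>2) * theta \<zeta> x) (at x)"
    unfolding theta_def dtheta_def[abs_def] by (simp add: algebra_simps power2_eq_square)
qed

end

section \<open>Zeros of the Jost function\<close>

lemma at_within_half_line_neq_bot: "0 \<le> x \<Longrightarrow> at x within {0..} \<noteq> (bot :: real filter)"
proof -
  assume "0 \<le> x"
  have "x islimpt {x<..<x + 1}" by (rule islimpt_greaterThanLessThan1) simp
  then have "x islimpt {0..}" using \<open>0 \<le> x\<close> by (rule_tac islimpt_subset) auto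
  then show ?thesis by (simp add: trivial_limit_within)
qed

lemma hderiv_eqI: "(f has_vector_derivative D) (at x within {0..}) \<Longrightarrow> 0 \<le> x \<Longrightarrow> hderiv f x = D"
  unfolding hderiv_def by (rule vector_derivative_within[OF at_within_half_line_neq_bot])

lemma constant_on_half_line:
  fixes f :: "real \<Rightarrow> 'a::real_normed_vector"
  assumes "\<And>x. 0 \<le> x \<Longrightarrow> (f has_vector_derivative 0) (at x within {0..})" "0 \<le> x"
  shows "f x = f 0"
proof -
  have "\<exists>c. \<forall>x\<in>{0..}. f x = c"
    by (rule has_derivative_zero_constant) (use assms in \<open>auto simp: has_vector_derivative_def\<close>)
  then show ?thesis using assms(2) by auto
qed

text \<open>Gronwall for the energy |u|^2 + |u'|^2 on [0, b]: if K bounds q there, its derivative is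
  at most 1 + K times itself, so the product with exp(- (1 + K) x) is nonincreasing, and it starts
  at 0.\<close>

lemma second_order_unique:
  fixes u u' q :: "real \<Rightarrow> complex"
  assumes u: "\<And>x. 0 \<le> x \<Longrightarrow> (u has_vector_derivative u' x) (at x within {0..})"
    and u': "\<And>x. 0 \<le> x \<Longrightarrow> (u' has_vector_derivative q x * u x) (at x within {0..})"
    and q: "continuous_on {0..} q" and "u 0 = 0" "u' 0 = 0" "0 \<le> b"
  shows "u b = 0"
proof -
  have "compact (q ` {0..b})"
    using q by (intro compact_continuous_image) (auto intro: continuous_on_subset)
  then obtain K where K: "\<And>x. x \<in> {0..b} \<Longrightarrow> norm (q x) \<le> K"
    by (meson bounded_iff compact_imp_bounded imageI)
  define N where "N x = (u x \<bullet> u x + u' x \<bullet> u' x) * exp (- (1 + K) * x)" for x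
  have d: "(N has_real_derivative (2 * (u x \<bullet> u' x) + 2 * (u' x \<bullet> (q x * u x))) * exp (- (1 + K) * x)
      + (u x \<bullet> u x + u' x \<bullet> u' x) * (exp (- (1 + K) * x) * - (1 + K))) (at x within {0..})" if "0 \<le> x" for x
  proof -
    have 1: "((\<lambda>x. u x \<bullet> u x) has_real_derivative (2 * (u x \<bullet> u' x))) (at x within {0..})"
      using bounded_bilinear.has_vector_derivative[OF bounded_bilinear_inner u[OF that] u[OF that]]
      by (simp add: has_real_derivative_iff_has_vector_derivative inner_commute)
    have 2: "((\<lambda>x. u' x \<bullet> u' x) has_real_derivative (2 * (u' x \<bullet> (q x * u x)))) (at x within {0..})"
      using bounded_bilinear.has_vector_derivative[OF bounded_bilinear_inner u'[OF that] u'[OF that]]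
      by (simp add: has_real_derivative_iff_has_vector_derivative inner_commute)
    show ?thesis unfolding N_def
      by (rule derivative_eq_intros 1 2 refl)+ simp
  qed
  have le: "2 * (u x \<bullet> u' x) + 2 * (u' x \<bullet> (q x * u x)) \<le> (1 + K) * (u x \<bullet> u x + u' x \<bullet> u' x)" if "x \<in> {0..b}" for x
  proof -
    have K0: "0 \<le> K" using K[OF that] norm_ge_zero order_trans by blast
    have am: "2 * (norm (u x) * norm (u' x)) \<le> u x \<bullet> u x + u' x \<bullet> u' x"
      using zero_le_power2[of "norm (u x) - norm (u' x)"]
      by (simp add: power2_diff dot_square_norm)
    have "u x \<bullet> u' x \<le> norm (u x) * norm (u' x)"
      by (rule norm_cauchy_schwarz)
    moreover have "u' x \<bullet> (q x * u x) \<le> norm (u' x) * norm (q x * u x)"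
      by (rule norm_cauchy_schwarz)
    moreover have "norm (u' x) * norm (q x * u x) \<le> norm (u' x) * (K * norm (u x))"
      unfolding norm_mult by (intro mult_left_mono mult_right_mono K that) auto
    ultimately have "2 * (u x \<bullet> u' x) + 2 * (u' x \<bullet> (q x * u x)) \<le> (1 + K) * (2 * (norm (u x) * norm (u' x)))"
      by (simp add: algebra_simps)
    also have "\<dots> \<le> (1 + K) * (u x \<bullet> u x + u' x \<bullet> u' x)"
      using am K0 by (intro mult_left_mono) auto
    finally show ?thesis .
  qed
  have "N 0 \<ge> N b"
  proof (rule DERIV_nonpos_imp_decreasing_open[OF \<open>0 \<le> b\<close>])
    show "continuous_on {0..b} N"
      by (rule DERIV_continuous_on[where D = "\<lambda>x. (2 * (u x \<bullet> u' x) + 2 * (u' x \<bullet> (q x * u x))) * exp (- (1 + K) * x)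
      + (u x \<bullet> u x + u' x \<bullet> u' x) * (exp (- (1 + K) * x) * - (1 + K))"], rule DERIV_subset[OF d]) auto
    fix x assume x: "0 < x" "x < b"
    have "at x within {0..} = at x" using x by (intro at_within_interior) (auto simp: interior_real_atLeast)
    then have "(N has_real_derivative (2 * (u x \<bullet> u' x) + 2 * (u' x \<bullet> (q x * u x))) * exp (- (1 + K) * x)
      + (u x \<bullet> u x + u' x \<bullet> u' x) * (exp (- (1 + K) * x) * - (1 + K))) (at x)"
      using d[of x] x by simp
    moreover have "(2 * (u x \<bullet> u' x) + 2 * (u' x \<bullet> (q x * u x))) * exp (- (1 + K) * x)
      + (u x \<bullet> u x + u' x \<bullet> u' x) * (exp (- (1 + K) * x) * - (1 + K))
      = (2 * (u x \<bullet> u' x) + 2 * (u' x \<bullet> (q x * u x)) - (1 + K) * (u x \<bullet> u x + u' x \<bullet> u' x)) * exp (- (1 + K) * x)"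
      by (simp add: algebra_simps)
    moreover have "\<dots> \<le> 0" using le[of x] x by (intro mult_nonpos_nonneg) auto
    ultimately show "\<exists>y. (N has_real_derivative y) (at x) \<and> y \<le> 0" by metis
  qed
  then have "(u b \<bullet> u b + u' b \<bullet> u' b) * exp (- (1 + K) * b) \<le> 0"
    using assms by (simp add: N_def)
  then have "u b \<bullet> u b + u' b \<bullet> u' b \<le> 0"
    by (simp add: mult_le_0_iff not_le[symmetric])
  then show "u b = 0"
    by (smt (verit) inner_ge_zero inner_eq_zero_iff)
qed

lemma exp_integrable_atLeast:
  assumes "0 < (a::real)"
  shows "set_integrable lborel {b..} (\<lambda>x. exp (- (a * x)))"
    "(LINT x:{b..}|lborel. exp (- (a * x))) = exp (- (a * b)) / a"
proof -
  have d: "DERIV (\<lambda>x. - exp (- (a * x)) / a) x :> exp (- (a * x))" for x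
    using assms by (auto intro!: derivative_eq_intros)
  have l: "((\<lambda>x. - exp (- (a * x)) / a) \<longlongrightarrow> 0) at_top"
  proof -
    have "((\<lambda>x. exp (- (a * x))) \<longlongrightarrow> 0) at_top"
      by (rule filterlim_compose[OF exp_at_bot])
        (use assms in \<open>auto simp: filterlim_uminus_at_bot intro!: filterlim_tendsto_pos_mult_at_top[OF tendsto_const _ filterlim_ident]\<close>)
    from tendsto_divide[OF tendsto_minus[OF this] tendsto_const[of a]] assms show ?thesis by simp
  qed
  have c: "continuous_on UNIV (\<lambda>x. exp (- (a * x)))" by (intro continuous_intros)
  show "set_integrable lborel {b..} (\<lambda>x. exp (- (a * x)))"
    by (rule set_integral_FTC_atLeast_nonneg(1)[OF c d _ l]) simp
  show "(LINT x:{b..}|lborel. exp (- (a * x))) = exp (- (a * b)) / a"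
    using set_integral_FTC_atLeast_nonneg(2)[OF c d _ l, of b] by simp
qed

context jost_potential
begin

lemma cont_theta: "0 \<le> Im \<zeta> \<Longrightarrow> continuous_on A (theta \<zeta>)"
  and cont_dtheta: "0 \<le> Im \<zeta> \<Longrightarrow> continuous_on A (dtheta \<zeta>)"
  by (rule continuous_at_imp_continuous_on, rule ballI,
      rule has_vector_derivative_continuous, rule theta_has_vector_derivative, assumption)+

lemma norm_theta_le:
  assumes "0 \<le> Im \<zeta>" "0 \<le> x"
  shows "norm (theta \<zeta> x) \<le> exp (- (Im \<zeta> * x)) * (2 * weight 0)"
    and "norm (dtheta \<zeta> x) \<le> exp (- (Im \<zeta> * x)) * (2 * weight 0 * tailV 0 + norm \<zeta> * (2 * weight 0))"
proof -
  have m: "norm (jm \<zeta> x) \<le> 2 * weight 0"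
    using norm_jm_le[OF assms(1), of x] weight_antimono[OF assms(2)] by simp
  have "weight x * tailV x \<le> weight 0 * tailV 0"
    using weight_antimono[OF assms(2)] tailV_antimono[OF assms(2)] tailV_nonneg weight_pos
    by (intro mult_mono) (auto simp: less_imp_le)
  then have p: "norm (jp \<zeta> x) \<le> 2 * weight 0 * tailV 0"
    using norm_jp_le[OF assms(1), of x] by simp
  have e: "norm (exp (\<i> * \<zeta> * complex_of_real x)) = exp (- (Im \<zeta> * x))" by simp
  show "norm (theta \<zeta> x) \<le> exp (- (Im \<zeta> * x)) * (2 * weight 0)"
    unfolding theta_def norm_mult e by (intro mult_left_mono m) auto
  have "norm (jp \<zeta> x + \<i> * \<zeta> * jm \<zeta> x) \<le> 2 * weight 0 * tailV 0 + norm \<zeta> * (2 * weight 0)"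
    using p m by (intro norm_triangle_mono) (auto simp: norm_mult intro!: mult_left_mono)
  then show "norm (dtheta \<zeta> x) \<le> exp (- (Im \<zeta> * x)) * (2 * weight 0 * tailV 0 + norm \<zeta> * (2 * weight 0))"
    unfolding dtheta_def norm_mult e by (intro mult_left_mono) auto
qed

lemma norm_theta_mult_le:
  assumes "0 \<le> Im \<zeta>" "0 \<le> Im \<xi>" "0 \<le> x"
  shows "norm (theta \<zeta> x * theta \<xi> x) \<le> exp (- (Im \<zeta> * x)) * (4 * (weight 0)\<^sup>2)"
proof -
  have "norm (theta \<xi> x) \<le> exp (- (Im \<xi> * x)) * (2 * weight 0)"
    using norm_theta_le assms by blast
  also have "\<dots> \<le> 1 * (2 * weight 0)"
    using assms weight_pos[of 0] by (intro mult_right_mono) auto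
  finally have "norm (theta \<zeta> x * theta \<xi> x) \<le> (exp (- (Im \<zeta> * x)) * (2 * weight 0)) * (2 * weight 0)"
    unfolding norm_mult using assms weight_pos[of 0] by (intro mult_mono norm_theta_le) auto
  then show ?thesis by (simp add: power2_eq_square mult_ac)
qed

lemma int_theta_mult:
  assumes "0 < Im \<zeta>" "0 \<le> Im \<xi>"
  shows "set_integrable lborel {0..} (\<lambda>x. theta \<zeta> x * theta \<xi> x)"
proof (rule set_integrable_continuous_bound)
  show "set_integrable lborel {0..} (\<lambda>x. exp (- (Im \<zeta> * x)) * (4 * (weight 0)\<^sup>2))"
    using exp_integrable_atLeast(1)[OF assms(1)] by simp
qed (use assms norm_theta_mult_le cont_theta in \<open>auto intro!: continuous_intros\<close>)

lemma exp_decay_tendsto_0: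
  assumes "0 < (a::real)"
  shows "((\<lambda>x. exp (- (a * x)) * c) \<longlongrightarrow> 0) at_top"
proof -
  have "((\<lambda>x. exp (- (a * x))) \<longlongrightarrow> 0) at_top"
    by (rule filterlim_compose[OF exp_at_bot])
      (use assms in \<open>auto simp: filterlim_uminus_at_bot intro!: filterlim_tendsto_pos_mult_at_top[OF tendsto_const _ filterlim_ident]\<close>)
  then show ?thesis by (rule tendsto_mult_left_zero)
qed

section \<open>Wronskians and the Lagrange identity\<close>

definition wronskian :: "complex \<Rightarrow> complex \<Rightarrow> real \<Rightarrow> complex" where
  "wronskian \<zeta> \<xi> x = theta \<zeta> x * dtheta \<xi> x - dtheta \<zeta> x * theta \<xi> x"

lemma wronskian_0: "wronskian \<zeta> \<xi> 0 = theta \<xi> 0 * jostw \<gamma> \<zeta> - theta \<zeta> 0 * jostw \<gamma> \<xi>"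
  by (simp add: wronskian_def jostw_eq algebra_simps)

lemma wronskian_has_vector_derivative:
  assumes "0 \<le> Im \<zeta>" "0 \<le> Im \<xi>"
  shows "(wronskian \<zeta> \<xi> has_vector_derivative (\<zeta>\<^sup>2 - \<xi>\<^sup>2) * (theta \<zeta> x * theta \<xi> x)) (at x)"
  unfolding wronskian_def[abs_def]
  by (rule has_vector_derivative_eq_rhs, rule has_vector_derivative_diff
      [OF has_vector_derivative_mult[OF theta_has_vector_derivative(1)[OF assms(1)] theta_has_vector_derivative(2)[OF assms(2)]]
          has_vector_derivative_mult[OF theta_has_vector_derivative(2)[OF assms(1)] theta_has_vector_derivative(1)[OF assms(2)]]])
    (simp add: algebra_simps)

text \<open>Lagrange's identity: the derivative of the Wronskian is a multiple of the product of the
  two solutions, and the boundary term at infinity vanishes because \<open>theta \<zeta>\<close>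
  decays. Taking \<xi> = - cnj \<zeta> locates the zeros of w, taking for \<zeta> a zero shows that
  it is simple, and \<xi> = 0 controls w near 0.\<close>

lemma wronskian_identity:
  assumes "0 < Im \<zeta>" "0 \<le> Im \<xi>"
  shows "theta \<xi> 0 * jostw \<gamma> \<zeta> - theta \<zeta> 0 * jostw \<gamma> \<xi>
    = (\<xi>\<^sup>2 - \<zeta>\<^sup>2) * (LINT x:{0..}|lborel. theta \<zeta> x * theta \<xi> x)"
proof -
  have Im: "0 \<le> Im \<zeta>" using assms by simp
  let ?K = "2 * weight 0 * tailV 0 + norm \<xi> * (2 * weight 0)" and ?L = "2 * weight 0 * tailV 0 + norm \<zeta> * (2 * weight 0)"
  have K: "0 \<le> ?K" "0 \<le> ?L" using weight_pos[of 0] tailV_nonneg[of 0] by (auto intro!: add_nonneg_nonneg)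
  have bd: "norm (wronskian \<zeta> \<xi> x) \<le> exp (- (Im \<zeta> * x)) * (2 * weight 0 * ?K + ?L * (2 * weight 0))" if "0 \<le> x" for x
  proof -
    have e: "exp (- (Im \<xi> * x)) \<le> 1" using assms that by simp
    have 1: "norm (theta \<xi> x) \<le> 2 * weight 0"
      using norm_theta_le(1)[OF assms(2) that] mult_right_mono[OF e, of "2 * weight 0"] weight_pos[of 0] by linarith
    have 2: "norm (dtheta \<xi> x) \<le> ?K"
      using order_trans[OF norm_theta_le(2)[OF assms(2) that] mult_right_mono[OF e K(1)]] by simp
    have "norm (wronskian \<zeta> \<xi> x) \<le> norm (theta \<zeta> x) * norm (dtheta \<xi> x) + norm (dtheta \<zeta> x) * norm (theta \<xi> x)"
      unfolding wronskian_def by (metis norm_mult norm_triangle_ineq4)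
    also have "\<dots> \<le> (exp (- (Im \<zeta> * x)) * (2 * weight 0)) * ?K + (exp (- (Im \<zeta> * x)) * ?L) * (2 * weight 0)"
      using norm_theta_le[OF Im that] 1 2 K weight_pos[of 0] by (intro add_mono mult_mono) auto
    finally show ?thesis by (simp add: algebra_simps)
  qed
  have lim: "(wronskian \<zeta> \<xi> \<longlongrightarrow> 0) at_top"
    by (rule Lim_null_comparison[OF _ exp_decay_tendsto_0[OF assms(1)]],
        use eventually_ge_at_top[of 0] in eventually_elim) (rule bd)
  have "(LINT x:{0..}|lborel. (\<zeta>\<^sup>2 - \<xi>\<^sup>2) * (theta \<zeta> x * theta \<xi> x)) = 0 - wronskian \<zeta> \<xi> 0"
    by (rule set_integral_FTC_atLeast[OF has_vector_derivative_at_within[OF wronskian_has_vector_derivative[OF Im assms(2)]] _ _ lim])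
      (use int_theta_mult[OF assms] cont_theta Im assms(2) in \<open>auto intro!: continuous_intros set_integrable_mult_right\<close>)
  then show ?thesis
    unfolding wronskian_0[of \<zeta> \<xi> \<gamma>] set_integral_mult_right by (simp add: algebra_simps)
qed

lemma theta_over_exp_tendsto:
  assumes "0 \<le> Im \<zeta>"
  shows "((\<lambda>x. theta \<zeta> x / exp (\<i> * \<zeta> * x)) \<longlongrightarrow> 1) at_top"
    and "((\<lambda>x. dtheta \<zeta> x / exp (\<i> * \<zeta> * x)) \<longlongrightarrow> \<i> * \<zeta>) at_top"
proof -
  show "((\<lambda>x. theta \<zeta> x / exp (\<i> * \<zeta> * x)) \<longlongrightarrow> 1) at_top"
    unfolding theta_def using jm_tendsto_1[OF assms] by simp
  have "((\<lambda>x. jp \<zeta> x + \<i> * \<zeta> * jm \<zeta> x) \<longlongrightarrow> 0 + \<i> * \<zeta> * 1) at_top"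
    by (intro tendsto_intros jp_tendsto_0 jm_tendsto_1 assms)
  then show "((\<lambda>x. dtheta \<zeta> x / exp (\<i> * \<zeta> * x)) \<longlongrightarrow> \<i> * \<zeta>) at_top"
    unfolding dtheta_def by simp
qed

text \<open>Equal squares of the spectral parameters make the Wronskian constant; its value is read
  off at infinity, where the two exponentials cancel.\<close>

lemma wronskian_real:
  assumes "0 \<le> x"
  shows "wronskian (of_real k) (of_real (- k)) x = - 2 * \<i> * k"
proof -
  let ?W = "wronskian (of_real k) (of_real (- k))"
  have c: "?W x = ?W 0" if "0 \<le> x" for x
    by (rule constant_on_half_line[OF _ that], rule has_vector_derivative_at_within,
        rule has_vector_derivative_eq_rhs[OF wronskian_has_vector_derivative]) auto
  have "((\<lambda>x. (theta (of_real k) x / exp (\<i> * of_real k * x)) * (dtheta (of_real (- k)) x / exp (\<i> * of_real (- k) * x))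
      - (dtheta (of_real k) x / exp (\<i> * of_real k * x)) * (theta (of_real (- k)) x / exp (\<i> * of_real (- k) * x)))
      \<longlongrightarrow> 1 * (\<i> * of_real (- k)) - (\<i> * of_real k) * 1) at_top"
    by (intro tendsto_intros theta_over_exp_tendsto) auto
  moreover have "(\<lambda>x. (theta (of_real k) x / exp (\<i> * of_real k * x)) * (dtheta (of_real (- k)) x / exp (\<i> * of_real (- k) * x))
      - (dtheta (of_real k) x / exp (\<i> * of_real k * x)) * (theta (of_real (- k)) x / exp (\<i> * of_real (- k) * x))) = ?W"
    by (auto simp: fun_eq_iff wronskian_def exp_minus field_simps)
  ultimately have "(?W \<longlongrightarrow> - 2 * \<i> * k) at_top" by (simp add: mult.assoc)
  moreover have "(?W \<longlongrightarrow> ?W 0) at_top"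
    by (rule tendsto_eventually, use eventually_ge_at_top[of 0] in eventually_elim) (rule c)
  ultimately have "?W 0 = - 2 * \<i> * k"
    by (rule tendsto_unique[OF trivial_limit_at_top_linorder, rotated])
  then show ?thesis using c[OF assms] by simp
qed

text \<open>By reflection a real zero k brings along the zero - k. Two solutions with the same
  boundary condition have Wronskian zero at 0, whereas here it is - 2 \<i> k.\<close>

lemma jostw_real_nonzero:
  assumes "k \<noteq> 0"
  shows "jostw \<gamma> (of_real k) \<noteq> 0"
proof
  assume 0: "jostw \<gamma> (of_real k) = 0"
  then have "jostw \<gamma> (of_real (- k)) = 0" using jostw_cnj[of "of_real k" \<gamma>] by simp
  with 0 show False
    using wronskian_real[of 0 k] wronskian_0[of "of_real k" "of_real (- k)" \<gamma>] assms by simp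
qed

text \<open>Otherwise both initial values vanish, so the solution is zero on the half-line, against
  its normalisation at infinity.\<close>

lemma theta_0_nonzero:
  assumes "0 \<le> Im \<zeta>" "jostw \<gamma> \<zeta> = 0"
  shows "theta \<zeta> 0 \<noteq> 0"
proof
  assume 0: "theta \<zeta> 0 = 0"
  then have "dtheta \<zeta> 0 = 0" using assms(2) by (simp add: jostw_eq)
  have z: "theta \<zeta> x = 0" if "0 \<le> x" for x
    by (rule second_order_unique[where u = "theta \<zeta>" and u' = "dtheta \<zeta>" and q = "\<lambda>x. of_real (V x) - \<zeta>\<^sup>2"])
      (use 0 \<open>dtheta \<zeta> 0 = 0\<close> that in \<open>auto intro!: has_vector_derivative_at_within theta_has_vector_derivative assms continuous_intros\<close>)
  have "\<forall>\<^sub>F x in at_top. theta \<zeta> x / exp (\<i> * \<zeta> * x) = 0"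
    by (rule eventually_mono[OF eventually_ge_at_top[of "0::real"]]) (simp add: z)
  then have "((\<lambda>x. theta \<zeta> x / exp (\<i> * \<zeta> * x)) \<longlongrightarrow> 0) at_top" by (rule tendsto_eventually)
  with theta_over_exp_tendsto(1)[OF assms(1)] show False
    using tendsto_unique trivial_limit_at_top_linorder zero_neq_one by blast
qed

lemma theta_square_integrable:
  assumes "0 < Im \<zeta>"
  shows "set_integrable lborel {0..} (\<lambda>x. (cmod (theta \<zeta> x))\<^sup>2)"
proof -
  have "set_integrable lborel {0..} (\<lambda>x. cmod (theta \<zeta> x * theta \<zeta> x))"
    by (rule set_integrable_norm[OF int_theta_mult]) (use assms in auto)
  then show ?thesis by (simp add: norm_mult power2_eq_square)
qed

section \<open>Zeros of the Jost function and lower bounds near 0\<close>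

lemma weight_near_1:
  assumes "0 < e"
  obtains R where "0 \<le> R" "\<And>\<zeta> x. 0 \<le> Im \<zeta> \<Longrightarrow> R \<le> x \<Longrightarrow> norm (jm \<zeta> x - 1) \<le> e"
proof -
  have "\<forall>\<^sub>F x in at_top. weight x < 1 + e"
    using weight_tendsto assms by (intro order_tendstoD) auto
  then obtain R where R: "\<And>x. R \<le> x \<Longrightarrow> weight x < 1 + e"
    by (auto simp: eventually_at_top_linorder)
  show thesis
  proof (rule that[of "max 0 R"])
    show "norm (jm \<zeta> x - 1) \<le> e" if "0 \<le> Im \<zeta>" "max 0 R \<le> x" for \<zeta> x
      using R[of x] norm_jm_minus_1_le[OF that(1), of x] that(2) by simp
  qed simp
qed

text \<open>Beyond an R independent of \<zeta> one has |jm| \<ge> 1/2, hence |theta|^2 \<ge> exp(- 2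
  Im \<zeta> x) / 4, and this is integrated from R. The growth like 1 / Im \<zeta> later compensates
  the factor Im \<zeta> in \<open>Im_theta_jostw\<close>.\<close>

lemma theta_square_integral_lower:
  obtains R where "0 \<le> R" "\<And>\<zeta>. 0 < Im \<zeta> \<Longrightarrow>
    exp (- (2 * Im \<zeta> * R)) / (8 * Im \<zeta>) \<le> (LINT x:{0..}|lborel. (cmod (theta \<zeta> x))\<^sup>2)"
proof -
  obtain R where R: "0 \<le> R" "\<And>\<zeta> x. 0 \<le> Im \<zeta> \<Longrightarrow> R \<le> x \<Longrightarrow> norm (jm \<zeta> x - 1) \<le> 1/2"
    using weight_near_1[of "1/2"] by auto
  have "exp (- (2 * Im \<zeta> * R)) / (8 * Im \<zeta>) \<le> (LINT x:{0..}|lborel. (cmod (theta \<zeta> x))\<^sup>2)" if "0 < Im \<zeta>" for \<zeta>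
  proof -
    have a: "0 < 2 * Im \<zeta>" using that by simp
    have lb: "exp (- (2 * Im \<zeta> * x)) / 4 \<le> (cmod (theta \<zeta> x))\<^sup>2" if "R \<le> x" for x
    proof -
      have "norm (jm \<zeta> x - 1) \<le> 1/2" using R \<open>R \<le> x\<close> \<open>0 < Im \<zeta>\<close> by simp
      then have "1/2 \<le> norm (jm \<zeta> x)"
        using norm_triangle_ineq2[of 1 "jm \<zeta> x"] by (simp add: norm_minus_commute)
      then have "(exp (- (Im \<zeta> * x)) * (1/2))\<^sup>2 \<le> (cmod (theta \<zeta> x))\<^sup>2"
        unfolding theta_def norm_mult by (intro power_mono mult_mono) auto
      moreover have "(exp (- (Im \<zeta> * x)) * (1/2))\<^sup>2 = exp (- (2 * Im \<zeta> * x)) / 4"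
        unfolding power2_eq_square using exp_add[of "- (Im \<zeta> * x)" "- (Im \<zeta> * x)"] by (simp add: mult_ac)
      ultimately show ?thesis by metis
    qed
    have "exp (- (2 * Im \<zeta> * R)) / (8 * Im \<zeta>) = (LINT x:{R..}|lborel. exp (- (2 * Im \<zeta> * x)) / 4)"
      using exp_integrable_atLeast(2)[OF a, of R] by simp
    also have "\<dots> \<le> (LINT x:{R..}|lborel. (cmod (theta \<zeta> x))\<^sup>2)"
      by (rule set_integral_mono)
        (use exp_integrable_atLeast(1)[OF a, of R] lb R(1) set_integrable_subset[OF theta_square_integrable[OF that], of "{R..}"] in auto)
    also have "\<dots> \<le> (LINT x:{0..}|lborel. (cmod (theta \<zeta> x))\<^sup>2)"
      unfolding set_lebesgue_integral_def
      by (rule integral_mono)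
        (use R(1) theta_square_integrable[OF that] set_integrable_subset[OF theta_square_integrable[OF that], of "{R..}"]
         in \<open>auto simp: set_integrable_def split: split_indicator\<close>)
    finally show ?thesis .
  qed
  then show thesis using that R(1) by blast
qed

lemma theta_square_integral_pos:
  assumes "0 < Im \<zeta>"
  shows "0 < (LINT x:{0..}|lborel. (cmod (theta \<zeta> x))\<^sup>2)"
proof -
  obtain R where "0 \<le> R" and R: "\<And>\<zeta>. 0 < Im \<zeta> \<Longrightarrow>
      exp (- (2 * Im \<zeta> * R)) / (8 * Im \<zeta>) \<le> (LINT x:{0..}|lborel. (cmod (theta \<zeta> x))\<^sup>2)"
    by (rule theta_square_integral_lower) blast
  have "0 < exp (- (2 * Im \<zeta> * R)) / (8 * Im \<zeta>)" using assms by simp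
  also note R[OF assms]
  finally show ?thesis .
qed

text \<open>The Lagrange identity with \<xi> = - cnj \<zeta>: there \<open>theta \<xi>\<close> is
  the conjugate of \<open>theta \<zeta>\<close>, so the integrand becomes a squared modulus, and
  \<xi>^2 - \<zeta>^2 = - 4 \<i> Re \<zeta> Im \<zeta>.\<close>

lemma Im_theta_jostw:
  assumes "0 < Im \<zeta>"
  shows "Im (cnj (theta \<zeta> 0) * jostw \<gamma> \<zeta>) = - 2 * Re \<zeta> * Im \<zeta> * (LINT x:{0..}|lborel. (cmod (theta \<zeta> x))\<^sup>2)"
proof -
  let ?I = "LINT x:{0..}|lborel. (cmod (theta \<zeta> x))\<^sup>2"
  have Im: "0 \<le> Im \<zeta>" "0 \<le> Im (- cnj \<zeta>)" using assms by auto
  have "theta (- cnj \<zeta>) 0 * jostw \<gamma> \<zeta> - theta \<zeta> 0 * jostw \<gamma> (- cnj \<zeta>)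
      = ((- cnj \<zeta>)\<^sup>2 - \<zeta>\<^sup>2) * (LINT x:{0..}|lborel. theta \<zeta> x * theta (- cnj \<zeta>) x)"
    by (rule wronskian_identity[OF assms Im(2)])
  also have "(LINT x:{0..}|lborel. theta \<zeta> x * theta (- cnj \<zeta>) x) = of_real ?I"
    unfolding theta_cnj[OF Im(1)] by (simp add: complex_norm_square[symmetric] set_integral_complex_of_real del: of_real_power)
  finally have "cnj (theta \<zeta> 0) * jostw \<gamma> \<zeta> - theta \<zeta> 0 * cnj (jostw \<gamma> \<zeta>) = ((cnj \<zeta>)\<^sup>2 - \<zeta>\<^sup>2) * of_real ?I"
    by (simp add: theta_cnj[OF Im(1)] jostw_cnj[OF Im(1)])
  from arg_cong[OF this, of Im] show ?thesis
    by (simp add: power2_eq_square algebra_simps)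
qed

lemma jostw_zero_imaginary:
  assumes "0 < Im \<zeta>" "jostw \<gamma> \<zeta> = 0"
  shows "Re \<zeta> = 0"
  using Im_theta_jostw[OF assms(1), of \<gamma>] theta_square_integral_pos[OF assms(1)] assms by simp

text \<open>The Lagrange identity against the zero z itself exhibits w as \<zeta> - z times a
  function whose value at z is a nonzero multiple of the integral of theta^2. On the imaginary axis
  \<open>theta\<close> is real, so this integral is positive.\<close>

lemma jostw_simple_zero:
  assumes "0 < \<kappa>" "jostw \<gamma> (\<i> * of_real \<kappa>) = 0"
  shows "deriv (jostw \<gamma>) (\<i> * of_real \<kappa>) \<noteq> 0"
proof -
  let ?z = "\<i> * complex_of_real \<kappa>"
  have Im: "0 < Im ?z" "0 \<le> Im ?z" using assms by auto
  define I where "I \<zeta> = (LINT x:{0..}|lborel. theta ?z x * theta \<zeta> x)" for \<zeta>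
  have cont: "continuous_on closed_uhp I"
    unfolding I_def set_lebesgue_integral_def
  proof (rule continuous_on_LINT_dominated)
    show "integrable lborel (\<lambda>x. indicator {0..} x *\<^sub>R (exp (- (Im ?z * x)) * (4 * (weight 0)\<^sup>2)))"
      using exp_integrable_atLeast(1)[OF Im(1), of 0, THEN set_integrable_mult_left, of "4 * (weight 0)\<^sup>2"]
      by (simp only: set_integrable_def)
    show "(\<lambda>x. indicator {0..} x *\<^sub>R (theta ?z x * theta \<zeta> x)) \<in> borel_measurable lborel" if "\<zeta> \<in> closed_uhp" for \<zeta>
      using int_theta_mult[OF Im(1), of \<zeta>] that unfolding set_integrable_def by auto
    show "norm (indicator {0..} x *\<^sub>R (theta ?z x * theta \<zeta> x)) \<le> indicator {0..} x *\<^sub>R (exp (- (Im ?z * x)) * (4 * (weight 0)\<^sup>2))"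
      if "\<zeta> \<in> closed_uhp" for \<zeta> x
      using norm_theta_mult_le[OF Im(2), of \<zeta> x] that by (auto split: split_indicator)
  qed (auto intro!: continuous_intros continuous_jm simp: theta_def)
  have th: "cnj (theta ?z x) = theta ?z x" for x
    using theta_cnj[OF Im(2), of x] by simp
  have "theta ?z x * theta ?z x = of_real ((cmod (theta ?z x))\<^sup>2)" for x
    using complex_norm_square[of "theta ?z x"] th[of x] by simp
  then have "I ?z = of_real (LINT x:{0..}|lborel. (cmod (theta ?z x))\<^sup>2)"
    unfolding I_def by (simp only: set_integral_complex_of_real)
  then have Inz: "I ?z \<noteq> 0" using theta_square_integral_pos[OF Im(1)] by (simp del: of_real_power)
  have t0: "theta ?z 0 \<noteq> 0" using theta_0_nonzero assms Im by blast
  have w: "jostw \<gamma> \<zeta> = (\<zeta> - ?z) * (- (\<zeta> + ?z) * I \<zeta> / theta ?z 0)" if "0 \<le> Im \<zeta>" for \<zeta>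
  proof -
    have "- (theta ?z 0 * jostw \<gamma> \<zeta>) = (\<zeta>\<^sup>2 - ?z\<^sup>2) * I \<zeta>"
      using wronskian_identity[OF Im(1) that, of \<gamma>] assms(2) by (simp add: I_def)
    then have "theta ?z 0 * jostw \<gamma> \<zeta> = - ((\<zeta>\<^sup>2 - ?z\<^sup>2) * I \<zeta>)"
      by (metis minus_minus)
    then have "jostw \<gamma> \<zeta> = - ((\<zeta>\<^sup>2 - ?z\<^sup>2) * I \<zeta>) / theta ?z 0"
      using t0 by (metis nonzero_mult_div_cancel_left)
    also have "\<zeta>\<^sup>2 - ?z\<^sup>2 = (\<zeta> - ?z) * (\<zeta> + ?z)" by (simp add: power2_eq_square algebra_simps)
    finally have "jostw \<gamma> \<zeta> = - ((\<zeta> - ?z) * ((\<zeta> + ?z) * I \<zeta>)) / theta ?z 0"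
      by (simp only: mult.assoc)
    then show ?thesis
      by (simp only: minus_mult_left[symmetric] minus_mult_right times_divide_eq_right)
  qed
  have "((\<lambda>\<zeta>. - (\<zeta> + ?z) * I \<zeta> / theta ?z 0) \<longlongrightarrow> - (?z + ?z) * I ?z / theta ?z 0) (at ?z)"
  proof -
    have "continuous_on open_uhp I"
      by (rule continuous_on_subset[OF cont]) auto
    then have "isCont I ?z"
      using Im(1) open_open_uhp continuous_on_eq_continuous_at by blast
    then show ?thesis using t0 by (intro tendsto_intros) (auto simp: isCont_def)
  qed
  then have "((\<lambda>\<zeta>. (jostw \<gamma> \<zeta> - jostw \<gamma> ?z) / (\<zeta> - ?z)) \<longlongrightarrow> - (?z + ?z) * I ?z / theta ?z 0) (at ?z)"
  proof (rule Lim_transform_eventually)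
    have "\<forall>\<^sub>F \<zeta> in at ?z. \<zeta> \<in> open_uhp - {?z}"
      using Im(1) open_open_uhp by (intro eventually_at_in_open) auto
    then show "\<forall>\<^sub>F \<zeta> in at ?z. - (\<zeta> + ?z) * I \<zeta> / theta ?z 0 = (jostw \<gamma> \<zeta> - jostw \<gamma> ?z) / (\<zeta> - ?z)"
      by eventually_elim (simp add: w[of _] assms(2) less_imp_le)
  qed
  then have "deriv (jostw \<gamma>) ?z = - (?z + ?z) * I ?z / theta ?z 0"
    by (intro DERIV_imp_deriv) (simp add: has_field_derivative_iff)
  then show ?thesis using Inz t0 assms(1) by simp
qed

lemma norm_jostw_theta_ge:
  assumes "0 < Im \<zeta>"
  shows "2 * \<bar>Re \<zeta>\<bar> * Im \<zeta> * (LINT x:{0..}|lborel. (cmod (theta \<zeta> x))\<^sup>2) \<le> norm (theta \<zeta> 0) * norm (jostw \<gamma> \<zeta>)"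
proof -
  have "\<bar>Im (cnj (theta \<zeta> 0) * jostw \<gamma> \<zeta>)\<bar> \<le> norm (cnj (theta \<zeta> 0) * jostw \<gamma> \<zeta>)"
    by (rule abs_Im_le_cmod)
  then show ?thesis
    unfolding Im_theta_jostw[OF assms] norm_mult
    using assms theta_square_integral_pos[OF assms] by (simp add: abs_mult)
qed

lemma norm_theta_0_le: "0 \<le> Im \<zeta> \<Longrightarrow> norm (theta \<zeta> 0) \<le> 2 * weight 0"
  using norm_theta_le(1)[of \<zeta> 0] by simp

text \<open>Off the imaginary axis the imaginary part of \<open>cnj (theta \<zeta> 0) * jostw \<gamma> \<zeta>\<close> is bounded from below,
  because the norm of \<open>theta \<zeta>\<close> blows up like \<open>1 / Im \<zeta>\<close>; near the axis the comparison with \<open>theta 0\<close> helps.\<close>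

lemma jostw_lower_bound_side:
  obtains c where "0 < c"
    "\<And>\<zeta>. 0 < Im \<zeta> \<Longrightarrow> Im \<zeta> \<le> 1 \<Longrightarrow> c * \<bar>Re \<zeta>\<bar> \<le> norm (jostw \<gamma> \<zeta>)"
proof -
  obtain R where R: "0 \<le> R" "\<And>\<zeta>. 0 < Im \<zeta> \<Longrightarrow>
      exp (- (2 * Im \<zeta> * R)) / (8 * Im \<zeta>) \<le> (LINT x:{0..}|lborel. (cmod (theta \<zeta> x))\<^sup>2)"
    by (rule theta_square_integral_lower) blast
  have "exp (- (2 * R)) / (8 * weight 0) * \<bar>Re \<zeta>\<bar> \<le> norm (jostw \<gamma> \<zeta>)" if \<zeta>: "0 < Im \<zeta>" "Im \<zeta> \<le> 1" for \<zeta>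
  proof -
    have "Im \<zeta> * R \<le> 1 * R" using \<zeta> R(1) by (intro mult_right_mono) auto
    then have "exp (- (2 * R)) / (8 * Im \<zeta>) \<le> exp (- (2 * Im \<zeta> * R)) / (8 * Im \<zeta>)"
      using \<zeta> by (intro divide_right_mono) auto
    also note R(2)[OF \<zeta>(1)]
    finally have "2 * \<bar>Re \<zeta>\<bar> * Im \<zeta> * (exp (- (2 * R)) / (8 * Im \<zeta>)) \<le> 2 * \<bar>Re \<zeta>\<bar> * Im \<zeta> * (LINT x:{0..}|lborel. (cmod (theta \<zeta> x))\<^sup>2)"
      using \<zeta> by (intro mult_left_mono) auto
    also have "\<dots> \<le> norm (theta \<zeta> 0) * norm (jostw \<gamma> \<zeta>)"
      by (rule norm_jostw_theta_ge[OF \<zeta>(1)])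
    also have "\<dots> \<le> 2 * weight 0 * norm (jostw \<gamma> \<zeta>)"
      using \<zeta> by (intro mult_right_mono norm_theta_0_le) auto
    finally show ?thesis using weight_pos[of 0] \<zeta> by (simp add: field_simps)
  qed
  then show thesis using that[of "exp (- (2 * R)) / (8 * weight 0)"] weight_pos[of 0] by simp
qed

lemma exp_integral_tail:
  assumes "0 < Im \<zeta>"
  shows "set_integrable lborel {R..} (\<lambda>x::real. exp (\<i> * \<zeta> * x))"
    "(LINT x:{R..}|lborel. exp (\<i> * \<zeta> * complex_of_real x)) = - exp (\<i> * \<zeta> * R) / (\<i> * \<zeta>)"
proof -
  have nz: "\<zeta> \<noteq> 0" using assms by auto
  show int: "set_integrable lborel {R..} (\<lambda>x::real. exp (\<i> * \<zeta> * x))"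
    by (rule set_integrable_continuous_bound[OF _ _ exp_integrable_atLeast(1)[OF assms]]) (auto intro!: continuous_intros)
  have d: "((\<lambda>x::real. exp (\<i> * \<zeta> * x) / (\<i> * \<zeta>)) has_vector_derivative exp (\<i> * \<zeta> * x)) (at x within {R..})" for x
    by (rule has_vector_derivative_real_field) (use nz in \<open>auto intro!: derivative_eq_intros\<close>)
  have l: "((\<lambda>x::real. exp (\<i> * \<zeta> * x) / (\<i> * \<zeta>)) \<longlongrightarrow> 0) at_top"
    by (rule Lim_null_comparison[OF _ exp_decay_tendsto_0[OF assms, of "1 / norm \<zeta>"]])
      (simp add: norm_divide norm_mult)
  show "(LINT x:{R..}|lborel. exp (\<i> * \<zeta> * complex_of_real x)) = - exp (\<i> * \<zeta> * R) / (\<i> * \<zeta>)"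
    using set_integral_FTC_atLeast[OF d _ int l] by (simp add: continuous_intros)
qed

text \<open>If w(0) = 0, the Lagrange identity with \<xi> = 0 equates theta(0,0) w(\<zeta>) with -
  \<zeta>^2 times the integral of theta(\<zeta>) theta(0). For large x the integrand is close to
  exp(\<i> \<zeta> x), whose integral has size 1 / |\<zeta>|; this dominates in the sector |\<zeta>|
  \<le> 2 Im \<zeta>.\<close>

lemma jostw_lower_bound_axis:
  assumes "jostw \<gamma> 0 = 0"
  obtains c d where "0 < c" "0 < d"
    "\<And>\<zeta>. 0 < Im \<zeta> \<Longrightarrow> norm \<zeta> \<le> 2 * Im \<zeta> \<Longrightarrow> norm \<zeta> < d \<Longrightarrow> c * norm \<zeta> \<le> norm (jostw \<gamma> \<zeta>)"
proof -
  \<comment> \<open>With both factors within 1/10 of 1 their product is within 21/100 \<le> 1/4 of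
    1. In the sector the resulting error exp(- Im \<zeta> R) / (4 Im \<zeta>) is at most half of the
    main term exp(- Im \<zeta> R) / |\<zeta>|.\<close>
  obtain R where R: "0 \<le> R" "\<And>\<zeta> x. 0 \<le> Im \<zeta> \<Longrightarrow> R \<le> x \<Longrightarrow> norm (jm \<zeta> x - 1) \<le> 1/10"
    using weight_near_1[of "1/10"] by auto
  have t0: "theta 0 0 \<noteq> 0" using theta_0_nonzero[of 0 \<gamma>] assms by simp
  define K where "K = R * (4 * (weight 0)\<^sup>2)"
  have K: "0 \<le> K" using R(1) by (simp add: K_def)
  define c where "c = exp (- R) / (4 * norm (theta 0 0))"
  \<comment> \<open>For |\<zeta>| < d the contribution of [0, R), bounded by \<open>K\<close>,
    consumes at most half of what remains of the main term, and Im \<zeta> \<le> 1 allows exp(- Im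
    \<zeta> R) to be replaced by exp(- R).\<close>
  define d where "d = min 1 (exp (- R) / (4 * (K + 1)))"
  have "c * norm \<zeta> \<le> norm (jostw \<gamma> \<zeta>)"
    if \<zeta>: "0 < Im \<zeta>" "norm \<zeta> \<le> 2 * Im \<zeta>" "norm \<zeta> < d" for \<zeta>
  proof -
    have nz: "\<zeta> \<noteq> 0" "0 < norm \<zeta>" using \<zeta>(1) by auto
    have Im1: "Im \<zeta> \<le> 1" using \<zeta> abs_Im_le_cmod[of \<zeta>] by (simp add: d_def)
    let ?f = "\<lambda>x. theta \<zeta> x * theta 0 x" and ?e = "\<lambda>x::real. exp (\<i> * \<zeta> * x)"
    have int: "set_integrable lborel {0..} ?f" by (rule int_theta_mult) (use \<zeta> in auto)
    have int': "set_integrable lborel {0..<R} ?f" "set_integrable lborel {R..} ?f"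
      using R(1) by (auto intro: set_integrable_subset[OF int])
    have un: "{0..} = {0..<R} \<union> {R..}" using R(1) by auto
    have triangle: "norm e \<le> norm (a + b) + norm (b - e) + norm a" for a b e :: complex
      by norm
    have "(LINT x:{0..}|lborel. ?f x) = (LINT x:{0..<R}|lborel. ?f x) + (LINT x:{R..}|lborel. ?f x)"
      unfolding un by (rule set_integral_Un) (use int' in auto)
    moreover have "norm (LINT x:{0..<R}|lborel. ?f x) \<le> K"
    proof -
      have "norm (LINT x:{0..<R}|lborel. ?f x) \<le> (LINT x:{0..<R}|lborel. 4 * (weight 0)\<^sup>2)"
      proof (rule set_integral_norm_le[OF int'(1)])
        show "norm (?f x) \<le> 4 * (weight 0)\<^sup>2" if "x \<in> {0..<R}" for x
          using norm_theta_mult_le[of 0 \<zeta> x] \<zeta>(1) that by (simp add: mult.commute)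
        show "set_integrable lborel {0..<R} (\<lambda>_. 4 * (weight 0)\<^sup>2)"
          by (rule set_integrable_subset[of _ "{0..R}"]) (auto intro!: borel_integrable_atLeastAtMost')
      qed
      then show ?thesis using R(1) by (simp add: K_def set_lebesgue_integral_def)
    qed
    moreover have "norm ((LINT x:{R..}|lborel. ?f x) - (LINT x:{R..}|lborel. ?e x)) \<le> exp (- (Im \<zeta> * R)) / (2 * norm \<zeta>)"
    proof -
      have "(LINT x:{R..}|lborel. ?f x) - (LINT x:{R..}|lborel. ?e x) = (LINT x:{R..}|lborel. ?f x - ?e x)"
        by (rule set_integral_diff(2)[symmetric]) (use int' exp_integral_tail[OF \<zeta>(1)] in auto)
      also have "norm \<dots> \<le> (LINT x:{R..}|lborel. exp (- (Im \<zeta> * x)) * (1/4))"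
      proof (rule set_integral_norm_le)
        fix x assume x: "x \<in> {R..}"
        let ?a = "jm \<zeta> x - 1" and ?b = "jm 0 x - 1"
        have ab: "norm ?a \<le> 1/10" "norm ?b \<le> 1/10" using R(2) x \<zeta>(1) by auto
        have "norm (?a * ?b) \<le> 1/10 * (1/10)" unfolding norm_mult using ab by (intro mult_mono) auto
        then have "norm (?a * ?b + ?a + ?b) \<le> 1/10 * (1/10) + 1/10 + 1/10"
          using ab by (intro norm_triangle_mono)
        moreover have "?f x - ?e x = ?e x * (?a * ?b + ?a + ?b)"
          by (simp add: theta_def algebra_simps)
        ultimately show "norm (?f x - ?e x) \<le> exp (- (Im \<zeta> * x)) * (1/4)"
          by (simp add: norm_mult)
      qed (use int' exp_integral_tail[OF \<zeta>(1)] exp_integrable_atLeast[OF \<zeta>(1)] in auto)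
      also have "\<dots> = exp (- (Im \<zeta> * R)) / Im \<zeta> * (1/4)"
        using exp_integrable_atLeast(2)[OF \<zeta>(1), of R] by simp
      also have "\<dots> = exp (- (Im \<zeta> * R)) / (4 * Im \<zeta>)" by simp
      also have "\<dots> \<le> exp (- (Im \<zeta> * R)) / (2 * norm \<zeta>)"
      proof (rule divide_left_mono)
        show "0 < 4 * Im \<zeta> * (2 * norm \<zeta>)" by (intro mult_pos_pos nz \<zeta>(1)) auto
      qed (use \<zeta>(2) in auto)
      finally show ?thesis .
    qed
    moreover have "norm (LINT x:{R..}|lborel. ?e x) = exp (- (Im \<zeta> * R)) / norm \<zeta>"
      unfolding exp_integral_tail(2)[OF \<zeta>(1)] by (simp add: norm_divide norm_mult)
    ultimately have "exp (- (Im \<zeta> * R)) / norm \<zeta> - exp (- (Im \<zeta> * R)) / (2 * norm \<zeta>) - K \<le> norm (LINT x:{0..}|lborel. ?f x)"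
      using triangle[of "LINT x:{R..}|lborel. ?e x" "LINT x:{0..<R}|lborel. ?f x" "LINT x:{R..}|lborel. ?f x"]
      by simp
    moreover have "exp (- R) / (2 * norm \<zeta>) \<le> exp (- (Im \<zeta> * R)) / norm \<zeta> - exp (- (Im \<zeta> * R)) / (2 * norm \<zeta>)"
    proof -
      have "Im \<zeta> * R \<le> 1 * R" using Im1 R(1) by (intro mult_right_mono) auto
      then have "exp (- R) / (2 * norm \<zeta>) \<le> exp (- (Im \<zeta> * R)) / (2 * norm \<zeta>)"
        by (intro divide_right_mono) auto
      then show ?thesis by (simp add: field_simps)
    qed
    moreover have "K \<le> exp (- R) / (4 * norm \<zeta>)"
    proof -
      have "norm \<zeta> < exp (- R) / (4 * (K + 1))" using \<zeta>(3) by (simp add: d_def)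
      then have "norm \<zeta> * (4 * (K + 1)) < exp (- R)" using K by (simp add: field_simps)
      moreover have "K * (4 * norm \<zeta>) \<le> norm \<zeta> * (4 * (K + 1))" using nz by (simp add: algebra_simps)
      ultimately have "K * (4 * norm \<zeta>) \<le> exp (- R)" by linarith
      then show ?thesis using nz by (simp add: pos_le_divide_eq)
    qed
    moreover have "exp (- R) / (2 * norm \<zeta>) - exp (- R) / (4 * norm \<zeta>) = exp (- R) / (4 * norm \<zeta>)"
      by (simp add: field_simps)
    ultimately have I: "exp (- R) / (4 * norm \<zeta>) \<le> norm (LINT x:{0..}|lborel. ?f x)"
      by linarith
    have "theta 0 0 * jostw \<gamma> \<zeta> = - \<zeta>\<^sup>2 * (LINT x:{0..}|lborel. ?f x)"
      using wronskian_identity[OF \<zeta>(1), of 0 \<gamma>] assms by simp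
    then have "norm (theta 0 0) * norm (jostw \<gamma> \<zeta>) = (norm \<zeta>)\<^sup>2 * norm (LINT x:{0..}|lborel. ?f x)"
      by (metis norm_minus_cancel norm_mult norm_power)
    also have "\<dots> \<ge> (norm \<zeta>)\<^sup>2 * (exp (- R) / (4 * norm \<zeta>))"
      using I by (rule mult_left_mono) auto
    finally have "norm \<zeta> * exp (- R) / 4 \<le> norm (theta 0 0) * norm (jostw \<gamma> \<zeta>)"
      using nz by (simp add: power2_eq_square)
    then show ?thesis using t0 by (simp add: c_def field_simps)
  qed
  moreover have "0 < c" "0 < d" using t0 K by (auto simp: c_def d_def)
  ultimately show thesis using that by blast
qed

text \<open>If w(0) = 0, the sector |\<zeta>| \<le> 2 Im \<zeta> is covered by the estimate near the
  axis; outside it |\<zeta>| \<le> 2 |Re \<zeta>|, and the estimate by |Re \<zeta>| applies. If w(0)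
  is nonzero, continuity gives even a constant bound.\<close>

lemma jostw_lower_bound:
  obtains c d where "0 < c" "0 < d"
    "\<And>\<zeta>. 0 < Im \<zeta> \<Longrightarrow> norm \<zeta> < d \<Longrightarrow> c * norm \<zeta> \<le> norm (jostw \<gamma> \<zeta>)"
proof (cases "jostw \<gamma> 0 = 0")
  case True
  obtain c1 where c1: "0 < c1"
    "\<And>\<zeta>. 0 < Im \<zeta> \<Longrightarrow> Im \<zeta> \<le> 1 \<Longrightarrow> c1 * \<bar>Re \<zeta>\<bar> \<le> norm (jostw \<gamma> \<zeta>)"
    by (rule jostw_lower_bound_side) blast
  obtain c2 d where c2: "0 < c2" "0 < d"
    "\<And>\<zeta>. 0 < Im \<zeta> \<Longrightarrow> norm \<zeta> \<le> 2 * Im \<zeta> \<Longrightarrow> norm \<zeta> < d \<Longrightarrow> c2 * norm \<zeta> \<le> norm (jostw \<gamma> \<zeta>)"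
    by (rule jostw_lower_bound_axis[OF True]) blast
  show thesis
  proof (rule that[of "min (c1 / 2) c2" "min d 1"])
    fix \<zeta> assume \<zeta>: "0 < Im \<zeta>" "norm \<zeta> < min d 1"
    show "min (c1 / 2) c2 * norm \<zeta> \<le> norm (jostw \<gamma> \<zeta>)"
    proof (cases "norm \<zeta> \<le> 2 * Im \<zeta>")
      case True
      have "min (c1 / 2) c2 * norm \<zeta> \<le> c2 * norm \<zeta>" by (intro mult_right_mono) auto
      also have "\<dots> \<le> norm (jostw \<gamma> \<zeta>)" using c2 True \<zeta> by simp
      finally show ?thesis .
    next
      case False
      have "norm \<zeta> \<le> \<bar>Re \<zeta>\<bar> + \<bar>Im \<zeta>\<bar>" by (rule cmod_le)
      then have "norm \<zeta> \<le> 2 * \<bar>Re \<zeta>\<bar>" using False \<zeta> by linarith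
      moreover have "min (c1 / 2) c2 * norm \<zeta> \<le> c1 / 2 * norm \<zeta>" by (intro mult_right_mono) auto
      ultimately have "min (c1 / 2) c2 * norm \<zeta> \<le> c1 * \<bar>Re \<zeta>\<bar>"
        using c1(1) mult_left_mono[of "norm \<zeta>" "2 * \<bar>Re \<zeta>\<bar>" "c1 / 2"] by linarith
      also have "\<dots> \<le> norm (jostw \<gamma> \<zeta>)"
        using \<zeta>(2) abs_Im_le_cmod[of \<zeta>] by (intro c1(2)[OF \<zeta>(1)]) linarith
      finally show ?thesis .
    qed
  qed (use c1 c2 in auto)
next
  case False
  let ?a = "norm (jostw \<gamma> 0) / 2"
  have a: "0 < ?a" using False by simp
  have "continuous (at 0 within closed_uhp) (jostw \<gamma>)"
    using continuous_jostw by (auto simp: continuous_on_eq_continuous_within)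
  then have "\<exists>d>0. \<forall>\<zeta>\<in>closed_uhp. dist \<zeta> 0 < d \<longrightarrow> dist (jostw \<gamma> \<zeta>) (jostw \<gamma> 0) < ?a"
    unfolding continuous_within_eps_delta using a by blast
  then obtain d where d: "0 < d" "\<And>\<zeta>. 0 \<le> Im \<zeta> \<Longrightarrow> norm \<zeta> < d \<Longrightarrow> norm (jostw \<gamma> \<zeta> - jostw \<gamma> 0) < ?a"
    by (auto simp: dist_norm)
  show thesis
  proof (rule that[of ?a "min d 1"])
    fix \<zeta> assume \<zeta>: "0 < Im \<zeta>" "norm \<zeta> < min d 1"
    then have "norm (jostw \<gamma> \<zeta> - jostw \<gamma> 0) < ?a" using d by simp
    then have "?a \<le> norm (jostw \<gamma> \<zeta>)"
      using norm_triangle_ineq2[of "jostw \<gamma> 0" "jostw \<gamma> \<zeta>"] by (simp add: norm_minus_commute)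
    moreover have "?a * norm \<zeta> \<le> ?a * 1" using \<zeta> a by (intro mult_left_mono) auto
    ultimately show "?a * norm \<zeta> \<le> norm (jostw \<gamma> \<zeta>)" by simp
  qed (use a d in auto)
qed

text \<open>The combination jp + 2 \<i> \<zeta> (jm - 1) has derivative V jm and tends to 0 at
  infinity, so at 0 it is bounded uniformly in \<zeta>. This controls \<zeta> (jm - 1) without an
  expansion.\<close>

lemma jostw_large:
  obtains K where "0 < K" "\<And>\<zeta>. 0 \<le> Im \<zeta> \<Longrightarrow> norm (jostw \<gamma> \<zeta> + \<i> * \<zeta>) \<le> K"
proof -
  define K where "K = \<bar>\<gamma>\<bar> * (2 * weight 0) + 4 * (weight 0 * tailV 0) + 1"
  have "norm (jostw \<gamma> \<zeta> + \<i> * \<zeta>) \<le> K" if Im: "0 \<le> Im \<zeta>" for \<zeta>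
  proof -
    have d: "((\<lambda>x. jp \<zeta> x + 2 * \<i> * \<zeta> * (jm \<zeta> x - 1)) has_vector_derivative V x * jm \<zeta> x) (at x within {0..})" for x
      by (rule has_vector_derivative_at_within, rule has_vector_derivative_eq_rhs, rule has_vector_derivative_add
          [OF jp_has_vector_derivative[OF Im] has_vector_derivative_mult_right[OF has_vector_derivative_diff[OF jm_has_vector_derivative[OF Im] has_vector_derivative_const]]])
        simp
    have l: "((\<lambda>x. jp \<zeta> x + 2 * \<i> * \<zeta> * (jm \<zeta> x - 1)) \<longlongrightarrow> 0 + 2 * \<i> * \<zeta> * (1 - 1)) at_top"
      by (intro tendsto_intros jp_tendsto_0 jm_tendsto_1 Im)
    have b: "norm (V x * jm \<zeta> x) \<le> \<bar>V x\<bar> * (2 * weight x)" for x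
      unfolding norm_mult using norm_jm_le[OF Im] by (auto intro!: mult_left_mono)
    have c: "continuous_on {0..} (\<lambda>x. V x * jm \<zeta> x)"
      using cont_jm[OF Im] by (intro continuous_intros) (auto intro: continuous_on_subset)
    have int: "set_integrable lborel {0..} (\<lambda>x. V x * jm \<zeta> x)"
      by (rule set_integrable_continuous_bound[OF c _ int_V_weight[of 0 2] b]) auto
    have "norm (LINT x:{0..}|lborel. V x * jm \<zeta> x) \<le> tail_integral (\<lambda>x. \<bar>V x\<bar> * (2 * weight x)) 0"
      unfolding tail_integral_def by (rule set_integral_norm_le[OF int int_V_weight b])
    also have "\<dots> \<le> 2 * weight 0 * tailV 0" by (rule tail_V_weight_le) simp
    finally have h: "norm (jp \<zeta> 0 + 2 * \<i> * \<zeta> * (jm \<zeta> 0 - 1)) \<le> 2 * weight 0 * tailV 0"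
      using set_integral_FTC_atLeast[OF d c int l]
        norm_minus_cancel[of "jp \<zeta> 0 + 2 * \<i> * \<zeta> * (jm \<zeta> 0 - 1)"] by simp
    have "jostw \<gamma> \<zeta> + \<i> * \<zeta> = \<gamma> * jm \<zeta> 0 - jp \<zeta> 0 / 2 - (jp \<zeta> 0 + 2 * \<i> * \<zeta> * (jm \<zeta> 0 - 1)) / 2"
      by (simp add: jostw_def field_simps)
    also have "norm \<dots> \<le> \<bar>\<gamma>\<bar> * (2 * weight 0) + 2 * weight 0 * tailV 0 / 2 + 2 * weight 0 * tailV 0 / 2"
      using norm_jm_le[OF Im, of 0] norm_jp_le[OF Im, of 0] h
      by (intro norm_triangle_le_diff add_mono) (auto simp: norm_mult norm_divide intro!: mult_left_mono)
    also have "\<dots> \<le> K"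
      using weight_pos[of 0] tailV_nonneg[of 0] by (simp add: K_def)
    finally show ?thesis .
  qed
  moreover have "0 < K" using weight_pos[of 0] tailV_nonneg[of 0] by (auto simp: K_def intro!: add_nonneg_pos add_nonneg_nonneg)
  ultimately show thesis using that by blast
qed

text \<open>The zeros lie in a compact subset of the open half plane: near 0 they are excluded by
  the linear lower bound, far out because w + \<i> \<zeta> is bounded, and on the real axis by
  \<open>jostw_real_nonzero\<close>. A nonconstant holomorphic function has finitely many zeros in
  such a set.\<close>

lemma finite_jostw_zeros: "finite {\<zeta> \<in> open_uhp. jostw \<gamma> \<zeta> = 0}"
proof -
  obtain c d where cd: "0 < c" "0 < d"
    "\<And>\<zeta>. 0 < Im \<zeta> \<Longrightarrow> norm \<zeta> < d \<Longrightarrow> c * norm \<zeta> \<le> norm (jostw \<gamma> \<zeta>)"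
    by (rule jostw_lower_bound) blast
  obtain K where K: "0 < K" "\<And>\<zeta>. 0 \<le> Im \<zeta> \<Longrightarrow> norm (jostw \<gamma> \<zeta> + \<i> * \<zeta>) \<le> K"
    by (rule jostw_large) blast
  define Z where "Z = {\<zeta> \<in> closed_uhp \<inter> (cball 0 K - ball 0 d). jostw \<gamma> \<zeta> \<in> {0}}"
  have "closed (closed_uhp \<inter> (cball 0 K - ball 0 d))"
    by (intro closed_Int closed_halfspace_Im_ge closed_Diff) auto
  then have "closed Z"
    unfolding Z_def by (intro continuous_closed_preimage[unfolded vimage_def Int_def, simplified]
        continuous_on_subset[OF continuous_jostw]) auto
  then have "compact Z" unfolding Z_def by (rule_tac compact_eq_bounded_closed[THEN iffD2])
      (auto intro: bounded_subset[OF bounded_cball[of 0 K]])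
  have sub: "Z \<subseteq> open_uhp"
  proof
    fix \<zeta> assume \<zeta>: "\<zeta> \<in> Z"
    have "Im \<zeta> \<noteq> 0"
    proof
      assume "Im \<zeta> = 0"
      then have "\<zeta> = of_real (Re \<zeta>)" by (simp add: complex_eq_iff)
      moreover have "Re \<zeta> \<noteq> 0" using \<zeta> cd(2) \<open>\<zeta> = of_real (Re \<zeta>)\<close> by (auto simp: Z_def)
      ultimately show False using jostw_real_nonzero[of "Re \<zeta>" \<gamma>] \<zeta> by (simp add: Z_def)
    qed
    then show "\<zeta> \<in> open_uhp" using \<zeta> by (auto simp: Z_def)
  qed
  have nc: "\<not> jostw \<gamma> constant_on open_uhp"
  proof
    assume "jostw \<gamma> constant_on open_uhp"
    then obtain a where a: "\<And>\<zeta>. \<zeta> \<in> open_uhp \<Longrightarrow> jostw \<gamma> \<zeta> = a" by (auto simp: constant_on_def)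
    \<comment> \<open>At the height t the bound for |w + \<i> \<zeta>| fails if w has the constant
      value a.\<close>
    define t where "t = K + norm a + 1"
    have t: "0 < t" using K(1) by (simp add: t_def add_pos_nonneg)
    have "norm (a + \<i> * (\<i> * of_real t)) \<le> K"
      using K(2)[of "\<i> * of_real t"] a[of "\<i> * of_real t"] t by simp
    moreover have "t - norm a \<le> norm (a + \<i> * (\<i> * of_real t))"
      using norm_triangle_ineq2[of "of_real t" a] t by (simp add: norm_minus_commute)
    ultimately show False by (simp add: t_def)
  qed
  have "finite {\<zeta> \<in> Z. jostw \<gamma> \<zeta> = 0}"
    by (rule holomorphic_compact_finite_zeros[OF holomorphic_jostw open_open_uhp _ \<open>compact Z\<close> sub nc])
      (rule convex_connected[OF convex_open_uhp])
  moreover have "{\<zeta> \<in> open_uhp. jostw \<gamma> \<zeta> = 0} \<subseteq> {\<zeta> \<in> Z. jostw \<gamma> \<zeta> = 0}"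
  proof safe
    fix \<zeta> assume \<zeta>: "0 < Im \<zeta>" "jostw \<gamma> \<zeta> = 0"
    have "norm \<zeta> \<le> K" using K(2)[of \<zeta>] \<zeta> by (simp add: norm_mult)
    moreover have "\<not> norm \<zeta> < d" using cd \<zeta> by (smt (verit) mult_pos_pos norm_eq_zero norm_zero zero_complex.simps(2) zero_less_norm_iff)
    ultimately show "\<zeta> \<in> Z" using \<zeta> by (simp add: Z_def)
  qed
  ultimately show ?thesis by (rule rev_finite_subset)
qed

text \<open>\<open>U\<close> is the potential as given, with arbitrary values at negative arguments,
  and \<open>V\<close> its continuous continuation; the notions of the theorem only see the
  half-line. The same device is used for the eigenvalues and the final formulas.\<close>

lemma is_jost_solution_theta:
  assumes "0 \<le> Im \<zeta>" "\<zeta> \<noteq> 0" and U: "\<And>x. 0 \<le> x \<Longrightarrow> U x = V x" and u: "\<And>x. 0 \<le> x \<Longrightarrow> u x = theta \<zeta> x"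
  shows "is_jost_solution U \<zeta> u" "\<And>x. 0 \<le> x \<Longrightarrow> hderiv u x = dtheta \<zeta> x"
proof -
  have 1: "(u has_vector_derivative dtheta \<zeta> x) (at x within {0..})" if "0 \<le> x" for x
    by (rule has_vector_derivative_transform[OF _ _ has_vector_derivative_at_within[OF theta_has_vector_derivative(1)[OF assms(1)]]])
      (use that u in auto)
  show h: "hderiv u x = dtheta \<zeta> x" if "0 \<le> x" for x
    using hderiv_eqI[OF 1] that by blast
  have 2: "(hderiv u has_vector_derivative (of_real (V x) - \<zeta>\<^sup>2) * theta \<zeta> x) (at x within {0..})" if "0 \<le> x" for x
    by (rule has_vector_derivative_transform[OF _ _ has_vector_derivative_at_within[OF theta_has_vector_derivative(2)[OF assms(1)]]])
      (use that h in auto)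
  have ev: "\<forall>\<^sub>F x in at_top. (0::real) \<le> x" by (rule eventually_ge_at_top)
  have "((\<lambda>x. u x / exp (\<i> * \<zeta> * of_real x)) \<longlongrightarrow> 1) at_top"
    by (rule Lim_transform_eventually[OF theta_over_exp_tendsto(1)[OF assms(1)]])
      (use ev in eventually_elim, simp add: u)
  moreover have "((\<lambda>x. hderiv u x / (\<i> * \<zeta> * exp (\<i> * \<zeta> * of_real x))) \<longlongrightarrow> 1) at_top"
  proof (rule Lim_transform_eventually)
    show "((\<lambda>x. dtheta \<zeta> x / exp (\<i> * \<zeta> * of_real x) / (\<i> * \<zeta>)) \<longlongrightarrow> 1) at_top"
      using tendsto_divide[OF theta_over_exp_tendsto(2)[OF assms(1)] tendsto_const[of "\<i> * \<zeta>"]] assms(2) by simp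
    show "\<forall>\<^sub>F x in at_top. dtheta \<zeta> x / exp (\<i> * \<zeta> * of_real x) / (\<i> * \<zeta>) = hderiv u x / (\<i> * \<zeta> * exp (\<i> * \<zeta> * of_real x))"
      using ev by eventually_elim (simp add: h mult.commute)
  qed
  moreover have "hderiv (hderiv u) x = (of_real (V x) - \<zeta>\<^sup>2) * theta \<zeta> x" if "0 \<le> x" for x
    using hderiv_eqI[OF 2] that by blast
  moreover have "u differentiable (at x within {0..})" "hderiv u differentiable (at x within {0..})" if "0 \<le> x" for x
    using 1[OF that] 2[OF that] differentiableI_vector by blast+
  ultimately show "is_jost_solution U \<zeta> u"
    unfolding is_jost_solution_def by (auto simp: u U algebra_simps)
qed

text \<open>The difference d of two Jost solutions and its derivative tend to 0, since |exp(\<i> k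
  x)| = 1. The Wronskians of d with theta(k) and theta(- k) are constant and hence 0; as these two
  solutions have a nonzero Wronskian, d = 0.\<close>

lemma jost_solution_unique:
  assumes "k \<noteq> 0" and U: "\<And>x. 0 \<le> x \<Longrightarrow> U x = V x"
    and u: "is_jost_solution U (of_real k) u" and "0 \<le> x"
  shows "u x = theta (of_real k) x"
proof -
  define d where "d x = u x - theta (of_real k) x" for x
  define d' where "d' x = hderiv u x - dtheta (of_real k) x" for x
  have hd: "(f has_vector_derivative hderiv f x) (at x within {0..})"
    if "f differentiable (at x within {0..})" for f :: "real \<Rightarrow> complex" and x
    using that unfolding hderiv_def by (simp add: vector_derivative_works)
  have "(u has_vector_derivative hderiv u x) (at x within {0..})"
    "(hderiv u has_vector_derivative hderiv (hderiv u) x) (at x within {0..})"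
    "hderiv (hderiv u) x = (of_real (V x) - (of_real k)\<^sup>2) * u x" if "0 \<le> x" for x
  proof -
    have *: "u differentiable (at x within {0..})" "hderiv u differentiable (at x within {0..})"
      "- hderiv (hderiv u) x + of_real (V x) * u x = (of_real k)\<^sup>2 * u x"
      using u that U[OF that] unfolding is_jost_solution_def by auto
    show "(u has_vector_derivative hderiv u x) (at x within {0..})"
      "(hderiv u has_vector_derivative hderiv (hderiv u) x) (at x within {0..})"
      using *(1,2)[THEN hd] .
    show "hderiv (hderiv u) x = (of_real (V x) - (of_real k)\<^sup>2) * u x"
      using *(3) by (simp add: algebra_simps)
  qed
  note du0 = this
  have th: "(theta (of_real k) has_vector_derivative dtheta (of_real k) x) (at x within {0..})"
    "(dtheta (of_real k) has_vector_derivative (of_real (V x) - (of_real k)\<^sup>2) * theta (of_real k) x) (at x within {0..})" for x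
    by (auto intro!: has_vector_derivative_at_within theta_has_vector_derivative)
  have du: "(d has_vector_derivative d' x) (at x within {0..})"
    "(d' has_vector_derivative (of_real (V x) - (of_real k)\<^sup>2) * d x) (at x within {0..})" if "0 \<le> x" for x
    using has_vector_derivative_diff[OF du0(1)[OF that] th(1)] has_vector_derivative_diff[OF du0(2)[OF that] th(2)]
    unfolding d_def[abs_def] d'_def[abs_def] du0(3)[OF that] right_diff_distrib by blast+
  let ?e = "\<lambda>x::real. exp (\<i> * of_real k * of_real x)"
  have dl: "((\<lambda>x. d x / ?e x) \<longlongrightarrow> 0) at_top" "((\<lambda>x. d' x / ?e x) \<longlongrightarrow> 0) at_top"
  proof -
    have "((\<lambda>x. u x / ?e x) \<longlongrightarrow> 1) at_top" using u by (simp add: is_jost_solution_def)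
    from tendsto_diff[OF this theta_over_exp_tendsto(1)[of "of_real k"]]
    show "((\<lambda>x. d x / ?e x) \<longlongrightarrow> 0) at_top" by (simp add: d_def diff_divide_distrib)
    have "((\<lambda>x. hderiv u x / (\<i> * of_real k * ?e x) * (\<i> * of_real k)) \<longlongrightarrow> 1 * (\<i> * of_real k)) at_top"
      using u by (intro tendsto_intros) (simp add: is_jost_solution_def)
    then have "((\<lambda>x. hderiv u x / ?e x) \<longlongrightarrow> \<i> * of_real k) at_top"
      using \<open>k \<noteq> 0\<close> by (simp add: field_simps)
    from tendsto_diff[OF this theta_over_exp_tendsto(2)[of "of_real k"]]
    show "((\<lambda>x. d' x / ?e x) \<longlongrightarrow> 0) at_top" by (simp add: d'_def diff_divide_distrib)
  qed
  have W0: "d x * dtheta (of_real l) x - d' x * theta (of_real l) x = 0" if "l\<^sup>2 = k\<^sup>2" "0 \<le> x" for l x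
  proof -
    let ?W = "\<lambda>x. d x * dtheta (of_real l) x - d' x * theta (of_real l) x" and ?f = "\<lambda>x::real. exp (\<i> * of_real l * of_real x)"
    have l2: "(complex_of_real l)\<^sup>2 = (of_real k)\<^sup>2" using that(1) by (metis of_real_power)
    have c: "?W x = ?W 0" if "0 \<le> x" for x
    proof (rule constant_on_half_line[OF _ that])
      fix x :: real assume x: "0 \<le> x"
      show "(?W has_vector_derivative 0) (at x within {0..})"
        by (rule has_vector_derivative_eq_rhs, rule has_vector_derivative_diff
            [OF has_vector_derivative_mult[OF du(1)[OF x] has_vector_derivative_at_within[OF theta_has_vector_derivative(2)]]
                has_vector_derivative_mult[OF du(2)[OF x] has_vector_derivative_at_within[OF theta_has_vector_derivative(1)]]])
          (auto simp: l2 algebra_simps)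
    qed
    have "((\<lambda>x. (d x / ?e x) * (dtheta (of_real l) x / ?f x) - (d' x / ?e x) * (theta (of_real l) x / ?f x))
        \<longlongrightarrow> 0 * (\<i> * of_real l) - 0 * 1) at_top"
      by (intro tendsto_intros dl theta_over_exp_tendsto) auto
    moreover have "(d x / ?e x) * (dtheta (of_real l) x / ?f x) - (d' x / ?e x) * (theta (of_real l) x / ?f x)
        = ?W x / (?e x * ?f x)" for x
      by (simp add: diff_divide_distrib)
    ultimately have "((\<lambda>x. ?W x / (?e x * ?f x)) \<longlongrightarrow> 0) at_top" by simp
    from tendsto_norm_zero[OF this] have "((\<lambda>x. norm (?W x)) \<longlongrightarrow> 0) at_top"
      by (simp add: norm_divide norm_mult)
    moreover have "((\<lambda>x. norm (?W x)) \<longlongrightarrow> norm (?W 0)) at_top"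
      by (rule tendsto_eventually, rule eventually_mono[OF eventually_ge_at_top[of "0::real"]], rule arg_cong[where f = norm], rule c)
    ultimately have "norm (?W 0) = 0"
      by (rule tendsto_unique[OF trivial_limit_at_top_linorder, rotated])
    then show ?thesis using c[OF that(2)] by simp
  qed
  have "d x * wronskian (of_real k) (of_real (- k)) x
      = theta (of_real k) x * (d x * dtheta (of_real (- k)) x - d' x * theta (of_real (- k)) x)
        - theta (of_real (- k)) x * (d x * dtheta (of_real k) x - d' x * theta (of_real k) x)"
    by (simp add: wronskian_def algebra_simps)
  also have "\<dots> = 0" using W0[of k x] W0[of "- k" x] \<open>0 \<le> x\<close> by simp
  finally have "d x = 0" unfolding wronskian_real[OF \<open>0 \<le> x\<close>] using \<open>k \<noteq> 0\<close> by simp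
  then show ?thesis by (simp add: d_def)
qed

lemma jost_function_eq:
  assumes "k \<noteq> 0" and U: "\<And>x. 0 \<le> x \<Longrightarrow> U x = V x"
  shows "jost_function U \<gamma> (of_real k) = jostw \<gamma> (of_real k)"
proof -
  define u where "u x = (if x < 0 then 0 else theta (of_real k) x)" for x
  have u: "u x = theta (of_real k) x" if "0 \<le> x" for x using that by (simp add: u_def)
  note j = is_jost_solution_theta[of "of_real k" U u, OF _ _ U u]
  have "jost_solution U (of_real k) = u"
    unfolding jost_solution_def
  proof (rule the_equality)
    show "is_jost_solution U (of_real k) u \<and> (\<forall>x<0. u x = 0)"
      using j(1) assms(1) by (simp add: u_def)
    fix f assume f: "is_jost_solution U (of_real k) f \<and> (\<forall>x<0. f x = 0)"
    show "f = u"
    proof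
      fix x show "f x = u x"
        using jost_solution_unique[OF assms(1) U, of f x] f by (cases "0 \<le> x") (auto simp: u_def)
    qed
  qed
  then show ?thesis
    unfolding jost_function_def jostw_eq using j(2)[of 0] assms(1) u[of 0] by simp
qed

end

section \<open>Negative eigenvalues\<close>

text \<open>The positive and the negative part of h on [0, n] are densities of finite measures which
  give the same mass to every half-line {x<..}. Such measures coincide, and then so do their
  densities almost everywhere. Both parts arise from the truncation of negative values by
  \<open>ennreal\<close>.\<close>

lemma AE_eq_0_if_integrals_eq_0_real:
  fixes h :: "real \<Rightarrow> real"
  assumes int: "\<And>b. set_integrable lborel {0..b} h"
    and eq: "\<And>b. 0 \<le> b \<Longrightarrow> (LINT t:{0..b}|lborel. h t) = 0"
  shows "AE x in lborel. 0 \<le> x \<longrightarrow> h x = 0"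
proof -
  have "AE x in lborel. x \<in> {0..real n} \<longrightarrow> h x = 0" for n
  proof -
    let ?k = "\<lambda>x. indicator {0..real n} x * h x"
    have k: "integrable lborel ?k" using int[of n] by (simp add: set_integrable_def)
    have km[measurable]: "?k \<in> borel_measurable borel" using borel_measurable_integrable[OF k] by simp
    have fin: "(\<integral>\<^sup>+x. ennreal (?k x) * indicator A x \<partial>lborel) < \<infinity>"
      "(\<integral>\<^sup>+x. ennreal (- ?k x) * indicator A x \<partial>lborel) < \<infinity>" for A
    proof -
      have "(\<integral>\<^sup>+x. ennreal (?k x) * indicator A x \<partial>lborel) \<le> (\<integral>\<^sup>+x. ennreal (norm (?k x)) \<partial>lborel)"
        "(\<integral>\<^sup>+x. ennreal (- ?k x) * indicator A x \<partial>lborel) \<le> (\<integral>\<^sup>+x. ennreal (norm (?k x)) \<partial>lborel)"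
        by (intro nn_integral_mono; auto split: split_indicator intro!: ennreal_leI)+
      moreover have "(\<integral>\<^sup>+x. ennreal (norm (?k x)) \<partial>lborel) < \<infinity>"
        using k by (simp only: integrable_iff_bounded)
      ultimately show "(\<integral>\<^sup>+x. ennreal (?k x) * indicator A x \<partial>lborel) < \<infinity>"
        "(\<integral>\<^sup>+x. ennreal (- ?k x) * indicator A x \<partial>lborel) < \<infinity>" by auto
    qed
    have "density lborel (\<lambda>x. ennreal (?k x)) = density lborel (\<lambda>x. ennreal (- ?k x))"
    proof (rule measure_eqI_lessThan)
      show "emeasure (density lborel (\<lambda>x. ennreal (?k x))) {x<..} < \<infinity>" for x
        using fin(1)[of "{x<..}"] by (subst emeasure_density) auto
      show "emeasure (density lborel (\<lambda>x. ennreal (?k x))) {x<..} = emeasure (density lborel (\<lambda>x. ennreal (- ?k x))) {x<..}" for x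
      proof -
        let ?f = "\<lambda>t. indicator {x<..} t * ?k t"
        have f: "integrable lborel ?f"
          using integrable_mult_indicator[OF _ k, of "{x<..}"] by simp
        have z: "(LINT t|lborel. ?f t) = 0"
        proof -
          consider "x < 0" | "0 \<le> x" "x \<le> real n" | "real n < x" by linarith
          then show ?thesis
          proof cases
            case 1
            then have "?f = ?k" by (auto simp: fun_eq_iff split: split_indicator)
            then show ?thesis using eq[of n] by (simp add: set_lebesgue_integral_def)
          next
            case 2
            have "?f t = ?k t - indicator {0..x} t * h t" for t
              using 2 by (auto split: split_indicator)
            moreover have "integrable lborel (\<lambda>t. indicator {0..x} t * h t)"
              using int[of x] by (simp add: set_integrable_def)
            ultimately have "(LINT t|lborel. ?f t) = (LINT t|lborel. ?k t) - (LINT t|lborel. indicator {0..x} t * h t)"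
              using k by (simp add: Bochner_Integration.integral_diff)
            then show ?thesis using eq[of n] eq[of x] 2 by (simp add: set_lebesgue_integral_def)
          next
            case 3
            then have "?f = (\<lambda>_. 0)" by (auto simp: fun_eq_iff split: split_indicator)
            then show ?thesis by (simp only: Bochner_Integration.integral_zero)
          qed
        qed
        have e1: "ennreal (?k t) * indicator {x<..} t = ennreal (?f t)"
          and e2: "ennreal (- ?k t) * indicator {x<..} t = ennreal (- ?f t)" for t
          by (auto split: split_indicator)
        have "enn2real (\<integral>\<^sup>+t. ennreal (?f t) \<partial>lborel) = enn2real (\<integral>\<^sup>+t. ennreal (- ?f t) \<partial>lborel)"
          using z real_lebesgue_integral_def[OF f] by simp
        then have "(\<integral>\<^sup>+t. ennreal (?f t) \<partial>lborel) = (\<integral>\<^sup>+t. ennreal (- ?f t) \<partial>lborel)"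
          using fin[of "{x<..}"] unfolding e1 e2 by (metis ennreal_enn2real infinity_ennreal_def)
        moreover have "emeasure (density lborel (\<lambda>x. ennreal (?k x))) {x<..} = (\<integral>\<^sup>+t. ennreal (?k t) * indicator {x<..} t \<partial>lborel)"
          by (rule emeasure_density) auto
        moreover have "emeasure (density lborel (\<lambda>x. ennreal (- ?k x))) {x<..} = (\<integral>\<^sup>+t. ennreal (- ?k t) * indicator {x<..} t \<partial>lborel)"
          by (rule emeasure_density) auto
        ultimately show ?thesis unfolding e1 e2 by simp
      qed
    qed auto
    then have "AE x in lborel. ennreal (?k x) = ennreal (- ?k x)"
      by (intro sigma_finite_measure.density_unique[OF sigma_finite_lborel]) auto
    then show ?thesis
    proof eventually_elim
      fix x assume eq: "ennreal (?k x) = ennreal (- ?k x)"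
      have "?k x = 0"
      proof (rule antisym)
        show "?k x \<le> 0"
          using eq ennreal_neg[of "- ?k x"] by (cases "0 \<le> ?k x") (auto simp: ennreal_eq_0_iff)
        show "0 \<le> ?k x"
          using eq ennreal_neg[of "?k x"] ennreal_eq_0_iff[of "- ?k x"] by (cases "0 \<le> ?k x") auto
      qed
      then show "x \<in> {0..real n} \<longrightarrow> h x = 0" by auto
    qed
  qed
  then have "AE x in lborel. \<forall>n. x \<in> {0..real n} \<longrightarrow> h x = 0" by (intro AE_all_countable[THEN iffD2] allI)
  then show ?thesis
  proof eventually_elim
    fix x assume "\<forall>n. x \<in> {0..real n} \<longrightarrow> h x = 0"
    then show "0 \<le> x \<longrightarrow> h x = 0" using real_arch_simple[of x] by auto
  qed
qed

lemma AE_eq_if_integrals_eq: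
  fixes g h :: "real \<Rightarrow> complex"
  assumes int: "\<And>b. set_integrable lborel {0..b} g" "\<And>b. set_integrable lborel {0..b} h"
    and eq: "\<And>b. 0 \<le> b \<Longrightarrow> (LINT t:{0..b}|lborel. g t) = (LINT t:{0..b}|lborel. h t)"
  shows "AE x in lborel. 0 \<le> x \<longrightarrow> g x = h x"
proof -
  let ?d = "\<lambda>x. g x - h x"
  have d: "set_integrable lborel {0..b} ?d" for b using int by (rule set_integral_diff(1))
  have 0: "0 \<le> b \<Longrightarrow> (LINT t:{0..b}|lborel. ?d t) = 0" for b
    using eq[of b] int[of b] by (simp add: set_integral_diff(2))
  have i: "integrable lborel (\<lambda>x. indicator {0..b} x *\<^sub>R ?d x)" for b
    using d[of b] by (simp only: set_integrable_def)
  have "AE x in lborel. 0 \<le> x \<longrightarrow> Re (?d x) = 0"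
  proof (rule AE_eq_0_if_integrals_eq_0_real)
    show "set_integrable lborel {0..b} (\<lambda>x. Re (?d x))" for b
      using integrable_Re[OF i[of b]] by (simp add: set_integrable_def)
    show "(LINT t:{0..b}|lborel. Re (?d t)) = 0" if "0 \<le> b" for b
      using 0[OF that] integral_Re[OF i[of b]] by (simp add: set_lebesgue_integral_def)
  qed
  moreover have "AE x in lborel. 0 \<le> x \<longrightarrow> Im (?d x) = 0"
  proof (rule AE_eq_0_if_integrals_eq_0_real)
    show "set_integrable lborel {0..b} (\<lambda>x. Im (?d x))" for b
      using integrable_Im[OF i[of b]] by (simp add: set_integrable_def)
    show "(LINT t:{0..b}|lborel. Im (?d t)) = 0" if "0 \<le> b" for b
      using 0[OF that] integral_Im[OF i[of b]] by (simp add: set_lebesgue_integral_def)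
  qed
  ultimately show ?thesis by eventually_elim (auto simp: complex_eq_iff)
qed

section \<open>Square-integrable functions and the form domain\<close>

lemma L2_half_mult:
  assumes "f \<in> L2_half" "g \<in> L2_half"
  shows "set_integrable lborel {0<..} (\<lambda>x. f x * g x)"
proof (rule set_integrable_bound)
  show "set_integrable lborel {0<..} (\<lambda>x. (cmod (f x))\<^sup>2 + (cmod (g x))\<^sup>2)"
    using assms by (intro set_integral_add) (auto simp: L2_half_def)
  have "(\<lambda>x. (indicator {0<..} x *\<^sub>R f x) * (indicator {0<..} x *\<^sub>R g x)) \<in> borel_measurable lborel"
    using assms by (intro borel_measurable_times) (auto simp: L2_half_def set_borel_measurable_def)
  moreover have "(indicator {0<..} x *\<^sub>R f x) * (indicator {0<..} x *\<^sub>R g x) = indicator {0<..} x *\<^sub>R (f x * g x)" for x :: real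
    by (auto split: split_indicator)
  ultimately show "set_borel_measurable lborel {0<..} (\<lambda>x. f x * g x)"
    by (simp only: set_borel_measurable_def)
  show "AE x in lborel. x \<in> {0<..} \<longrightarrow> norm (f x * g x) \<le> norm ((cmod (f x))\<^sup>2 + (cmod (g x))\<^sup>2)"
  proof (rule AE_I2, rule impI)
    fix x
    have "0 \<le> (cmod (f x))\<^sup>2 + (cmod (g x))\<^sup>2 - 2 * (cmod (f x) * cmod (g x))"
      using zero_le_power2[of "cmod (f x) - cmod (g x)"] by (simp add: power2_diff)
    moreover have "0 \<le> cmod (f x) * cmod (g x)" by simp
    ultimately show "norm (f x * g x) \<le> norm ((cmod (f x))\<^sup>2 + (cmod (g x))\<^sup>2)"
      unfolding norm_mult real_norm_def by linarith
  qed
qed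

lemma L2_half_cnj: "f \<in> L2_half \<Longrightarrow> (\<lambda>x. cnj (f x)) \<in> L2_half"
proof -
  assume f: "f \<in> L2_half"
  then have "(\<lambda>x. cnj (indicator {0<..} x *\<^sub>R f x)) \<in> borel_measurable lborel"
    by (intro measurable_compose[OF _ borel_measurable_continuous_onI[of cnj]])
      (auto simp: L2_half_def set_borel_measurable_def intro!: continuous_intros)
  then show ?thesis using f by (auto simp: L2_half_def set_borel_measurable_def)
qed

lemma L2_half_continuous:
  assumes "continuous_on {0..} f" "0 < a" "\<And>x. 0 \<le> x \<Longrightarrow> norm (f x) \<le> exp (- (a * x)) * K"
  shows "f \<in> L2_half"
proof -
  have c: "continuous_on {0<..} f" using assms(1) by (rule continuous_on_subset) auto
  have K: "0 \<le> K" using assms(3)[of 0] order_trans[OF norm_ge_zero] by simp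
  have "set_integrable lborel {0<..} (\<lambda>x. (cmod (f x))\<^sup>2)"
  proof (rule set_integrable_continuous_bound)
    show "set_integrable lborel {0<..} (\<lambda>x. exp (- (2 * a * x)) * K\<^sup>2)"
      using exp_integrable_atLeast(1)[of "2 * a" 0] \<open>0 < a\<close>
      by (intro set_integrable_mult_left) (auto intro: set_integrable_subset)
    show "norm ((cmod (f x))\<^sup>2) \<le> exp (- (2 * a * x)) * K\<^sup>2" if "x \<in> {0<..}" for x
    proof -
      have "(cmod (f x))\<^sup>2 \<le> (exp (- (a * x)) * K)\<^sup>2" using assms(3)[of x] that by (intro power_mono) auto
      moreover have "(exp (- (a * x)))\<^sup>2 = exp (- (2 * a * x))"
        unfolding power2_eq_square using exp_add[of "- (a * x)" "- (a * x)"] by (simp add: mult_ac)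
      ultimately show ?thesis by (simp add: power_mult_distrib)
    qed
  qed (use c in \<open>auto intro!: continuous_intros\<close>)
  moreover have "set_borel_measurable lborel {0<..} f"
    unfolding set_borel_measurable_def using borel_measurable_continuous_on_indicator[OF _ c] by simp
  ultimately show ?thesis by (simp add: L2_half_def)
qed

lemma L2_half_integrable_Icc:
  assumes "g \<in> L2_half"
  shows "set_integrable lborel {0..b} g"
proof -
  have "set_integrable lborel {0<..b} g"
  proof (rule set_integrable_bound)
    show "set_integrable lborel {0<..b} (\<lambda>x. 1 + (cmod (g x))\<^sup>2)"
    proof (intro set_integral_add)
      show "set_integrable lborel {0<..b} (\<lambda>x. 1::real)"
        by (rule set_integrable_subset[of _ "{0..b}"]) (auto intro!: borel_integrable_atLeastAtMost')
      show "set_integrable lborel {0<..b} (\<lambda>x. (cmod (g x))\<^sup>2)"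
        using assms by (auto simp: L2_half_def intro: set_integrable_subset)
    qed
    show "set_borel_measurable lborel {0<..b} g"
    proof -
      have "(\<lambda>x. indicator {0<..b} x *\<^sub>R (indicator {0<..} x *\<^sub>R g x)) \<in> borel_measurable lborel"
        using assms by (intro borel_measurable_scaleR[of "indicator {0<..b}"]) (simp_all add: L2_half_def set_borel_measurable_def)
      moreover have "indicator {0<..b} x *\<^sub>R (indicator {0<..} x *\<^sub>R g x) = indicator {0<..b} x *\<^sub>R g x" for x
        by (auto split: split_indicator)
      ultimately show ?thesis by (simp only: set_borel_measurable_def)
    qed
    show "AE x in lborel. x \<in> {0<..b} \<longrightarrow> norm (g x) \<le> norm (1 + (cmod (g x))\<^sup>2)"
    proof (rule AE_I2, rule impI)
      fix x
      have "0 \<le> (cmod (g x) - 1/2)\<^sup>2" by simp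
      then show "norm (g x) \<le> norm (1 + (cmod (g x))\<^sup>2)" by (simp add: power2_diff power_divide)
    qed
  qed
  \<comment> \<open>Membership in \<open>L2_half\<close> says nothing about the point 0, which is
    therefore added separately.\<close>
  moreover have "set_integrable lborel {0} g"
  proof -
    have "(\<lambda>x. indicator {0} x *\<^sub>R g x) = (\<lambda>x. indicator {0} x *\<^sub>R g 0)"
      by (auto simp: fun_eq_iff split: split_indicator)
    then show ?thesis by (simp add: set_integrable_def)
  qed
  ultimately have "set_integrable lborel ({0} \<union> {0<..b}) g"
    by (intro set_integrable_Un) auto
  then show ?thesis by (rule set_integrable_subset) auto
qed

lemma H1_derivD:
  assumes "H1_deriv u g"
  shows "u \<in> L2_half" "g \<in> L2_half" "0 \<le> x \<Longrightarrow> u x = u 0 + (LINT t:{0..x}|lborel. g t)"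
  using assms unfolding H1_deriv_def by blast+

lemma H1_deriv_unique:
  assumes "H1_deriv u g" "H1_deriv u h"
  shows "AE x in lborel. x \<in> {0<..} \<longrightarrow> g x = h x"
proof -
  have "AE x in lborel. 0 \<le> x \<longrightarrow> g x = h x"
  proof (rule AE_eq_if_integrals_eq)
    show "(LINT t:{0..b}|lborel. g t) = (LINT t:{0..b}|lborel. h t)" if "0 \<le> b" for b
    proof -
      have "u b = u 0 + (LINT t:{0..b}|lborel. g t)" "u b = u 0 + (LINT t:{0..b}|lborel. h t)"
        using H1_derivD(3)[OF assms(1) that] H1_derivD(3)[OF assms(2) that] .
      then show ?thesis by simp
    qed
  qed (intro L2_half_integrable_Icc H1_derivD[OF assms(1)] H1_derivD[OF assms(2)])+
  then show ?thesis by eventually_elim auto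
qed

lemma weak_deriv: "H1_deriv u g \<Longrightarrow> H1_deriv u (weak_deriv u)"
  unfolding weak_deriv_def by (rule someI[where P = "H1_deriv u"])

text \<open>\<open>weak_deriv\<close> chooses one of the derivatives of u, and all of them agree
  almost everywhere; so the form can be computed with whichever derivative is at hand. Boundedness
  of V lets the potential term be split off as an integral of its own.\<close>

lemma H_form_eq:
  assumes u: "H1_deriv u g" and v: "H1_deriv v h"
    and "continuous_on {0..} V" "\<And>x. 0 \<le> x \<Longrightarrow> \<bar>V x\<bar> \<le> M"
  shows "H_form V \<gamma> u v = (LINT x:{0<..}|lborel. g x * cnj (h x))
      + (LINT x:{0<..}|lborel. of_real (V x) * u x * cnj (v x)) + of_real \<gamma> * u 0 * cnj (v 0)"
    and "set_integrable lborel {0<..} (\<lambda>x. of_real (V x) * u x * cnj (v x))"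
proof -
  have uv: "set_integrable lborel {0<..} (\<lambda>x. u x * cnj (v x))"
    by (intro L2_half_mult L2_half_cnj H1_derivD[OF u] H1_derivD[OF v])
  have Vm: "set_borel_measurable lborel {0<..} (\<lambda>x. complex_of_real (V x))"
  proof -
    have "continuous_on {0<..} (\<lambda>x. complex_of_real (V x))"
      using assms(3) by (intro continuous_intros) (auto intro: continuous_on_subset)
    then show ?thesis
      unfolding set_borel_measurable_def using borel_measurable_continuous_on_indicator[of "{0<..}" "\<lambda>x. complex_of_real (V x)"] by simp
  qed
  show Vuv: "set_integrable lborel {0<..} (\<lambda>x. of_real (V x) * u x * cnj (v x))"
  proof (rule set_integrable_bound)
    show "set_integrable lborel {0<..} (\<lambda>x. of_real M * (u x * cnj (v x)))"
      using uv by (rule set_integrable_mult_right)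
    have "(\<lambda>x. (indicator {0<..} x *\<^sub>R complex_of_real (V x)) * (indicator {0<..} x *\<^sub>R (u x * cnj (v x)))) \<in> borel_measurable lborel"
      using uv Vm unfolding set_integrable_def set_borel_measurable_def by (intro borel_measurable_times) auto
    moreover have "(indicator {0<..} x *\<^sub>R complex_of_real (V x)) * (indicator {0<..} x *\<^sub>R (u x * cnj (v x)))
        = indicator {0<..} x *\<^sub>R (of_real (V x) * u x * cnj (v x))" for x :: real
      by (auto split: split_indicator)
    ultimately show "set_borel_measurable lborel {0<..} (\<lambda>x. of_real (V x) * u x * cnj (v x))"
      by (simp only: set_borel_measurable_def)
    show "AE x in lborel. x \<in> {0<..} \<longrightarrow> norm (of_real (V x) * u x * cnj (v x)) \<le> norm (of_real M * (u x * cnj (v x)))"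
      using assms(4) by (intro AE_I2) (auto simp: norm_mult mult.assoc intro!: mult_right_mono order_trans[OF _ abs_ge_self])
  qed
  have wd: "H1_deriv u (weak_deriv u)" "H1_deriv v (weak_deriv v)"
    using u v by (auto intro: weak_deriv)
  have i: "set_integrable lborel {0<..} (\<lambda>x. weak_deriv u x * cnj (weak_deriv v x))"
    "set_integrable lborel {0<..} (\<lambda>x. g x * cnj (h x))"
    by (intro L2_half_mult L2_half_cnj H1_derivD[OF wd(1)] H1_derivD[OF wd(2)] H1_derivD[OF u] H1_derivD[OF v])+
  have "(LINT x:{0<..}|lborel. weak_deriv u x * cnj (weak_deriv v x)) = (LINT x:{0<..}|lborel. g x * cnj (h x))"
    unfolding set_lebesgue_integral_def
  proof (rule integral_cong_AE)
    show "AE x in lborel. indicator {0<..} x *\<^sub>R (weak_deriv u x * cnj (weak_deriv v x)) = indicator {0<..} x *\<^sub>R (g x * cnj (h x))"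
      using H1_deriv_unique[OF wd(1) u] H1_deriv_unique[OF wd(2) v]
      by eventually_elim (auto split: split_indicator)
  qed (use i in \<open>auto simp: set_integrable_def\<close>)
  then show "H_form V \<gamma> u v = (LINT x:{0<..}|lborel. g x * cnj (h x))
      + (LINT x:{0<..}|lborel. of_real (V x) * u x * cnj (v x)) + of_real \<gamma> * u 0 * cnj (v 0)"
    unfolding H_form_def using set_integral_add(2)[OF i(1) Vuv] by simp
qed

lemma integral_has_vector_derivative_half_line:
  fixes f :: "real \<Rightarrow> 'a::banach"
  assumes "continuous_on {0..} f" "0 \<le> x"
  shows "((\<lambda>x. integral {0..x} f) has_vector_derivative f x) (at x within {0..})"
proof -
  have "continuous_on {0..x + 1} f" by (rule continuous_on_subset[OF assms(1)]) auto
  then have "((\<lambda>x. integral {0..x} f) has_vector_derivative f x) (at x within {0..x + 1})"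
    by (rule integral_has_vector_derivative) (use assms(2) in auto)
  moreover have "at x within {0..x + 1} = at x within {0..}"
    by (rule at_within_nhd[of _ "{..<x + 1}"]) auto
  ultimately show ?thesis by simp
qed

lemma H1_deriv_continuous_on:
  assumes "H1_deriv u g"
  shows "continuous_on {0..} u"
proof -
  have "continuous (at x within {0..}) u" if "0 \<le> x" for x
  proof -
    have "g integrable_on {0..x + 1}"
      using set_borel_integral_eq_integral(1)[OF L2_half_integrable_Icc[OF H1_derivD(2)[OF assms]]] .
    then have "continuous_on {0..x + 1} (\<lambda>x. u 0 + integral {0..x} g)"
      by (intro continuous_intros indefinite_integral_continuous_1)
    moreover have "u y = u 0 + integral {0..y} g" if "y \<in> {0..x + 1}" for y
    proof -
      have "0 \<le> y" using that by simp
      show ?thesis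
        by (subst H1_derivD(3)[OF assms \<open>0 \<le> y\<close>])
          (simp add: set_borel_integral_eq_integral(2)[OF L2_half_integrable_Icc[OF H1_derivD(2)[OF assms]]])
    qed
    ultimately have "continuous_on {0..x + 1} u" by (rule continuous_on_eq[OF _ sym])
    then have "continuous (at x within {0..x + 1}) u"
      using that by (simp add: continuous_on_eq_continuous_within)
    moreover have "at x within {0..x + 1} = at x within {0..}"
      by (rule at_within_nhd[of _ "{..<x + 1}"]) auto
    ultimately show ?thesis by simp
  qed
  then show ?thesis by (simp add: continuous_on_eq_continuous_within)
qed

lemma set_integral_Ioi_indicator:
  fixes f :: "real \<Rightarrow> complex"
  assumes "set_integrable lborel {0..b} f"
  shows "(LINT x:{0<..}|lborel. f x * indicator {0..b} x) = (LINT x:{0..b}|lborel. f x)"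
  unfolding set_lebesgue_integral_def
proof (rule integral_cong_AE)
  have m: "(\<lambda>x. indicator {0..b} x *\<^sub>R f x) \<in> borel_measurable lborel"
    using assms unfolding set_integrable_def by (rule borel_measurable_integrable)
  then show "(\<lambda>x. indicator {0..b} x *\<^sub>R f x) \<in> borel_measurable lborel" .
  have "(\<lambda>x. indicator {0<..} x *\<^sub>R (indicator {0..b} x *\<^sub>R f x)) \<in> borel_measurable lborel"
    by (rule borel_measurable_scaleR[OF _ m]) auto
  moreover have "indicator {0<..} x *\<^sub>R (indicator {0..b} x *\<^sub>R f x) = indicator {0<..} x *\<^sub>R (f x * indicator {0..b} x)" for x :: real
    by (auto split: split_indicator)
  ultimately show "(\<lambda>x. indicator {0<..} x *\<^sub>R (f x * indicator {0..b} x)) \<in> borel_measurable lborel"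
    by (simp only:)
  show "AE x in lborel. indicator {0<..} x *\<^sub>R (f x * indicator {0..b} x) = indicator {0..b} x *\<^sub>R f x"
    using AE_lborel_singleton[of 0] by eventually_elim (auto split: split_indicator)
qed

text \<open>Ramps as test functions: pairing the derivative of u with - 1 on [0, b] gives u(0) -
  u(b) at once, so the eigenvalue equation appears in twice integrated form, and the regularity of u
  becomes a consequence.\<close>

lemma H1_deriv_test_function:
  assumes "0 \<le> b"
  shows "H1_deriv (\<lambda>x. of_real (max (b - x) 0)) (\<lambda>x. - indicator {0..b} x)"
proof -
  have i: "set_integrable lborel {0<..} (\<lambda>x. indicator {0..b} x * c)" for c :: real
  proof -
    have "(\<lambda>x. indicator {0<..} x *\<^sub>R (indicator {0..b} x * c)) = (\<lambda>x. indicator {0<..b} x *\<^sub>R c)"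
      by (auto simp: fun_eq_iff split: split_indicator)
    then show ?thesis using assms by (simp add: set_integrable_def)
  qed
  have 1: "(\<lambda>x. of_real (max (b - x) 0)) \<in> L2_half"
  proof -
    have c: "continuous_on {0<..} (\<lambda>x. of_real (max (b - x) 0) :: complex)" by (intro continuous_intros)
    have "set_integrable lborel {0<..} (\<lambda>x. (cmod (of_real (max (b - x) 0)))\<^sup>2)"
    proof (rule set_integrable_continuous_bound[OF _ _ i[of "b\<^sup>2"]])
      show "norm ((cmod (of_real (max (b - x) 0)))\<^sup>2) \<le> indicator {0..b} x * b\<^sup>2" if "x \<in> {0<..}" for x
        using that assms by (auto simp: max_def split: split_indicator intro!: power_mono)
    qed (auto intro!: continuous_intros)
    then show ?thesis
      using borel_measurable_continuous_on_indicator[OF _ c] by (simp add: L2_half_def set_borel_measurable_def)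
  qed
  have 2: "(\<lambda>x. - indicator {0..b} x) \<in> L2_half"
  proof -
    have "(cmod (- indicator {0..b} x))\<^sup>2 = indicator {0..b} x * 1" for x
      by (auto split: split_indicator)
    then show ?thesis using i[of 1] by (simp add: L2_half_def set_borel_measurable_def)
  qed
  have 3: "of_real (max (b - x) 0) = of_real (max (b - 0) 0) + (LINT t:{0..x}|lborel. - indicator {0..b} t :: complex)" if "0 \<le> x" for x
  proof -
    have "indicator {0..x} t *\<^sub>R (- indicator {0..b} t :: complex) = indicator {0..min x b} t *\<^sub>R (- 1)" for t
      by (auto split: split_indicator)
    then have "(LINT t:{0..x}|lborel. - indicator {0..b} t :: complex) = - of_real (min x b)"
      using that assms by (simp add: set_lebesgue_integral_def scaleR_conv_of_real)
    then show ?thesis using that assms by (auto simp: min_def max_def)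
  qed
  show ?thesis unfolding H1_deriv_def using 1 2 3 by blast
qed

section \<open>Eigenvalues and zeros of the Jost function\<close>

context jost_potential
begin

text \<open>Tested with ramps, the weak equation shows that u solves u'' = (V + \<kappa>^2) u
  classically, with u'(0) = \<gamma> u(0). Its Wronskian with the decaying Jost solution is
  constant, but also integrable as a combination of products of square-integrable functions, so it
  vanishes; at 0 it equals - u(0) w(\<i> \<kappa>), and u(0) = 0 would make u vanish.\<close>

lemma eigenvalue_imp_jostw_zero:
  assumes U: "\<And>x. 0 \<le> x \<Longrightarrow> U x = V x" and M: "\<And>x. 0 \<le> x \<Longrightarrow> \<bar>V x\<bar> \<le> M" and \<kappa>: "0 < \<kappa>"
    and graph: "(u, \<lambda>x. of_real (- \<kappa>\<^sup>2) * u x) \<in> H_graph U \<gamma>"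
    and nz: "\<not> (AE x in lborel. 0 < x \<longrightarrow> u x = 0)"
  shows "jostw \<gamma> (\<i> * of_real \<kappa>) = 0"
proof -
  obtain g where g: "H1_deriv u g" using graph by (auto simp: H_graph_def H1_half_def)
  define \<phi> where "\<phi> x = (of_real (V x) + (of_real \<kappa>)\<^sup>2) * u x" for x
  have cu: "continuous_on {0..} u" by (rule H1_deriv_continuous_on[OF g])
  have c\<phi>: "continuous_on {0..} \<phi>" unfolding \<phi>_def by (intro continuous_intros cu)
  have cU: "continuous_on {0..} U"
    by (rule continuous_on_eq[OF continuous_on_subset[OF cont_V]]) (auto simp: U)
  have u_eq: "u b = u 0 + of_real \<gamma> * u 0 * of_real b + integral {0..b} (\<lambda>t. \<phi> t * of_real (b - t))" if b: "0 \<le> b" for b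
  proof -
    let ?v = "\<lambda>x. complex_of_real (max (b - x) 0)" and ?h = "\<lambda>x. - indicator {0..b} x :: complex"
    have v: "H1_deriv ?v ?h" by (rule H1_deriv_test_function[OF b])
    have UM: "0 \<le> x \<Longrightarrow> \<bar>U x\<bar> \<le> M" for x using U M by simp
    note form = H_form_eq[OF g v cU UM]
    have "?v \<in> H1_half" using v by (auto simp: H1_half_def)
    then have "H_form U \<gamma> u ?v = (LINT x:{0<..}|lborel. of_real (- \<kappa>\<^sup>2) * u x * cnj (?v x))"
      using graph by (auto simp: H_graph_def)
    moreover have "(LINT x:{0<..}|lborel. g x * cnj (?h x)) = - (u b - u 0)"
    proof -
      have "(LINT x:{0<..}|lborel. g x * cnj (?h x)) = (LINT x:{0<..}|lborel. - (g x * indicator {0..b} x))"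
        by (rule set_lebesgue_integral_cong) (auto split: split_indicator)
      also have "\<dots> = - (LINT x:{0..b}|lborel. g x)"
        using set_integral_Ioi_indicator[OF L2_half_integrable_Icc[OF H1_derivD(2)[OF g]], of b]
        by (simp add: set_lebesgue_integral_def)
      also have "(LINT x:{0..b}|lborel. g x) = u b - u 0"
        using H1_derivD(3)[OF g b] by (metis add_diff_cancel_left')
      finally show ?thesis .
    qed
    moreover have "(LINT x:{0<..}|lborel. of_real (U x) * u x * cnj (?v x)) - (LINT x:{0<..}|lborel. of_real (- \<kappa>\<^sup>2) * u x * cnj (?v x))
        = integral {0..b} (\<lambda>t. \<phi> t * of_real (b - t))"
    proof -
      have i: "set_integrable lborel {0<..} (\<lambda>x. of_real (- \<kappa>\<^sup>2) * u x * cnj (?v x))"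
        unfolding mult.assoc by (intro set_integrable_mult_right L2_half_mult L2_half_cnj H1_derivD(1)[OF g] H1_derivD(1)[OF v])
      have j: "set_integrable lborel {0..b} (\<lambda>t. \<phi> t * of_real (b - t))"
        by (rule borel_integrable_atLeastAtMost', intro continuous_intros continuous_on_subset[OF c\<phi>]) auto
      have "(LINT x:{0<..}|lborel. of_real (U x) * u x * cnj (?v x)) - (LINT x:{0<..}|lborel. of_real (- \<kappa>\<^sup>2) * u x * cnj (?v x))
          = (LINT x:{0<..}|lborel. of_real (U x) * u x * cnj (?v x) - of_real (- \<kappa>\<^sup>2) * u x * cnj (?v x))"
        by (rule set_integral_diff(2)[OF form(2) i, symmetric])
      also have "\<dots> = (LINT x:{0<..}|lborel. \<phi> x * of_real (b - x) * indicator {0..b} x)"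
        by (rule set_lebesgue_integral_cong) (auto simp: U \<phi>_def algebra_simps split: split_indicator)
      also have "\<dots> = (LINT x:{0..b}|lborel. \<phi> x * of_real (b - x))"
        by (rule set_integral_Ioi_indicator[OF j])
      also have "\<dots> = integral {0..b} (\<lambda>t. \<phi> t * of_real (b - t))"
        by (rule set_borel_integral_eq_integral(2)[OF j])
      finally show ?thesis .
    qed
    moreover have "cnj (?v 0) = of_real b" using b by simp
    \<comment> \<open>Linear algebra stated for variables, so that the integrals involved stay
      opaque.\<close>
    moreover have "A = d + c * b' + I" if "F = Z" "X = - (A - d)" "Y - Z = I" "e = b'" "F = X + Y + c * e"
      for A I F X Y Z b' c d e :: complex
      using that by (simp add: algebra_simps)
    ultimately show ?thesis using form(1)[where \<gamma> = \<gamma>] by blast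
  qed
  \<comment> \<open>\<open>P\<close> will be the classical derivative of u; its value at 0 is the
    natural boundary condition.\<close>
  define P where "P x = of_real \<gamma> * u 0 + integral {0..x} \<phi>" for x
  have dP: "(P has_vector_derivative \<phi> x) (at x within {0..})" if "0 \<le> x" for x
    unfolding P_def[abs_def]
    using has_vector_derivative_add[OF has_vector_derivative_const integral_has_vector_derivative_half_line[OF c\<phi> that]]
    by simp
  have c\<phi>2: "continuous_on {0..} (\<lambda>t. \<phi> t * of_real t)" by (intro continuous_intros c\<phi>)
  have u_eq2: "u x = u 0 + of_real \<gamma> * u 0 * of_real x + (of_real x * integral {0..x} \<phi> - integral {0..x} (\<lambda>t. \<phi> t * of_real t))"
    if "0 \<le> x" for x
  proof -
    have "\<phi> integrable_on {0..x}" "(\<lambda>t. \<phi> t * of_real t) integrable_on {0..x}"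
      by (auto intro!: integrable_continuous_real continuous_on_subset[OF c\<phi>] continuous_on_subset[OF c\<phi>2])
    then have "integral {0..x} (\<lambda>t. of_real x * \<phi> t - \<phi> t * of_real t) = of_real x * integral {0..x} \<phi> - integral {0..x} (\<lambda>t. \<phi> t * of_real t)"
      by (simp add: integral_diff integrable_on_mult_right)
    then show ?thesis using u_eq[OF that] by (simp add: algebra_simps)
  qed
  have du: "(u has_vector_derivative P x) (at x within {0..})" if "0 \<le> x" for x
  proof (rule has_vector_derivative_transform[OF _ u_eq2])
    have "((\<lambda>x. u 0 + of_real \<gamma> * u 0 * of_real x + (of_real x * integral {0..x} \<phi> - integral {0..x} (\<lambda>t. \<phi> t * of_real t)))
      has_vector_derivative (0 + of_real \<gamma> * u 0 * 1 + ((of_real x * \<phi> x + 1 * integral {0..x} \<phi>) - \<phi> x * of_real x))) (at x within {0..})"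
      by (intro has_vector_derivative_add has_vector_derivative_diff has_vector_derivative_mult has_vector_derivative_mult_right
          has_vector_derivative_const integral_has_vector_derivative_half_line[OF c\<phi> that] integral_has_vector_derivative_half_line[OF c\<phi>2 that])
        (auto intro!: derivative_eq_intros)
    then show "((\<lambda>x. u 0 + of_real \<gamma> * u 0 * of_real x + (of_real x * integral {0..x} \<phi> - integral {0..x} (\<lambda>t. \<phi> t * of_real t)))
      has_vector_derivative P x) (at x within {0..})"
      by (simp add: P_def algebra_simps)
  qed (use that in auto)
  have cP: "continuous_on {0..} P"
    using dP by (auto intro: has_vector_derivative_continuous simp: continuous_on_eq_continuous_within)
  have gP: "AE x in lborel. 0 \<le> x \<longrightarrow> g x = P x"
  proof (rule AE_eq_if_integrals_eq)
    show "set_integrable lborel {0..b} g" for b by (rule L2_half_integrable_Icc[OF H1_derivD(2)[OF g]])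
    show Pi: "set_integrable lborel {0..b} P" for b
      by (rule borel_integrable_atLeastAtMost'[OF continuous_on_subset[OF cP]]) auto
    show "(LINT t:{0..b}|lborel. g t) = (LINT t:{0..b}|lborel. P t)" if "0 \<le> b" for b
    proof -
      have "(LINT t:{0..b}|lborel. g t) = u b - u 0" using H1_derivD(3)[OF g that] by (metis add_diff_cancel_left')
      also have "\<dots> = integral {0..b} P"
        by (rule integral_unique[symmetric], rule fundamental_theorem_of_calculus[OF that])
          (auto intro: has_vector_derivative_within_subset[OF du])
      also have "\<dots> = (LINT t:{0..b}|lborel. P t)"
        using set_borel_integral_eq_integral(2)[OF Pi] by simp
      finally show ?thesis .
    qed
  qed
  let ?z = "\<i> * complex_of_real \<kappa>"
  have Im: "0 < Im ?z" "0 \<le> Im ?z" using \<kappa> by auto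
  have z2: "?z\<^sup>2 = - (of_real \<kappa>)\<^sup>2" by (simp add: power_mult_distrib)
  define W where "W x = u x * dtheta ?z x - P x * theta ?z x" for x
  have dW: "(W has_vector_derivative 0) (at x within {0..})" if "0 \<le> x" for x
    unfolding W_def[abs_def]
    by (rule has_vector_derivative_eq_rhs, rule has_vector_derivative_diff
        [OF has_vector_derivative_mult[OF du[OF that] has_vector_derivative_at_within[OF theta_has_vector_derivative(2)[OF Im(2)]]]
            has_vector_derivative_mult[OF dP[OF that] has_vector_derivative_at_within[OF theta_has_vector_derivative(1)[OF Im(2)]]]])
      (simp add: \<phi>_def z2 algebra_simps)
  have W: "W x = W 0" if "0 \<le> x" for x by (rule constant_on_half_line[OF dW that])
  have tL2: "theta ?z \<in> L2_half" "dtheta ?z \<in> L2_half"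
    using L2_half_continuous[OF cont_theta[OF Im(2)] Im(1) norm_theta_le(1)[OF Im(2)]]
      L2_half_continuous[OF cont_dtheta[OF Im(2)] Im(1) norm_theta_le(2)[OF Im(2)]] by auto
  have "W 0 = 0"
  proof -
    let ?f = "\<lambda>x. u x * dtheta ?z x - g x * theta ?z x"
    have f: "set_integrable lborel {0<..} ?f"
      by (intro set_integral_diff(1) L2_half_mult tL2 H1_derivD[OF g])
    have Ioc: "{0<..b} \<subseteq> {0<..}" for b :: real by auto
    define K where "K = (LINT x:{0<..}|lborel. norm (?f x))"
    \<comment> \<open>A constant whose integral over every (0, b] stays below the same
      \<open>K\<close> is zero.\<close>
    have "norm (W 0) * b \<le> K" if "0 \<le> b" for b
    proof -
      have "norm (W 0) * b = (LINT x:{0<..b}|lborel. norm (W 0))"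
        using that by (simp add: set_lebesgue_integral_def)
      also have "\<dots> = (LINT x:{0<..b}|lborel. norm (?f x))"
        unfolding set_lebesgue_integral_def
      proof (rule integral_cong_AE)
        show "(\<lambda>x. indicator {0<..b} x *\<^sub>R norm (?f x)) \<in> borel_measurable lborel"
        proof (rule borel_measurable_integrable)
          show "integrable lborel (\<lambda>x. indicator {0<..b} x *\<^sub>R norm (?f x))"
            using set_integrable_subset[OF set_integrable_norm[OF f] _ Ioc]
            unfolding set_integrable_def by auto
        qed
        show "AE x in lborel. indicator {0<..b} x *\<^sub>R norm (W 0) = indicator {0<..b} x *\<^sub>R norm (?f x)"
          using gP
        proof eventually_elim
          case (elim x)
          then have "0 < x \<Longrightarrow> ?f x = W 0" using W[of x] by (simp add: W_def)
          then show ?case by (auto split: split_indicator)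
        qed
      qed simp
      also have "\<dots> \<le> K"
        unfolding K_def set_lebesgue_integral_def
        by (rule integral_mono)
          (use set_integrable_norm[OF f] set_integrable_subset[OF set_integrable_norm[OF f] _ Ioc]
            in \<open>auto simp: set_integrable_def split: split_indicator\<close>)
      finally show ?thesis .
    qed
    note le = this
    show ?thesis
    proof (rule ccontr)
      assume "W 0 \<noteq> 0"
      then have n: "0 < norm (W 0)" by simp
      have "norm (W 0) * ((\<bar>K\<bar> + 1) / norm (W 0)) \<le> K" by (rule le) simp
      then show False using n by simp
    qed
  qed
  then have "u 0 * jostw \<gamma> ?z = 0" by (auto simp: W_def P_def jostw_eq algebra_simps)
  moreover have "u 0 \<noteq> 0"
  proof
    assume u0: "u 0 = 0"
    have "u x = 0" if "0 \<le> x" for x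
    proof (rule second_order_unique[OF du, where q = "\<lambda>x. of_real (V x) + (of_real \<kappa>)\<^sup>2"])
      show "(P has_vector_derivative (of_real (V x) + (of_real \<kappa>)\<^sup>2) * u x) (at x within {0..})" if "0 \<le> x" for x
        using dP[OF that] by (simp add: \<phi>_def)
    qed (use u0 that in \<open>auto simp: P_def intro!: continuous_intros\<close>)
    then show False using nz by auto
  qed
  ultimately show ?thesis by simp
qed

text \<open>The Jost solution itself is the eigenfunction, and w(\<i> \<kappa>) = 0 is its boundary
  condition. The work lies in integrating by parts against an arbitrary function of the form
  domain.\<close>

lemma jostw_zero_imp_eigenvalue:
  assumes U: "\<And>x. 0 \<le> x \<Longrightarrow> U x = V x" and M: "\<And>x. 0 \<le> x \<Longrightarrow> \<bar>V x\<bar> \<le> M" and \<kappa>: "0 < \<kappa>"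
    and zero: "jostw \<gamma> (\<i> * of_real \<kappa>) = 0"
  shows "H_eigenvalue U \<gamma> (- \<kappa>\<^sup>2)"
proof -
  let ?z = "\<i> * complex_of_real \<kappa>"
  have Im: "0 < Im ?z" "0 \<le> Im ?z" using \<kappa> by auto
  have z2: "?z\<^sup>2 = - (of_real \<kappa>)\<^sup>2" by (simp add: power_mult_distrib)
  let ?u = "theta ?z" and ?g = "dtheta ?z"
  define \<phi> where "\<phi> x = (of_real (V x) + (of_real \<kappa>)\<^sup>2) * ?u x" for x
  have M0: "0 \<le> M" using M[of 0] by simp
  have c\<phi>: "continuous_on A \<phi>" for A unfolding \<phi>_def by (intro continuous_intros cont_theta Im)
  have dg: "(?g has_vector_derivative \<phi> x) (at x)" for x
    using theta_has_vector_derivative(2)[OF Im(2), of x] by (simp add: \<phi>_def z2)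
  have cU: "continuous_on {0..} U"
    by (rule continuous_on_eq[OF continuous_on_subset[OF cont_V]]) (auto simp: U)
  have UM: "0 \<le> x \<Longrightarrow> \<bar>U x\<bar> \<le> M" for x using U M by simp
  have tL2: "?u \<in> L2_half" "?g \<in> L2_half"
    using L2_half_continuous[OF cont_theta[OF Im(2)] Im(1) norm_theta_le(1)[OF Im(2)]]
      L2_half_continuous[OF cont_dtheta[OF Im(2)] Im(1) norm_theta_le(2)[OF Im(2)]] by auto
  have u: "H1_deriv ?u ?g"
  proof -
    have "?u x = ?u 0 + (LINT t:{0..x}|lborel. ?g t)" if "0 \<le> x" for x
    proof -
      have "set_integrable lborel {0..x} ?g"
        by (rule borel_integrable_atLeastAtMost'[OF cont_dtheta[OF Im(2)]])
      then have "(LINT t:{0..x}|lborel. ?g t) = integral {0..x} ?g" by (rule set_borel_integral_eq_integral(2))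
      also have "\<dots> = ?u x - ?u 0"
        by (rule integral_unique, rule fundamental_theorem_of_calculus[OF that])
          (rule has_vector_derivative_at_within[OF theta_has_vector_derivative(1)[OF Im(2)]])
      finally show ?thesis by simp
    qed
    then show ?thesis unfolding H1_deriv_def using tL2 by blast
  qed
  define K where "K = (M + \<kappa>\<^sup>2) * (2 * weight 0)"
  have K: "0 \<le> K" using M0 weight_pos[of 0] by (simp add: K_def)
  have b\<phi>: "norm (\<phi> x) \<le> K * exp (- (\<kappa> * x))" if "0 \<le> x" for x
  proof -
    have "norm (complex_of_real (V x) + (of_real \<kappa>)\<^sup>2) = \<bar>V x + \<kappa>\<^sup>2\<bar>"
      by (metis norm_of_real of_real_add of_real_power)
    also have "\<dots> \<le> M + \<kappa>\<^sup>2" using M[OF that] zero_le_power2[of \<kappa>] by linarith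
    finally have "norm (\<phi> x) \<le> (M + \<kappa>\<^sup>2) * (exp (- (Im ?z * x)) * (2 * weight 0))"
      unfolding \<phi>_def norm_mult using norm_theta_le(1)[OF Im(2) that] M0 by (intro mult_mono) auto
    moreover have "Im ?z = \<kappa>" by simp
    ultimately show ?thesis unfolding K_def by (simp only: mult_ac)
  qed
  have int\<phi>: "set_integrable lborel {x..} \<phi>" if "0 \<le> x" for x
    by (rule set_integrable_continuous_bound[OF c\<phi>, where g = "\<lambda>x. K * exp (- (\<kappa> * x))"])
      (use exp_integrable_atLeast(1)[OF \<kappa>] b\<phi> that in auto)
  have g_eq: "(LINT t:{x..}|lborel. \<phi> t) = - ?g x" if "0 \<le> x" for x
  proof -
    have "(?g \<longlongrightarrow> 0) at_top"
    proof (rule Lim_null_comparison[OF _ exp_decay_tendsto_0[OF Im(1)]])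
      show "\<forall>\<^sub>F x in at_top. norm (?g x) \<le> exp (- (Im ?z * x)) * (2 * weight 0 * tailV 0 + norm ?z * (2 * weight 0))"
        by (rule eventually_mono[OF eventually_ge_at_top[of "0::real"]]) (rule norm_theta_le(2)[OF Im(2)])
    qed
    from set_integral_FTC_atLeast[OF has_vector_derivative_at_within[OF dg] c\<phi> int\<phi>[OF that] this] show ?thesis by simp
  qed
  \<comment> \<open>Integration by parts through Fubini: \<open>?g\<close> is minus the integral of
    \<open>\<phi>\<close> from x to infinity, v - v(0) is the integral of h from 0 to t, and the
    order of integration over the triangle 0 < x \<le> t is exchanged.\<close>
  have parts: "(LINT x:{0<..}|lborel. ?g x * cnj (h x)) = - (LINT x:{0<..}|lborel. \<phi> x * cnj (v x)) - ?g 0 * cnj (v 0)"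
    if v: "H1_deriv v h" for v h
  proof -
    define H where "H x = indicator {0<..} x *\<^sub>R cnj (h x)" for x :: real
    define \<Phi> where "\<Phi> t = indicator {0..} t *\<^sub>R \<phi> t" for t :: real
    have hc: "(\<lambda>x. cnj (h x)) \<in> L2_half" by (rule L2_half_cnj[OF H1_derivD(2)[OF v]])
    have Hm[measurable]: "H \<in> borel_measurable borel"
      using hc by (simp add: H_def[abs_def] L2_half_def set_borel_measurable_def)
    have \<Phi>m[measurable]: "\<Phi> \<in> borel_measurable borel"
      unfolding \<Phi>_def[abs_def] by (rule borel_measurable_continuous_on_indicator[OF _ c\<phi>]) simp
    \<comment> \<open>On the triangle the decay of \<open>\<phi>\<close> is shared between the
      variables: exp(- \<kappa> t) \<le> exp(- \<kappa> x / 2) exp(- \<kappa> t / 2). This yields an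
      integrable majorant a(x) b(t), although h is only square-integrable.\<close>
    define a where "a x = norm (H x) * exp (- (\<kappa> / 2 * x))" for x
    define b where "b t = indicator {0..} t * (K * exp (- (\<kappa> / 2 * t)))" for t
    have am[measurable]: "a \<in> borel_measurable borel" and bm[measurable]: "b \<in> borel_measurable borel"
      unfolding a_def[abs_def] b_def[abs_def] by measurable
    have ai: "integrable lborel a"
    proof -
      have e: "(\<lambda>x::real. complex_of_real (exp (- (\<kappa> / 2 * x)))) \<in> L2_half"
        using \<kappa> by (intro L2_half_continuous[of _ "\<kappa> / 2" 1] continuous_intros) auto
      have "integrable lborel (\<lambda>x. norm (indicator {0<..} x *\<^sub>R (cnj (h x) * complex_of_real (exp (- (\<kappa> / 2 * x))))))"
        using L2_half_mult[OF hc e] unfolding set_integrable_def by (rule integrable_norm)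
      then show ?thesis by (simp add: a_def[abs_def] H_def norm_mult mult.assoc)
    qed
    have bi: "integrable lborel b"
      using exp_integrable_atLeast(1)[of "\<kappa> / 2" 0, THEN set_integrable_mult_right, of K] \<kappa>
      by (simp add: b_def[abs_def] set_integrable_def)
    have b0: "0 \<le> b t" and a0: "0 \<le> a t" for t using K by (auto simp: a_def b_def)
    have ab: "integrable (lborel \<Otimes>\<^sub>M lborel) (\<lambda>(x, t). a x * b t)"
    proof (rule lborel_pair.Fubini_integrable)
      show "integrable lborel (\<lambda>x. LINT t|lborel. norm (case (x, t) of (x, t) \<Rightarrow> a x * b t))"
        using ai a0 b0 by (simp add: abs_mult)
    qed (use bi in auto)
    let ?F = "\<lambda>(x, t). if x \<le> t then H x * \<Phi> t else 0"
    have F: "integrable (lborel \<Otimes>\<^sub>M lborel) ?F"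
    proof (rule Bochner_Integration.integrable_bound[OF ab])
      show "AE p in lborel \<Otimes>\<^sub>M lborel. norm (?F p) \<le> norm ((\<lambda>(x, t). a x * b t) p)"
      proof (rule AE_I2)
        fix p :: "real \<times> real"
        obtain x t where p: "p = (x, t)" by (cases p)
        have "norm (H x * \<Phi> t) \<le> a x * b t" if xt: "x \<le> t" "0 < x"
        proof -
          have "exp (- (\<kappa> * t)) = exp (- (\<kappa> / 2 * t)) * exp (- (\<kappa> / 2 * t))"
            by (simp flip: exp_add)
          also have "\<dots> \<le> exp (- (\<kappa> / 2 * x)) * exp (- (\<kappa> / 2 * t))"
            using xt \<kappa> by (intro mult_right_mono) auto
          finally have "K * exp (- (\<kappa> * t)) \<le> K * (exp (- (\<kappa> / 2 * x)) * exp (- (\<kappa> / 2 * t)))"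
            using K by (intro mult_left_mono)
          then have "norm (\<Phi> t) \<le> exp (- (\<kappa> / 2 * x)) * (K * exp (- (\<kappa> / 2 * t)))"
            using b\<phi>[of t] xt by (simp add: \<Phi>_def mult_ac)
          then have "norm (H x) * norm (\<Phi> t) \<le> norm (H x) * (exp (- (\<kappa> / 2 * x)) * (K * exp (- (\<kappa> / 2 * t))))"
            by (intro mult_left_mono) auto
          then show ?thesis using xt by (simp add: norm_mult a_def b_def mult_ac)
        qed
        moreover have "H x = 0" if "\<not> 0 < x" using that by (simp add: H_def)
        ultimately show "norm (?F p) \<le> norm ((\<lambda>(x, t). a x * b t) p)"
          using a0[of x] b0[of t] by (cases "0 < x") (auto simp: p abs_mult)
      qed
    qed measurable
    have "(LINT x:{0<..}|lborel. ?g x * cnj (h x)) = (LINT x|lborel. - (LINT t|lborel. ?F (x, t)))"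
      unfolding set_lebesgue_integral_def
    proof (rule Bochner_Integration.integral_cong[OF refl])
      fix x :: real
      show "indicator {0<..} x *\<^sub>R (?g x * cnj (h x)) = - (LINT t|lborel. ?F (x, t))"
      proof (cases "0 < x")
        case True
        have "?F (x, t) = cnj (h x) * (indicator {x..} t *\<^sub>R \<phi> t)" for t
          using True by (auto simp: H_def \<Phi>_def split: split_indicator)
        then have "(LINT t|lborel. ?F (x, t)) = cnj (h x) * (LINT t:{x..}|lborel. \<phi> t)"
          by (simp only: set_lebesgue_integral_def Bochner_Integration.integral_mult_right_zero)
        then show ?thesis using True g_eq[of x] by simp
      next
        case False
        then have "?F (x, t) = 0" for t by (simp add: H_def)
        then show ?thesis using False by simp
      qed
    qed
    also have "\<dots> = - (LINT x|lborel. LINT t|lborel. ?F (x, t))" by simp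
    also have "(LINT x|lborel. LINT t|lborel. ?F (x, t)) = (LINT t|lborel. LINT x|lborel. ?F (x, t))"
    proof (rule lborel_pair.Fubini_integral[symmetric])
      have "(\<lambda>(x, t). ?F (x, t)) = ?F" by (simp add: fun_eq_iff)
      then show "integrable (lborel \<Otimes>\<^sub>M lborel) (\<lambda>(x, t). ?F (x, t))" using F by (simp only:)
    qed
    also have "\<dots> = (LINT t:{0..}|lborel. \<phi> t * (cnj (v t) - cnj (v 0)))"
      unfolding set_lebesgue_integral_def
    proof (rule Bochner_Integration.integral_cong[OF refl])
      fix t :: real
      show "(LINT x|lborel. ?F (x, t)) = indicator {0..} t *\<^sub>R (\<phi> t * (cnj (v t) - cnj (v 0)))"
      proof (cases "0 \<le> t")
        case True
        have "?F (x, t) = \<phi> t * (indicator {0<..} x *\<^sub>R (cnj (h x) * indicator {0..t} x))" for x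
          using True by (auto simp: H_def \<Phi>_def split: split_indicator)
        then have "(LINT x|lborel. ?F (x, t)) = \<phi> t * (LINT x:{0<..}|lborel. cnj (h x) * indicator {0..t} x)"
          by (simp only: set_lebesgue_integral_def Bochner_Integration.integral_mult_right_zero)
        also have "(LINT x:{0<..}|lborel. cnj (h x) * indicator {0..t} x) = (LINT x:{0..t}|lborel. cnj (h x))"
          by (rule set_integral_Ioi_indicator[OF L2_half_integrable_Icc[OF hc]])
        also have "\<dots> = cnj (LINT x:{0..t}|lborel. h x)"
          unfolding set_lebesgue_integral_def by (simp only: complex_cnj_scaleR flip: Bochner_Integration.integral_cnj)
        also have "(LINT x:{0..t}|lborel. h x) = v t - v 0"
          using H1_derivD(3)[OF v True] by (metis add_diff_cancel_left')
        finally show ?thesis using True by simp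
      next
        case False
        then have "?F (x, t) = 0" for x by (simp add: \<Phi>_def)
        then show ?thesis using False by simp
      qed
    qed
    also have "\<dots> = (LINT t:{0<..}|lborel. \<phi> t * cnj (v t)) - (LINT t:{0..}|lborel. \<phi> t * cnj (v 0))"
    proof -
      have i: "set_integrable lborel {0<..} (\<lambda>t. \<phi> t * cnj (v t))"
        by (intro L2_half_mult L2_half_cnj H1_derivD(1)[OF v] L2_half_continuous[OF c\<phi> \<kappa>, of K])
          (use b\<phi> in \<open>simp add: mult.commute\<close>)
      have j: "set_integrable lborel {0<..} (\<lambda>t. \<phi> t * cnj (v 0))"
        using set_integrable_subset[OF int\<phi>[OF order_refl], of "{0<..}"]
        by (intro set_integrable_mult_left) (simp add: subset_eq)
      have m: "(\<lambda>t. indicator {0..} t *\<^sub>R (\<phi> t * (cnj (v t) - cnj (v 0)))) \<in> borel_measurable lborel"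
      proof -
        have "continuous_on {0..} (\<lambda>t. \<phi> t * (cnj (v t) - cnj (v 0)))"
          by (intro continuous_intros c\<phi> H1_deriv_continuous_on[OF v])
        from borel_measurable_continuous_on_indicator[OF _ this] show ?thesis by simp
      qed
      have "(LINT t:{0..}|lborel. \<phi> t * (cnj (v t) - cnj (v 0))) = (LINT t:{0<..}|lborel. \<phi> t * cnj (v t) - \<phi> t * cnj (v 0))"
        unfolding set_lebesgue_integral_def
      proof (rule integral_cong_AE[OF m])
        show "(\<lambda>t. indicator {0<..} t *\<^sub>R (\<phi> t * cnj (v t) - \<phi> t * cnj (v 0))) \<in> borel_measurable lborel"
          using set_integral_diff(1)[OF i j] unfolding set_integrable_def by auto
        show "AE t in lborel. indicator {0..} t *\<^sub>R (\<phi> t * (cnj (v t) - cnj (v 0))) = indicator {0<..} t *\<^sub>R (\<phi> t * cnj (v t) - \<phi> t * cnj (v 0))"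
          using AE_lborel_singleton[of 0] by eventually_elim (auto simp: algebra_simps split: split_indicator)
      qed
      also have "\<dots> = (LINT t:{0<..}|lborel. \<phi> t * cnj (v t)) - (LINT t:{0<..}|lborel. \<phi> t * cnj (v 0))"
        by (rule set_integral_diff(2)[OF i j])
      also have "(LINT t:{0<..}|lborel. \<phi> t * cnj (v 0)) = (LINT t:{0..}|lborel. \<phi> t * cnj (v 0))"
      proof (rule set_integral_cong_set)
        show "set_borel_measurable lborel {0..} (\<lambda>t. \<phi> t * cnj (v 0))" "set_borel_measurable lborel {0<..} (\<lambda>t. \<phi> t * cnj (v 0))"
          using j set_integrable_mult_left[OF int\<phi>[of 0], of "cnj (v 0)"] unfolding set_integrable_def set_borel_measurable_def by auto
        show "AE x in lborel. (x \<in> {0::real..}) = (x \<in> {0<..})"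
          using AE_lborel_singleton[of "0::real"] by eventually_elim auto
      qed
      finally show ?thesis .
    qed
    also have "(LINT t:{0..}|lborel. \<phi> t * cnj (v 0)) = - ?g 0 * cnj (v 0)"
      using g_eq[of 0] by (simp add: set_integral_mult_left)
    finally show ?thesis by simp
  qed
  have "(?u, \<lambda>x. of_real (- \<kappa>\<^sup>2) * ?u x) \<in> H_graph U \<gamma>"
    unfolding H_graph_def
  proof (safe intro!: CollectI)
    show "?u \<in> H1_half" using u by (auto simp: H1_half_def)
    have "norm (of_real (- \<kappa>\<^sup>2) * ?u x) \<le> exp (- (\<kappa> * x)) * (\<kappa>\<^sup>2 * (2 * weight 0))" if "0 \<le> x" for x
      using mult_left_mono[OF norm_theta_le(1)[OF Im(2) that], of "\<kappa>\<^sup>2"] by (simp add: norm_mult norm_power mult_ac)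
    then show "(\<lambda>x. of_real (- \<kappa>\<^sup>2) * ?u x) \<in> L2_half"
      by (intro L2_half_continuous[OF _ \<kappa>] continuous_intros cont_theta Im(2)) auto
    fix v assume "v \<in> H1_half"
    then obtain h where v: "H1_deriv v h" by (auto simp: H1_half_def)
    have i: "set_integrable lborel {0<..} (\<lambda>x. of_real (\<kappa>\<^sup>2) * (?u x * cnj (v x)))"
      by (intro set_integrable_mult_right L2_half_mult L2_half_cnj tL2 H1_derivD(1)[OF v])
    have "(LINT x:{0<..}|lborel. \<phi> x * cnj (v x)) = (LINT x:{0<..}|lborel. of_real (U x) * ?u x * cnj (v x) + of_real (\<kappa>\<^sup>2) * (?u x * cnj (v x)))"
      by (rule set_lebesgue_integral_cong) (auto simp: U \<phi>_def algebra_simps)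
    also have "\<dots> = (LINT x:{0<..}|lborel. of_real (U x) * ?u x * cnj (v x)) + (LINT x:{0<..}|lborel. of_real (\<kappa>\<^sup>2) * (?u x * cnj (v x)))"
      by (rule set_integral_add(2)[OF H_form_eq(2)[OF u v cU UM] i])
    also have "(LINT x:{0<..}|lborel. of_real (\<kappa>\<^sup>2) * (?u x * cnj (v x))) = - (LINT x:{0<..}|lborel. of_real (- \<kappa>\<^sup>2) * ?u x * cnj (v x))"
      unfolding mult.assoc set_integral_mult_right by simp
    finally have "H_form U \<gamma> ?u v = (LINT x:{0<..}|lborel. of_real (- \<kappa>\<^sup>2) * ?u x * cnj (v x)) + (of_real \<gamma> * ?u 0 - ?g 0) * cnj (v 0)"
      using H_form_eq(1)[OF u v cU UM, where \<gamma> = \<gamma>] unfolding parts[OF v] left_diff_distrib by simp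
    then show "H_form U \<gamma> ?u v = (LINT x:{0<..}|lborel. of_real (- \<kappa>\<^sup>2) * ?u x * cnj (v x))"
      using zero by (simp add: jostw_eq)
  qed
  moreover have "\<not> (AE x in lborel. 0 < x \<longrightarrow> ?u x = 0)"
  proof
    assume "AE x in lborel. 0 < x \<longrightarrow> ?u x = 0"
    then have "AE x in lborel. indicator {0..} x *\<^sub>R (cmod (?u x))\<^sup>2 = 0"
      using AE_lborel_singleton[of "0::real"] by eventually_elim (auto split: split_indicator)
    then have "(LINT x:{0..}|lborel. (cmod (?u x))\<^sup>2) = 0"
      unfolding set_lebesgue_integral_def by (rule integral_eq_zero_AE)
    then show False using theta_square_integral_pos[OF Im(1)] by simp
  qed
  ultimately show ?thesis unfolding H_eigenvalue_def by blast
qed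

lemma neg_eigenvalues_eq:
  assumes U: "\<And>x. 0 \<le> x \<Longrightarrow> U x = V x" and M: "\<And>x. 0 \<le> x \<Longrightarrow> \<bar>V x\<bar> \<le> M"
  shows "neg_eigenvalues U \<gamma> = (\<lambda>\<zeta>. - (Im \<zeta>)\<^sup>2) ` {\<zeta> \<in> open_uhp. jostw \<gamma> \<zeta> = 0}"
proof safe
  fix \<mu> assume "\<mu> \<in> neg_eigenvalues U \<gamma>"
  then obtain u where u: "\<mu> < 0" "(u, \<lambda>x. of_real \<mu> * u x) \<in> H_graph U \<gamma>" "\<not> (AE x in lborel. 0 < x \<longrightarrow> u x = 0)"
    by (auto simp: neg_eigenvalues_def H_eigenvalue_def)
  define \<kappa> where "\<kappa> = sqrt (- \<mu>)"
  have \<kappa>: "0 < \<kappa>" "\<mu> = - \<kappa>\<^sup>2" using u(1) by (auto simp: \<kappa>_def)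
  have "jostw \<gamma> (\<i> * of_real \<kappa>) = 0"
    by (rule eigenvalue_imp_jostw_zero[OF U M \<kappa>(1)]) (use u \<kappa>(2) in auto)
  then show "\<mu> \<in> (\<lambda>\<zeta>. - (Im \<zeta>)\<^sup>2) ` {\<zeta> \<in> open_uhp. jostw \<gamma> \<zeta> = 0}"
    using \<kappa> by (intro image_eqI[of _ _ "\<i> * of_real \<kappa>"]) auto
next
  fix \<zeta> assume \<zeta>: "0 < Im \<zeta>" "jostw \<gamma> \<zeta> = 0"
  then have "\<zeta> = \<i> * of_real (Im \<zeta>)" using jostw_zero_imaginary[OF \<zeta>] by (simp add: complex_eq_iff)
  then have "H_eigenvalue U \<gamma> (- (Im \<zeta>)\<^sup>2)"
    using jostw_zero_imp_eigenvalue[OF U M \<zeta>(1), of \<gamma>] \<zeta>(2) by metis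
  then show "- (Im \<zeta>)\<^sup>2 \<in> neg_eigenvalues U \<gamma>" using \<zeta>(1) by (simp add: neg_eigenvalues_def)
qed

end

section \<open>Asymptotics of the Jost function\<close>

abbreviation uhp_infinity :: "complex filter" where
  "uhp_infinity \<equiv> inf at_infinity (principal closed_uhp)"

lemma eventually_uhp_infinity:
  "eventually P uhp_infinity \<longleftrightarrow> (\<exists>R. \<forall>\<zeta>. 0 \<le> Im \<zeta> \<longrightarrow> R \<le> norm \<zeta> \<longrightarrow> P \<zeta>)"
  by (simp add: eventually_inf_principal eventually_at_infinity) blast

text \<open>The fourth formula involves the coefficient of 1 / \<zeta>^4 in log E, hence an error of
  order five. Relations of this kind can be multiplied, so the factors of E are expanded one by one,
  without logarithms.\<close>

definition near_one :: "(complex \<Rightarrow> complex) \<Rightarrow> bool" where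
  "near_one f \<longleftrightarrow> (\<exists>K. \<forall>\<^sub>F \<zeta> in uhp_infinity. norm (f \<zeta> - 1) \<le> K / norm \<zeta> ^ 5)"

lemma eventually_norm_ge: "\<forall>\<^sub>F \<zeta> in uhp_infinity. c \<le> norm \<zeta>"
  unfolding eventually_uhp_infinity by auto

lemma near_one_cong:
  assumes "near_one f" "\<forall>\<^sub>F \<zeta> in uhp_infinity. f \<zeta> = g \<zeta>"
  shows "near_one g"
proof -
  obtain K where "\<forall>\<^sub>F \<zeta> in uhp_infinity. norm (f \<zeta> - 1) \<le> K / norm \<zeta> ^ 5"
    using assms(1) by (auto simp: near_one_def)
  with assms(2) have "\<forall>\<^sub>F \<zeta> in uhp_infinity. norm (g \<zeta> - 1) \<le> K / norm \<zeta> ^ 5"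
    by eventually_elim simp
  then show ?thesis by (auto simp: near_one_def)
qed

lemma near_one_add:
  assumes "near_one f" "\<forall>\<^sub>F \<zeta> in uhp_infinity. norm (e \<zeta>) \<le> L / norm \<zeta> ^ 5"
  shows "near_one (\<lambda>\<zeta>. f \<zeta> + e \<zeta>)"
proof -
  obtain K where "\<forall>\<^sub>F \<zeta> in uhp_infinity. norm (f \<zeta> - 1) \<le> K / norm \<zeta> ^ 5"
    using assms(1) by (auto simp: near_one_def)
  with assms(2) have "\<forall>\<^sub>F \<zeta> in uhp_infinity. norm (f \<zeta> + e \<zeta> - 1) \<le> (K + L) / norm \<zeta> ^ 5"
  proof eventually_elim
    case (elim \<zeta>)
    have "norm ((f \<zeta> - 1) + e \<zeta>) \<le> K / norm \<zeta> ^ 5 + L / norm \<zeta> ^ 5"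
      by (intro norm_triangle_mono elim)
    then show ?case by (simp add: add_divide_distrib algebra_simps)
  qed
  then show ?thesis by (auto simp: near_one_def)
qed

lemma near_one_mult:
  assumes "near_one f" "near_one g"
  shows "near_one (\<lambda>\<zeta>. f \<zeta> * g \<zeta>)"
proof -
  obtain K where K: "\<forall>\<^sub>F \<zeta> in uhp_infinity. norm (f \<zeta> - 1) \<le> K / norm \<zeta> ^ 5"
    using assms(1) by (auto simp: near_one_def)
  obtain L where L: "\<forall>\<^sub>F \<zeta> in uhp_infinity. norm (g \<zeta> - 1) \<le> L / norm \<zeta> ^ 5"
    using assms(2) by (auto simp: near_one_def)
  have "\<forall>\<^sub>F \<zeta> in uhp_infinity. norm ((f \<zeta> - 1) * g \<zeta>) \<le> (\<bar>K\<bar> * (1 + \<bar>L\<bar>)) / norm \<zeta> ^ 5"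
    using K L eventually_norm_ge[of 1]
  proof eventually_elim
    case (elim \<zeta>)
    have "norm (g \<zeta> - 1) \<le> \<bar>L\<bar> / norm \<zeta> ^ 5"
      using elim(2) by (rule order_trans) (intro divide_right_mono, auto)
    also have "\<dots> \<le> \<bar>L\<bar> / 1"
      using one_le_power[OF elim(3), of 5] by (intro divide_left_mono) auto
    finally have "norm (g \<zeta>) \<le> 1 + \<bar>L\<bar>"
      using norm_triangle_ineq2[of "g \<zeta>" 1] by simp
    moreover have "norm (f \<zeta> - 1) \<le> \<bar>K\<bar> / norm \<zeta> ^ 5"
      using elim(1) by (rule order_trans) (intro divide_right_mono, auto)
    ultimately have "norm (f \<zeta> - 1) * norm (g \<zeta>) \<le> \<bar>K\<bar> / norm \<zeta> ^ 5 * (1 + \<bar>L\<bar>)"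
      by (intro mult_mono) auto
    then show ?case by (simp add: norm_mult)
  qed
  from near_one_add[OF assms(2) this] show ?thesis by (simp add: algebra_simps)
qed

lemma near_one_prod: "finite A \<Longrightarrow> (\<And>a. a \<in> A \<Longrightarrow> near_one (f a)) \<Longrightarrow> near_one (\<lambda>\<zeta>. \<Prod>a\<in>A. f a \<zeta>)"
proof (induction A rule: finite_induct)
  case empty
  show ?case by (auto simp: near_one_def intro!: exI[of _ 0])
next
  case (insert a A)
  then show ?case using near_one_mult[of "f a" "\<lambda>\<zeta>. \<Prod>a\<in>A. f a \<zeta>"] by simp
qed

text \<open>The reciprocal of z = 2 \<i> \<zeta>, the parameter in the Riccati equation of jm' / jm.
  In this variable the coefficients of the expansions are real.\<close>

abbreviation yvar :: "complex \<Rightarrow> complex" where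
  "yvar \<zeta> \<equiv> 1 / (2 * \<i> * \<zeta>)"

lemma norm_yvar: "norm (yvar \<zeta>) = 1 / (2 * norm \<zeta>)"
  by (simp add: norm_divide norm_mult)

lemma eventually_yvar:
  assumes "0 < d"
  shows "\<forall>\<^sub>F \<zeta> in uhp_infinity. norm (yvar \<zeta>) < d \<and> \<zeta> \<noteq> 0"
  using eventually_norm_ge[of "1 / d"]
proof eventually_elim
  case (elim \<zeta>)
  have "0 < 1 / d" using assms by simp
  then have n: "0 < norm \<zeta>" using elim by linarith
  have "1 \<le> d * norm \<zeta>" using elim assms by (simp add: field_simps)
  then have "1 < d * (2 * norm \<zeta>)" by linarith
  then show ?case using n unfolding norm_yvar by (auto simp: field_simps)
qed

text \<open>A factor \<open>h (1 / (2 \<i> \<zeta>))\<close> is recognised as \<open>1 + O(\<zeta>\<^sup>-\<^sup>5)\<close> through a factor \<open>y\<^sup>4\<close> in the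
  derivative of \<open>h\<close>, which avoids expanding \<open>h\<close> itself.\<close>

lemma near_one_if_deriv:
  assumes "0 < r" and der: "\<And>y. norm y < r \<Longrightarrow> (h has_field_derivative y ^ 4 * P y) (at y)"
    and "isCont P 0" "h 0 = 1"
  shows "near_one (\<lambda>\<zeta>. h (yvar \<zeta>))"
proof -
  obtain s where s: "0 < s" "\<And>y. norm y < s \<Longrightarrow> norm (P y - P 0) < 1"
    using \<open>isCont P 0\<close> unfolding continuous_at_eps_delta by (metis dist_0_norm dist_norm norm_minus_commute diff_zero zero_less_one)
  define M where "M = norm (P 0) + 1"
  have P: "norm (P y) \<le> M" if "norm y < s" for y
    using s(2)[OF that] norm_triangle_ineq2[of "P y" "P 0"] by (simp add: M_def)
  have b: "norm (h y - 1) \<le> M * norm y ^ 5" if y: "norm y < min r s" for y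
  proof -
    have "norm (h y - h 0) \<le> (norm y ^ 4 * M) * norm (y - 0)"
    proof (rule field_differentiable_bound[of "cball 0 (norm y)"])
      fix x :: complex assume "x \<in> cball 0 (norm y)"
      then have x: "norm x \<le> norm y" by simp
      show "(h has_field_derivative x ^ 4 * P x) (at x within cball 0 (norm y))"
        using der[of x] x y by (auto intro: has_field_derivative_at_within)
      show "norm (x ^ 4 * P x) \<le> norm y ^ 4 * M"
        unfolding norm_mult norm_power using x y by (intro mult_mono power_mono P) auto
    qed auto
    then show ?thesis using assms(4) by (simp add: mult_ac eval_nat_numeral)
  qed
  have "\<forall>\<^sub>F \<zeta> in uhp_infinity. norm (h (yvar \<zeta>) - 1) \<le> M / norm \<zeta> ^ 5"
    using eventually_yvar[of "min r s"] assms(1) s(1)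
  proof (simp, elim eventually_mono)
    fix \<zeta> :: complex assume "norm (yvar \<zeta>) < r \<and> norm (yvar \<zeta>) < s \<and> \<zeta> \<noteq> 0"
    then have "norm (h (yvar \<zeta>) - 1) \<le> M * norm (yvar \<zeta>) ^ 5" by (intro b) auto
    also have "\<dots> = M / (32 * norm \<zeta> ^ 5)" unfolding norm_yvar by (simp add: power_divide power_mult_distrib)
    also have "\<dots> \<le> M / norm \<zeta> ^ 5"
      using \<open>norm (yvar \<zeta>) < r \<and> norm (yvar \<zeta>) < s \<and> \<zeta> \<noteq> 0\<close> by (intro divide_left_mono) (auto simp: M_def)
    finally show "norm (h (yvar \<zeta>) - 1) \<le> M / norm \<zeta> ^ 5" .
  qed
  then show ?thesis by (auto simp: near_one_def)
qed

lemma times_inverse_Suc_less_1: "0 \<le> t \<Longrightarrow> t * (1 / (t + 1)) < (1 :: real)"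
  by (simp add: divide_less_eq)

text \<open>The logarithm of (1 - a y) / (1 + a y) is - 2 (a y + a^3 y^3 / 3 + ...), without even
  powers; the exponential removes the orders one and three, and the next order is five. For a = 2
  \<kappa> the quotient is the factor (\<zeta> + \<i> \<kappa>) / (\<zeta> - \<i> \<kappa>).\<close>

lemma near_one_blaschke:
  "near_one (\<lambda>\<zeta>. (1 - a * yvar \<zeta>) / (1 + a * yvar \<zeta>) * exp (2 * a * yvar \<zeta> + 2 / 3 * a ^ 3 * yvar \<zeta> ^ 3))"
proof (rule near_one_if_deriv[where r = "1 / (norm a + 1)" and P = "\<lambda>y. - 2 * a ^ 5 * exp (2 * a * y + 2 / 3 * a ^ 3 * y ^ 3) / (1 + a * y)\<^sup>2"])
  fix y :: complex assume y: "norm y < 1 / (norm a + 1)"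
  have nz: "1 + a * y \<noteq> 0"
  proof
    assume "1 + a * y = 0"
    then have "norm (a * y) = 1" by (metis add_eq_0_iff norm_minus_cancel norm_one)
    moreover have "norm a * norm y \<le> norm a * (1 / (norm a + 1))" using y by (intro mult_left_mono) auto
    moreover have "norm a * (1 / (norm a + 1)) < 1"
      by (rule times_inverse_Suc_less_1) simp
    ultimately show False by (simp add: norm_mult)
  qed
  show "((\<lambda>y. (1 - a * y) / (1 + a * y) * exp (2 * a * y + 2 / 3 * a ^ 3 * y ^ 3)) has_field_derivative
      y ^ 4 * (- 2 * a ^ 5 * exp (2 * a * y + 2 / 3 * a ^ 3 * y ^ 3) / (1 + a * y)\<^sup>2)) (at y)"
  proof -
    let ?X = "exp (2 * a * y + 2 / 3 * a ^ 3 * y ^ 3)"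
    have "((\<lambda>y. (1 - a * y) / (1 + a * y) * exp (2 * a * y + 2 / 3 * a ^ 3 * y ^ 3)) has_field_derivative
        (- a * (1 + a * y) - (1 - a * y) * a) / ((1 + a * y) * (1 + a * y)) * ?X
          + (1 - a * y) / (1 + a * y) * (?X * (2 * a + 2 * a ^ 3 * y ^ 2))) (at y)"
      by (rule derivative_eq_intros refl nz)+ (simp add: algebra_simps)
    also have "(- a * (1 + a * y) - (1 - a * y) * a) / ((1 + a * y) * (1 + a * y)) * ?X
          + (1 - a * y) / (1 + a * y) * (?X * (2 * a + 2 * a ^ 3 * y ^ 2))
        = ((- a * (1 + a * y) - (1 - a * y) * a) + (1 - a * y) * (1 + a * y) * (2 * a + 2 * a ^ 3 * y ^ 2)) / (1 + a * y)\<^sup>2 * ?X"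
    proof -
      have "p / (q * q) * X + r / q * (X * s) = (p + r * q * s) / q\<^sup>2 * X" if "q \<noteq> 0" for p q r s X :: complex
        using that by (simp add: field_simps power2_eq_square)
      from this[OF nz] show ?thesis .
    qed
    also have "(- a * (1 + a * y) - (1 - a * y) * a) + (1 - a * y) * (1 + a * y) * (2 * a + 2 * a ^ 3 * y ^ 2) = y ^ 4 * (- 2 * a ^ 5)"
      by algebra
    finally show ?thesis by (simp add: mult_ac)
  qed
qed (auto intro!: continuous_intros add_nonneg_pos)

lemma near_one_exp5: "near_one (\<lambda>\<zeta>. exp (- a * yvar \<zeta> ^ 5))"
  by (rule near_one_if_deriv[where r = 1 and P = "\<lambda>y. - 5 * a * exp (- a * y ^ 5)"])
    (auto intro!: derivative_eq_intros continuous_intros)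

text \<open>For c = \<gamma> the factor 1 + S / (1 - 2 c y) is 1 - g / (\<gamma> - \<i> \<zeta>),
  where g is the truncated expansion of jm' / jm at 0; it carries the boundary condition.
  \<open>A\<close> is its logarithm up to order four; the term - 2 g1^2 is minus half the square of
  the leading coefficient 2 g1.\<close>

lemma near_one_boundary_factor:
  fixes c g1 g2 g3 g4 g5 :: complex
  defines "S \<equiv> \<lambda>y. 2 * y * (g1 * y + g2 * y ^ 2 + g3 * y ^ 3 + g4 * y ^ 4 + g5 * y ^ 5)"
    and "A \<equiv> \<lambda>y. 2 * g1 * y ^ 2 + (2 * g2 + 4 * c * g1) * y ^ 3 + (2 * g3 + 4 * c * g2 + 8 * c ^ 2 * g1 - 2 * g1 ^ 2) * y ^ 4"
  shows "near_one (\<lambda>\<zeta>. (1 + S (yvar \<zeta>) / (1 - 2 * c * yvar \<zeta>)) * exp (- A (yvar \<zeta>)))"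
proof -
  \<comment> \<open>The quotient by y^4 of the numerator of the derivative, certified by the
    polynomial identity \<open>N\<close> below.\<close>
  define P where "P y = 10 * g4 - 20 * g1 * g2 + 20 * c * g3 - 40 * c * g1 ^ 2 + 40 * c ^ 2 * g2 + 80 * c ^ 3 * g1 + 12 * y * g5 - 12
      * y * g2 ^ 2 - 24 * y * g1 * g3 + 16 * y * g1 ^ 3 - 16 * y * c * g4 - 16 * y * c * g1 * g2 - 32 * y * c ^ 2 *
      g3 + 16 * y * c ^ 2 * g1 ^ 2 - 64 * y * c ^ 3 * g2 - 128 * y * c ^ 4 * g1 - 28 * y ^ 2 * g2 * g3 - 8 * y ^ 2 *
      g1 * g4 + 16 * y ^ 2 * g1 ^ 2 * g2 - 20 * y ^ 2 * c * g5 - 8 * y ^ 2 * c * g2 ^ 2 + 24 * y ^ 2 * c * g1 * g3 -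
      32 * y ^ 2 * c * g1 ^ 3 + 48 * y ^ 2 * c ^ 2 * g1 * g2 + 128 * y ^ 2 * c ^ 3 * g1 ^ 2 - 16 * y ^ 3 * g3 ^ 2 -
      12 * y ^ 3 * g2 * g4 - 8 * y ^ 3 * g1 * g5 + 16 * y ^ 3 * g1 ^ 2 * g3 + 24 * y ^ 3 * c * g2 * g3 - 8 * y ^ 3 *
      c * g1 * g4 - 32 * y ^ 3 * c * g1 ^ 2 * g2 + 64 * y ^ 3 * c ^ 2 * g2 ^ 2 - 16 * y ^ 3 * c ^ 2 * g1 * g3 + 128
      * y ^ 3 * c ^ 3 * g1 * g2 - 16 * y ^ 4 * g3 * g4 - 12 * y ^ 4 * g2 * g5 + 16 * y ^ 4 * g1 ^ 2 * g4 + 32 * y ^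
      4 * c * g3 ^ 2 - 8 * y ^ 4 * c * g2 * g4 - 8 * y ^ 4 * c * g1 * g5 - 32 * y ^ 4 * c * g1 ^ 2 * g3 + 64 * y ^ 4
      * c ^ 2 * g2 * g3 - 16 * y ^ 4 * c ^ 2 * g1 * g4 + 128 * y ^ 4 * c ^ 3 * g1 * g3 - 16 * y ^ 5 * g3 * g5 + 16 *
      y ^ 5 * g1 ^ 2 * g5 + 32 * y ^ 5 * c * g3 * g4 - 8 * y ^ 5 * c * g2 * g5 - 32 * y ^ 5 * c * g1 ^ 2 * g4 + 64 *
      y ^ 5 * c ^ 2 * g2 * g4 - 16 * y ^ 5 * c ^ 2 * g1 * g5 + 128 * y ^ 5 * c ^ 3 * g1 * g4 + 32 * y ^ 6 * c * g3 *
      g5 - 32 * y ^ 6 * c * g1 ^ 2 * g5 + 64 * y ^ 6 * c ^ 2 * g2 * g5 + 128 * y ^ 6 * c ^ 3 * g1 * g5" for y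
  show ?thesis
  proof (rule near_one_if_deriv[where r = "1 / (2 * norm c + 1)" and P = "\<lambda>y. P y / (1 - 2 * c * y)\<^sup>2 * exp (- A y)"])
    fix y :: complex assume y: "norm y < 1 / (2 * norm c + 1)"
    have nz: "1 - 2 * c * y \<noteq> 0"
    proof
      assume "1 - 2 * c * y = 0"
      then have "norm (2 * c * y) = 1" by (metis eq_iff_diff_eq_0 norm_one)
      moreover have "2 * norm c * norm y \<le> 2 * norm c * (1 / (2 * norm c + 1))" using y by (intro mult_left_mono) auto
      moreover have "2 * norm c * (1 / (2 * norm c + 1)) < 1"
        by (rule times_inverse_Suc_less_1) simp
      ultimately show False by (simp add: norm_mult)
    qed
    define S' where "S' = 4 * g1 * y + 6 * g2 * y ^ 2 + 8 * g3 * y ^ 3 + 10 * g4 * y ^ 4 + 12 * g5 * y ^ 5"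
    define A' where "A' = 4 * g1 * y + 3 * (2 * g2 + 4 * c * g1) * y ^ 2 + 4 * (2 * g3 + 4 * c * g2 + 8 * c ^ 2 * g1 - 2 * g1 ^ 2) * y ^ 3"
    have dS: "(S has_field_derivative S') (at y)"
      unfolding S_def S'_def by (rule derivative_eq_intros refl)+ (simp add: algebra_simps eval_nat_numeral)
    have dA: "(A has_field_derivative A') (at y)"
      unfolding A_def A'_def by (rule derivative_eq_intros refl)+ (simp add: algebra_simps eval_nat_numeral)
    have N: "S' * (1 - 2 * c * y) + 2 * c * S y - A' * ((1 - 2 * c * y) * (1 - 2 * c * y + S y)) = y ^ 4 * P y"
      unfolding S_def S'_def A'_def P_def by algebra
    have "((\<lambda>y. (1 + S y / (1 - 2 * c * y)) * exp (- A y)) has_field_derivative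
        (S' * (1 - 2 * c * y) - S y * (- 2 * c)) / ((1 - 2 * c * y) * (1 - 2 * c * y)) * exp (- A y)
          + (1 + S y / (1 - 2 * c * y)) * (exp (- A y) * - A')) (at y)"
      by (rule derivative_eq_intros refl dS dA nz)+ (simp add: algebra_simps)
    also have "(S' * (1 - 2 * c * y) - S y * (- 2 * c)) / ((1 - 2 * c * y) * (1 - 2 * c * y)) * exp (- A y)
          + (1 + S y / (1 - 2 * c * y)) * (exp (- A y) * - A')
        = (S' * (1 - 2 * c * y) + 2 * c * S y - A' * ((1 - 2 * c * y) * (1 - 2 * c * y + S y))) / (1 - 2 * c * y)\<^sup>2 * exp (- A y)"
    proof -
      have "(S' * q - S0 * (- 2 * c)) / (q * q) * x + (1 + S0 / q) * (x * - A')
          = (S' * q + 2 * c * S0 - A' * (q * (q + S0))) / q\<^sup>2 * x" if "q \<noteq> 0" for q S0 x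
        using that by (simp add: field_simps power2_eq_square)
      from this[OF nz] show ?thesis .
    qed
    also have "\<dots> = y ^ 4 * (P y / (1 - 2 * c * y)\<^sup>2 * exp (- A y))" unfolding N by simp
    finally show "((\<lambda>y. (1 + S y / (1 - 2 * c * y)) * exp (- A y)) has_field_derivative
        y ^ 4 * (P y / (1 - 2 * c * y)\<^sup>2 * exp (- A y))) (at y)" .
  next
    show "isCont (\<lambda>y. P y / (1 - 2 * c * y)\<^sup>2 * exp (- A y)) 0"
      unfolding P_def A_def by (intro continuous_intros) auto
  qed (auto simp: S_def A_def intro!: add_nonneg_pos)
qed

text \<open>In the application \<open>v j\<close> is the j-th derivative of the potential, continued
  by its value at 0; hence continuity on the line, but derivatives within {0..}. Orders up to five
  enter, because the defect of the expansion contains the fifth derivative.\<close>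

locale jost_smooth = jost_potential V for V +
  fixes v :: "nat \<Rightarrow> real \<Rightarrow> real" and \<rho> D :: real
  assumes v_0: "v 0 = V" and cont_v: "continuous_on UNIV (v j)"
    and deriv_v: "0 \<le> x \<Longrightarrow> (v j has_real_derivative v (Suc j) x) (at x within {0..})"
    and rho: "1 < \<rho>" and bound_v: "0 \<le> x \<Longrightarrow> j \<le> 5 \<Longrightarrow> \<bar>v j x\<bar> \<le> D * (1 + x) powr (- \<rho> - real j)"
begin

text \<open>Two decay classes are used. As \<rho> > 1, a product of two functions of class
  \<open>w1\<close> is of class \<open>w2\<close>, and so are the derivatives of V; integrating
  class \<open>w2\<close> from x to infinity leads back to \<open>w1\<close>, which can be
  integrated once more.\<close>

definition w1 :: "real \<Rightarrow> real" where "w1 x = (1 + x) powr (- \<rho>)"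

definition w2 :: "real \<Rightarrow> real" where "w2 x = (1 + x) powr (- \<rho> - 1)"

definition bnd :: "(real \<Rightarrow> real) \<Rightarrow> (real \<Rightarrow> real) \<Rightarrow> bool" where
  "bnd w f \<longleftrightarrow> (\<exists>c\<ge>0. \<forall>x\<ge>0. \<bar>f x\<bar> \<le> c * w x)"

lemma w_nonneg: "0 \<le> w1 x" "0 \<le> w2 x"
  by (simp_all add: w1_def w2_def)

lemma w2_le_w1: "0 \<le> x \<Longrightarrow> w2 x \<le> w1 x"
  unfolding w1_def w2_def by (rule powr_mono) auto

lemma w1_w1_le: "0 \<le> x \<Longrightarrow> w1 x * w1 x \<le> w2 x"
  using rho unfolding w1_def w2_def powr_add[symmetric] by (intro powr_mono) auto

lemma bnd_diff: "bnd w f \<Longrightarrow> bnd w g \<Longrightarrow> bnd w (\<lambda>x. f x - g x)"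
  and bnd_add: "bnd w f \<Longrightarrow> bnd w g \<Longrightarrow> bnd w (\<lambda>x. f x + g x)"
proof -
  assume "bnd w f" "bnd w g"
  then obtain c d where "0 \<le> c" "0 \<le> d" "\<And>x. 0 \<le> x \<Longrightarrow> \<bar>f x\<bar> \<le> c * w x" "\<And>x. 0 \<le> x \<Longrightarrow> \<bar>g x\<bar> \<le> d * w x"
    by (auto simp: bnd_def)
  then show "bnd w (\<lambda>x. f x - g x)" "bnd w (\<lambda>x. f x + g x)"
    unfolding bnd_def distrib_right
    by (intro exI[of _ "c + d"] conjI allI impI, simp, fastforce simp: distrib_right)+
qed

lemma bnd_cmult: "bnd w f \<Longrightarrow> bnd w (\<lambda>x. a * f x)"
proof -
  assume "bnd w f"
  then obtain c where "0 \<le> c" "\<And>x. 0 \<le> x \<Longrightarrow> \<bar>f x\<bar> \<le> c * w x" by (auto simp: bnd_def)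
  then show ?thesis unfolding bnd_def
    by (intro exI[of _ "\<bar>a\<bar> * c"]) (auto simp: abs_mult mult.assoc intro!: mult_left_mono)
qed

lemma bnd_minus: "bnd w f \<Longrightarrow> bnd w (\<lambda>x. - f x)"
  by (simp add: bnd_def)

lemma bnd_mult: "bnd w1 f \<Longrightarrow> bnd w1 g \<Longrightarrow> bnd w2 (\<lambda>x. f x * g x)"
proof -
  assume "bnd w1 f" "bnd w1 g"
  then obtain c d where cd: "0 \<le> c" "0 \<le> d" "\<And>x. 0 \<le> x \<Longrightarrow> \<bar>f x\<bar> \<le> c * w1 x" "\<And>x. 0 \<le> x \<Longrightarrow> \<bar>g x\<bar> \<le> d * w1 x"
    by (auto simp: bnd_def)
  have "\<bar>f x * g x\<bar> \<le> c * d * w2 x" if "0 \<le> x" for x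
  proof -
    have "\<bar>f x * g x\<bar> \<le> (c * w1 x) * (d * w1 x)"
      unfolding abs_mult using cd that w_nonneg by (intro mult_mono) auto
    also have "\<dots> = c * d * (w1 x * w1 x)" by simp
    also have "\<dots> \<le> c * d * w2 x" using w1_w1_le[OF that] cd by (intro mult_left_mono) auto
    finally show ?thesis .
  qed
  then show ?thesis unfolding bnd_def using cd by (intro exI[of _ "c * d"]) auto
qed

lemma bnd_w2_imp_w1: "bnd w2 f \<Longrightarrow> bnd w1 f"
  unfolding bnd_def using w2_le_w1 by (meson mult_left_mono order_trans)

lemma bnd_v: "j \<le> 5 \<Longrightarrow> bnd w1 (v j)" "0 < j \<Longrightarrow> j \<le> 5 \<Longrightarrow> bnd w2 (v j)"
proof -
  have "\<bar>v j x\<bar> \<le> \<bar>D\<bar> * (1 + x) powr (- \<rho> - k)" if "0 \<le> x" "j \<le> 5" "k \<le> real j" for x k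
  proof -
    have "\<bar>v j x\<bar> \<le> D * (1 + x) powr (- \<rho> - real j)" by (rule bound_v) fact+
    also have "\<dots> \<le> \<bar>D\<bar> * (1 + x) powr (- \<rho> - k)"
      using that by (intro mult_mono powr_mono) auto
    finally show ?thesis .
  qed
  from this[of _ 0] this[of _ 1]
  show "j \<le> 5 \<Longrightarrow> bnd w1 (v j)" "0 < j \<Longrightarrow> j \<le> 5 \<Longrightarrow> bnd w2 (v j)"
    unfolding bnd_def w1_def w2_def by (force intro!: exI[of _ "\<bar>D\<bar>"])+
qed

lemma w_integrable:
  "set_integrable lborel {0..} w1"
  "0 \<le> x \<Longrightarrow> set_integrable lborel {x..} w2" "0 \<le> x \<Longrightarrow> (LINT t:{x..}|lborel. w2 t) = w1 x / \<rho>"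
proof -
  have main: "set_integrable lborel {x..} (\<lambda>t. (1 + t) powr (- a - 1)) \<and> (LINT t:{x..}|lborel. (1 + t) powr (- a - 1)) = (1 + x) powr (- a) / a"
    if a: "0 < a" and x: "0 \<le> x" for a x :: real
  proof -
    let ?f = "\<lambda>t::real. (1 + max 0 t) powr (- a - 1)" and ?F = "\<lambda>t::real. - ((1 + t) powr (- a)) / a"
    have c: "continuous_on UNIV ?f"
      by (rule continuous_on_powr) (auto intro!: continuous_intros)
    have d: "DERIV ?F t :> ?f t" if "x \<le> t" for t
      using that x a by (auto intro!: derivative_eq_intros simp: max_def)
    have "filterlim (\<lambda>t. 1 + t) at_top (at_top :: real filter)"
      by (rule filterlim_tendsto_add_at_top[OF tendsto_const filterlim_ident])
    then have "((\<lambda>t. (1 + t) powr (- a)) \<longlongrightarrow> 0) at_top"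
      using a by (intro tendsto_neg_powr) auto
    from tendsto_divide[OF tendsto_minus[OF this] tendsto_const[of a]] a
    have l: "(?F \<longlongrightarrow> 0) at_top" by simp
    have f0: "0 \<le> ?f t" for t by simp
    have "(\<lambda>t. indicator {x..} t *\<^sub>R ?f t) = (\<lambda>t. indicator {x..} t *\<^sub>R ((1 + t) powr (- a - 1)))"
      using x by (auto simp: fun_eq_iff split: split_indicator)
    moreover have "set_integrable lborel {x..} ?f" "(LINT t:{x..}|lborel. ?f t) = 0 - ?F x"
      by (rule set_integral_FTC_atLeast_nonneg[OF c d f0 l]; assumption)+
    ultimately show ?thesis by (simp only: set_integrable_def set_lebesgue_integral_def) simp
  qed
  show "0 \<le> x \<Longrightarrow> set_integrable lborel {x..} w2" "0 \<le> x \<Longrightarrow> (LINT t:{x..}|lborel. w2 t) = w1 x / \<rho>"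
    using main[of \<rho> x] rho unfolding w1_def[abs_def] w2_def[abs_def] by auto
  show "set_integrable lborel {0..} w1"
    using main[of "\<rho> - 1" 0] rho unfolding w1_def[abs_def] by simp
qed

lemma w1_tendsto_0: "(w1 \<longlongrightarrow> 0) at_top"
proof -
  have "filterlim (\<lambda>t. 1 + t) at_top (at_top :: real filter)"
    by (rule filterlim_tendsto_add_at_top[OF tendsto_const filterlim_ident])
  then show ?thesis
    unfolding w1_def[abs_def] using rho by (intro tendsto_neg_powr) auto
qed

lemma bnd_tendsto_0: "bnd w1 f \<Longrightarrow> (f \<longlongrightarrow> 0) at_top"
proof -
  assume "bnd w1 f"
  then obtain c where c: "\<And>x. 0 \<le> x \<Longrightarrow> \<bar>f x\<bar> \<le> c * w1 x" by (auto simp: bnd_def)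
  have "((\<lambda>x. c * w1 x) \<longlongrightarrow> 0) at_top"
    using tendsto_mult_right_zero[OF w1_tendsto_0] .
  then show ?thesis
    by (rule Lim_null_comparison[rotated]) (rule eventually_mono[OF eventually_ge_at_top[of "0::real"]], simp add: c)
qed

lemma bnd_integrable:
  assumes "bnd w1 f" "continuous_on UNIV f"
  shows "set_integrable lborel {x..} f"
proof -
  obtain c where c: "\<And>x. 0 \<le> x \<Longrightarrow> \<bar>f x\<bar> \<le> c * w1 x" using assms(1) by (auto simp: bnd_def)
  have "set_integrable lborel {0..} f"
    by (rule set_integrable_continuous_bound[where g = "\<lambda>x. c * w1 x"])
      (use assms(2) w_integrable(1) c in \<open>auto intro: continuous_on_subset\<close>)
  then show ?thesis by (rule set_integrable_continuous_extend[OF assms(2)])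
qed

text \<open>The coefficients of the formal solution \<open>\<Sum>\<^sub>n g\<^sub>n z\<^sup>-\<^sup>n\<close> of the Riccati equation \<open>g' + z g + g\<^sup>2 = V\<close>.\<close>

definition "g1 x = v 0 x"
definition "g2 x = - v 1 x"
definition "g3 x = v 2 x - v 0 x * v 0 x"
definition "g4 x = 4 * (v 0 x * v 1 x) - v 3 x"
definition "g5 x = v 4 x - 6 * (v 0 x * v 2 x) - 5 * (v 1 x * v 1 x) + 2 * (v 0 x * (v 0 x * v 0 x))"
definition "dg5 x = v 5 x - 16 * (v 1 x * v 2 x) - 6 * (v 0 x * v 3 x) + 6 * (v 0 x * (v 0 x * v 1 x))"

text \<open>The coefficients of y^5, ..., y^10 in g' + z g + g^2 - V for the truncated sum g, that
  is, the defect of the truncation; \<open>dg5\<close> is the derivative of \<open>g5\<close>. All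
  of them are of class \<open>w2\<close>, so they survive two integrations.\<close>

definition "r5 x = dg5 x + 2 * (g1 x * g4 x) + 2 * (g2 x * g3 x)"
definition "r6 x = 2 * (g1 x * g5 x) + 2 * (g2 x * g4 x) + g3 x * g3 x"
definition "r7 x = 2 * (g2 x * g5 x) + 2 * (g3 x * g4 x)"
definition "r8 x = 2 * (g3 x * g5 x) + g4 x * g4 x"
definition "r9 x = 2 * (g4 x * g5 x)"
definition "r10 x = g5 x * g5 x"

lemma bnd_g: "bnd w1 g1" "bnd w1 g2" "bnd w1 g3" "bnd w1 g4" "bnd w1 g5" "bnd w2 dg5"
  unfolding g1_def[abs_def] g2_def[abs_def] g3_def[abs_def] g4_def[abs_def] g5_def[abs_def] dg5_def[abs_def]
  by (intro bnd_diff bnd_add bnd_minus bnd_cmult bnd_v bnd_mult bnd_w2_imp_w1[OF bnd_mult]; simp)+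

lemma bnd_r: "bnd w2 r5" "bnd w2 r6" "bnd w2 r7" "bnd w2 r8" "bnd w2 r9" "bnd w2 r10"
  unfolding r5_def[abs_def] r6_def[abs_def] r7_def[abs_def] r8_def[abs_def] r9_def[abs_def] r10_def[abs_def]
  by (intro bnd_diff bnd_add bnd_cmult bnd_g bnd_mult)+

lemma cont_v': "continuous_on A (v j)"
  using cont_v continuous_on_subset by blast

lemma cont_g: "continuous_on A g1" "continuous_on A g2" "continuous_on A g3" "continuous_on A g4" "continuous_on A g5" "continuous_on A dg5"
  unfolding g1_def[abs_def] g2_def[abs_def] g3_def[abs_def] g4_def[abs_def] g5_def[abs_def] dg5_def[abs_def]
  by (intro continuous_intros cont_v')+

text \<open>Comparing coefficients in the Riccati equation makes each coefficient minus the
  derivative of its predecessor, minus a convolution of earlier ones. This is that recursion solved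
  for the derivatives.\<close>

lemma deriv_g:
  assumes "0 \<le> x"
  shows "(g1 has_real_derivative - g2 x) (at x within {0..})"
    "(g2 has_real_derivative - g3 x - g1 x * g1 x) (at x within {0..})"
    "(g3 has_real_derivative - g4 x - 2 * (g1 x * g2 x)) (at x within {0..})"
    "(g4 has_real_derivative - g5 x - 2 * (g1 x * g3 x) - g2 x * g2 x) (at x within {0..})"
    "(g5 has_real_derivative dg5 x) (at x within {0..})"
proof -
  note d = deriv_v[OF assms, of 0] deriv_v[OF assms, of 1] deriv_v[OF assms, of 2] deriv_v[OF assms, of 3] deriv_v[OF assms, of 4]
  have d: "(v 0 has_real_derivative v 1 x) (at x within {0..})" "(v 1 has_real_derivative v 2 x) (at x within {0..})"
    "(v 2 has_real_derivative v 3 x) (at x within {0..})" "(v 3 has_real_derivative v 4 x) (at x within {0..})"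
    "(v 4 has_real_derivative v 5 x) (at x within {0..})"
    using d by (simp_all add: eval_nat_numeral)
  show "(g1 has_real_derivative - g2 x) (at x within {0..})"
    "(g2 has_real_derivative - g3 x - g1 x * g1 x) (at x within {0..})"
    "(g3 has_real_derivative - g4 x - 2 * (g1 x * g2 x)) (at x within {0..})"
    "(g4 has_real_derivative - g5 x - 2 * (g1 x * g3 x) - g2 x * g2 x) (at x within {0..})"
    "(g5 has_real_derivative dg5 x) (at x within {0..})"
    unfolding g1_def[abs_def] g2_def[abs_def] g3_def[abs_def] g4_def[abs_def] g5_def[abs_def] dg5_def
    by (rule DERIV_cong, (rule derivative_intros d)+, simp add: algebra_simps)+
qed

abbreviation "T1 \<equiv> tail_integral g1"
abbreviation "T2 \<equiv> tail_integral g2"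
abbreviation "T3 \<equiv> tail_integral g3"
abbreviation "T4 \<equiv> tail_integral g4"
abbreviation "T5 \<equiv> tail_integral g5"

lemma deriv_T:
  "(tail_integral g1 has_real_derivative - g1 x) (at x within {0..})"
  "(tail_integral g2 has_real_derivative - g2 x) (at x within {0..})"
  "(tail_integral g3 has_real_derivative - g3 x) (at x within {0..})"
  "(tail_integral g4 has_real_derivative - g4 x) (at x within {0..})"
  "(tail_integral g5 has_real_derivative - g5 x) (at x within {0..})"
  unfolding has_real_derivative_iff_has_vector_derivative
  by (intro has_vector_derivative_at_within[of _ _ _ "{0..}"] tail_integral_has_vector_derivative cont_g bnd_integrable bnd_g)+

definition gy :: "complex \<Rightarrow> real \<Rightarrow> complex" where
  "gy y x = of_real (g1 x) * y + of_real (g2 x) * y ^ 2 + of_real (g3 x) * y ^ 3 + of_real (g4 x) * y ^ 4 + of_real (g5 x) * y ^ 5"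

text \<open>The integral of \<open>gy\<close> from x to infinity. Since \<open>gy\<close>
  approximates jm' / jm and jm tends to 1, the approximation of jm is exp(- Ty).\<close>

definition Ty :: "complex \<Rightarrow> real \<Rightarrow> complex" where
  "Ty y x = of_real (T1 x) * y + of_real (T2 x) * y ^ 2 + of_real (T3 x) * y ^ 3 + of_real (T4 x) * y ^ 4 + of_real (T5 x) * y ^ 5"

definition ry0 :: "complex \<Rightarrow> real \<Rightarrow> complex" where
  "ry0 y x = of_real (r5 x) + of_real (r6 x) * y + of_real (r7 x) * y ^ 2 + of_real (r8 x) * y ^ 3
    + of_real (r9 x) * y ^ 4 + of_real (r10 x) * y ^ 5"

definition ry :: "complex \<Rightarrow> real \<Rightarrow> complex" where
  "ry y x = y ^ 5 * ry0 y x"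

lemma deriv_Ty: "(Ty y has_vector_derivative - gy y x) (at x within {0..})"
  unfolding Ty_def[abs_def] gy_def
  by (rule has_vector_derivative_eq_rhs, (rule has_vector_derivative_add has_vector_derivative_mult_left has_vector_derivative_of_real deriv_T)+)
    (simp add: algebra_simps)

lemma deriv_gy:
  assumes "0 \<le> x" "z * y = 1"
  shows "(gy y has_vector_derivative (of_real (V x) - z * gy y x - (gy y x)\<^sup>2 + ry y x)) (at x within {0..})"
proof -
  have "(gy y has_vector_derivative
      (of_real (- g2 x) * y + of_real (- g3 x - g1 x * g1 x) * y ^ 2 + of_real (- g4 x - 2 * (g1 x * g2 x)) * y ^ 3
        + of_real (- g5 x - 2 * (g1 x * g3 x) - g2 x * g2 x) * y ^ 4 + of_real (dg5 x) * y ^ 5)) (at x within {0..})"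
    unfolding gy_def[abs_def]
    by (rule has_vector_derivative_add has_vector_derivative_mult_left has_vector_derivative_of_real deriv_g[OF assms(1)])+
  moreover have "of_real (- g2 x) * y + of_real (- g3 x - g1 x * g1 x) * y ^ 2 + of_real (- g4 x - 2 * (g1 x * g2 x)) * y ^ 3
        + of_real (- g5 x - 2 * (g1 x * g3 x) - g2 x * g2 x) * y ^ 4 + of_real (dg5 x) * y ^ 5
      = of_real (V x) - z * gy y x - (gy y x)\<^sup>2 + ry y x"
  proof -
    have "z * gy y x = of_real (g1 x) * (z * y) + of_real (g2 x) * ((z * y) * y) + of_real (g3 x) * ((z * y) * y ^ 2)
        + of_real (g4 x) * ((z * y) * y ^ 3) + of_real (g5 x) * ((z * y) * y ^ 4)"
      unfolding gy_def by (simp add: algebra_simps eval_nat_numeral)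
    then have z: "z * gy y x = of_real (V x) + of_real (g2 x) * y + of_real (g3 x) * y ^ 2 + of_real (g4 x) * y ^ 3 + of_real (g5 x) * y ^ 4"
      unfolding assms(2) by (simp add: g1_def v_0)
    show ?thesis
      unfolding z unfolding gy_def ry_def ry0_def r5_def r6_def r7_def r8_def r9_def r10_def of_real_add of_real_diff of_real_mult of_real_minus of_real_numeral
      by algebra
  qed
  ultimately show ?thesis by simp
qed

definition cbnd :: "(real \<Rightarrow> real) \<Rightarrow> (complex \<Rightarrow> real \<Rightarrow> complex) \<Rightarrow> bool" where
  "cbnd w F \<longleftrightarrow> (\<exists>c\<ge>0. \<forall>x\<ge>0. \<forall>y. norm y \<le> 1 \<longrightarrow> norm (F y x) \<le> c * w x)"

lemma cbnd_add: "cbnd w F \<Longrightarrow> cbnd w G \<Longrightarrow> cbnd w (\<lambda>y x. F y x + G y x)"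
proof -
  assume "cbnd w F" "cbnd w G"
  then obtain c d where cd: "0 \<le> c" "0 \<le> d"
    "\<And>x y. 0 \<le> x \<Longrightarrow> norm y \<le> 1 \<Longrightarrow> norm (F y x) \<le> c * w x" "\<And>x y. 0 \<le> x \<Longrightarrow> norm y \<le> 1 \<Longrightarrow> norm (G y x) \<le> d * w x"
    by (auto simp: cbnd_def)
  then have "norm (F y x + G y x) \<le> (c + d) * w x" if "0 \<le> x" "norm y \<le> 1" for x y
    unfolding distrib_right using that by (intro norm_triangle_mono) auto
  then show ?thesis unfolding cbnd_def using cd by (intro exI[of _ "c + d"]) auto
qed

lemma cbnd_monom:
  assumes "bnd w f" "\<And>x. 0 \<le> w x"
  shows "cbnd w (\<lambda>y x. of_real (f x) * y ^ n)" "cbnd w (\<lambda>y x. of_real (f x) * y)" "cbnd w (\<lambda>y x. of_real (f x))"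
proof -
  obtain d where d: "0 \<le> d" "\<And>x. 0 \<le> x \<Longrightarrow> \<bar>f x\<bar> \<le> d * w x" using assms(1) by (auto simp: bnd_def)
  have *: "norm (of_real (f x) * y ^ n) \<le> d * w x" if "0 \<le> x" "norm y \<le> 1" for x n and y :: complex
  proof -
    have "norm (of_real (f x) * y ^ n) \<le> (d * w x) * 1"
      unfolding norm_mult norm_power using d that assms(2)[of x] by (intro mult_mono power_le_one) auto
    then show ?thesis by simp
  qed
  show "cbnd w (\<lambda>y x. of_real (f x) * y ^ n)" "cbnd w (\<lambda>y x. of_real (f x) * y)" "cbnd w (\<lambda>y x. of_real (f x))"
    unfolding cbnd_def using *[of _ _ n] *[of _ _ 1] *[of _ _ 0] d(1) by (auto intro!: exI[of _ d])
qed

lemma gy_bound: "cbnd w1 gy"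
  unfolding gy_def[abs_def] by (intro cbnd_add cbnd_monom bnd_g w_nonneg)

lemma ry0_bound: "cbnd w2 ry0"
  unfolding ry0_def[abs_def] by (intro cbnd_add cbnd_monom bnd_r w_nonneg)

lemma tail_bounded:
  assumes "bnd w1 f" "continuous_on UNIV f"
  shows "bnd (\<lambda>_. 1) (tail_integral f)"
proof -
  obtain c where c: "0 \<le> c" "\<And>x. 0 \<le> x \<Longrightarrow> \<bar>f x\<bar> \<le> c * w1 x" using assms(1) by (auto simp: bnd_def)
  have "\<bar>tail_integral f x\<bar> \<le> c * (LINT t:{0..}|lborel. w1 t)" if "0 \<le> x" for x
  proof -
    have sub: "{x..} \<subseteq> {0..}" using that by auto
    have i: "set_integrable lborel {x..} (\<lambda>t. c * w1 t)" "set_integrable lborel {0..} (\<lambda>t. c * w1 t)"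
      using set_integrable_subset[OF w_integrable(1) _ sub] w_integrable(1) by auto
    have "norm (tail_integral f x) \<le> (LINT t:{x..}|lborel. c * w1 t)"
      unfolding tail_integral_def
      by (rule set_integral_norm_le[OF bnd_integrable[OF assms] i(1)]) (use c that in auto)
    also have "\<dots> \<le> (LINT t:{0..}|lborel. c * w1 t)"
      unfolding set_lebesgue_integral_def
      by (rule integral_mono) (use i c(1) w_nonneg that in \<open>auto simp: set_integrable_def split: split_indicator\<close>)
    finally show ?thesis by simp
  qed
  moreover have "0 \<le> (LINT t:{0..}|lborel. w1 t)"
    by (simp add: set_lebesgue_integral_def w_nonneg)
  ultimately show ?thesis unfolding bnd_def using c(1) by (intro exI[of _ "c * (LINT t:{0..}|lborel. w1 t)"]) auto
qed

lemma Ty_bound: "cbnd (\<lambda>_. 1) Ty"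
  unfolding Ty_def[abs_def] by (intro cbnd_add cbnd_monom tail_bounded bnd_g cont_g) auto

lemma Ty_tendsto_0: "(Ty y \<longlongrightarrow> 0) at_top"
proof -
  have "(Ty y \<longlongrightarrow> of_real 0 * y + of_real 0 * y ^ 2 + of_real 0 * y ^ 3 + of_real 0 * y ^ 4 + of_real 0 * y ^ 5) at_top"
    unfolding Ty_def[abs_def] by (intro tendsto_intros tail_integral_tendsto_0 bnd_integrable bnd_g cont_g)
  then show ?thesis by simp
qed

text \<open>Comparison of the Jost solution with the approximate solution \<open>exp (\<i> \<zeta> x - Ty y x)\<close>, through their Wronskian.\<close>

lemma wkb_comparison:
  obtains K where "0 \<le> K" "\<And>\<zeta>. 0 \<le> Im \<zeta> \<Longrightarrow> 1 \<le> norm \<zeta> \<Longrightarrow>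
      norm (jm \<zeta> 0 * exp (Ty (yvar \<zeta>) 0) - 1) \<le> K * norm (yvar \<zeta>) ^ 5 \<and>
      norm (jp \<zeta> 0 - jm \<zeta> 0 * gy (yvar \<zeta>) 0) \<le> K * norm (yvar \<zeta>) ^ 5"
proof -
  obtain B where B: "0 \<le> B" "\<And>x y. 0 \<le> x \<Longrightarrow> norm y \<le> 1 \<Longrightarrow> norm (Ty y x) \<le> B"
    using Ty_bound by (auto simp: cbnd_def)
  obtain c where c: "0 \<le> c" "\<And>x y. 0 \<le> x \<Longrightarrow> norm y \<le> 1 \<Longrightarrow> norm (gy y x) \<le> c * w1 x"
    using gy_bound by (auto simp: cbnd_def)
  obtain d where d: "0 \<le> d" "\<And>x y. 0 \<le> x \<Longrightarrow> norm y \<le> 1 \<Longrightarrow> norm (ry0 y x) \<le> d * w2 x"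
    using ry0_bound by (auto simp: cbnd_def)
  define M where "M = 2 * weight 0"
  have M: "0 \<le> M" using weight_pos[of 0] by (simp add: M_def)
  define L where "L = d * M * exp B / \<rho>"
  have L: "0 \<le> L" using d M rho by (simp add: L_def)
  define W where "W = (LINT t:{0..}|lborel. w1 t)"
  have W: "0 \<le> W" by (simp add: W_def set_lebesgue_integral_def w_nonneg)
  have "norm (jm \<zeta> 0 * exp (Ty (yvar \<zeta>) 0) - 1) \<le> L * exp (2 * B) * W * norm (yvar \<zeta>) ^ 5 \<and>
      norm (jp \<zeta> 0 - jm \<zeta> 0 * gy (yvar \<zeta>) 0) \<le> L * exp B * norm (yvar \<zeta>) ^ 5"
    if \<zeta>: "0 \<le> Im \<zeta>" "1 \<le> norm \<zeta>" for \<zeta>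
  proof -
    define z where "z = 2 * \<i> * \<zeta>"
    define y where "y = yvar \<zeta>"
    have nz: "\<zeta> \<noteq> 0" using \<zeta>(2) by auto
    have zy: "z * y = 1" using nz by (simp add: z_def y_def)
    have y1: "norm y \<le> 1" unfolding y_def norm_yvar using \<zeta>(2) by (simp add: divide_le_eq_1)
    have eT: "norm (exp (Ty y x)) \<le> exp B" "norm (exp (- Ty y x)) \<le> exp B" if "0 \<le> x" for x
      using norm_exp[of "Ty y x"] norm_exp[of "- Ty y x"] B(2)[OF that y1] by (auto intro: order_trans)
    have m: "norm (jm \<zeta> x) \<le> M" if "0 \<le> x" for x
      using norm_jm_le[OF \<zeta>(1), of x] weight_antimono[OF that] by (simp add: M_def)
    have r: "norm (ry y x) \<le> norm y ^ 5 * (d * w2 x)" if "0 \<le> x" for x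
      unfolding ry_def norm_mult norm_power by (intro mult_left_mono d(2)[OF that y1]) auto
    \<comment> \<open>Up to exponential factors this is the Wronskian of the exact and the
      approximate solution. It satisfies a first-order equation whose inhomogeneity is the defect
      \<open>ry\<close>; the order y^5 comes from there.\<close>
    define k where "k x = (jp \<zeta> x - jm \<zeta> x * gy y x) * exp (- Ty y x)" for x
    have djm: "(jm \<zeta> has_vector_derivative jp \<zeta> x) (at x within {0..})"
      and djp: "(jp \<zeta> has_vector_derivative (V x * jm \<zeta> x - z * jp \<zeta> x)) (at x within {0..})" for x
      using has_vector_derivative_at_within[OF jm_has_vector_derivative[OF \<zeta>(1)]]
        has_vector_derivative_at_within[OF jp_has_vector_derivative[OF \<zeta>(1)]] by (auto simp: z_def)
    have dexp: "((\<lambda>x. exp (s * Ty y x)) has_vector_derivative - s * gy y x * exp (s * Ty y x)) (at x within {0..})" for s x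
      using field_vector_diff_chain_within[OF has_vector_derivative_mult_right[OF deriv_Ty, of s] has_field_derivative_at_within[OF DERIV_exp]]
      by (simp add: o_def mult_ac)
    have dk: "(k has_vector_derivative - z * k x - ry y x * jm \<zeta> x * exp (- Ty y x)) (at x within {0..})" if x: "0 \<le> x" for x
    proof -
      have "(k has_vector_derivative ((jp \<zeta> x - jm \<zeta> x * gy y x) * (- (- 1) * gy y x * exp (- 1 * Ty y x))
          + ((V x * jm \<zeta> x - z * jp \<zeta> x) - (jm \<zeta> x * (of_real (V x) - z * gy y x - (gy y x)\<^sup>2 + ry y x) + jp \<zeta> x * gy y x)) * exp (- 1 * Ty y x))) (at x within {0..})"
        unfolding k_def[abs_def]
        using has_vector_derivative_mult[OF has_vector_derivative_diff[OF djp has_vector_derivative_mult[OF djm deriv_gy[OF x zy]]] dexp[of "- 1" x]]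
        by simp
      then show ?thesis
        by (rule has_vector_derivative_eq_rhs) (simp add: k_def algebra_simps power2_eq_square)
    qed
    have cgy: "continuous_on {0..} (gy y)" "continuous_on {0..} (ry y)" "continuous_on {0..} (Ty y)"
      unfolding gy_def[abs_def] ry_def[abs_def] ry0_def r5_def r6_def r7_def r8_def r9_def r10_def
      by (intro continuous_intros cont_g)+
        (use deriv_Ty in \<open>auto intro: has_vector_derivative_continuous simp: continuous_on_eq_continuous_within\<close>)
    have cjm: "continuous_on A (jm \<zeta>)" for A using cont_jm[OF \<zeta>(1)] continuous_on_subset by blast
    have kb: "norm (k x) \<le> L * norm y ^ 5 * w1 x" if x: "0 \<le> x" for x
    proof -
      \<comment> \<open>The integrating factor has modulus at most 1 for t \<ge> x because Im
        \<zeta> \<ge> 0, so integrating from x to infinity is uniform in \<zeta>.\<close>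
      define u where "u t = exp (z * of_real (t - x)) * k t" for t
      define u' where "u' t = - (exp (z * of_real (t - x)) * (ry y t * jm \<zeta> t * exp (- Ty y t)))" for t
      have e1: "norm (exp (z * of_real (t - x))) \<le> 1" if "x \<le> t" for t
        using norm_exp_le_1[OF \<zeta>(1) that] by (simp add: z_def)
      have ub: "norm (u' t) \<le> norm y ^ 5 * (d * M * exp B) * w2 t" if "x \<le> t" for t
      proof -
        have t0: "0 \<le> t" using that x by simp
        have "norm (u' t) \<le> 1 * ((norm y ^ 5 * (d * w2 t)) * M * exp B)"
          unfolding u'_def norm_minus_cancel norm_mult
          using e1[OF that] r[OF t0] m[OF t0] eT(2)[OF t0] M d(1) w_nonneg[of t] by (intro mult_mono) auto
        then show ?thesis by (simp add: mult_ac)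
      qed
      have sub: "{x..} \<subseteq> {0..}" using x by auto
      have cu': "continuous_on {x..} u'"
        unfolding u'_def by (intro continuous_intros continuous_on_subset[OF cgy(2) sub] continuous_on_subset[OF cgy(3) sub] cjm)
      have iu': "set_integrable lborel {x..} u'"
        by (rule set_integrable_continuous_bound[OF cu' _ set_integrable_mult_right[OF w_integrable(2)[OF x]] ub]) auto
      have du: "(u has_vector_derivative u' t) (at t within {x..})" if "x \<le> t" for t
      proof -
        have E: "((\<lambda>t. exp (z * of_real (t - x))) has_vector_derivative z * exp (z * of_real (t - x))) (at t within {x..})"
          unfolding of_real_diff by (rule has_vector_derivative_real_field) (auto intro!: derivative_eq_intros)
        have "0 \<le> t" using that x by simp
        from has_vector_derivative_mult[OF E has_vector_derivative_within_subset[OF dk[OF this] sub]]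
        show ?thesis unfolding u_def[abs_def] by (rule has_vector_derivative_eq_rhs) (simp add: u'_def algebra_simps)
      qed
      have lim: "(u \<longlongrightarrow> 0) at_top"
      proof (rule Lim_null_comparison)
        show "\<forall>\<^sub>F t in at_top. norm (u t) \<le> (norm (jp \<zeta> t) + M * (c * w1 t)) * exp B"
          using eventually_ge_at_top[of x]
        proof eventually_elim
          case (elim t)
          then have t0: "0 \<le> t" using x by simp
          have "norm (jp \<zeta> t - jm \<zeta> t * gy y t) \<le> norm (jp \<zeta> t) + M * (c * w1 t)"
            using m[OF t0] c(2)[OF t0 y1] M by (intro norm_triangle_le_diff add_mono) (auto simp: norm_mult intro!: mult_mono)
          then have "norm (u t) \<le> 1 * ((norm (jp \<zeta> t) + M * (c * w1 t)) * exp B)"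
            unfolding u_def k_def norm_mult using e1[OF elim] eT(2)[OF t0] by (intro mult_mono) (auto intro: order_trans[OF norm_ge_zero])
          then show ?case by simp
        qed
        have "((\<lambda>t. (norm (jp \<zeta> t) + M * (c * w1 t)) * exp B) \<longlongrightarrow> (norm (0::complex) + M * (c * 0)) * exp B) at_top"
          by (intro tendsto_intros jp_tendsto_0[OF \<zeta>(1)] w1_tendsto_0)
        then show "((\<lambda>t. (norm (jp \<zeta> t) + M * (c * w1 t)) * exp B) \<longlongrightarrow> 0) at_top" by simp
      qed
      have "k x = - (LINT t:{x..}|lborel. u' t)"
        using set_integral_FTC_atLeast[OF du cu' iu' lim] by (simp add: u_def)
      then have "norm (k x) \<le> (LINT t:{x..}|lborel. norm y ^ 5 * (d * M * exp B) * w2 t)"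
        using set_integral_norm_le[OF iu' set_integrable_mult_right[OF w_integrable(2)[OF x]] ub] by simp
      also have "\<dots> = norm y ^ 5 * (d * M * exp B) * (w1 x / \<rho>)"
        unfolding set_integral_mult_right w_integrable(3)[OF x] ..
      finally show ?thesis by (simp add: L_def mult_ac)
    qed
    have 1: "norm (jp \<zeta> 0 - jm \<zeta> 0 * gy y 0) \<le> L * exp B * norm y ^ 5"
    proof -
      have "jp \<zeta> 0 - jm \<zeta> 0 * gy y 0 = k 0 * exp (Ty y 0)"
        unfolding k_def by (simp add: mult.assoc flip: exp_add)
      also have "norm \<dots> \<le> (L * norm y ^ 5 * w1 0) * exp B"
        unfolding norm_mult using kb[of 0] eT(1)[of 0] by (intro mult_mono) (auto intro: order_trans[OF norm_ge_zero])
      finally show ?thesis by (simp add: w1_def mult_ac)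
    qed
    \<comment> \<open>The quotient of the exact and the approximate solution. Its derivative is
      \<open>k\<close> times a bounded factor, and a second integration, now of \<open>w1\<close>,
      bounds its distance from the limit 1.\<close>
    define q where "q x = jm \<zeta> x * exp (1 * Ty y x)" for x
    define q' where "q' x = k x * exp (2 * Ty y x)" for x
    have dq: "(q has_vector_derivative q' x) (at x within {0..})" for x
      unfolding q_def[abs_def]
    proof (rule has_vector_derivative_eq_rhs[OF has_vector_derivative_mult[OF djm dexp[of 1 x]]])
      have "exp (2 * Ty y x) * exp (- Ty y x) = exp (Ty y x)" by (simp flip: exp_add)
      then have "q' x = (jp \<zeta> x - jm \<zeta> x * gy y x) * exp (Ty y x)"
        unfolding q'_def k_def by (metis mult.assoc mult.commute)
      then show "jm \<zeta> x * (- 1 * gy y x * exp (1 * Ty y x)) + jp \<zeta> x * exp (1 * Ty y x) = q' x"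
        by (simp add: algebra_simps)
    qed
    have qb: "norm (q' x) \<le> L * exp (2 * B) * norm y ^ 5 * w1 x" if x: "0 \<le> x" for x
    proof -
      have "norm (exp (2 * Ty y x)) \<le> exp (norm (2 * Ty y x))" by (rule norm_exp)
      also have "\<dots> \<le> exp (2 * B)" using B(2)[OF x y1] by (simp add: norm_mult)
      finally have "norm (q' x) \<le> (L * norm y ^ 5 * w1 x) * exp (2 * B)"
        unfolding q'_def norm_mult using kb[OF x] by (intro mult_mono) (auto intro: order_trans[OF norm_ge_zero])
      then show ?thesis by (simp add: mult_ac)
    qed
    have cq': "continuous_on {0..} q'"
      unfolding q'_def k_def by (intro continuous_intros cgy cjm cont_jp[OF \<zeta>(1)])
    have iq': "set_integrable lborel {0..} q'"
      by (rule set_integrable_continuous_bound[OF cq' _ set_integrable_mult_right[OF w_integrable(1)] qb]) auto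
    have "(q \<longlongrightarrow> 1 * exp (1 * 0)) at_top"
      unfolding q_def[abs_def] by (intro tendsto_intros jm_tendsto_1[OF \<zeta>(1)] Ty_tendsto_0)
    then have "(q \<longlongrightarrow> 1) at_top" by simp
    from set_integral_FTC_atLeast[OF dq cq' iq' this]
    have "norm (q 0 - 1) = norm (LINT t:{0..}|lborel. q' t)" by (simp add: norm_minus_commute)
    also have "\<dots> \<le> (LINT t:{0..}|lborel. L * exp (2 * B) * norm y ^ 5 * w1 t)"
      by (rule set_integral_norm_le[OF iq' set_integrable_mult_right[OF w_integrable(1)] qb]) auto
    also have "\<dots> = L * exp (2 * B) * W * norm y ^ 5"
      unfolding set_integral_mult_right by (simp add: W_def mult_ac)
    finally show ?thesis using 1 by (simp add: q_def y_def)
  qed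
  note main = this
  show thesis
  proof (rule that[of "L * exp (2 * B) * W + L * exp B"])
    fix \<zeta> assume \<zeta>: "0 \<le> Im \<zeta>" "1 \<le> norm \<zeta>"
    have le: "L * exp (2 * B) * W * norm (yvar \<zeta>) ^ 5 \<le> (L * exp (2 * B) * W + L * exp B) * norm (yvar \<zeta>) ^ 5"
      "L * exp B * norm (yvar \<zeta>) ^ 5 \<le> (L * exp (2 * B) * W + L * exp B) * norm (yvar \<zeta>) ^ 5"
      using L W by (intro mult_right_mono; simp)+
    show "norm (jm \<zeta> 0 * exp (Ty (yvar \<zeta>) 0) - 1) \<le> (L * exp (2 * B) * W + L * exp B) * norm (yvar \<zeta>) ^ 5 \<and>
      norm (jp \<zeta> 0 - jm \<zeta> 0 * gy (yvar \<zeta>) 0) \<le> (L * exp (2 * B) * W + L * exp B) * norm (yvar \<zeta>) ^ 5"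
      using main[OF \<zeta>] order_trans[OF _ le(1)] order_trans[OF _ le(2)] by blast
  qed (use L W in simp)
qed

end

section \<open>Expansion of the normalised Jost function at infinity\<close>

context jost_smooth
begin

definition jzeros :: "real \<Rightarrow> complex set" where
  "jzeros \<gamma> = {\<zeta> \<in> open_uhp. jostw \<gamma> \<zeta> = 0}"

text \<open>Zeros minus poles: for \<gamma> < 0 the denominator \<gamma> - \<i> \<zeta> has the zero
  \<i> |\<gamma>| in the upper half plane, which counts negatively. With |\<lambda>| = \<kappa>^2
  this is the sum of |\<lambda>|^(n/2) minus M with index n/2.\<close>

definition Smom :: "real \<Rightarrow> nat \<Rightarrow> real" where
  "Smom \<gamma> n = (\<Sum>z\<in>jzeros \<gamma>. Im z ^ n) - (if \<gamma> < 0 then (- \<gamma>) ^ n else 0)"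

text \<open>Apart from its zeros, also the zero \<open>- \<i> \<gamma>\<close> of \<open>\<gamma> - \<i> \<zeta>\<close> has to be moved out of the upper half plane
  if \<open>\<gamma> < 0\<close>; this is the effect of the absolute value.\<close>

definition Efun :: "real \<Rightarrow> complex \<Rightarrow> complex" where
  "Efun \<gamma> \<zeta> = jostw \<gamma> \<zeta> / (of_real \<bar>\<gamma>\<bar> - \<i> * \<zeta>) * (\<Prod>z\<in>jzeros \<gamma>. (\<zeta> + z) / (\<zeta> - z))"

text \<open>Coefficients of log E in powers of y = 1 / (2 \<i> \<zeta>), assembled in
  \<open>Qf\<close>. They collect - Ty at 0, the boundary factor and the Blaschke factors; the
  latter subtract 2 (2 \<kappa>) = 4 \<kappa> in order one and 2 (2 \<kappa>)^3 / 3 = 16 \<kappa>^3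
  / 3 in order three, and nothing in even orders.\<close>

definition "c1 \<gamma> = - (LINT x:{0..}|lborel. V x) - 4 * Smom \<gamma> 1"
definition "c3 \<gamma> = (LINT x:{0..}|lborel. v 0 x * v 0 x) + 4 * \<gamma> * v 0 0 - v 1 0 - 16 / 3 * Smom \<gamma> 3"
definition "c4 \<gamma> = v 2 0 + 8 * \<gamma>\<^sup>2 * v 0 0 - 4 * \<gamma> * v 1 0 - 2 * (v 0 0)\<^sup>2"

definition Qf :: "real \<Rightarrow> complex \<Rightarrow> complex" where
  "Qf \<gamma> y = of_real (c1 \<gamma>) * y + of_real (v 0 0) * y ^ 2 + of_real (c3 \<gamma>) * y ^ 3 + of_real (c4 \<gamma>) * y ^ 4"

text \<open>\<open>g2\<close> and \<open>g4\<close> are exact derivatives, so their integrals reduce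
  to boundary values; in \<open>g3\<close> the square of V remains. Hence integrals of the potential
  occur only in the odd coefficients.\<close>

lemma T_0:
  "T1 0 = (LINT x:{0..}|lborel. V x)" "T2 0 = v 0 0"
  "T3 0 = - v 1 0 - (LINT x:{0..}|lborel. v 0 x * v 0 x)" "T4 0 = v 2 0 - 2 * (v 0 0)\<^sup>2"
proof -
  have V: "g1 = V" by (simp add: g1_def[abs_def] v_0)
  show "T1 0 = (LINT x:{0..}|lborel. V x)" by (simp add: tail_integral_def V)
  have d: "(v j has_vector_derivative v (Suc j) x) (at x within {0..})" if "0 \<le> x" for j x
    using deriv_v[OF that] by (simp add: has_real_derivative_iff_has_vector_derivative)
  have i: "set_integrable lborel {0..} (v j)" "(v j \<longlongrightarrow> 0) at_top" if "j \<le> 5" for j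
    using bnd_integrable[OF bnd_v(1)[OF that] cont_v] bnd_tendsto_0[OF bnd_v(1)[OF that]] by auto
  have I: "(LINT x:{0..}|lborel. v (Suc j) x) = - v j 0" if "j < 5" for j
    using set_integral_FTC_atLeast[OF d cont_v' i(1)[of "Suc j"] i(2)[of j]] that by simp
  show "T2 0 = v 0 0"
    using I[of 0] unfolding tail_integral_def g2_def by (simp add: set_lebesgue_integral_def)
  have i00: "set_integrable lborel {0..} (\<lambda>x. v 0 x * v 0 x)"
    by (intro bnd_integrable bnd_w2_imp_w1 bnd_mult bnd_v continuous_intros cont_v') auto
  show "T3 0 = - v 1 0 - (LINT x:{0..}|lborel. v 0 x * v 0 x)"
    using I[of 1] set_integral_diff(2)[OF i(1)[of 2] i00] unfolding tail_integral_def g3_def by (simp add: eval_nat_numeral)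
  have "(LINT x:{0..}|lborel. g4 x) = 0 - (2 * (v 0 0 * v 0 0) - v 2 0)"
  proof (rule set_integral_FTC_atLeast)
    show "((\<lambda>x. 2 * (v 0 x * v 0 x) - v 2 x) has_vector_derivative g4 x) (at x within {0..})" if "0 \<le> x" for x
      unfolding g4_def has_real_derivative_iff_has_vector_derivative[symmetric]
      using deriv_v[OF that, of 0] deriv_v[OF that, of 2]
      by (auto intro!: derivative_eq_intros simp: eval_nat_numeral)
    show "set_integrable lborel {0..} g4" by (rule bnd_integrable[OF bnd_g(4) cont_g(4)])
    have "((\<lambda>x. 2 * (v 0 x * v 0 x) - v 2 x) \<longlongrightarrow> 2 * (0 * 0) - 0) at_top"
      by (intro tendsto_intros i(2)) auto
    then show "((\<lambda>x. 2 * (v 0 x * v 0 x) - v 2 x) \<longlongrightarrow> 0) at_top" by simp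
  qed (rule cont_g)
  then show "T4 0 = v 2 0 - 2 * (v 0 0)\<^sup>2" by (simp add: tail_integral_def power2_eq_square)
qed

text \<open>By the comparison of solutions, w exp(Ty) / G with G = \<gamma> - \<i> \<zeta> equals 1
  - gy / G up to O(y^5), and this is the boundary factor expanded before.\<close>

lemma near_one_jostw:
  "near_one (\<lambda>\<zeta>. jostw \<gamma> \<zeta> * exp (Ty (yvar \<zeta>) 0) / (of_real \<gamma> - \<i> * \<zeta>)
    * exp (- (2 * of_real (g1 0) * yvar \<zeta> ^ 2 + (2 * of_real (g2 0) + 4 * of_real \<gamma> * of_real (g1 0)) * yvar \<zeta> ^ 3
        + (2 * of_real (g3 0) + 4 * of_real \<gamma> * of_real (g2 0) + 8 * of_real \<gamma> ^ 2 * of_real (g1 0) - 2 * of_real (g1 0) ^ 2) * yvar \<zeta> ^ 4)))"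
proof -
  obtain K where K: "0 \<le> K" "\<And>\<zeta>. 0 \<le> Im \<zeta> \<Longrightarrow> 1 \<le> norm \<zeta> \<Longrightarrow>
      norm (jm \<zeta> 0 * exp (Ty (yvar \<zeta>) 0) - 1) \<le> K * norm (yvar \<zeta>) ^ 5 \<and>
      norm (jp \<zeta> 0 - jm \<zeta> 0 * gy (yvar \<zeta>) 0) \<le> K * norm (yvar \<zeta>) ^ 5"
    by (rule wkb_comparison) blast
  obtain B where B: "0 \<le> B" "\<And>x y. 0 \<le> x \<Longrightarrow> norm y \<le> 1 \<Longrightarrow> norm (Ty y x) \<le> B"
    using Ty_bound by (auto simp: cbnd_def)
  obtain c where c: "0 \<le> c" "\<And>x y. 0 \<le> x \<Longrightarrow> norm y \<le> 1 \<Longrightarrow> norm (gy y x) \<le> c * w1 x"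
    using gy_bound by (auto simp: cbnd_def)
  define A where "A y = 2 * of_real (g1 0) * y ^ 2 + (2 * of_real (g2 0) + 4 * of_real \<gamma> * of_real (g1 0)) * y ^ 3
        + (2 * of_real (g3 0) + 4 * of_real \<gamma> * of_real (g2 0) + 8 * of_real \<gamma> ^ 2 * of_real (g1 0) - 2 * of_real (g1 0) ^ 2) * y ^ 4" for y :: complex
  define S where "S y = 2 * y * gy y 0" for y
  have "compact (A ` cball 0 1)" unfolding A_def by (intro compact_continuous_image continuous_intros) auto
  then obtain MA where MA: "\<And>y. norm y \<le> 1 \<Longrightarrow> norm (A y) \<le> MA"
    by (metis bounded_iff compact_imp_bounded imageI mem_cball_0)
  define W where "W \<zeta> = jostw \<gamma> \<zeta> * exp (Ty (yvar \<zeta>) 0) / (of_real \<gamma> - \<i> * \<zeta>)" for \<zeta>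
  let ?f = "\<lambda>\<zeta>. (1 + S (yvar \<zeta>) / (1 - 2 * of_real \<gamma> * yvar \<zeta>)) * exp (- A (yvar \<zeta>))"
  have f: "near_one ?f"
    unfolding S_def A_def gy_def by (rule near_one_boundary_factor)
  define L where "L = (K * (1 + c) + K * exp B) * exp MA"
  have e: "\<forall>\<^sub>F \<zeta> in uhp_infinity. norm ((W \<zeta> - (1 + S (yvar \<zeta>) / (1 - 2 * of_real \<gamma> * yvar \<zeta>))) * exp (- A (yvar \<zeta>))) \<le> L / norm \<zeta> ^ 5"
    unfolding eventually_uhp_infinity
  proof (intro exI[of _ "1 + \<bar>\<gamma>\<bar>"] allI impI)
    fix \<zeta> assume \<zeta>: "0 \<le> Im \<zeta>" "1 + \<bar>\<gamma>\<bar> \<le> norm \<zeta>"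
    define y where "y = yvar \<zeta>"
    have \<zeta>1: "1 \<le> norm \<zeta>" "\<zeta> \<noteq> 0" using \<zeta>(2) by auto
    have y1: "norm y \<le> 1" "norm y ^ 5 \<le> 1 / norm \<zeta> ^ 5"
    proof -
      show "norm y \<le> 1" unfolding y_def norm_yvar using \<zeta>1(1) by (simp add: divide_le_eq_1)
      have "norm y \<le> 1 / norm \<zeta>" unfolding y_def norm_yvar using \<zeta>1 by (intro divide_left_mono) auto
      then have "norm y ^ 5 \<le> (1 / norm \<zeta>) ^ 5" by (intro power_mono) auto
      then show "norm y ^ 5 \<le> 1 / norm \<zeta> ^ 5" by (simp add: power_one_over)
    qed
    \<comment> \<open>The radius 1 + |\<gamma>| makes |G| \<ge> 1, so division by G does not enlarge
      the errors.\<close>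
    define G where "G = of_real \<gamma> - \<i> * \<zeta>"
    have G: "1 \<le> norm G" using norm_triangle_ineq2[of "\<i> * \<zeta>" "of_real \<gamma>"] \<zeta>(2) by (simp add: G_def norm_mult norm_minus_commute)
    then have G0: "G \<noteq> 0" by auto
    have Gy: "G * (2 * y) = - (1 - 2 * of_real \<gamma> * y)" using \<zeta>1 by (simp add: G_def y_def field_simps)
    have q0: "1 - 2 * of_real \<gamma> * y \<noteq> 0"
      using Gy G0 \<zeta>1 by (metis divide_eq_0_iff mult_eq_0_iff neg_equal_0_iff_equal y_def zero_neq_numeral zero_neq_one complex_i_not_zero)
    have S: "S y / (1 - 2 * of_real \<gamma> * y) = - gy y 0 / G"
    proof -
      have "S y * G = - gy y 0 * (1 - 2 * of_real \<gamma> * y)"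
      proof -
        have "S y * G = gy y 0 * (G * (2 * y))" by (simp add: S_def mult_ac)
        then show ?thesis unfolding Gy by (simp add: algebra_simps)
      qed
      then show ?thesis using frac_eq_eq[OF q0 G0, of "S y" "- gy y 0"] by blast
    qed
    define \<epsilon> where "\<epsilon> = jm \<zeta> 0 * exp (Ty y 0) - 1"
    define \<delta> where "\<delta> = jp \<zeta> 0 - jm \<zeta> 0 * gy y 0"
    have ed: "norm \<epsilon> \<le> K * norm y ^ 5" "norm \<delta> \<le> K * norm y ^ 5"
      using K(2)[OF \<zeta>(1) \<zeta>1(1)] by (auto simp: \<epsilon>_def \<delta>_def y_def)
    have g: "norm (gy y 0) \<le> c" using c(2)[of 0 y] y1 by (simp add: w1_def)
    have Weq: "W \<zeta> = (G - gy y 0) * (1 + \<epsilon>) / G - \<delta> * exp (Ty y 0) / G"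
      by (simp add: W_def jostw_def G_def \<epsilon>_def \<delta>_def y_def algebra_simps flip: diff_divide_distrib)
    have "W \<zeta> - (1 + S y / (1 - 2 * of_real \<gamma> * y)) = \<epsilon> * (1 - gy y 0 / G) - \<delta> * exp (Ty y 0) / G"
      unfolding S
    proof -
      have "(G - gy y 0) / G = 1 - gy y 0 / G" using G0 by (simp add: diff_divide_distrib)
      then have "(G - gy y 0) * (1 + \<epsilon>) / G = (1 - gy y 0 / G) * (1 + \<epsilon>)" by (metis times_divide_eq_left)
      then show "W \<zeta> - (1 + - gy y 0 / G) = \<epsilon> * (1 - gy y 0 / G) - \<delta> * exp (Ty y 0) / G"
        unfolding Weq by (simp add: ring_distribs)
    qed
    also have "norm \<dots> \<le> K * norm y ^ 5 * (1 + c) + K * norm y ^ 5 * exp B"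
    proof (intro norm_triangle_le_diff add_mono)
      have "norm (gy y 0 / G) \<le> c / 1"
        unfolding norm_divide using g G c(1) by (intro frac_le) auto
      then have "norm (1 - gy y 0 / G) \<le> 1 + c" using norm_triangle_ineq4[of 1 "gy y 0 / G"] by simp
      then show "norm (\<epsilon> * (1 - gy y 0 / G)) \<le> K * norm y ^ 5 * (1 + c)"
        unfolding norm_mult using ed(1) K(1) by (intro mult_mono) auto
      have "norm (exp (Ty y 0)) \<le> exp B" using norm_exp[of "Ty y 0"] B(2)[of 0 y] y1(1) by (auto intro: order_trans)
      then have "norm (\<delta> * exp (Ty y 0)) \<le> K * norm y ^ 5 * exp B"
        unfolding norm_mult using ed(2) K(1) by (intro mult_mono) auto
      moreover have "norm (\<delta> * exp (Ty y 0)) / norm G \<le> norm (\<delta> * exp (Ty y 0)) / 1"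
        using G by (intro divide_left_mono) auto
      ultimately show "norm (\<delta> * exp (Ty y 0) / G) \<le> K * norm y ^ 5 * exp B" unfolding norm_divide by simp
    qed
    also have "\<dots> = (K * (1 + c) + K * exp B) * norm y ^ 5" by (simp add: algebra_simps)
    finally have "norm ((W \<zeta> - (1 + S y / (1 - 2 * of_real \<gamma> * y))) * exp (- A y)) \<le> (K * (1 + c) + K * exp B) * norm y ^ 5 * exp MA"
      unfolding norm_mult[of _ "exp (- A y)"] using norm_exp[of "- A y"] MA[OF y1(1)] K(1) c(1)
      by (intro mult_mono) (auto intro: order_trans)
    also have "\<dots> = L * norm y ^ 5" by (simp add: L_def)
    also have "\<dots> \<le> L * (1 / norm \<zeta> ^ 5)" using y1(2) K(1) c(1) by (intro mult_left_mono) (auto simp: L_def)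
    finally show "norm ((W \<zeta> - (1 + S (yvar \<zeta>) / (1 - 2 * of_real \<gamma> * yvar \<zeta>))) * exp (- A (yvar \<zeta>))) \<le> L / norm \<zeta> ^ 5"
      by (simp add: y_def)
  qed
  have "near_one (\<lambda>\<zeta>. W \<zeta> * exp (- A (yvar \<zeta>)))"
    by (rule near_one_cong[OF near_one_add[OF f e]]) (simp add: algebra_simps)
  then show ?thesis unfolding W_def A_def .
qed

lemma finite_jzeros: "finite (jzeros \<gamma>)"
  unfolding jzeros_def by (rule finite_jostw_zeros)

lemma jzeros_imaginary: "z \<in> jzeros \<gamma> \<Longrightarrow> z = \<i> * of_real (Im z)" "z \<in> jzeros \<gamma> \<Longrightarrow> 0 < Im z"
  using jostw_zero_imaginary[of z \<gamma>] by (auto simp: jzeros_def complex_eq_iff)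

text \<open>E is composed of factors that are each 1 + O(1 / |\<zeta>|^5): the Jost function with
  its boundary factor, the order-five term of Ty, absorbed into the error, one factor per zero, and
  one that moves the zero of \<gamma> - \<i> \<zeta>. The compensating exponents add up to -
  Qf.\<close>

lemma near_one_Efun: "near_one (\<lambda>\<zeta>. Efun \<gamma> \<zeta> * exp (- Qf \<gamma> (yvar \<zeta>)))"
proof -
  let ?A = "\<lambda>y::complex. 2 * of_real (g1 0) * y ^ 2 + (2 * of_real (g2 0) + 4 * of_real \<gamma> * of_real (g1 0)) * y ^ 3
        + (2 * of_real (g3 0) + 4 * of_real \<gamma> * of_real (g2 0) + 8 * of_real \<gamma> ^ 2 * of_real (g1 0) - 2 * of_real (g1 0) ^ 2) * y ^ 4"
  let ?R = "\<lambda>a y. (1 - a * y) / (1 + a * y)" and ?X = "\<lambda>a y::complex. 2 * a * y + 2 / 3 * a ^ 3 * y ^ 3"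
  let ?a = "\<lambda>z. 2 * complex_of_real (Im z)" and ?Z = "jzeros \<gamma>"
  \<comment> \<open>For \<gamma> < 0 the factor with parameter 2 \<gamma> is (\<gamma> - \<i>
    \<zeta>) / (|\<gamma>| - \<i> \<zeta>), which exchanges the denominators; otherwise the
    parameter 0 makes the factor 1.\<close>
  define \<gamma>' :: complex where "\<gamma>' = (if \<gamma> < 0 then 2 * of_real \<gamma> else 0)"
  have "near_one (\<lambda>\<zeta>. (jostw \<gamma> \<zeta> * exp (Ty (yvar \<zeta>) 0) / (of_real \<gamma> - \<i> * \<zeta>) * exp (- ?A (yvar \<zeta>)))
      * exp (- of_real (T5 0) * yvar \<zeta> ^ 5)
      * (\<Prod>z\<in>?Z. ?R (?a z) (yvar \<zeta>) * exp (?X (?a z) (yvar \<zeta>)))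
      * (?R \<gamma>' (yvar \<zeta>) * exp (?X \<gamma>' (yvar \<zeta>))))"
    by (intro near_one_mult near_one_prod near_one_jostw near_one_exp5 near_one_blaschke finite_jzeros)
  then show ?thesis
  proof (rule near_one_cong)
    show "\<forall>\<^sub>F \<zeta> in uhp_infinity. (jostw \<gamma> \<zeta> * exp (Ty (yvar \<zeta>) 0) / (of_real \<gamma> - \<i> * \<zeta>) * exp (- ?A (yvar \<zeta>)))
      * exp (- of_real (T5 0) * yvar \<zeta> ^ 5)
      * (\<Prod>z\<in>?Z. ?R (?a z) (yvar \<zeta>) * exp (?X (?a z) (yvar \<zeta>)))
      * (?R \<gamma>' (yvar \<zeta>) * exp (?X \<gamma>' (yvar \<zeta>))) = Efun \<gamma> \<zeta> * exp (- Qf \<gamma> (yvar \<zeta>))"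
      using eventually_norm_ge[of "1 + \<bar>\<gamma>\<bar> + (\<Sum>z\<in>?Z. norm z)"]
    proof eventually_elim
      case (elim \<zeta>)
      define y where "y = yvar \<zeta>"
      have s0: "0 \<le> (\<Sum>z\<in>?Z. norm z)" by (rule sum_nonneg) simp
      then have \<zeta>: "1 + \<bar>\<gamma>\<bar> \<le> norm \<zeta>" "\<zeta> \<noteq> 0" using elim by auto
      have R: "?R (2 * of_real t) y = (\<zeta> + \<i> * of_real t) / (\<zeta> - \<i> * of_real t)" for t
      proof -
        have "2 * of_real t * y = - (\<i> * of_real t / \<zeta>)" using \<zeta>(2) by (simp add: y_def field_simps)
        then have "?R (2 * of_real t) y = ((\<zeta> + \<i> * of_real t) / \<zeta>) / ((\<zeta> - \<i> * of_real t) / \<zeta>)"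
          using \<zeta>(2) by (simp add: add_divide_distrib diff_divide_distrib)
        then show ?thesis using \<zeta>(2) by simp
      qed
      have RZ: "?R (?a z) y = (\<zeta> + z) / (\<zeta> - z)" if "z \<in> ?Z" for z
        using R[of "Im z"] jzeros_imaginary(1)[OF that] by simp
      have R\<gamma>: "?R \<gamma>' y / (of_real \<gamma> - \<i> * \<zeta>) = 1 / (of_real \<bar>\<gamma>\<bar> - \<i> * \<zeta>)"
      proof (cases "\<gamma> < 0")
        case True
        have "norm (\<i> * \<zeta>) \<noteq> norm (complex_of_real \<gamma>)" using \<zeta>(1) by (simp add: norm_mult)
        then have n: "of_real \<gamma> - \<i> * \<zeta> \<noteq> 0" by (metis right_minus_eq)
        have 1: "\<zeta> + \<i> * of_real \<gamma> = \<i> * (of_real \<gamma> - \<i> * \<zeta>)" "\<zeta> - \<i> * of_real \<gamma> = \<i> * (of_real \<bar>\<gamma>\<bar> - \<i> * \<zeta>)"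
          using True by (simp_all add: algebra_simps)
        have "?R \<gamma>' y = (\<zeta> + \<i> * of_real \<gamma>) / (\<zeta> - \<i> * of_real \<gamma>)" using R[of \<gamma>] True by (simp add: \<gamma>'_def)
        then show ?thesis using n unfolding 1 by simp
      qed (simp add: \<gamma>'_def)
      have ex: "Ty y 0 + - ?A y + - of_real (T5 0) * y ^ 5 + (\<Sum>z\<in>?Z. ?X (?a z) y) + ?X \<gamma>' y = - Qf \<gamma> y"
      proof -
        have 1: "(\<Sum>z\<in>?Z. ?X (?a z) y) = 4 * of_real (\<Sum>z\<in>?Z. Im z) * y + 16 / 3 * of_real (\<Sum>z\<in>?Z. Im z ^ 3) * y ^ 3"
          by (simp add: sum.distrib sum_distrib_left sum_distrib_right power_mult_distrib)
        have 2: "?X \<gamma>' y = - 4 * of_real (if \<gamma> < 0 then (- \<gamma>) else 0) * y - 16 / 3 * of_real (if \<gamma> < 0 then (- \<gamma>) ^ 3 else 0) * y ^ 3"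
          by (simp add: \<gamma>'_def power_mult_distrib)
        have 3: "Smom \<gamma> 1 = (\<Sum>z\<in>?Z. Im z) - (if \<gamma> < 0 then (- \<gamma>) else 0)" by (simp add: Smom_def)
        show ?thesis
          unfolding 1 2 Qf_def c1_def c3_def c4_def 3 Smom_def[of \<gamma> 3] Ty_def T_0 g1_def g2_def g3_def
          by (simp add: algebra_simps power2_eq_square)
      qed
      have prod: "(\<Prod>z\<in>?Z. ?R (?a z) y * exp (?X (?a z) y)) = (\<Prod>z\<in>?Z. (\<zeta> + z) / (\<zeta> - z)) * exp (\<Sum>z\<in>?Z. ?X (?a z) y)"
        unfolding prod.distrib exp_sum[OF finite_jzeros] by (intro arg_cong2[where f = "(*)"] prod.cong RZ refl)
      have "(jostw \<gamma> \<zeta> * exp (Ty y 0) / (of_real \<gamma> - \<i> * \<zeta>) * exp (- ?A y)) * exp (- of_real (T5 0) * y ^ 5)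
          * (\<Prod>z\<in>?Z. ?R (?a z) y * exp (?X (?a z) y)) * (?R \<gamma>' y * exp (?X \<gamma>' y))
        = jostw \<gamma> \<zeta> * (?R \<gamma>' y / (of_real \<gamma> - \<i> * \<zeta>)) * (\<Prod>z\<in>?Z. (\<zeta> + z) / (\<zeta> - z))
          * (exp (Ty y 0) * exp (- ?A y) * exp (- of_real (T5 0) * y ^ 5) * exp (\<Sum>z\<in>?Z. ?X (?a z) y) * exp (?X \<gamma>' y))"
        unfolding prod by (simp only: times_divide_eq_right times_divide_eq_left mult_ac)
      also have "\<dots> = Efun \<gamma> \<zeta> * exp (- Qf \<gamma> y)"
        unfolding R\<gamma> exp_add[symmetric] ex Efun_def by simp
      finally show ?case by (simp only: y_def)
    qed
  qed
qed

end

section \<open>Integrals over large half discs\<close>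

lemma interior_closed_uhp: "interior closed_uhp = open_uhp"
proof
  show "open_uhp \<subseteq> interior closed_uhp"
    by (rule interior_maximal) (auto simp: open_open_uhp)
  show "interior closed_uhp \<subseteq> open_uhp"
  proof
    fix z assume "z \<in> interior closed_uhp"
    then obtain e where e: "0 < e" "ball z e \<subseteq> closed_uhp" by (auto simp: mem_interior)
    then have "z - \<i> * of_real (e / 2) \<in> closed_uhp" by (intro subsetD[OF e(2)]) (simp add: dist_norm norm_mult)
    then show "z \<in> open_uhp" using e(1) by simp
  qed
qed

text \<open>Cauchy's theorem on a convex closed set: continuity up to the boundary and
  differentiability in the interior suffice, so the segment from - T to T may belong to the
  contour.\<close>

lemma half_disc_integral:
  assumes c: "continuous_on closed_uhp G" and h: "G holomorphic_on open_uhp" and T: "0 < T"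
  shows "integral {-T..T} (\<lambda>k. G (of_real k)) = - contour_integral (part_circlepath 0 T 0 pi) G"
    "G contour_integrable_on part_circlepath 0 T 0 pi"
proof -
  have arc: "path_image (part_circlepath 0 T 0 pi) \<subseteq> closed_uhp"
    using T by (auto simp: path_image_part_circlepath cis_conv_exp[symmetric] sin_ge_zero)
  have line: "path_image (linepath (- of_real T) (of_real T)) \<subseteq> closed_uhp"
    by (auto simp: path_image_linepath closed_segment_def)
  show ci: "G contour_integrable_on part_circlepath 0 T 0 pi"
    by (rule contour_integrable_continuous_part_circlepath[OF continuous_on_subset[OF c arc]])
  have ci2: "G contour_integrable_on linepath (- of_real T) (of_real T)"
    by (rule contour_integrable_continuous_linepath[OF continuous_on_subset[OF c]]) (use line in simp)
  have e: "pathstart (part_circlepath 0 T 0 pi) = of_real T" "pathfinish (part_circlepath 0 T 0 pi) = - of_real T"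
    by (auto simp: exp_Euler)
  have "(G has_contour_integral 0) (linepath (- of_real T) (of_real T) +++ part_circlepath 0 T 0 pi)"
  proof (rule Cauchy_theorem_convex[OF c convex_closed_uhp, where K = "{}"])
    show "G field_differentiable at x" if "x \<in> interior closed_uhp - {}" for x
      using that h open_open_uhp holomorphic_on_imp_differentiable_at unfolding interior_closed_uhp by blast
    show "path_image (linepath (- of_real T) (of_real T) +++ part_circlepath 0 T 0 pi) \<subseteq> closed_uhp"
      by (rule subset_path_image_join[OF line arc])
  qed (use e in auto)
  then have "contour_integral (linepath (- of_real T) (of_real T)) G + contour_integral (part_circlepath 0 T 0 pi) G = 0"
    using contour_integral_join[OF ci2 ci] e by (auto dest: contour_integral_unique)
  moreover have "contour_integral (linepath (- of_real T) (of_real T)) G = integral {-T..T} (\<lambda>k. G (of_real k))"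
    using contour_integral_linepath_Reals_eq[of "- of_real T" "of_real T" G] T by simp
  ultimately show "integral {-T..T} (\<lambda>k. G (of_real k)) = - contour_integral (part_circlepath 0 T 0 pi) G"
    by (simp add: eq_neg_iff_add_eq_0)
qed

text \<open>On the half circle of radius T the function is a / \<zeta> up to O(1 / T^2). The main
  part integrates to \<i> \<pi> a for every radius, and the error contributes O(1 / T).\<close>

lemma line_integral_tendsto:
  assumes c: "continuous_on closed_uhp G" and h: "G holomorphic_on open_uhp"
    and asym: "\<And>\<zeta>. 0 \<le> Im \<zeta> \<Longrightarrow> R \<le> norm \<zeta> \<Longrightarrow> norm (\<zeta> * G \<zeta> - a) \<le> K / norm \<zeta>"
  shows "((\<lambda>T. integral {-T..T} (\<lambda>k. G (of_real k))) \<longlongrightarrow> - \<i> * pi * a) at_top"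
proof -
  have b: "norm (integral {-T..T} (\<lambda>k. G (of_real k)) - (- \<i> * pi * a)) \<le> K * pi / T" if T: "max R 1 \<le> T" for T
  proof -
    have T0: "0 < T" "R \<le> T" using T by auto
    note hd = half_disc_integral[OF c h T0(1)]
    let ?p = "part_circlepath 0 T 0 pi"
    have im: "0 \<le> Im \<zeta>" "norm \<zeta> = T" if "\<zeta> \<in> path_image ?p" for \<zeta>
      using that T0(1) by (auto simp: path_image_part_circlepath cis_conv_exp[symmetric] norm_mult sin_ge_zero)
    have ai: "((\<lambda>\<zeta>. a / \<zeta>) has_contour_integral (\<i> * pi * a)) ?p"
    proof -
      have ci: "(\<lambda>\<zeta>. a / \<zeta>) contour_integrable_on ?p"
        by (rule contour_integrable_continuous_part_circlepath) (use im T0(1) in \<open>force intro!: continuous_intros\<close>)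
      have "contour_integral ?p (\<lambda>\<zeta>. a / \<zeta>) = integral {0..pi} (\<lambda>t. a / (0 + of_real T * cis t) * of_real T * \<i> * cis t)"
        by (rule contour_integral_part_circlepath_eq) simp
      also have "(\<lambda>t. a / (0 + of_real T * cis t) * of_real T * \<i> * cis t) = (\<lambda>t. a * \<i>)"
        using T0(1) by (auto simp: fun_eq_iff)
      finally show ?thesis using has_contour_integral_integral[OF ci] by (simp add: scaleR_conv_of_real mult_ac)
    qed
    have "((\<lambda>\<zeta>. G \<zeta> - a / \<zeta>) has_contour_integral (contour_integral ?p G - \<i> * pi * a)) ?p"
      by (rule has_contour_integral_diff[OF has_contour_integral_integral[OF hd(2)] ai])
    moreover have "norm (G \<zeta> - a / \<zeta>) \<le> K / T\<^sup>2" if "\<zeta> \<in> path_image ?p" for \<zeta>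
    proof -
      have n: "norm \<zeta> = T" "\<zeta> \<noteq> 0" using im[OF that] T0(1) by auto
      have "norm (\<zeta> * G \<zeta> - a) \<le> K / T" using asym[of \<zeta>] im[OF that] T0 by auto
      moreover have "G \<zeta> - a / \<zeta> = (\<zeta> * G \<zeta> - a) / \<zeta>" using n by (simp add: field_simps)
      then have "norm (G \<zeta> - a / \<zeta>) = norm (\<zeta> * G \<zeta> - a) / T" by (simp only: norm_divide n(1))
      ultimately show ?thesis
        using divide_right_mono[of "norm (\<zeta> * G \<zeta> - a)" "K / T" T] T0(1) by (simp add: power2_eq_square)
    qed
    moreover have "0 \<le> K / T\<^sup>2"
      using order_trans[OF norm_ge_zero asym[of "of_real T"]] T0 by (simp add: zero_le_divide_iff)
    ultimately have "norm (contour_integral ?p G - \<i> * pi * a) \<le> K / T\<^sup>2 * T * (pi - 0)"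
      by (intro has_contour_integral_bound_part_circlepath T0(1)) auto
    also have "K / T\<^sup>2 * T * (pi - 0) = K * pi / T" using T0(1) by (simp add: power2_eq_square)
    finally show ?thesis unfolding hd(1)
      by (metis (no_types, opaque_lifting) minus_diff_minus mult_minus_left norm_minus_cancel)
  qed
  have "((\<lambda>T. K * pi / T) \<longlongrightarrow> 0) at_top"
    by (rule tendsto_divide_0[OF tendsto_const filterlim_at_top_imp_at_infinity[OF filterlim_ident]])
  then have "((\<lambda>T. integral {-T..T} (\<lambda>k. G (of_real k)) - (- \<i> * pi * a)) \<longlongrightarrow> 0) at_top"
    by (rule Lim_null_comparison[rotated]) (rule eventually_mono[OF eventually_ge_at_top[of "max R 1"]], rule b)
  then show ?thesis by (rule LIM_zero_cancel)
qed

text \<open>The contour argument controls only symmetric integrals over [-T, T]. Folding the line at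
  0 turns them into an absolutely convergent integral over the half-line.\<close>

lemma line_integral_eq:
  assumes c: "continuous_on closed_uhp G" and h: "G holomorphic_on open_uhp"
    and asym: "\<And>\<zeta>. 0 \<le> Im \<zeta> \<Longrightarrow> R \<le> norm \<zeta> \<Longrightarrow> norm (\<zeta> * G \<zeta> - a) \<le> K / norm \<zeta>"
    and int: "set_integrable lborel {0<..} (\<lambda>k. G (of_real k) + G (of_real (- k)))"
  shows "(LINT k:{0<..}|lborel. G (of_real k) + G (of_real (- k))) = - \<i> * pi * a"
proof -
  let ?h = "\<lambda>k. G (of_real k) + G (of_real (- k))"
  have cr: "continuous_on UNIV (\<lambda>k. G (of_real k))" "continuous_on UNIV (\<lambda>k. G (of_real (- k)))"
    by (rule continuous_on_compose2[OF c]; force intro!: continuous_intros)+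
  have ch: "continuous_on A ?h" for A
    by (rule continuous_on_subset[of UNIV]) (use cr in \<open>auto intro!: continuous_intros simp del: of_real_minus\<close>)
  have int0: "set_integrable lborel {0..} ?h"
  proof -
    have "set_integrable lborel ({0..1} \<union> {0<..}) ?h"
      by (intro set_integrable_Un int borel_integrable_atLeastAtMost' ch) auto
    then show ?thesis by (rule set_integrable_subset) auto
  qed
  have "integral {-T..T} (\<lambda>k. G (of_real k)) = (LINT k:{0..T}|lborel. ?h k)" if "0 \<le> T" for T
  proof -
    have i: "(\<lambda>k. G (of_real k)) integrable_on {a..b}" "(\<lambda>k. G (of_real (- k))) integrable_on {a..b}" for a b
      by (rule integrable_continuous_real[OF continuous_on_subset[OF cr(1)]], simp,
          rule integrable_continuous_real[OF continuous_on_subset[OF cr(2)]], simp)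
    have "integral {-T..T} (\<lambda>k. G (of_real k)) = integral {-T..0} (\<lambda>k. G (of_real k)) + integral {0..T} (\<lambda>k. G (of_real k))"
      using that by (intro Henstock_Kurzweil_Integration.integral_combine[symmetric] i) auto
    also have "integral {-T..0} (\<lambda>k. G (of_real k)) = integral {0..T} (\<lambda>k. G (of_real (- k)))"
      using Henstock_Kurzweil_Integration.integral_reflect_real[of T 0 "\<lambda>k. G (of_real (- k))"] by simp
    also have "integral {0..T} (\<lambda>k. G (of_real (- k))) + integral {0..T} (\<lambda>k. G (of_real k)) = integral {0..T} ?h"
      using Henstock_Kurzweil_Integration.integral_add[OF i(1)[of 0 T] i(2)[of 0 T]] by (simp add: add.commute)
    also have "\<dots> = (LINT k:{0..T}|lborel. ?h k)"
      by (rule set_borel_integral_eq_integral(2)[symmetric], rule borel_integrable_atLeastAtMost'[OF ch])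
    finally show ?thesis .
  qed
  then have "\<forall>\<^sub>F T in at_top. integral {-T..T} (\<lambda>k. G (of_real k)) = (LINT k:{0..T}|lborel. ?h k)"
    by (rule eventually_mono[OF eventually_ge_at_top[of "0::real"]])
  then have "((\<lambda>T. LINT k:{0..T}|lborel. ?h k) \<longlongrightarrow> - \<i> * pi * a) at_top"
    using line_integral_tendsto[OF c h asym] by (rule Lim_transform_eventually[rotated])
  moreover have "((\<lambda>T. LINT k:{0..T}|lborel. ?h k) \<longlongrightarrow> (LINT k:{0..}|lborel. ?h k)) at_top"
    by (rule tendsto_set_lebesgue_integral_at_top[OF _ int0]) auto
  ultimately have "(LINT k:{0..}|lborel. ?h k) = - \<i> * pi * a"
    using tendsto_unique[OF trivial_limit_at_top_linorder] by blast
  moreover have "(LINT k:{0..}|lborel. ?h k) = (LINT k:{0<..}|lborel. ?h k)"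
  proof (rule set_integral_cong_set)
    show "set_borel_measurable lborel {0<..} ?h" "set_borel_measurable lborel {0..} ?h"
      using int int0 unfolding set_integrable_def set_borel_measurable_def by auto
    show "AE x in lborel. (x \<in> {0::real<..}) = (x \<in> {0..})"
      using AE_lborel_singleton[of "0::real"] by eventually_elim auto
  qed
  ultimately show ?thesis by simp
qed

text \<open>The inverse square root at 0 leaves room for a logarithmic singularity.\<close>

lemma set_integrable_Ioi_criterion:
  fixes f :: "real \<Rightarrow> 'a::euclidean_space"
  assumes c: "continuous_on {0<..} f" and d: "0 < d"
    and near0: "\<And>k. 0 < k \<Longrightarrow> k < d \<Longrightarrow> norm (f k) \<le> A / sqrt k"
    and far: "\<And>k. R \<le> k \<Longrightarrow> norm (f k) \<le> B / k\<^sup>2"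
  shows "set_integrable lborel {0<..} f"
proof -
  define b where "b = max (max R d) 1"
  have b: "d \<le> b" "R \<le> b" "0 < b" using d by (auto simp: b_def)
  have cs: "continuous_on S f" if "S \<subseteq> {0<..}" for S using continuous_on_subset[OF c that] .
  have "set_integrable lborel (einterval 0 d) (\<lambda>k. 1 / sqrt k)"
  proof (rule interval_integral_FTC_nonneg(1)[where F = "\<lambda>k. 2 * sqrt k" and A = 0 and B = "2 * sqrt d"])
    show "DERIV (\<lambda>k. 2 * sqrt k) x :> 1 / sqrt x" if "0 < ereal x" for x
      using that by (auto intro!: derivative_eq_intros simp: field_simps)
    show "(((\<lambda>k. 2 * sqrt k) \<circ> real_of_ereal) \<longlongrightarrow> 0) (at_right 0)"
      unfolding zero_ereal_def ereal_tendsto_simps by (auto intro!: tendsto_eq_intros)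
    show "(((\<lambda>k. 2 * sqrt k) \<circ> real_of_ereal) \<longlongrightarrow> 2 * sqrt d) (at_left (ereal d))"
      unfolding ereal_tendsto_simps by (auto intro!: tendsto_eq_intros)
  qed (use d in \<open>auto intro!: continuous_intros\<close>)
  moreover have "einterval 0 (ereal d) = {0<..<d}" by (auto simp: einterval_def)
  ultimately have "set_integrable lborel {0<..<d} (\<lambda>k. A * (1 / sqrt k))"
    by (simp only: set_integrable_mult_right)
  then have 1: "set_integrable lborel {0<..<d} f"
    by (rule set_integrable_continuous_bound[OF cs, rotated 2]) (use near0 in auto)
  have 2: "set_integrable lborel {d..b} f"
    by (rule borel_integrable_atLeastAtMost'[OF cs]) (use d in auto)
  have "set_integrable lborel (einterval b \<infinity>) (\<lambda>k. 1 / k\<^sup>2)"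
  proof (rule interval_integral_FTC_nonneg(1)[where F = "\<lambda>k. - 1 / k" and A = "- 1 / b" and B = 0])
    show "DERIV (\<lambda>k. - 1 / k) x :> 1 / x\<^sup>2" if "ereal b < ereal x" for x
      using that b by (auto intro!: derivative_eq_intros simp: power2_eq_square)
    show "(((\<lambda>k. - 1 / k) \<circ> real_of_ereal) \<longlongrightarrow> - 1 / b) (at_right (ereal b))"
      unfolding ereal_tendsto_simps using b by (auto intro!: tendsto_eq_intros)
    show "(((\<lambda>k. - 1 / k) \<circ> real_of_ereal) \<longlongrightarrow> 0) (at_left \<infinity>)"
      unfolding ereal_tendsto_simps
      by (rule tendsto_divide_0[OF tendsto_const filterlim_at_top_imp_at_infinity[OF filterlim_ident]])
  qed (use b in \<open>auto intro!: continuous_intros\<close>)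
  moreover have "einterval (ereal b) \<infinity> = {b<..}" by (auto simp: einterval_def)
  ultimately have "set_integrable lborel {b<..} (\<lambda>k. B * (1 / k\<^sup>2))"
    by (simp only: set_integrable_mult_right)
  then have 3: "set_integrable lborel {b<..} f"
    by (rule set_integrable_continuous_bound[OF cs, rotated 2]) (use far b in auto)
  have "set_integrable lborel ({0<..<d} \<union> {d..b} \<union> {b<..}) f"
    by (intro set_integrable_Un 1 2 3) auto
  then show ?thesis by (rule set_integrable_subset) auto
qed

section \<open>Contour integrals of a function with a given expansion at infinity\<close>

lemma set_integrable_complex_of_real:
  assumes "set_integrable M A f"
  shows "set_integrable M A (\<lambda>x. complex_of_real (f x))"
proof -
  have "integrable M (\<lambda>x. complex_of_real (indicator A x *\<^sub>R f x))"
    using assms unfolding set_integrable_def by (rule integrable_of_real)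
  then show ?thesis by (simp add: set_integrable_def scaleR_conv_of_real)
qed

lemma abs_Im_le_of_norm_diff_of_real:
  assumes "norm (z - of_real a) \<le> r" shows "\<bar>Im z\<bar> \<le> r"
  using abs_Im_le_cmod[of "z - of_real a"] assms by simp

text \<open>In the application \<open>Y \<zeta> = \<zeta> * log E \<zeta>\<close>, where \<open>E\<close> is the Jost function divided by its zeros and its
  leading asymptotic term; the factor \<open>\<zeta>\<close> removes the logarithmic singularity at \<open>0\<close>.\<close>

locale trace_setup =
  fixes Y :: "complex \<Rightarrow> complex" and \<phi>1 \<phi>2 \<phi>3 \<phi>4 K R A d :: real
  assumes cont_Y: "continuous_on closed_uhp Y" and hol_Y: "Y holomorphic_on open_uhp"
    and Y_neg: "\<And>k. Y (- of_real k) = - cnj (Y (of_real k))"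
    and Y_asym: "\<And>\<zeta> :: complex. 0 \<le> Im \<zeta> \<Longrightarrow> R \<le> norm \<zeta> \<Longrightarrow>
      norm (Y \<zeta> - (\<i> * \<phi>1 + \<phi>2 / \<zeta> + \<i> * \<phi>3 / \<zeta>\<^sup>2 + \<phi>4 / \<zeta> ^ 3)) \<le> K / norm \<zeta> ^ 4"
    and R: "1 \<le> R" and d: "0 < d" and near0: "\<And>k. 0 < k \<Longrightarrow> k < d \<Longrightarrow> norm (Y (of_real k)) \<le> A * sqrt k"
begin

lemma K_nonneg: "0 \<le> K"
proof -
  have "0 \<le> K / norm (complex_of_real R) ^ 4"
    using order_trans[OF norm_ge_zero Y_asym[of "of_real R"]] R by simp
  then show ?thesis using R by (simp add: zero_le_divide_iff)
qed

lemma cont_Y_real: "continuous_on S (\<lambda>k. Y (of_real k))"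
  by (rule continuous_on_compose2[OF cont_Y]) (auto intro!: continuous_intros)

lemma power_le: "R \<le> norm \<zeta> \<Longrightarrow> m \<le> n \<Longrightarrow> norm \<zeta> ^ m \<le> norm \<zeta> ^ n" for \<zeta> :: complex
  using R by (intro power_increasing) auto

lemma divide_power_le:
  assumes "R \<le> norm (\<zeta> :: complex)" "m \<le> n" "0 \<le> c"
  shows "c / norm \<zeta> ^ n \<le> c / norm \<zeta> ^ m"
proof -
  have "0 < norm \<zeta>" using R assms(1) by linarith
  then show ?thesis
    using power_le[OF assms(1,2)] assms(3) by (intro divide_left_mono mult_pos_pos zero_less_power) auto
qed

text \<open>A common constant for \<open>asym2\<close>, \<open>asym3\<close> and
  \<open>asym4\<close>: since |\<zeta>| \<ge> R \<ge> 1, the terms dropped from the expansion are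
  bounded by their coefficients.\<close>

definition "bd = K + \<bar>\<phi>2\<bar> + \<bar>\<phi>3\<bar> + \<bar>\<phi>4\<bar>"

lemma asym4:
  fixes \<zeta> :: complex
  assumes "0 \<le> Im \<zeta>" "R \<le> norm \<zeta>"
  shows "norm (\<zeta> * (\<zeta>\<^sup>2 * Y \<zeta> - \<i> * \<phi>1 * \<zeta>\<^sup>2 - \<phi>2 * \<zeta> - \<i> * \<phi>3) - \<phi>4) \<le> bd / norm \<zeta>"
proof -
  have nz: "\<zeta> \<noteq> 0" "0 < norm \<zeta>" using assms R by auto
  have "\<zeta> * (\<zeta>\<^sup>2 * Y \<zeta> - \<i> * \<phi>1 * \<zeta>\<^sup>2 - \<phi>2 * \<zeta> - \<i> * \<phi>3) - \<phi>4
      = \<zeta> ^ 3 * (Y \<zeta> - (\<i> * \<phi>1 + \<phi>2 / \<zeta> + \<i> * \<phi>3 / \<zeta>\<^sup>2 + \<phi>4 / \<zeta> ^ 3))"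
    using nz by (simp add: field_simps power2_eq_square power3_eq_cube)
  also have "norm \<dots> \<le> norm \<zeta> ^ 3 * (K / norm \<zeta> ^ 4)"
    unfolding norm_mult norm_power by (intro mult_left_mono Y_asym assms) auto
  also have "\<dots> = K / norm \<zeta>" using nz by (simp add: field_simps eval_nat_numeral)
  also have "\<dots> \<le> bd / norm \<zeta>" by (intro divide_right_mono) (auto simp: bd_def)
  finally show ?thesis .
qed

lemma asym3:
  fixes \<zeta> :: complex
  assumes "0 \<le> Im \<zeta>" "R \<le> norm \<zeta>"
  shows "norm (\<zeta> * (\<zeta> * Y \<zeta> - \<i> * \<phi>1 * \<zeta> - \<phi>2) - \<i> * \<phi>3) \<le> bd / norm \<zeta>"
proof -
  have nz: "\<zeta> \<noteq> 0" "0 < norm \<zeta>" "1 \<le> norm \<zeta>" using assms R by auto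
  have "\<zeta> * (\<zeta> * Y \<zeta> - \<i> * \<phi>1 * \<zeta> - \<phi>2) - \<i> * \<phi>3
      = \<zeta>\<^sup>2 * (Y \<zeta> - (\<i> * \<phi>1 + \<phi>2 / \<zeta> + \<i> * \<phi>3 / \<zeta>\<^sup>2 + \<phi>4 / \<zeta> ^ 3)) + \<phi>4 / \<zeta>"
    using nz by (simp add: field_simps power2_eq_square power3_eq_cube)
  also have "norm \<dots> \<le> norm \<zeta> ^ 2 * (K / norm \<zeta> ^ 4) + \<bar>\<phi>4\<bar> / norm \<zeta>"
    by (intro norm_triangle_mono, unfold norm_mult norm_power norm_divide, intro mult_left_mono Y_asym assms) auto
  also have "norm \<zeta> ^ 2 * (K / norm \<zeta> ^ 4) = K / norm \<zeta> ^ 2" using nz by (simp add: field_simps eval_nat_numeral)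
  also have "\<dots> \<le> K / norm \<zeta> ^ 1" by (intro divide_power_le assms K_nonneg) auto
  also have "K / norm \<zeta> ^ 1 + \<bar>\<phi>4\<bar> / norm \<zeta> \<le> bd / norm \<zeta>"
    unfolding power_one_right add_divide_distrib[symmetric] by (intro divide_right_mono) (auto simp: bd_def)
  finally show ?thesis by simp
qed

lemma asym2:
  fixes \<zeta> :: complex
  assumes "0 \<le> Im \<zeta>" "R \<le> norm \<zeta>"
  shows "norm (\<zeta> * (Y \<zeta> - \<i> * \<phi>1) - \<phi>2) \<le> bd / norm \<zeta>"
proof -
  have nz: "\<zeta> \<noteq> 0" "0 < norm \<zeta>" "1 \<le> norm \<zeta>" using assms R by auto
  have "norm (\<zeta> * (Y \<zeta> - \<i> * \<phi>1) - \<phi>2) * norm \<zeta> = norm (\<zeta> * (\<zeta> * Y \<zeta> - \<i> * \<phi>1 * \<zeta> - \<phi>2))"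
    unfolding norm_mult[symmetric] by (simp add: algebra_simps)
  also have "\<zeta> * (\<zeta> * Y \<zeta> - \<i> * \<phi>1 * \<zeta> - \<phi>2)
      = \<zeta>\<^sup>2 * (Y \<zeta> - (\<i> * \<phi>1 + \<phi>2 / \<zeta> + \<i> * \<phi>3 / \<zeta>\<^sup>2 + \<phi>4 / \<zeta> ^ 3)) + \<phi>4 / \<zeta> + \<i> * \<phi>3"
    using nz by (simp add: field_simps power2_eq_square power3_eq_cube)
  also have "norm \<dots> \<le> norm \<zeta> ^ 2 * (K / norm \<zeta> ^ 4) + \<bar>\<phi>4\<bar> / norm \<zeta> + \<bar>\<phi>3\<bar>"
    by (intro norm_triangle_mono, unfold norm_mult norm_power norm_divide, intro mult_left_mono Y_asym assms) auto
  also have "norm \<zeta> ^ 2 * (K / norm \<zeta> ^ 4) = K / norm \<zeta> ^ 2" using nz by (simp add: field_simps eval_nat_numeral)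
  also have "\<dots> \<le> K / norm \<zeta> ^ 0" by (intro divide_power_le assms K_nonneg) auto
  also have "\<bar>\<phi>4\<bar> / norm \<zeta> \<le> \<bar>\<phi>4\<bar> / 1" using nz by (intro divide_left_mono) auto
  finally have "norm (\<zeta> * (Y \<zeta> - \<i> * \<phi>1) - \<phi>2) * norm \<zeta> \<le> bd" by (simp add: bd_def)
  then show ?thesis using nz by (simp add: pos_le_divide_eq)
qed

lemma asym1:
  fixes \<zeta> :: complex
  assumes "0 \<le> Im \<zeta>" "R \<le> norm \<zeta>"
  shows "norm (Y \<zeta> - \<i> * \<phi>1) \<le> (bd + \<bar>\<phi>2\<bar>) / norm \<zeta>"
proof -
  have nz: "0 < norm \<zeta>" "1 \<le> norm \<zeta>" using assms R by auto
  have "norm (Y \<zeta> - \<i> * \<phi>1) * norm \<zeta> = norm ((\<zeta> * (Y \<zeta> - \<i> * \<phi>1) - \<phi>2) + \<phi>2)"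
    by (simp add: norm_mult)
  also have "\<dots> \<le> bd / norm \<zeta> + \<bar>\<phi>2\<bar>"
    using asym2[OF assms] by (intro norm_triangle_mono) auto
  also have "bd / norm \<zeta> \<le> bd / 1"
    using nz K_nonneg by (intro divide_left_mono) (auto simp: bd_def)
  finally show ?thesis using nz by (simp add: pos_le_divide_eq)
qed

lemma bounded_near0: 
  fixes f :: "real \<Rightarrow> real"
  assumes "continuous_on {0..} f"
  obtains C where "0 \<le> C" "\<And>k. 0 < k \<Longrightarrow> k < d \<Longrightarrow> norm (f k) \<le> C / sqrt k"
proof -
  have "compact (f ` {0..d})"
    by (intro compact_continuous_image continuous_on_subset[OF assms]) auto
  then obtain B where B: "\<And>k. k \<in> {0..d} \<Longrightarrow> norm (f k) \<le> B"
    by (meson bounded_iff compact_imp_bounded imageI)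
  have "0 \<le> B" using B[of 0] d by auto
  have "norm (f k) \<le> B * sqrt d / sqrt k" if "0 < k" "k < d" for k
  proof -
    have "norm (f k) * sqrt k \<le> B * sqrt d"
      using that B[of k] \<open>0 \<le> B\<close> by (intro mult_mono) auto
    then show ?thesis using that by (simp add: pos_le_divide_eq)
  qed
  then show thesis using that[of "B * sqrt d"] \<open>0 \<le> B\<close> d by simp
qed

text \<open>Subtracting the constant \<i> \<phi>1 leaves a function like \<phi>2 / \<zeta>, as the
  contour argument requires. By \<open>Y_neg\<close> its values at k and - k add up to 2 \<i> times
  a real integrand. The next two lemmas treat \<zeta> Y and \<zeta>^2 Y in the same way; even powers
  of \<zeta> select the imaginary part of Y, odd powers the real part.\<close>

lemma trace2:
  "set_integrable lborel {0<..} (\<lambda>k. Im (Y (of_real k)) - \<phi>1)"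
  "(LINT k:{0<..}|lborel. Im (Y (of_real k)) - \<phi>1) = - pi * \<phi>2 / 2"
proof -
  let ?f = "\<lambda>k. Im (Y (of_real k)) - \<phi>1"
  have c: "continuous_on S ?f" for S by (intro continuous_intros cont_Y_real)
  obtain C where C: "0 \<le> C" "\<And>k. 0 < k \<Longrightarrow> k < d \<Longrightarrow> norm (?f k) \<le> C / sqrt k"
    by (rule bounded_near0[OF c]) blast
  show int: "set_integrable lborel {0<..} ?f"
  proof (rule set_integrable_Ioi_criterion[OF c d C(2)])
    fix k assume k: "R \<le> k"
    have k0: "0 < k" using k R by simp
    have "k * norm (?f k) = \<bar>Im (of_real k * (Y (of_real k) - \<i> * \<phi>1))\<bar>"
      using k0 by (simp add: abs_mult)
    also have "\<dots> \<le> bd / k"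
      using abs_Im_le_of_norm_diff_of_real[OF asym2[of "of_real k"]] k k0 by simp
    finally show "norm (?f k) \<le> bd / k\<^sup>2" using k0 by (simp add: field_simps power2_eq_square)
  qed
  let ?G = "\<lambda>\<zeta> :: complex. Y \<zeta> - \<i> * \<phi>1"
  have eq: "?G (of_real k) + ?G (of_real (- k)) = 2 * \<i> * of_real (?f k)" for k
    by (simp add: Y_neg complex_eq_iff)
  have "set_integrable lborel {0<..} (\<lambda>k. complex_of_real (?f k))"
    by (rule set_integrable_complex_of_real[OF int])
  then have "set_integrable lborel {0<..} (\<lambda>k. ?G (of_real k) + ?G (of_real (- k)))"
    unfolding eq by (rule set_integrable_mult_right)
  then have "(LINT k:{0<..}|lborel. ?G (of_real k) + ?G (of_real (- k))) = - \<i> * pi * \<phi>2"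
    by (intro line_integral_eq[OF _ _ asym2]) (auto intro!: continuous_intros holomorphic_intros cont_Y hol_Y)
  then have "2 * \<i> * of_real (LINT k:{0<..}|lborel. ?f k) = - \<i> * pi * \<phi>2"
    unfolding eq set_integral_mult_right set_integral_complex_of_real .
  from arg_cong[OF this, of Im] show "(LINT k:{0<..}|lborel. ?f k) = - pi * \<phi>2 / 2" by simp
qed

lemma trace3:
  "set_integrable lborel {0<..} (\<lambda>k. k * Re (Y (of_real k)) - \<phi>2)"
  "(LINT k:{0<..}|lborel. k * Re (Y (of_real k)) - \<phi>2) = pi * \<phi>3 / 2"
proof -
  let ?f = "\<lambda>k. k * Re (Y (of_real k)) - \<phi>2"
  have c: "continuous_on S ?f" for S by (intro continuous_intros cont_Y_real)
  obtain C where C: "0 \<le> C" "\<And>k. 0 < k \<Longrightarrow> k < d \<Longrightarrow> norm (?f k) \<le> C / sqrt k"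
    by (rule bounded_near0[OF c]) blast
  let ?G = "\<lambda>\<zeta> :: complex. \<zeta> * Y \<zeta> - \<i> * \<phi>1 * \<zeta> - \<phi>2"
  show int: "set_integrable lborel {0<..} ?f"
  proof (rule set_integrable_Ioi_criterion[OF c d C(2)])
    fix k assume k: "R \<le> k"
    have k0: "0 < k" using k R by simp
    have "k * norm (?f k) = \<bar>Re (of_real k * ?G (of_real k) - \<i> * \<phi>3)\<bar>"
      using k0 by (simp add: abs_mult)
    also have "\<dots> \<le> bd / k"
      using order_trans[OF abs_Re_le_cmod asym3[of "of_real k"]] k k0 by simp
    finally show "norm (?f k) \<le> bd / k\<^sup>2" using k0 by (simp add: field_simps power2_eq_square)
  qed
  have eq: "?G (of_real k) + ?G (of_real (- k)) = 2 * of_real (?f k)" for k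
    by (simp add: Y_neg complex_eq_iff)
  have "set_integrable lborel {0<..} (\<lambda>k. complex_of_real (?f k))"
    by (rule set_integrable_complex_of_real[OF int])
  then have "set_integrable lborel {0<..} (\<lambda>k. ?G (of_real k) + ?G (of_real (- k)))"
    unfolding eq by (rule set_integrable_mult_right)
  then have "(LINT k:{0<..}|lborel. ?G (of_real k) + ?G (of_real (- k))) = - \<i> * pi * (\<i> * \<phi>3)"
    by (intro line_integral_eq[OF _ _ asym3]) (auto intro!: continuous_intros holomorphic_intros cont_Y hol_Y)
  then have "2 * of_real (LINT k:{0<..}|lborel. ?f k) = - \<i> * pi * (\<i> * \<phi>3)"
    unfolding eq set_integral_mult_right set_integral_complex_of_real .
  from arg_cong[OF this, of Re] show "(LINT k:{0<..}|lborel. ?f k) = pi * \<phi>3 / 2" by simp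
qed

lemma trace4:
  "set_integrable lborel {0<..} (\<lambda>k. k\<^sup>2 * Im (Y (of_real k)) - \<phi>1 * k\<^sup>2 - \<phi>3)"
  "(LINT k:{0<..}|lborel. k\<^sup>2 * Im (Y (of_real k)) - \<phi>1 * k\<^sup>2 - \<phi>3) = - pi * \<phi>4 / 2"
proof -
  let ?f = "\<lambda>k. k\<^sup>2 * Im (Y (of_real k)) - \<phi>1 * k\<^sup>2 - \<phi>3"
  have c: "continuous_on S ?f" for S by (intro continuous_intros cont_Y_real)
  obtain C where C: "0 \<le> C" "\<And>k. 0 < k \<Longrightarrow> k < d \<Longrightarrow> norm (?f k) \<le> C / sqrt k"
    by (rule bounded_near0[OF c]) blast
  let ?G = "\<lambda>\<zeta> :: complex. \<zeta>\<^sup>2 * Y \<zeta> - \<i> * \<phi>1 * \<zeta>\<^sup>2 - \<phi>2 * \<zeta> - \<i> * \<phi>3"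
  have r2: "complex_of_real k ^ 2 = of_real (k\<^sup>2)" for k by simp
  show int: "set_integrable lborel {0<..} ?f"
  proof (rule set_integrable_Ioi_criterion[OF c d C(2)])
    fix k assume k: "R \<le> k"
    have k0: "0 < k" using k R by simp
    have "k * norm (?f k) = \<bar>Im (of_real k * ?G (of_real k))\<bar>"
      using k0 unfolding r2 by (simp add: abs_mult del: of_real_power)
    also have "\<dots> \<le> bd / k"
      using abs_Im_le_of_norm_diff_of_real[OF asym4[of "of_real k"]] k k0 by simp
    finally show "norm (?f k) \<le> bd / k\<^sup>2" using k0 by (simp add: field_simps power2_eq_square)
  qed
  have eq: "?G (of_real k) + ?G (of_real (- k)) = 2 * \<i> * of_real (?f k)" for k
    unfolding r2 by (simp add: Y_neg complex_eq_iff del: of_real_power)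
  have "set_integrable lborel {0<..} (\<lambda>k. complex_of_real (?f k))"
    by (rule set_integrable_complex_of_real[OF int])
  then have "set_integrable lborel {0<..} (\<lambda>k. ?G (of_real k) + ?G (of_real (- k)))"
    unfolding eq by (rule set_integrable_mult_right)
  then have "(LINT k:{0<..}|lborel. ?G (of_real k) + ?G (of_real (- k))) = - \<i> * pi * \<phi>4"
    by (intro line_integral_eq[OF _ _ asym4]) (auto intro!: continuous_intros holomorphic_intros cont_Y hol_Y)
  then have "2 * \<i> * of_real (LINT k:{0<..}|lborel. ?f k) = - \<i> * pi * \<phi>4"
    unfolding eq set_integral_mult_right set_integral_complex_of_real .
  from arg_cong[OF this, of Im] show "(LINT k:{0<..}|lborel. ?f k) = - pi * \<phi>4 / 2" by simp
qed

text \<open>For the integral of \<open>log \<bar>E\<bar>\<close> itself the singularity at \<open>0\<close> is moved off the real axis.\<close>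

lemma trace1_shifted:
  assumes e: "0 < e" "e \<le> 1"
  defines "f \<equiv> \<lambda>k. (k * Re (Y (of_real k)) + e * Im (Y (of_real k))) / (k\<^sup>2 + e\<^sup>2)"
  shows "set_integrable lborel {0<..} f" "(LINT k:{0<..}|lborel. f k) = pi * \<phi>1 / 2"
proof -
  have pos: "0 < k\<^sup>2 + e\<^sup>2" for k using e by (simp add: add_nonneg_pos)
  have c: "continuous_on S f" for S
    unfolding f_def using pos by (intro continuous_intros cont_Y_real) (metis less_irrefl)
  obtain C where C: "0 \<le> C" "\<And>k. 0 < k \<Longrightarrow> k < d \<Longrightarrow> norm (f k) \<le> C / sqrt k"
    by (rule bounded_near0[OF c]) blast
  define B where "B = bd + \<bar>\<phi>2\<bar> + (\<bar>\<phi>1\<bar> + (bd + \<bar>\<phi>2\<bar>))"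
  have bd: "0 \<le> bd" using K_nonneg by (simp add: bd_def)
  show int: "set_integrable lborel {0<..} f"
  proof (rule set_integrable_Ioi_criterion[OF c d C(2)])
    fix k assume k: "R \<le> k"
    have k0: "1 \<le> k" using k R by simp
    have n: "norm (Y (of_real k) - \<i> * \<phi>1) \<le> (bd + \<bar>\<phi>2\<bar>) / k" using asym1[of "of_real k"] k k0 by simp
    have "\<bar>Re (Y (of_real k))\<bar> \<le> (bd + \<bar>\<phi>2\<bar>) / k"
      using order_trans[OF abs_Re_le_cmod n] by simp
    then have 1: "k * \<bar>Re (Y (of_real k))\<bar> \<le> bd + \<bar>\<phi>2\<bar>" using k0 by (simp add: field_simps)
    have "\<bar>Im (Y (of_real k)) - \<phi>1\<bar> \<le> (bd + \<bar>\<phi>2\<bar>) / k"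
      using order_trans[OF abs_Im_le_cmod n] by simp
    also have "\<dots> \<le> (bd + \<bar>\<phi>2\<bar>) / 1" using k0 bd by (intro divide_left_mono) auto
    finally have 2: "\<bar>Im (Y (of_real k))\<bar> \<le> \<bar>\<phi>1\<bar> + (bd + \<bar>\<phi>2\<bar>)" unfolding div_by_1 by linarith
    have "e * \<bar>Im (Y (of_real k))\<bar> \<le> 1 * (\<bar>\<phi>1\<bar> + (bd + \<bar>\<phi>2\<bar>))" using e 2 by (intro mult_mono) auto
    moreover have "\<bar>k * Re (Y (of_real k)) + e * Im (Y (of_real k))\<bar> \<le> k * \<bar>Re (Y (of_real k))\<bar> + e * \<bar>Im (Y (of_real k))\<bar>"
      using k0 e abs_triangle_ineq[of "k * Re (Y (of_real k))" "e * Im (Y (of_real k))"] by (simp add: abs_mult)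
    ultimately have "\<bar>k * Re (Y (of_real k)) + e * Im (Y (of_real k))\<bar> \<le> B" using 1 by (simp add: B_def)
    then have "norm (f k) \<le> B / (k\<^sup>2 + e\<^sup>2)" using pos[of k] by (simp add: f_def abs_divide divide_right_mono)
    also have "\<dots> \<le> B / k\<^sup>2" using k0 bd e by (intro divide_left_mono) (auto simp: B_def intro!: mult_pos_pos add_pos_pos)
    finally show "norm (f k) \<le> B / k\<^sup>2" .
  qed
  let ?G = "\<lambda>\<zeta> :: complex. Y \<zeta> / (\<zeta> + \<i> * e)"
  have nz: "\<zeta> + \<i> * complex_of_real e \<noteq> 0" if "0 \<le> Im \<zeta>" for \<zeta>
    using that e by (auto simp: complex_eq_iff)
  have eq: "?G (of_real k) + ?G (of_real (- k)) = 2 * of_real (f k)" for k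
  proof -
    have 1: "complex_of_real k + \<i> * e \<noteq> 0" "complex_of_real k - \<i> * e \<noteq> 0" using e by (auto simp: complex_eq_iff)
    have p: "(complex_of_real k + \<i> * e) * (complex_of_real k - \<i> * e) = of_real (k\<^sup>2 + e\<^sup>2)"
      by (simp add: complex_eq_iff power2_eq_square)
    have m: "complex_of_real (- k) + \<i> * e = - (of_real k - \<i> * e)" by simp
    have "?G (of_real k) + ?G (of_real (- k)) = Y (of_real k) / (of_real k + \<i> * e) + cnj (Y (of_real k)) / (of_real k - \<i> * e)"
      unfolding m by (simp only: of_real_minus Y_neg minus_divide_divide)
    also have "\<dots> = (Y (of_real k) * (of_real k - \<i> * e) + cnj (Y (of_real k)) * (of_real k + \<i> * e)) / ((of_real k + \<i> * e) * (of_real k - \<i> * e))"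
      using 1 by (simp add: add_frac_eq)
    also have "\<dots> = of_real (2 * (k * Re (Y (of_real k)) + e * Im (Y (of_real k)))) / of_real (k\<^sup>2 + e\<^sup>2)"
      unfolding p by (rule arg_cong[where f = "\<lambda>x. x / _"]) (simp add: complex_eq_iff algebra_simps)
    finally show ?thesis by (simp add: f_def)
  qed
  have "set_integrable lborel {0<..} (\<lambda>k. complex_of_real (f k))"
    by (rule set_integrable_complex_of_real[OF int])
  then have I: "set_integrable lborel {0<..} (\<lambda>k. ?G (of_real k) + ?G (of_real (- k)))"
    unfolding eq by (rule set_integrable_mult_right)
  have "(LINT k:{0<..}|lborel. ?G (of_real k) + ?G (of_real (- k))) = - \<i> * pi * (\<i> * \<phi>1)"
  proof (rule line_integral_eq[OF _ _ _ I])
    show "continuous_on closed_uhp ?G" by (intro continuous_intros cont_Y) (use nz in auto)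
    show "?G holomorphic_on open_uhp" by (intro holomorphic_intros hol_Y) (use nz in auto)
    fix \<zeta> assume \<zeta>: "0 \<le> Im \<zeta>" "R \<le> norm \<zeta>"
    have n0: "0 < norm \<zeta>" using \<zeta> R by linarith
    have le: "norm \<zeta> \<le> norm (\<zeta> + \<i> * e)"
      using \<zeta>(1) e by (auto simp: cmod_def intro!: real_sqrt_le_mono power_mono)
    have "\<zeta> * ?G \<zeta> - \<i> * \<phi>1 = (\<zeta> * (Y \<zeta> - \<i> * \<phi>1) + e * \<phi>1) / (\<zeta> + \<i> * e)"
      using nz[OF \<zeta>(1)] by (simp add: field_simps)
    also have "norm \<dots> \<le> ((bd + \<bar>\<phi>2\<bar>) + \<bar>\<phi>1\<bar>) / norm (\<zeta> + \<i> * e)"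
      unfolding norm_divide
    proof (intro divide_right_mono norm_triangle_mono)
      show "norm (\<zeta> * (Y \<zeta> - \<i> * \<phi>1)) \<le> bd + \<bar>\<phi>2\<bar>"
        using asym1[OF \<zeta>] n0 by (simp add: norm_mult pos_le_divide_eq mult.commute)
      show "norm (complex_of_real (e * \<phi>1)) \<le> \<bar>\<phi>1\<bar>"
        using e mult_right_mono[of e 1 "\<bar>\<phi>1\<bar>"] by (simp add: norm_mult)
    qed auto
    also have "\<dots> \<le> ((bd + \<bar>\<phi>2\<bar>) + \<bar>\<phi>1\<bar>) / norm \<zeta>"
      using le n0 bd by (intro divide_left_mono mult_pos_pos) auto
    finally show "norm (\<zeta> * ?G \<zeta> - \<i> * \<phi>1) \<le> ((bd + \<bar>\<phi>2\<bar>) + \<bar>\<phi>1\<bar>) / norm \<zeta>" .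
  qed
  then have "2 * of_real (LINT k:{0<..}|lborel. f k) = - \<i> * pi * (\<i> * \<phi>1)"
    unfolding eq set_integral_mult_right set_integral_complex_of_real .
  from arg_cong[OF this, of Re] show "(LINT k:{0<..}|lborel. f k) = pi * \<phi>1 / 2" by simp
qed

text \<open>The formula with denominator \<zeta> + \<i> e holds for all small e > 0, and dominated
  convergence allows e to tend to 0.\<close>

lemma trace1:
  "set_integrable lborel {0<..} (\<lambda>k. Re (Y (of_real k)) / k)"
  "(LINT k:{0<..}|lborel. Re (Y (of_real k)) / k) = pi * \<phi>1 / 2"
proof -
  let ?f = "\<lambda>k. Re (Y (of_real k)) / k"
  \<comment> \<open>Majorant of e |Im Y| / (k^2 + e^2): the bound 1 / k follows from e k \<le> k^2 +
    e^2 and serves near 0, the bound 1 / k^2 follows from e \<le> 1 and serves at infinity.\<close>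
  let ?w = "\<lambda>k. \<bar>Im (Y (of_real k))\<bar> * min (1 / k) (1 / k\<^sup>2)"
  have A: "0 \<le> A"
    using order_trans[OF norm_ge_zero near0[of "d / 2"]] d by (simp add: zero_le_mult_iff)
  have bd: "0 \<le> bd" using K_nonneg by (simp add: bd_def)
  have sq: "A * sqrt k / k = A / sqrt k" if "0 < k" for k
    using that by (simp add: field_simps)
  have n: "norm (Y (of_real k) - \<i> * \<phi>1) \<le> (bd + \<bar>\<phi>2\<bar>) / k" if "R \<le> k" for k
    using asym1[of "of_real k"] that R by simp
  have int: "set_integrable lborel {0<..} ?f"
  proof (rule set_integrable_Ioi_criterion[OF _ d, where A = A])
    show "continuous_on {0<..} ?f" by (intro continuous_intros cont_Y_real) auto
    show "norm (?f k) \<le> A / sqrt k" if "0 < k" "k < d" for k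
      using divide_right_mono[OF order_trans[OF abs_Re_le_cmod near0[OF that]], of k] that sq[OF that(1)] by simp
    show "norm (?f k) \<le> (bd + \<bar>\<phi>2\<bar>) / k\<^sup>2" if "R \<le> k" for k
      using divide_right_mono[OF order_trans[OF abs_Re_le_cmod n[OF that]], of k] that R
      by (simp add: power2_eq_square)
  qed
  then show "set_integrable lborel {0<..} ?f" .
  have intw: "set_integrable lborel {0<..} ?w"
  proof (rule set_integrable_Ioi_criterion[OF _ d, where A = A])
    show "continuous_on {0<..} ?w" by (intro continuous_intros cont_Y_real) auto
    show "norm (?w k) \<le> A / sqrt k" if "0 < k" "k < d" for k
    proof -
      have "norm (?w k) \<le> A * sqrt k * (1 / k)"
        unfolding norm_mult using that order_trans[OF abs_Im_le_cmod near0[OF that]] by (intro mult_mono) auto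
      then show ?thesis using sq[OF that(1)] by simp
    qed
    show "norm (?w k) \<le> (\<bar>\<phi>1\<bar> + (bd + \<bar>\<phi>2\<bar>)) / k\<^sup>2" if "R \<le> k" for k
    proof -
      have k: "1 \<le> k" using that R by simp
      have "\<bar>Im (Y (of_real k)) - \<phi>1\<bar> \<le> (bd + \<bar>\<phi>2\<bar>) / k"
        using order_trans[OF abs_Im_le_cmod n[OF that]] by simp
      also have "\<dots> \<le> (bd + \<bar>\<phi>2\<bar>) / 1" using k bd by (intro divide_left_mono) auto
      finally have "\<bar>Im (Y (of_real k))\<bar> \<le> \<bar>\<phi>1\<bar> + (bd + \<bar>\<phi>2\<bar>)" unfolding div_by_1 by linarith
      then have "norm (?w k) \<le> (\<bar>\<phi>1\<bar> + (bd + \<bar>\<phi>2\<bar>)) * (1 / k\<^sup>2)"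
        unfolding norm_mult using k by (intro mult_mono) auto
      then show ?thesis by simp
    qed
  qed
  define e where "e n = inverse (real (Suc n))" for n
  have e: "0 < e n" "e n \<le> 1" for n by (auto simp: e_def inverse_le_1_iff)
  have e0: "e \<longlonglongrightarrow> 0" unfolding e_def by (rule LIMSEQ_inverse_real_of_nat)
  let ?g = "\<lambda>n k. (k * Re (Y (of_real k)) + e n * Im (Y (of_real k))) / (k\<^sup>2 + (e n)\<^sup>2)"
  have "(\<lambda>n. LINT k|lborel. indicator {0<..} k *\<^sub>R ?g n k) \<longlonglongrightarrow> (LINT k|lborel. indicator {0<..} k *\<^sub>R ?f k)"
  proof (rule integral_dominated_convergence[where w = "\<lambda>k. indicator {0<..} k *\<^sub>R \<bar>?f k\<bar> + indicator {0<..} k *\<^sub>R ?w k"])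
    show "integrable lborel (\<lambda>k. indicator {0<..} k *\<^sub>R \<bar>?f k\<bar> + indicator {0<..} k *\<^sub>R ?w k)"
      using set_integrable_abs[OF int] intw unfolding set_integrable_def by (rule Bochner_Integration.integrable_add)
    show "(\<lambda>k. indicator {0<..} k *\<^sub>R ?g n k) \<in> borel_measurable lborel" for n
      using trace1_shifted(1)[OF e] unfolding set_integrable_def by auto
    show "(\<lambda>k. indicator {0<..} k *\<^sub>R ?f k) \<in> borel_measurable lborel"
      using int unfolding set_integrable_def by auto
    show "AE k in lborel. (\<lambda>n. indicator {0<..} k *\<^sub>R ?g n k) \<longlonglongrightarrow> indicator {0<..} k *\<^sub>R ?f k"
    proof (rule AE_I2)
      fix k :: real
      show "(\<lambda>n. indicator {0<..} k *\<^sub>R ?g n k) \<longlonglongrightarrow> indicator {0<..} k *\<^sub>R ?f k"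
      proof (cases "0 < k")
        case True
        have "(\<lambda>n. ?g n k) \<longlonglongrightarrow> (k * Re (Y (of_real k)) + 0 * Im (Y (of_real k))) / (k\<^sup>2 + 0\<^sup>2)"
          using True by (intro tendsto_intros e0) auto
        then show ?thesis using True by (simp add: power2_eq_square)
      qed simp
    qed
    show "AE k in lborel. norm (indicator {0<..} k *\<^sub>R ?g n k) \<le> indicator {0<..} k *\<^sub>R \<bar>?f k\<bar> + indicator {0<..} k *\<^sub>R ?w k" for n
    proof (rule AE_I2)
      fix k :: real
      show "norm (indicator {0<..} k *\<^sub>R ?g n k) \<le> indicator {0<..} k *\<^sub>R \<bar>?f k\<bar> + indicator {0<..} k *\<^sub>R ?w k"
      proof (cases "0 < k")
        case True
        have p: "0 < k\<^sup>2 + (e n)\<^sup>2" using True by (simp add: add_pos_nonneg)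
        have "k * \<bar>Re (Y (of_real k))\<bar> / (k\<^sup>2 + (e n)\<^sup>2) \<le> k * \<bar>Re (Y (of_real k))\<bar> / k\<^sup>2"
          using True p by (intro divide_left_mono mult_pos_pos) auto
        then have 1: "k * \<bar>Re (Y (of_real k))\<bar> / (k\<^sup>2 + (e n)\<^sup>2) \<le> \<bar>?f k\<bar>"
          using True by (simp add: power2_eq_square abs_divide)
        have "e n * k \<le> k\<^sup>2 + (e n)\<^sup>2"
        proof -
          have "k\<^sup>2 + (e n)\<^sup>2 = (k - e n)\<^sup>2 + 2 * (e n * k)" by (simp add: power2_eq_square algebra_simps)
          then show ?thesis using zero_le_power2[of "k - e n"] mult_pos_pos[OF e(1)[of n] True] by linarith
        qed
        then have "e n / (k\<^sup>2 + (e n)\<^sup>2) \<le> 1 / k" using True p by (simp add: field_simps)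
        moreover have "e n / (k\<^sup>2 + (e n)\<^sup>2) \<le> 1 / k\<^sup>2"
          using e[of n] True p by (intro frac_le) auto
        ultimately have "\<bar>Im (Y (of_real k))\<bar> * (e n / (k\<^sup>2 + (e n)\<^sup>2)) \<le> ?w k"
          by (intro mult_left_mono) auto
        then have 2: "e n * \<bar>Im (Y (of_real k))\<bar> / (k\<^sup>2 + (e n)\<^sup>2) \<le> ?w k" by (simp add: mult.commute)
        have "\<bar>?g n k\<bar> \<le> (k * \<bar>Re (Y (of_real k))\<bar> + e n * \<bar>Im (Y (of_real k))\<bar>) / (k\<^sup>2 + (e n)\<^sup>2)"
          unfolding abs_divide abs_of_pos[OF p] using True e(1)[of n] p
            abs_triangle_ineq[of "k * Re (Y (of_real k))" "e n * Im (Y (of_real k))"]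
          by (intro divide_right_mono) (auto simp: abs_mult)
        also have "\<dots> \<le> \<bar>?f k\<bar> + ?w k" unfolding add_divide_distrib by (rule add_mono[OF 1 2])
        finally show ?thesis using True by simp
      qed simp
    qed
  qed
  moreover have "(LINT k|lborel. indicator {0<..} k *\<^sub>R ?g n k) = pi * \<phi>1 / 2" for n
    using trace1_shifted(2)[OF e] by (simp only: set_lebesgue_integral_def)
  ultimately have "(\<lambda>n. pi * \<phi>1 / 2) \<longlonglongrightarrow> (LINT k:{0<..}|lborel. ?f k)"
    by (simp only: set_lebesgue_integral_def)
  then show "(LINT k:{0<..}|lborel. ?f k) = pi * \<phi>1 / 2"
    by (simp only: LIMSEQ_const_iff)
qed

end

section \<open>The logarithm of the Jost function\<close>

text \<open>The values of f lie in 2 \<pi> \<i> times the integers, where distinct points have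
  distance at least 1. Every normalisation of a logarithm or a phase below rests on this.\<close>

lemma constant_if_exp_eq_1:
  fixes f :: "'a::real_normed_vector \<Rightarrow> complex"
  assumes "connected S" "continuous_on S f" "\<And>x. x \<in> S \<Longrightarrow> exp (f x) = 1" "x \<in> S" "y \<in> S"
  shows "f x = f y"
proof -
  have "f constant_on S"
  proof (rule continuous_discrete_range_constant[OF assms(1,2)])
    fix x assume x: "x \<in> S"
    show "\<exists>e>0. \<forall>y. y \<in> S \<and> f y \<noteq> f x \<longrightarrow> e \<le> norm (f y - f x)"
    proof (intro exI[of _ 1] conjI allI impI)
      fix y assume y: "y \<in> S \<and> f y \<noteq> f x"
      have "exp (f y - f x) = 1" using assms(3) x y by (simp add: exp_diff)
      then obtain n :: int where n: "Re (f y - f x) = 0" "Im (f y - f x) = of_int (2 * n) * pi"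
        by (auto simp: exp_eq_1)
      have "n \<noteq> 0" using n y by (auto simp: complex_eq_iff)
      then have "1 \<le> \<bar>of_int n :: real\<bar>" by linarith
      then have "1 * 1 \<le> (2 * \<bar>of_int n\<bar>) * pi" using pi_gt3 by (intro mult_mono) auto
      also have "\<dots> = \<bar>Im (f y - f x)\<bar>" using n(2) by (simp add: abs_mult)
      also have "\<dots> \<le> norm (f y - f x)" by (rule abs_Im_le_cmod)
      finally show "1 \<le> norm (f y - f x)" by simp
    qed simp
  qed
  then show ?thesis using assms(4,5) by (metis constant_on_def)
qed

text \<open>The zeros are divided out one at a time by difference quotients, which extend
  holomorphically. If the cofactor still vanished at a point of Z, the product rule would give f
  derivative 0 there, against simplicity.\<close>

lemma holomorphic_simple_zeros_factor:
  assumes "finite Z" "open S" "f holomorphic_on S" "Z \<subseteq> S"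
    and "\<And>z. z \<in> Z \<Longrightarrow> f z = 0" "\<And>z. z \<in> Z \<Longrightarrow> deriv f z \<noteq> 0" "\<And>z. z \<in> S - Z \<Longrightarrow> f z \<noteq> 0"
  obtains h where "h holomorphic_on S" "\<And>\<zeta>. \<zeta> \<in> S \<Longrightarrow> f \<zeta> = h \<zeta> * (\<Prod>z\<in>Z. \<zeta> - z)" "\<And>\<zeta>. \<zeta> \<in> S \<Longrightarrow> h \<zeta> \<noteq> 0"
proof -
  have "\<exists>h. h holomorphic_on S \<and> (\<forall>\<zeta>\<in>S. f \<zeta> = h \<zeta> * (\<Prod>z\<in>Z. \<zeta> - z))"
    using assms(1,4,5)
  proof (induction Z rule: finite_induct)
    case empty
    then show ?case using assms(3) by auto
  next
    case (insert a Z)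
    then obtain h where h: "h holomorphic_on S" "\<And>\<zeta>. \<zeta> \<in> S \<Longrightarrow> f \<zeta> = h \<zeta> * (\<Prod>z\<in>Z. \<zeta> - z)" by auto
    have "(\<Prod>z\<in>Z. a - z) \<noteq> 0" using insert by (simp add: prod_zero_iff)
    then have ha: "h a = 0" using h(2)[of a] insert by auto
    define g where "g \<zeta> = (if \<zeta> = a then deriv h a else (h \<zeta> - h a) / (\<zeta> - a))" for \<zeta>
    have "g holomorphic_on S" unfolding g_def[abs_def] by (rule pole_lemma_open[OF h(1) assms(2)])
    moreover have "f \<zeta> = g \<zeta> * (\<Prod>z\<in>insert a Z. \<zeta> - z)" if "\<zeta> \<in> S" for \<zeta>
      using h(2)[OF that] ha insert by (cases "\<zeta> = a") (auto simp: g_def)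
    ultimately show ?case by blast
  qed
  then obtain h where h: "h holomorphic_on S" "\<And>\<zeta>. \<zeta> \<in> S \<Longrightarrow> f \<zeta> = h \<zeta> * (\<Prod>z\<in>Z. \<zeta> - z)" by auto
  have "h \<zeta> \<noteq> 0" if "\<zeta> \<in> S" for \<zeta>
  proof (cases "\<zeta> \<in> Z")
    case False
    then show ?thesis using assms(7)[of \<zeta>] h(2)[OF that] that by auto
  next
    case True
    show ?thesis
    proof
      assume 0: "h \<zeta> = 0"
      let ?P = "\<lambda>\<zeta>. \<Prod>z\<in>Z. \<zeta> - z"
      have P0: "?P \<zeta> = 0" using True assms(1) by (auto simp: prod_zero_iff)
      have "?P holomorphic_on S" by (intro holomorphic_intros)
      then have dP: "(?P has_field_derivative deriv ?P \<zeta>) (at \<zeta>)"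
        using assms(2) that holomorphic_derivI by blast
      have dh: "(h has_field_derivative deriv h \<zeta>) (at \<zeta>)"
        using h(1) assms(2) that holomorphic_derivI by blast
      have "((\<lambda>\<zeta>. h \<zeta> * ?P \<zeta>) has_field_derivative 0) (at \<zeta>)"
        using DERIV_mult[OF dh dP] 0 P0 by simp
      then have "(f has_field_derivative 0) (at \<zeta>)"
        by (rule has_field_derivative_transform_within_open[OF _ assms(2) that]) (simp add: h(2))
      then show False using assms(6)[OF True] DERIV_imp_deriv by blast
    qed
  qed
  with h show thesis using that by blast
qed

text \<open>The set is the image of {R..} \<times> [0, \<pi>] under polar coordinates.\<close>

lemma connected_uhp_outside:
  assumes "0 < R"
  shows "connected {\<zeta>. 0 \<le> Im \<zeta> \<and> R \<le> norm \<zeta>}"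
proof -
  have eq: "{\<zeta>. 0 \<le> Im \<zeta> \<and> R \<le> norm \<zeta>} = (\<lambda>(r, t). complex_of_real r * cis t) ` ({R..} \<times> {0..pi})"
  proof (intro equalityI subsetI)
    fix \<zeta> assume "\<zeta> \<in> {\<zeta>. 0 \<le> Im \<zeta> \<and> R \<le> norm \<zeta>}"
    then have \<zeta>: "0 \<le> Im \<zeta>" "R \<le> norm \<zeta>" by auto
    have "\<zeta> \<noteq> 0" using \<zeta> assms by auto
    then have "\<zeta> = of_real (norm \<zeta>) * cis (Arg \<zeta>)" using Arg_eq[of \<zeta>] by (simp add: cis_conv_exp)
    moreover have "0 \<le> Arg \<zeta>" "Arg \<zeta> \<le> pi" using \<zeta>(1) Arg_less_0[of \<zeta>] Arg_le_pi by auto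
    ultimately show "\<zeta> \<in> (\<lambda>(r, t). complex_of_real r * cis t) ` ({R..} \<times> {0..pi})"
      using \<zeta>(2) by (intro image_eqI[of _ _ "(norm \<zeta>, Arg \<zeta>)"]) auto
  next
    fix \<zeta> assume "\<zeta> \<in> (\<lambda>(r, t). complex_of_real r * cis t) ` ({R..} \<times> {0..pi})"
    then obtain r t where rt: "\<zeta> = complex_of_real r * cis t" "R \<le> r" "0 \<le> t" "t \<le> pi" by auto
    have "0 \<le> r * sin t" using rt(2-4) assms by (intro mult_nonneg_nonneg sin_ge_zero) auto
    then show "\<zeta> \<in> {\<zeta>. 0 \<le> Im \<zeta> \<and> R \<le> norm \<zeta>}"
      using rt(1,2) assms by (auto simp: norm_mult)
  qed
  have "connected ({R..} \<times> {0..pi})"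
    by (intro connected_Times convex_connected convex_real_interval)
  moreover have "continuous_on ({R..} \<times> {0..pi}) (\<lambda>(r, t). complex_of_real r * cis t)"
    by (auto intro!: continuous_intros simp: case_prod_unfold)
  ultimately have "connected ((\<lambda>(r, t). complex_of_real r * cis t) ` ({R..} \<times> {0..pi}))"
    by (intro connected_continuous_image)
  then show ?thesis unfolding eq .
qed

text \<open>F - L - Ln C has exponential 1 and is therefore constant, so the bound for Im L passes
  to Im F up to a constant.\<close>

lemma Im_bounded_if_exp_eq:
  fixes F L :: "complex \<Rightarrow> complex"
  assumes "connected S" "continuous_on S F" "continuous_on S L" "C \<noteq> 0"
    and "\<And>x. x \<in> S \<Longrightarrow> exp (F x) = C * exp (L x)" "\<And>x. x \<in> S \<Longrightarrow> \<bar>Im (L x)\<bar> \<le> b"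
  obtains B where "\<And>x. x \<in> S \<Longrightarrow> \<bar>Im (F x)\<bar> \<le> B"
proof (cases "S = {}")
  case False
  then obtain a where a: "a \<in> S" by auto
  have "F x - L x - Ln C = F a - L a - Ln C" if "x \<in> S" for x
    by (rule constant_if_exp_eq_1[OF assms(1) _ _ that a])
      (use assms in \<open>auto simp: exp_diff intro!: continuous_intros\<close>)
  then have "F x = L x + (F a - L a)" if "x \<in> S" for x
    using that by (metis add.commute diff_add_cancel diff_right_commute)
  then have "Im (F x) = Im (L x) + Im (F a - L a)" if "x \<in> S" for x
    using that by (metis plus_complex.sel(2))
  then have "\<bar>Im (F x)\<bar> \<le> b + \<bar>Im (F a - L a)\<bar>" if "x \<in> S" for x
    using that assms(6)[OF that] by fastforce
  then show thesis using that by blast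
qed (use that in auto)

context jost_smooth
begin

lemma norm_denominator_ge: "0 \<le> Im \<zeta> \<Longrightarrow> norm \<zeta> \<le> norm (of_real \<bar>\<gamma>\<bar> - \<i> * \<zeta>)"
proof -
  assume "0 \<le> Im \<zeta>"
  then have "(Im \<zeta>)\<^sup>2 \<le> (\<bar>\<gamma>\<bar> + Im \<zeta>)\<^sup>2" by (intro power_mono) auto
  then show ?thesis by (simp add: cmod_def add.commute)
qed

lemma jzeros_nonzero_real: "0 \<notin> jzeros \<gamma>" "of_real k \<notin> jzeros \<gamma>"
  using jzeros_imaginary(2)[of 0 \<gamma>] jzeros_imaginary(2)[of "of_real k" \<gamma>] by auto

text \<open>At a zero of w the formula for \<open>Efun\<close> divides by zero and returns 0. In the
  open half plane it is replaced by the version with cancelled linear factors, while on the real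
  axis, which contains no zeros, it is kept. The two descriptions agree on an overlap of relatively
  open sets, whence continuity.\<close>

lemma Efun_extension:
  obtains E where "continuous_on (closed_uhp - {0}) E" "E holomorphic_on open_uhp"
    "\<And>\<zeta>. \<zeta> \<in> closed_uhp - {0} \<Longrightarrow> E \<zeta> \<noteq> 0" "\<And>\<zeta>. \<zeta> \<in> closed_uhp - {0} - jzeros \<gamma> \<Longrightarrow> E \<zeta> = Efun \<gamma> \<zeta>"
proof -
  let ?Z = "jzeros \<gamma>"
  have Z: "?Z \<subseteq> open_uhp" by (auto simp: jzeros_def)
  have dz: "deriv (jostw \<gamma>) z \<noteq> 0" if "z \<in> ?Z" for z
  proof -
    have z: "z = \<i> * of_real (Im z)" "0 < Im z" using jzeros_imaginary[OF that] by auto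
    have "jostw \<gamma> (\<i> * of_real (Im z)) = 0" using that z(1) by (simp add: jzeros_def)
    from jostw_simple_zero[OF z(2) this] show ?thesis using z(1) by simp
  qed
  obtain h where h: "h holomorphic_on open_uhp" "\<And>\<zeta>. \<zeta> \<in> open_uhp \<Longrightarrow> jostw \<gamma> \<zeta> = h \<zeta> * (\<Prod>z\<in>?Z. \<zeta> - z)"
    "\<And>\<zeta>. \<zeta> \<in> open_uhp \<Longrightarrow> h \<zeta> \<noteq> 0"
  proof -
    have 1: "jostw \<gamma> z = 0" if "z \<in> ?Z" for z using that by (simp add: jzeros_def)
    have 2: "jostw \<gamma> z \<noteq> 0" if "z \<in> open_uhp - ?Z" for z using that by (simp add: jzeros_def)
    show thesis
      using holomorphic_simple_zeros_factor[OF finite_jzeros open_open_uhp holomorphic_jostw Z 1 dz 2] that by blast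
  qed
  define g where "g \<zeta> = h \<zeta> * (\<Prod>z\<in>?Z. \<zeta> + z) / (of_real \<bar>\<gamma>\<bar> - \<i> * \<zeta>)" for \<zeta>
  define E where "E \<zeta> = (if 0 < Im \<zeta> then g \<zeta> else Efun \<gamma> \<zeta>)" for \<zeta>
  have den: "of_real \<bar>\<gamma>\<bar> - \<i> * \<zeta> \<noteq> 0" if "0 \<le> Im \<zeta>" "\<zeta> \<noteq> 0" for \<zeta>
    using norm_denominator_ge[OF that(1), of \<gamma>] that(2) by (metis norm_le_zero_iff norm_zero)
  have num: "\<zeta> + z \<noteq> 0" if "0 \<le> Im \<zeta>" "z \<in> ?Z" for \<zeta> z
  proof
    assume "\<zeta> + z = 0"
    then have "Im \<zeta> + Im z = 0" by (metis plus_complex.sel(2) zero_complex.sel(2))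
    then show False using jzeros_imaginary(2)[OF that(2)] that(1) by simp
  qed
  have gE: "g \<zeta> = Efun \<gamma> \<zeta>" if "\<zeta> \<in> open_uhp - ?Z" for \<zeta>
  proof -
    have "(\<Prod>z\<in>?Z. \<zeta> - z) \<noteq> 0" using that finite_jzeros by (auto simp: prod_zero_iff)
    then show ?thesis using h(2)[of \<zeta>] that by (simp add: g_def Efun_def prod_dividef)
  qed
  have E: "E \<zeta> = Efun \<gamma> \<zeta>" if "\<zeta> \<in> closed_uhp - {0} - ?Z" for \<zeta>
    using gE[of \<zeta>] that by (simp add: E_def)
  have gh: "g holomorphic_on open_uhp"
  proof -
    have "of_real \<bar>\<gamma>\<bar> - \<i> * \<zeta> \<noteq> 0" if "\<zeta> \<in> open_uhp" for \<zeta>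
      by (rule den) (use that in auto)
    then show ?thesis unfolding g_def[abs_def] by (intro holomorphic_intros h(1)) blast
  qed
  have Eh: "E holomorphic_on open_uhp"
    by (rule holomorphic_transform[OF gh]) (simp add: E_def)
  have un: "closed_uhp - {0} = open_uhp \<union> (closed_uhp - {0} - ?Z)" using Z by auto
  have "continuous_on (open_uhp \<union> (closed_uhp - {0} - ?Z)) E"
  proof (rule continuous_on_Un_local_open)
    show "openin (top_of_set (open_uhp \<union> (closed_uhp - {0} - ?Z))) open_uhp"
      unfolding openin_open using open_open_uhp by (intro exI[of _ open_uhp]) auto
    show "openin (top_of_set (open_uhp \<union> (closed_uhp - {0} - ?Z))) (closed_uhp - {0} - ?Z)"
      unfolding openin_open using finite_imp_closed[OF finite_jzeros[of \<gamma>]] Z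
      by (intro exI[of _ "- ?Z"]) auto
    show "continuous_on open_uhp E" by (rule holomorphic_on_imp_continuous_on[OF Eh])
    have "continuous_on (closed_uhp - {0} - ?Z) (Efun \<gamma>)"
      unfolding Efun_def
      by (intro continuous_intros continuous_on_subset[OF continuous_jostw]) (use den in auto)
    then show "continuous_on (closed_uhp - {0} - ?Z) E"
      by (rule continuous_on_eq) (simp add: E)
  qed
  then have "continuous_on (closed_uhp - {0}) E" unfolding un[symmetric] .
  moreover have "E \<zeta> \<noteq> 0" if \<zeta>: "\<zeta> \<in> closed_uhp - {0}" for \<zeta>
  proof (cases "0 < Im \<zeta>")
    case True
    then show ?thesis
      using h(3)[of \<zeta>] den[of \<zeta>] num[of \<zeta>] \<zeta> finite_jzeros by (auto simp: E_def g_def prod_zero_iff)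
  next
    case False
    then have r: "\<zeta> = of_real (Re \<zeta>)" using \<zeta> by (simp add: complex_eq_iff)
    then have "Re \<zeta> \<noteq> 0" using \<zeta> by auto
    have "jostw \<gamma> \<zeta> \<noteq> 0" using jostw_real_nonzero[OF \<open>Re \<zeta> \<noteq> 0\<close>] r by simp
    moreover have "\<zeta> \<notin> ?Z" using Z False by auto
    ultimately show ?thesis
      using False den[of \<zeta>] num[of \<zeta>] \<zeta> finite_jzeros by (auto simp: E_def Efun_def prod_zero_iff)
  qed
  ultimately show thesis using that Eh E by blast
qed

lemma norm_Qf_le:
  assumes "1 \<le> norm \<zeta>"
  shows "norm (Qf \<gamma> (yvar \<zeta>)) \<le> (\<bar>c1 \<gamma>\<bar> + \<bar>v 0 0\<bar> + \<bar>c3 \<gamma>\<bar> + \<bar>c4 \<gamma>\<bar>) / norm \<zeta>"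
proof -
  let ?y = "yvar \<zeta>"
  have y: "norm ?y \<le> 1 / norm \<zeta>" "norm ?y \<le> 1"
    unfolding norm_yvar using assms by (auto intro!: frac_le simp: divide_le_eq_1)
  have p: "norm (of_real c * ?y ^ Suc n) \<le> \<bar>c\<bar> * (1 / norm \<zeta>)" for c n
  proof -
    have "norm ?y * norm ?y ^ n \<le> 1 / norm \<zeta> * 1"
      using y assms by (intro mult_mono power_le_one) auto
    then have "\<bar>c\<bar> * (norm ?y * norm ?y ^ n) \<le> \<bar>c\<bar> * (1 / norm \<zeta>)" by (intro mult_left_mono) auto
    then show ?thesis by (simp only: norm_mult norm_power norm_of_real power_Suc mult_1_right)
  qed
  have "norm (Qf \<gamma> ?y) \<le> \<bar>c1 \<gamma>\<bar> * (1 / norm \<zeta>) + \<bar>v 0 0\<bar> * (1 / norm \<zeta>) + \<bar>c3 \<gamma>\<bar> * (1 / norm \<zeta>) + \<bar>c4 \<gamma>\<bar> * (1 / norm \<zeta>)"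
    unfolding Qf_def using p[of "c1 \<gamma>" 0] p[of "v 0 0" 1] p[of "c3 \<gamma>" 2] p[of "c4 \<gamma>" 3]
    by (intro norm_triangle_mono) (simp_all add: eval_nat_numeral)
  then show ?thesis by (simp add: add_divide_distrib)
qed

text \<open>The punctured closed half plane is starlike about \<i>, so a continuous logarithm
  exists; inside it differs by a constant from a holomorphic one. Far out Qf + Ln(1 + e) is a
  logarithm too. The two differ by a constant b with exp b = 1, and subtracting b makes F vanish at
  infinity.\<close>

lemma log_Efun:
  obtains F R K where "continuous_on (closed_uhp - {0}) F" "F holomorphic_on open_uhp"
    "\<And>\<zeta>. \<zeta> \<in> closed_uhp - {0} - jzeros \<gamma> \<Longrightarrow> exp (F \<zeta>) = Efun \<gamma> \<zeta>" "1 \<le> R" "0 \<le> K"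
    "\<And>\<zeta>. 0 \<le> Im \<zeta> \<Longrightarrow> R \<le> norm \<zeta> \<Longrightarrow> norm (F \<zeta> - Qf \<gamma> (yvar \<zeta>)) \<le> K / norm \<zeta> ^ 5"
proof -
  let ?Z = "jzeros \<gamma>"
  obtain E where E: "continuous_on (closed_uhp - {0}) E" "E holomorphic_on open_uhp"
    "\<And>\<zeta>. \<zeta> \<in> closed_uhp - {0} \<Longrightarrow> E \<zeta> \<noteq> 0" "\<And>\<zeta>. \<zeta> \<in> closed_uhp - {0} - ?Z \<Longrightarrow> E \<zeta> = Efun \<gamma> \<zeta>"
    using Efun_extension[of \<gamma>] by blast
  have "starlike (closed_uhp - {0})"
    unfolding starlike_def
  proof (intro bexI[of _ \<i>] ballI subsetI)
    fix x z assume x: "x \<in> closed_uhp - {0}" and "z \<in> closed_segment \<i> x"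
    then obtain u where u: "0 \<le> u" "u \<le> 1" "z = (1 - u) *\<^sub>R \<i> + u *\<^sub>R x" by (auto simp: closed_segment_def)
    then have "0 \<le> Im z" using x by auto
    \<comment> \<open>On the segment from \<i> to x the value 0 could only be attained at the end
      point x, which is not 0.\<close>
    moreover have "z \<noteq> 0"
    proof
      assume "z = 0"
      then have "(1 - u) + u * Im x = 0" "u * Re x = 0" using u(3) by (auto simp: complex_eq_iff)
      moreover have "0 \<le> u * Im x" using u x by auto
      ultimately have "u = 1" "u * Im x = 0" using u by linarith+
      then show False using x \<open>u * Re x = 0\<close> by (auto simp: complex_eq_iff)
    qed
    ultimately show "z \<in> closed_uhp - {0}" by simp
  qed auto
  then have "contractible (closed_uhp - {0})" by (rule starlike_imp_contractible)
  then obtain F0 where F0: "continuous_on (closed_uhp - {0}) F0" "\<And>\<zeta>. \<zeta> \<in> closed_uhp - {0} \<Longrightarrow> E \<zeta> = exp (F0 \<zeta>)"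
    using continuous_logarithm_on_contractible[OF E(1) _ E(3)] by blast
  have F0h: "F0 holomorphic_on open_uhp"
  proof -
    have sub: "open_uhp \<subseteq> closed_uhp - {0}" by auto
    have "simply_connected open_uhp" by (rule convex_imp_simply_connected[OF convex_open_uhp])
    then obtain g where g: "g holomorphic_on open_uhp" "\<And>z. z \<in> open_uhp \<Longrightarrow> E z = exp (g z)"
      using simply_connected_imp_holomorphic_log[OF E(2) _ convex_imp_locally_path_connected[OF convex_open_uhp]] E(3) sub by blast
    have "F0 \<zeta> - g \<zeta> = F0 \<i> - g \<i>" if "\<zeta> \<in> open_uhp" for \<zeta>
    proof (rule constant_if_exp_eq_1[OF convex_connected[OF convex_open_uhp] _ _ that])
      show "continuous_on open_uhp (\<lambda>\<zeta>. F0 \<zeta> - g \<zeta>)"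
        by (intro continuous_intros continuous_on_subset[OF F0(1) sub] holomorphic_on_imp_continuous_on g(1))
      show "exp (F0 \<zeta> - g \<zeta>) = 1" if "\<zeta> \<in> open_uhp" for \<zeta>
      proof -
        have "\<zeta> \<noteq> 0" using that by auto
        then show ?thesis using F0(2)[of \<zeta>] g(2)[OF that] that by (auto simp: exp_diff)
      qed
    qed auto
    then have "F0 \<zeta> = g \<zeta> + (F0 \<i> - g \<i>)" if "\<zeta> \<in> open_uhp" for \<zeta>
      using that by (metis add.commute diff_add_cancel)
    moreover have "(\<lambda>\<zeta>. g \<zeta> + (F0 \<i> - g \<i>)) holomorphic_on open_uhp" by (intro holomorphic_intros g(1))
    ultimately show ?thesis by (metis (no_types, lifting) holomorphic_transform)
  qed
  obtain K R0 where KR: "\<And>\<zeta>. 0 \<le> Im \<zeta> \<Longrightarrow> R0 \<le> norm \<zeta> \<Longrightarrow> norm (Efun \<gamma> \<zeta> * exp (- Qf \<gamma> (yvar \<zeta>)) - 1) \<le> K / norm \<zeta> ^ 5"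
    using near_one_Efun[of \<gamma>] unfolding near_one_def eventually_uhp_infinity by blast
  \<comment> \<open>Beyond this radius there are no zeros and |e| < 1/2, so the principal logarithm
    of 1 + e is continuous and bounded by 2 |e|.\<close>
  define R where "R = Max {1, R0, 4 * \<bar>K\<bar>, 1 + (\<Sum>z\<in>?Z. norm z)}"
  have R: "1 \<le> R" "R0 \<le> R" "4 * \<bar>K\<bar> \<le> R" "1 + (\<Sum>z\<in>?Z. norm z) \<le> R" by (auto simp: R_def)
  let ?S = "{\<zeta>. 0 \<le> Im \<zeta> \<and> R \<le> norm \<zeta>}"
  have SZ: "\<zeta> \<in> closed_uhp - {0} - ?Z" if "\<zeta> \<in> ?S" for \<zeta>
  proof -
    have "norm z \<le> (\<Sum>z\<in>?Z. norm z)" if "z \<in> ?Z" for z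
      using that finite_jzeros by (intro member_le_sum) auto
    then show ?thesis using that R(1,4) by force
  qed
  define e where "e \<zeta> = Efun \<gamma> \<zeta> * exp (- Qf \<gamma> (yvar \<zeta>)) - 1" for \<zeta>
  have eb: "norm (e \<zeta>) \<le> \<bar>K\<bar> / norm \<zeta> ^ 5" "norm (e \<zeta>) < 1/2" if "\<zeta> \<in> ?S" for \<zeta>
  proof -
    have n: "1 \<le> norm \<zeta>" using that R(1) by simp
    have "norm (e \<zeta>) \<le> K / norm \<zeta> ^ 5" unfolding e_def using KR[of \<zeta>] that R(2) by simp
    also have "\<dots> \<le> \<bar>K\<bar> / norm \<zeta> ^ 5" by (intro divide_right_mono) auto
    finally show 1: "norm (e \<zeta>) \<le> \<bar>K\<bar> / norm \<zeta> ^ 5" .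
    have "norm \<zeta> ^ 1 \<le> norm \<zeta> ^ 5" using n by (intro power_increasing) auto
    then have "4 * \<bar>K\<bar> \<le> norm \<zeta> ^ 5" using that R(3) by simp
    then have "\<bar>K\<bar> / norm \<zeta> ^ 5 \<le> 1/4" using n by (subst pos_divide_le_eq) auto
    then show "norm (e \<zeta>) < 1/2" using 1 by linarith
  qed
  define X where "X \<zeta> = Qf \<gamma> (yvar \<zeta>) + Ln (1 + e \<zeta>)" for \<zeta>
  have nz: "1 + e \<zeta> \<notin> \<real>\<^sub>\<le>\<^sub>0" if "\<zeta> \<in> ?S" for \<zeta>
  proof -
    have "0 < Re (1 + e \<zeta>)" using eb(2)[OF that] abs_Re_le_cmod[of "e \<zeta>"] by simp
    then show ?thesis by (auto simp: complex_nonpos_Reals_iff)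
  qed
  have expX: "exp (X \<zeta>) = E \<zeta>" if "\<zeta> \<in> ?S" for \<zeta>
  proof -
    have "1 + e \<zeta> \<noteq> 0" using nz[OF that] by auto
    then have "exp (X \<zeta>) = exp (Qf \<gamma> (yvar \<zeta>)) * (1 + e \<zeta>)" by (simp add: X_def exp_add)
    also have "\<dots> = Efun \<gamma> \<zeta>" unfolding e_def by (simp add: exp_minus)
    finally show ?thesis using E(4)[OF SZ[OF that]] by simp
  qed
  have Scont: "?S \<subseteq> closed_uhp - {0}" using SZ by blast
  have contX: "continuous_on ?S X"
  proof -
    have cy: "continuous_on ?S (\<lambda>\<zeta>. Qf \<gamma> (yvar \<zeta>))"
      unfolding Qf_def using Scont by (intro continuous_intros) auto
    have "continuous_on ?S (Efun \<gamma>)"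
      by (rule continuous_on_eq[OF continuous_on_subset[OF E(1) Scont]]) (use SZ E(4) in blast)
    then have "continuous_on ?S e" unfolding e_def using cy by (intro continuous_intros)
    then show ?thesis unfolding X_def using cy nz by (intro continuous_intros) auto
  qed
  have iR: "\<i> * of_real R \<in> ?S" using R(1) by (simp add: norm_mult)
  define b where "b = F0 (\<i> * of_real R) - X (\<i> * of_real R)"
  have const: "F0 \<zeta> - X \<zeta> = b" if "\<zeta> \<in> ?S" for \<zeta>
    unfolding b_def
  proof (rule constant_if_exp_eq_1[OF connected_uhp_outside _ _ that iR])
    show "continuous_on ?S (\<lambda>\<zeta>. F0 \<zeta> - X \<zeta>)"
      by (intro continuous_intros contX continuous_on_subset[OF F0(1) Scont])
    show "exp (F0 \<zeta> - X \<zeta>) = 1" if "\<zeta> \<in> ?S" for \<zeta>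
    proof -
      have "exp (F0 \<zeta>) = exp (X \<zeta>)" using expX[OF that] F0(2)[of \<zeta>] subsetD[OF Scont that] by metis
      then show ?thesis by (simp add: exp_diff)
    qed
  qed (use R in auto)
  have eb1: "exp b = 1"
  proof -
    have "exp (F0 (\<i> * of_real R)) = exp (X (\<i> * of_real R))"
      using expX[OF iR] F0(2) subsetD[OF Scont iR] by metis
    then show ?thesis by (simp add: b_def exp_diff)
  qed
  show thesis
  proof (rule that[of "\<lambda>\<zeta>. F0 \<zeta> - b" R "2 * \<bar>K\<bar>"])
    show "continuous_on (closed_uhp - {0}) (\<lambda>\<zeta>. F0 \<zeta> - b)" by (intro continuous_intros F0(1))
    show "(\<lambda>\<zeta>. F0 \<zeta> - b) holomorphic_on open_uhp" by (intro holomorphic_intros F0h)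
    show "exp (F0 \<zeta> - b) = Efun \<gamma> \<zeta>" if "\<zeta> \<in> closed_uhp - {0} - ?Z" for \<zeta>
      using F0(2)[of \<zeta>] E(4)[OF that] that eb1 by (simp add: exp_diff)
    fix \<zeta> assume \<zeta>: "0 \<le> Im \<zeta>" "R \<le> norm \<zeta>"
    then have S: "\<zeta> \<in> ?S" by simp
    have "F0 \<zeta> - b - Qf \<gamma> (yvar \<zeta>) = Ln (1 + e \<zeta>)"
      using const[OF S] by (simp add: X_def algebra_simps)
    then show "norm (F0 \<zeta> - b - Qf \<gamma> (yvar \<zeta>)) \<le> 2 * \<bar>K\<bar> / norm \<zeta> ^ 5"
      using norm_Ln_le[OF eb(2)[OF S]] eb(1)[OF S] by simp
  qed (use R in auto)
qed

end

section \<open>Behaviour of the logarithm near 0\<close>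

lemma bound_extends_to_closure:
  fixes f :: "complex \<Rightarrow> real"
  assumes "continuous_on T f" "S \<subseteq> T" "x \<in> T" "x \<in> closure S" "\<And>y. y \<in> S \<Longrightarrow> f y \<le> b"
  shows "f x \<le> b"
proof -
  obtain X where X: "\<And>n. X n \<in> S" "X \<longlonglongrightarrow> x" using assms(4) by (auto simp: closure_sequential)
  have "(\<lambda>n. f (X n)) \<longlonglongrightarrow> f x"
    by (rule continuous_on_tendsto_compose[OF assms(1) X(2) assms(3)]) (use X(1) assms(2) in \<open>auto intro!: always_eventually\<close>)
  then show ?thesis by (rule LIMSEQ_le_const2) (use X(1) assms(5) in auto)
qed

text \<open>A small shift in the direction s + \<i> moves the point into the open quarter
  disc.\<close>

lemma quarter_disc_closure:
  fixes s d :: real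
  assumes "s = 1 \<or> s = - 1" "0 \<le> Im x" "0 \<le> s * Re x" "norm x < d"
  shows "x \<in> closure {\<zeta>. 0 < Im \<zeta> \<and> 0 < s * Re \<zeta> \<and> norm \<zeta> < d}"
  unfolding closure_approachable
proof (intro allI impI)
  fix e :: real assume "0 < e"
  define t where "t = min (e / 4) ((d - norm x) / 4)"
  have t: "0 < t" "2 * t < e" "2 * t < d - norm x" using \<open>0 < e\<close> assms(4) by (auto simp: t_def min_def)
  define h where "h = of_real t * (of_real s + \<i>)"
  have "norm (of_real s + \<i>) \<le> \<bar>s\<bar> + 1" using norm_triangle_ineq[of "of_real s" \<i>] by simp
  then have "norm (of_real s + \<i>) \<le> 2" using assms(1) by auto
  then have "t * norm (of_real s + \<i>) \<le> t * 2" using t(1) by (intro mult_left_mono) auto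
  then have h: "norm h \<le> 2 * t" using t(1) by (simp add: h_def norm_mult)
  have "norm (x + h) \<le> norm x + norm h" by (rule norm_triangle_ineq)
  then have 1: "norm (x + h) < d" using h t(3) by linarith
  have "0 < Im (x + h)" using assms(2) t(1) by (simp add: h_def)
  moreover have "0 < s * Re (x + h)" using assms(1,3) t(1) by (auto simp: h_def)
  moreover have "dist (x + h) x < e" using h t(2) by (simp add: dist_norm)
  ultimately show "\<exists>y\<in>{\<zeta>. 0 < Im \<zeta> \<and> 0 < s * Re \<zeta> \<and> norm \<zeta> < d}. dist y x < e" using 1 by blast
qed

lemma convex_quarter_disc: "convex {\<zeta>. 0 < Im \<zeta> \<and> 0 < s * Re \<zeta> \<and> norm \<zeta> < d}"
proof -
  have "{\<zeta>. 0 < Im \<zeta> \<and> 0 < s * Re \<zeta> \<and> norm \<zeta> < d} = {\<zeta>. 0 < Im \<zeta>} \<inter> {\<zeta>. 0 < inner (of_real s) \<zeta>} \<inter> ball 0 d"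
    by (auto simp: inner_complex_def)
  then show ?thesis by (simp add: convex_Int convex_halfspace_Im_gt convex_halfspace_gt)
qed

text \<open>From ln u \<le> u - 1 at u = 1 / sqrt t; it trades a logarithmic singularity for an
  integrable power.\<close>

lemma abs_ln_le:
  fixes t :: real
  assumes "0 < t" "t \<le> 1"
  shows "\<bar>ln t\<bar> \<le> 2 / sqrt t"
proof -
  have "ln (1 / sqrt t) \<le> 1 / sqrt t - 1" using assms by (intro ln_le_minus_one) auto
  moreover have "ln (1 / sqrt t) = - ln t / 2" using assms by (simp add: ln_div ln_sqrt)
  moreover have "ln t \<le> 0" using assms by simp
  ultimately show ?thesis by simp
qed

lemma eventually_quotient_near_1:
  fixes a :: "complex \<Rightarrow> complex"
  assumes "continuous_on T a" "0 \<in> T" "a 0 \<noteq> 0"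
  obtains d where "0 < d" "\<And>\<zeta>. \<zeta> \<in> T \<Longrightarrow> norm \<zeta> < d \<Longrightarrow> norm (a \<zeta> / a 0 - 1) < 1/2"
proof -
  have "continuous_on T (\<lambda>\<zeta>. a \<zeta> / a 0)" using assms by (intro continuous_intros) auto
  from this[unfolded continuous_on_iff, rule_format, OF assms(2), of "1/2"]
  show thesis using that assms(3) by (auto simp: dist_norm)
qed

lemma not_nonpos_Reals_near_1: "norm (z - 1) < 1/2 \<Longrightarrow> z \<notin> \<real>\<^sub>\<le>\<^sub>0" for z :: complex
  using abs_Re_le_cmod[of "z - 1"] by (auto simp: complex_nonpos_Reals_iff)

lemma nonzero_if_not_nonpos_Reals: "z \<notin> \<real>\<^sub>\<le>\<^sub>0 \<Longrightarrow> z \<noteq> 0" for z :: complex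
  by auto

context jost_smooth
begin

lemma jostw_lower_bound_closed:
  obtains c d where "0 < c" "0 < d" "\<And>\<zeta>. 0 \<le> Im \<zeta> \<Longrightarrow> norm \<zeta> < d \<Longrightarrow> c * norm \<zeta> \<le> norm (jostw \<gamma> \<zeta>)"
proof -
  obtain c d where cd: "0 < c" "0 < d" "\<And>\<zeta>. 0 < Im \<zeta> \<Longrightarrow> norm \<zeta> < d \<Longrightarrow> c * norm \<zeta> \<le> norm (jostw \<gamma> \<zeta>)"
    by (rule jostw_lower_bound) blast
  have "c * norm \<zeta> \<le> norm (jostw \<gamma> \<zeta>)" if \<zeta>: "0 \<le> Im \<zeta>" "norm \<zeta> < d" for \<zeta>
  proof -
    define s :: real where "s = (if 0 \<le> Re \<zeta> then 1 else - 1)"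
    have s: "s = 1 \<or> s = - 1" "0 \<le> s * Re \<zeta>" by (auto simp: s_def)
    have "c * norm \<zeta> - norm (jostw \<gamma> \<zeta>) \<le> 0"
      by (rule bound_extends_to_closure[OF _ _ _ quarter_disc_closure[OF s(1) \<zeta>(1) s(2) \<zeta>(2)], of closed_uhp])
        (use cd \<zeta> in \<open>auto intro!: continuous_intros continuous_jostw\<close>)
    then show ?thesis by simp
  qed
  with cd show thesis using that by blast
qed

definition Bl :: "real \<Rightarrow> complex \<Rightarrow> complex" where
  "Bl \<gamma> \<zeta> = (\<Prod>z\<in>jzeros \<gamma>. (\<zeta> + z) / (\<zeta> - z))"

lemma Efun_Bl: "Efun \<gamma> \<zeta> = jostw \<gamma> \<zeta> / (of_real \<bar>\<gamma>\<bar> - \<i> * \<zeta>) * Bl \<gamma> \<zeta>"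
  by (simp add: Efun_def Bl_def)

lemma continuous_Bl: "continuous_on (- jzeros \<gamma>) (Bl \<gamma>)"
  unfolding Bl_def by (intro continuous_intros) auto

lemma norm_Bl_0: "norm (Bl \<gamma> 0) = 1"
proof -
  have "norm (Bl \<gamma> 0) = (\<Prod>z\<in>jzeros \<gamma>. norm ((0 + z) / (0 - z)))" unfolding Bl_def by (rule prod_norm[symmetric])
  also have "\<dots> = (\<Prod>z\<in>jzeros \<gamma>. 1)"
    by (rule prod.cong) (use jzeros_nonzero_real(1)[of \<gamma>] in \<open>auto simp: norm_divide\<close>)
  finally show ?thesis by simp
qed

lemma jzeros_away_from_0:
  obtains d where "0 < d" "\<And>\<zeta>. norm \<zeta> < d \<Longrightarrow> \<zeta> \<notin> jzeros \<gamma>"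
proof -
  have "open (- jzeros \<gamma>)" "0 \<in> - jzeros \<gamma>"
    using finite_imp_closed[OF finite_jzeros] jzeros_nonzero_real(1) by auto
  then obtain d where "0 < d" "ball 0 d \<subseteq> - jzeros \<gamma>" by (meson openE)
  then show thesis using that by (auto simp: subset_eq)
qed

text \<open>The argument of w must not wind near 0, although w may vanish there. If w(0) \<noteq> 0
  this is continuity. If w(0) = 0, then Im (cnj theta w) is nonzero on either side of the imaginary
  axis, so w / theta avoids the nonpositive reals there and its principal logarithm has a bounded
  imaginary part; theta itself is nonzero near 0. Continuity of F carries the bound to the
  axes.\<close>

lemma Im_log_Efun_bounded:
  assumes F: "continuous_on (closed_uhp - {0}) F"
    "\<And>\<zeta>. \<zeta> \<in> closed_uhp - {0} - jzeros \<gamma> \<Longrightarrow> exp (F \<zeta>) = Efun \<gamma> \<zeta>"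
  obtains B d where "0 < d" "\<And>\<zeta>. 0 \<le> Im \<zeta> \<Longrightarrow> \<zeta> \<noteq> 0 \<Longrightarrow> norm \<zeta> < d \<Longrightarrow> \<bar>Im (F \<zeta>)\<bar> \<le> B"
proof -
  \<comment> \<open>A comparison function that is nonzero at 0: w itself if w(0) \<noteq> 0, so that
    the quotient is 1, and the boundary value of \<open>theta\<close> otherwise.\<close>
  obtain a where a: "continuous_on closed_uhp a" "a 0 \<noteq> 0"
    "\<And>\<zeta>. 0 < Im \<zeta> \<Longrightarrow> Re \<zeta> \<noteq> 0 \<Longrightarrow> a \<zeta> \<noteq> 0 \<Longrightarrow> jostw \<gamma> \<zeta> / a \<zeta> \<notin> \<real>\<^sub>\<le>\<^sub>0"
  proof (cases "jostw \<gamma> 0 = 0")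
    case False
    then show thesis using that[of "jostw \<gamma>"] continuous_jostw by auto
  next
    case True
    have th: "theta \<zeta> 0 = jm \<zeta> 0" for \<zeta> by (simp add: theta_def)
    have "jostw \<gamma> \<zeta> / jm \<zeta> 0 \<notin> \<real>\<^sub>\<le>\<^sub>0" if \<zeta>: "0 < Im \<zeta>" "Re \<zeta> \<noteq> 0" "jm \<zeta> 0 \<noteq> 0" for \<zeta>
    proof
      assume "jostw \<gamma> \<zeta> / jm \<zeta> 0 \<in> \<real>\<^sub>\<le>\<^sub>0"
      then obtain r where "jostw \<gamma> \<zeta> / jm \<zeta> 0 = of_real r" by (auto elim: nonpos_Reals_cases)
      then have "jostw \<gamma> \<zeta> = of_real r * jm \<zeta> 0" using \<zeta>(3) by (simp add: field_simps)
      then have "cnj (theta \<zeta> 0) * jostw \<gamma> \<zeta> = of_real (r * (norm (jm \<zeta> 0))\<^sup>2)"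
        unfolding th using complex_norm_square[of "jm \<zeta> 0"] by (simp add: mult_ac)
      then have "Im (cnj (theta \<zeta> 0) * jostw \<gamma> \<zeta>) = 0" by simp
      then show False using Im_theta_jostw[OF \<zeta>(1), of \<gamma>] theta_square_integral_pos[OF \<zeta>(1)] \<zeta> by simp
    qed
    moreover have "jm 0 0 \<noteq> 0" using theta_0_nonzero[of 0 \<gamma>] True th by simp
    ultimately show thesis using that[of "\<lambda>\<zeta>. jm \<zeta> 0"] continuous_jm by blast
  qed
  obtain d1 where d1: "0 < d1" "\<And>\<zeta>. norm \<zeta> < d1 \<Longrightarrow> \<zeta> \<notin> jzeros \<gamma>" by (rule jzeros_away_from_0) blast
  obtain d2 where d2: "0 < d2" "\<And>\<zeta>. \<zeta> \<in> closed_uhp \<Longrightarrow> norm \<zeta> < d2 \<Longrightarrow> norm (a \<zeta> / a 0 - 1) < 1/2"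
    by (rule eventually_quotient_near_1[OF a(1) _ a(2)]) auto
  have Bl0: "Bl \<gamma> 0 \<noteq> 0" using norm_Bl_0[of \<gamma>] by auto
  obtain d3 where d3: "0 < d3" "\<And>\<zeta>. \<zeta> \<in> - jzeros \<gamma> \<Longrightarrow> norm \<zeta> < d3 \<Longrightarrow> norm (Bl \<gamma> \<zeta> / Bl \<gamma> 0 - 1) < 1/2"
    by (rule eventually_quotient_near_1[OF continuous_Bl _ Bl0]) (use jzeros_nonzero_real(1) in auto)
  define d where "d = min d1 (min d2 d3)"
  have d: "0 < d" "d \<le> d1" "d \<le> d2" "d \<le> d3" using d1(1) d2(1) d3(1) by (auto simp: d_def)
  \<comment> \<open>The imaginary axis has to be avoided, hence two quarter discs, distinguished by
    the sign s. On each, F differs by a constant from \<open>L\<close>, a combination of four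
    principal logarithms, each with imaginary part at most \<pi>.\<close>
  have quarter: "\<exists>B. \<forall>\<zeta>. 0 \<le> Im \<zeta> \<and> 0 \<le> s * Re \<zeta> \<and> \<zeta> \<noteq> 0 \<and> norm \<zeta> < d \<longrightarrow> \<bar>Im (F \<zeta>)\<bar> \<le> B"
    if s: "s = 1 \<or> s = - 1" for s :: real
  proof -
    let ?S = "{\<zeta>. 0 < Im \<zeta> \<and> 0 < s * Re \<zeta> \<and> norm \<zeta> < d}"
    define L where "L \<zeta> = Ln (Bl \<gamma> \<zeta> / Bl \<gamma> 0) - Ln (of_real \<bar>\<gamma>\<bar> - \<i> * \<zeta>) + (Ln (a \<zeta> / a 0) + Ln (jostw \<gamma> \<zeta> / a \<zeta>))" for \<zeta>
    have aN: "a \<zeta> / a 0 \<notin> \<real>\<^sub>\<le>\<^sub>0" "a \<zeta> \<noteq> 0" if "\<zeta> \<in> ?S" for \<zeta>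
    proof -
      have "norm (a \<zeta> / a 0 - 1) < 1/2" using d2(2)[of \<zeta>] that d(3) by auto
      then show "a \<zeta> / a 0 \<notin> \<real>\<^sub>\<le>\<^sub>0" by (rule not_nonpos_Reals_near_1)
      then show "a \<zeta> \<noteq> 0" by auto
    qed
    have BN: "Bl \<gamma> \<zeta> / Bl \<gamma> 0 \<notin> \<real>\<^sub>\<le>\<^sub>0" if "\<zeta> \<in> ?S" for \<zeta>
      using d3(2)[of \<zeta>] d1(2)[of \<zeta>] that d(2,4) by (intro not_nonpos_Reals_near_1) auto
    have DN: "of_real \<bar>\<gamma>\<bar> - \<i> * \<zeta> \<notin> \<real>\<^sub>\<le>\<^sub>0" if "\<zeta> \<in> ?S" for \<zeta>
      using that by (auto simp: complex_nonpos_Reals_iff)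
    have WN: "jostw \<gamma> \<zeta> / a \<zeta> \<notin> \<real>\<^sub>\<le>\<^sub>0" if "\<zeta> \<in> ?S" for \<zeta>
    proof -
      have "Re \<zeta> \<noteq> 0" using that by auto
      then show ?thesis using a(3)[of \<zeta>] aN(2)[OF that] that by auto
    qed
    have sub: "?S \<subseteq> closed_uhp" "?S \<subseteq> closed_uhp - {0}" "?S \<subseteq> - jzeros \<gamma>" using d1(2) d(2) by auto
    have contL: "continuous_on ?S L"
      unfolding L_def[abs_def]
      using aN BN DN WN
      by (intro continuous_intros continuous_on_subset[OF continuous_Bl sub(3)]
          continuous_on_subset[OF a(1) sub(1)] continuous_on_subset[OF continuous_jostw sub(1)]) (use Bl0 a(2) in auto)
    have eq: "exp (F \<zeta>) = (Bl \<gamma> 0 * a 0) * exp (L \<zeta>)" if "\<zeta> \<in> ?S" for \<zeta>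
    proof -
      have nz: "Bl \<gamma> \<zeta> / Bl \<gamma> 0 \<noteq> 0" "of_real \<bar>\<gamma>\<bar> - \<i> * \<zeta> \<noteq> 0" "a \<zeta> / a 0 \<noteq> 0" "jostw \<gamma> \<zeta> / a \<zeta> \<noteq> 0"
        by (rule nonzero_if_not_nonpos_Reals; fact aN(1)[OF that] BN[OF that] DN[OF that] WN[OF that])+
      have "exp (L \<zeta>) = Bl \<gamma> \<zeta> / Bl \<gamma> 0 / (of_real \<bar>\<gamma>\<bar> - \<i> * \<zeta>) * (a \<zeta> / a 0 * (jostw \<gamma> \<zeta> / a \<zeta>))"
        unfolding L_def exp_add exp_diff by (simp only: exp_Ln[OF nz(1)] exp_Ln[OF nz(2)] exp_Ln[OF nz(3)] exp_Ln[OF nz(4)])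
      then have "(Bl \<gamma> 0 * a 0) * exp (L \<zeta>) = Efun \<gamma> \<zeta>"
        using Bl0 a(2) aN(2)[OF that] by (simp add: Efun_Bl)
      then show ?thesis using F(2)[of \<zeta>] sub that by auto
    qed
    have "\<bar>Im (L \<zeta>)\<bar> \<le> 4 * pi" if "\<zeta> \<in> ?S" for \<zeta>
    proof -
      have nz: "Bl \<gamma> \<zeta> / Bl \<gamma> 0 \<noteq> 0" "of_real \<bar>\<gamma>\<bar> - \<i> * \<zeta> \<noteq> 0" "a \<zeta> / a 0 \<noteq> 0" "jostw \<gamma> \<zeta> / a \<zeta> \<noteq> 0"
        by (rule nonzero_if_not_nonpos_Reals; fact aN(1)[OF that] BN[OF that] DN[OF that] WN[OF that])+
      have "\<bar>Im (Ln z)\<bar> \<le> pi" if "z \<noteq> 0" for z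
        using mpi_less_Im_Ln[OF that] Im_Ln_le_pi[OF that] by linarith
      from this[OF nz(1)] this[OF nz(2)] this[OF nz(3)] this[OF nz(4)]
      show ?thesis unfolding L_def minus_complex.sel plus_complex.sel by linarith
    qed
    moreover have "continuous_on ?S F" by (rule continuous_on_subset[OF F(1) sub(2)])
    moreover have "Bl \<gamma> 0 * a 0 \<noteq> 0" using Bl0 a(2) by simp
    ultimately obtain B where B: "\<And>x. x \<in> ?S \<Longrightarrow> \<bar>Im (F x)\<bar> \<le> B"
      using Im_bounded_if_exp_eq[OF convex_connected[OF convex_quarter_disc] _ contL _ eq] by blast
    have "\<bar>Im (F \<zeta>)\<bar> \<le> B" if \<zeta>: "0 \<le> Im \<zeta>" "0 \<le> s * Re \<zeta>" "\<zeta> \<noteq> 0" "norm \<zeta> < d" for \<zeta>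
    proof (rule bound_extends_to_closure[OF _ sub(2) _ quarter_disc_closure[OF s \<zeta>(1,2,4)] B])
      show "continuous_on (closed_uhp - {0}) (\<lambda>a. \<bar>Im (F a)\<bar>)" by (intro continuous_intros F(1))
    qed (use \<zeta> in auto)
    then show ?thesis by blast
  qed
  obtain B1 where B1: "\<And>\<zeta>. 0 \<le> Im \<zeta> \<Longrightarrow> 0 \<le> Re \<zeta> \<Longrightarrow> \<zeta> \<noteq> 0 \<Longrightarrow> norm \<zeta> < d \<Longrightarrow> \<bar>Im (F \<zeta>)\<bar> \<le> B1"
    using quarter[of 1] by auto
  obtain B2 where B2: "\<And>\<zeta>. 0 \<le> Im \<zeta> \<Longrightarrow> Re \<zeta> \<le> 0 \<Longrightarrow> \<zeta> \<noteq> 0 \<Longrightarrow> norm \<zeta> < d \<Longrightarrow> \<bar>Im (F \<zeta>)\<bar> \<le> B2"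
    using quarter[of "- 1"] by auto
  have "\<bar>Im (F \<zeta>)\<bar> \<le> max B1 B2" if "0 \<le> Im \<zeta>" "\<zeta> \<noteq> 0" "norm \<zeta> < d" for \<zeta>
    using B1[of \<zeta>] B2[of \<zeta>] that by (cases "0 \<le> Re \<zeta>") auto
  then show thesis using that d(1) by blast
qed

text \<open>|E| lies between multiples of |\<zeta>| and of 1 / |\<zeta>|: the lower bound is that of
  w, the upper one stems from the denominator, whose modulus is at least |\<zeta>| also for \<gamma>
  = 0. Near 0 the Blaschke product has modulus between 1/2 and 2.\<close>

lemma Re_log_Efun_bounded:
  assumes F: "\<And>\<zeta>. \<zeta> \<in> closed_uhp - {0} - jzeros \<gamma> \<Longrightarrow> exp (F \<zeta>) = Efun \<gamma> \<zeta>"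
  obtains B d where "0 < d" "\<And>\<zeta>. 0 \<le> Im \<zeta> \<Longrightarrow> \<zeta> \<noteq> 0 \<Longrightarrow> norm \<zeta> < d \<Longrightarrow> \<bar>Re (F \<zeta>)\<bar> \<le> B + \<bar>ln (norm \<zeta>)\<bar>"
proof -
  obtain c d0 where cd: "0 < c" "0 < d0" "\<And>\<zeta>. 0 \<le> Im \<zeta> \<Longrightarrow> norm \<zeta> < d0 \<Longrightarrow> c * norm \<zeta> \<le> norm (jostw \<gamma> \<zeta>)"
    by (rule jostw_lower_bound_closed) blast
  obtain d1 where d1: "0 < d1" "\<And>\<zeta>. norm \<zeta> < d1 \<Longrightarrow> \<zeta> \<notin> jzeros \<gamma>" by (rule jzeros_away_from_0) blast
  have Bl0: "Bl \<gamma> 0 \<noteq> 0" using norm_Bl_0[of \<gamma>] by auto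
  obtain d3 where d3: "0 < d3" "\<And>\<zeta>. \<zeta> \<in> - jzeros \<gamma> \<Longrightarrow> norm \<zeta> < d3 \<Longrightarrow> norm (Bl \<gamma> \<zeta> / Bl \<gamma> 0 - 1) < 1/2"
    by (rule eventually_quotient_near_1[OF continuous_Bl _ Bl0]) (use jzeros_nonzero_real(1) in auto)
  have "compact (closed_uhp \<inter> cball 0 1)"
    by (intro closed_Int_compact closed_halfspace_Im_ge compact_cball)
  then have "compact (jostw \<gamma> ` (closed_uhp \<inter> cball 0 1))"
    by (intro compact_continuous_image continuous_on_subset[OF continuous_jostw]) auto
  then have "bounded (jostw \<gamma> ` (closed_uhp \<inter> cball 0 1))" by (rule compact_imp_bounded)
  then obtain M where M: "0 < M" "\<And>\<zeta>. 0 \<le> Im \<zeta> \<Longrightarrow> norm \<zeta> \<le> 1 \<Longrightarrow> norm (jostw \<gamma> \<zeta>) \<le> M"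
    unfolding bounded_pos by auto
  define d where "d = Min {d0, d1, d3, 1}"
  have d: "0 < d" "d \<le> d0" "d \<le> d1" "d \<le> d3" "d \<le> 1" using cd(2) d1(1) d3(1) by (auto simp: d_def)
  let ?c = "c / (\<bar>\<gamma>\<bar> + 1) / 2" and ?C = "2 * M"
  have "\<bar>Re (F \<zeta>)\<bar> \<le> (\<bar>ln ?c\<bar> + \<bar>ln ?C\<bar>) + \<bar>ln (norm \<zeta>)\<bar>" if \<zeta>: "0 \<le> Im \<zeta>" "\<zeta> \<noteq> 0" "norm \<zeta> < d" for \<zeta>
  proof -
    have nz: "\<zeta> \<notin> jzeros \<gamma>" using d1(2)[of \<zeta>] \<zeta>(3) d(3) by simp
    have b1: "norm (Bl \<gamma> \<zeta> / Bl \<gamma> 0 - 1) < 1/2" using d3(2)[of \<zeta>] nz \<zeta>(3) d(4) by simp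
    have "norm (Bl \<gamma> \<zeta> / Bl \<gamma> 0) = norm (Bl \<gamma> \<zeta>)" by (simp add: norm_divide norm_Bl_0)
    then have b: "1/2 \<le> norm (Bl \<gamma> \<zeta>)" "norm (Bl \<gamma> \<zeta>) \<le> 2"
      using b1 norm_triangle_ineq3[of "Bl \<gamma> \<zeta> / Bl \<gamma> 0" 1] by auto
    have n: "norm \<zeta> \<le> norm (of_real \<bar>\<gamma>\<bar> - \<i> * \<zeta>)" by (rule norm_denominator_ge[OF \<zeta>(1)])
    have n2: "norm (of_real \<bar>\<gamma>\<bar> - \<i> * \<zeta>) \<le> \<bar>\<gamma>\<bar> + 1"
      using norm_triangle_ineq4[of "of_real \<bar>\<gamma>\<bar>" "\<i> * \<zeta>"] \<zeta>(3) d(5) by (simp add: norm_mult)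
    have z0: "0 < norm \<zeta>" using \<zeta>(2) by simp
    have w: "c * norm \<zeta> \<le> norm (jostw \<gamma> \<zeta>)" "norm (jostw \<gamma> \<zeta>) \<le> M"
      using cd(3)[of \<zeta>] M(2)[of \<zeta>] \<zeta> d(2,5) by auto
    have E: "norm (Efun \<gamma> \<zeta>) = norm (jostw \<gamma> \<zeta>) / norm (of_real \<bar>\<gamma>\<bar> - \<i> * \<zeta>) * norm (Bl \<gamma> \<zeta>)"
      by (simp add: Efun_Bl norm_mult norm_divide)
    have "c * norm \<zeta> / (\<bar>\<gamma>\<bar> + 1) * (1/2) \<le> norm (Efun \<gamma> \<zeta>)"
      unfolding E using w(1) n n2 z0 b cd(1) by (intro mult_mono frac_le) auto
    then have lo: "?c * norm \<zeta> \<le> norm (Efun \<gamma> \<zeta>)" by simp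
    have "norm (Efun \<gamma> \<zeta>) \<le> M / norm \<zeta> * 2"
      unfolding E using w(2) n z0 b M(1) by (intro mult_mono frac_le) auto
    then have hi: "norm (Efun \<gamma> \<zeta>) \<le> ?C / norm \<zeta>" by (simp add: mult.commute)
    have "exp (Re (F \<zeta>)) = norm (Efun \<gamma> \<zeta>)" using F[of \<zeta>] nz \<zeta> norm_exp_eq_Re[of "F \<zeta>"] by auto
    then have R: "Re (F \<zeta>) = ln (norm (Efun \<gamma> \<zeta>))" by (metis ln_exp)
    have pc: "0 < ?c" using cd(1) by auto
    have "ln (?c * norm \<zeta>) \<le> Re (F \<zeta>)" unfolding R using lo mult_pos_pos[OF pc z0]
      by (intro ln_mono) linarith+
    then have 1: "ln ?c + ln (norm \<zeta>) \<le> Re (F \<zeta>)" using pc z0 by (subst (asm) ln_mult_pos) auto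
    have "0 < ?c * norm \<zeta>" using pc z0 by (rule mult_pos_pos)
    then have "Re (F \<zeta>) \<le> ln (?C / norm \<zeta>)" unfolding R using hi lo
      by (intro ln_mono) linarith+
    then have 2: "Re (F \<zeta>) \<le> ln ?C - ln (norm \<zeta>)" using M(1) z0 by (subst (asm) ln_divide_pos) auto
    show ?thesis using 1 2 by linarith
  qed
  then show thesis using that d(1) by blast
qed

lemma log_Efun_near_0:
  assumes F: "continuous_on (closed_uhp - {0}) F"
    "\<And>\<zeta>. \<zeta> \<in> closed_uhp - {0} - jzeros \<gamma> \<Longrightarrow> exp (F \<zeta>) = Efun \<gamma> \<zeta>"
  obtains A d where "0 < d" "\<And>\<zeta>. 0 \<le> Im \<zeta> \<Longrightarrow> \<zeta> \<noteq> 0 \<Longrightarrow> norm \<zeta> < d \<Longrightarrow> norm (\<zeta> * F \<zeta>) \<le> A * sqrt (norm \<zeta>)"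
proof -
  obtain B1 d1 where 1: "0 < d1" "\<And>\<zeta>. 0 \<le> Im \<zeta> \<Longrightarrow> \<zeta> \<noteq> 0 \<Longrightarrow> norm \<zeta> < d1 \<Longrightarrow> \<bar>Im (F \<zeta>)\<bar> \<le> B1"
    by (rule Im_log_Efun_bounded[OF F]) blast+
  obtain B2 d2 where 2: "0 < d2" "\<And>\<zeta>. 0 \<le> Im \<zeta> \<Longrightarrow> \<zeta> \<noteq> 0 \<Longrightarrow> norm \<zeta> < d2 \<Longrightarrow> \<bar>Re (F \<zeta>)\<bar> \<le> B2 + \<bar>ln (norm \<zeta>)\<bar>"
    by (rule Re_log_Efun_bounded[OF F(2)]) blast+
  have "norm (\<zeta> * F \<zeta>) \<le> (\<bar>B1\<bar> + \<bar>B2\<bar> + 2) * sqrt (norm \<zeta>)"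
    if \<zeta>: "0 \<le> Im \<zeta>" "\<zeta> \<noteq> 0" "norm \<zeta> < min (min d1 d2) 1" for \<zeta>
  proof -
    let ?t = "norm \<zeta>"
    have t: "0 < ?t" "?t \<le> 1" using \<zeta> by auto
    have "norm (F \<zeta>) \<le> \<bar>Re (F \<zeta>)\<bar> + \<bar>Im (F \<zeta>)\<bar>" by (rule cmod_le)
    also have "\<dots> \<le> (\<bar>B1\<bar> + \<bar>B2\<bar>) + 2 / sqrt ?t"
      using 1(2)[of \<zeta>] 2(2)[of \<zeta>] abs_ln_le[OF t] \<zeta> by auto
    finally have "norm \<zeta> * norm (F \<zeta>) \<le> ?t * ((\<bar>B1\<bar> + \<bar>B2\<bar>) + 2 / sqrt ?t)" by (intro mult_left_mono) auto
    also have "\<dots> = (\<bar>B1\<bar> + \<bar>B2\<bar>) * ?t + 2 * (?t / sqrt ?t)" by (simp add: algebra_simps)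
    also have "?t / sqrt ?t = sqrt ?t" using t by (simp add: real_div_sqrt)
    also have "(\<bar>B1\<bar> + \<bar>B2\<bar>) * ?t \<le> (\<bar>B1\<bar> + \<bar>B2\<bar>) * sqrt ?t"
    proof (intro mult_left_mono)
      have "sqrt ?t * sqrt ?t \<le> sqrt ?t * 1" using t by (intro mult_left_mono) auto
      then show "?t \<le> sqrt ?t" using t by simp
    qed auto
    finally show ?thesis by (simp add: norm_mult algebra_simps)
  qed
  then show thesis using that[of "min (min d1 d2) 1"] 1(1) 2(1) by auto
qed

text \<open>Zeros on the imaginary axis satisfy cnj z = - z, so each Blaschke factor has the same
  reflection symmetry as w.\<close>

lemma Efun_cnj:
  shows "Efun \<gamma> (- of_real k) = cnj (Efun \<gamma> (of_real k))"
proof -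
  have "jostw \<gamma> (- of_real k) = cnj (jostw \<gamma> (of_real k))" using jostw_cnj[of "of_real k" \<gamma>] by simp
  moreover have "(- of_real k + z) / (- of_real k - z) = cnj ((of_real k + z) / (of_real k - z))" if "z \<in> jzeros \<gamma>" for z
  proof -
    have "cnj z = - z" using jzeros_imaginary(1)[OF that] by (metis complex_cnj_i complex_cnj_mult complex_cnj_complex_of_real mult_minus_left)
    then have "cnj ((of_real k + z) / (of_real k - z)) = (of_real k - z) / (of_real k + z)" by simp
    also have "\<dots> = (- (of_real k - z)) / (- (of_real k + z))" by (simp only: minus_divide_divide)
    finally show ?thesis by simp
  qed
  ultimately show ?thesis by (simp add: Efun_def cong: prod.cong)
qed

text \<open>\<zeta> F(\<zeta>), set to 0 at 0, is continuous on the closed half plane, and its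
  expansion arises from \<open>Qf\<close> by inserting y = - \<i> / (2 \<zeta>). The powers of -
  \<i> / 2 account for the alternation of real and imaginary coefficients and for the denominators
  2, 4, 8, 16.\<close>

lemma trace_log_Efun:
  obtains F :: "complex \<Rightarrow> complex" where "continuous_on {0<..} (\<lambda>k. F (of_real k))"
    "((\<lambda>k. F (of_real k)) \<longlongrightarrow> 0) at_top" "\<And>k. 0 < k \<Longrightarrow> exp (F (of_real k)) = Efun \<gamma> (of_real k)"
    "set_integrable lborel {0<..} (\<lambda>k. Re (F (of_real k)))"
    "(LINT k:{0<..}|lborel. Re (F (of_real k))) = - pi * c1 \<gamma> / 4"
    "set_integrable lborel {0<..} (\<lambda>k. k * Im (F (of_real k)) + c1 \<gamma> / 2)"
    "(LINT k:{0<..}|lborel. k * Im (F (of_real k)) + c1 \<gamma> / 2) = pi * v 0 0 / 8"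
    "set_integrable lborel {0<..} (\<lambda>k. k\<^sup>2 * Re (F (of_real k)) + v 0 0 / 4)"
    "(LINT k:{0<..}|lborel. k\<^sup>2 * Re (F (of_real k)) + v 0 0 / 4) = pi * c3 \<gamma> / 16"
    "set_integrable lborel {0<..} (\<lambda>k. k ^ 3 * Im (F (of_real k)) + c1 \<gamma> / 2 * k\<^sup>2 - c3 \<gamma> / 8)"
    "(LINT k:{0<..}|lborel. k ^ 3 * Im (F (of_real k)) + c1 \<gamma> / 2 * k\<^sup>2 - c3 \<gamma> / 8) = - pi * c4 \<gamma> / 32"
proof -
  obtain F R K where F: "continuous_on (closed_uhp - {0}) F" "F holomorphic_on open_uhp"
    "\<And>\<zeta>. \<zeta> \<in> closed_uhp - {0} - jzeros \<gamma> \<Longrightarrow> exp (F \<zeta>) = Efun \<gamma> \<zeta>" "1 \<le> R" "0 \<le> K"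
    "\<And>\<zeta>. 0 \<le> Im \<zeta> \<Longrightarrow> R \<le> norm \<zeta> \<Longrightarrow> norm (F \<zeta> - Qf \<gamma> (yvar \<zeta>)) \<le> K / norm \<zeta> ^ 5"
    by (rule log_Efun) (rule that)
  obtain A d where A: "0 < d" "\<And>\<zeta>. 0 \<le> Im \<zeta> \<Longrightarrow> \<zeta> \<noteq> 0 \<Longrightarrow> norm \<zeta> < d \<Longrightarrow> norm (\<zeta> * F \<zeta>) \<le> A * sqrt (norm \<zeta>)"
    by (rule log_Efun_near_0[OF F(1,3)]) blast+
  define B where "B = K + (\<bar>c1 \<gamma>\<bar> + \<bar>v 0 0\<bar> + \<bar>c3 \<gamma>\<bar> + \<bar>c4 \<gamma>\<bar>)"
  have Finf: "norm (F \<zeta>) \<le> B / norm \<zeta>" if \<zeta>: "0 \<le> Im \<zeta>" "R \<le> norm \<zeta>" for \<zeta>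
  proof -
    have n: "1 \<le> norm \<zeta>" using \<zeta>(2) F(4) by simp
    have "norm \<zeta> ^ 1 \<le> norm \<zeta> ^ 5" using n by (intro power_increasing) auto
    then have "K / norm \<zeta> ^ 5 \<le> K / norm \<zeta>" using n F(5) by (intro frac_le) auto
    then have "norm (F \<zeta> - Qf \<gamma> (yvar \<zeta>)) \<le> K / norm \<zeta>" using F(6)[OF \<zeta>] by linarith
    then have "norm (F \<zeta>) \<le> K / norm \<zeta> + norm (Qf \<gamma> (yvar \<zeta>))"
      using norm_triangle_sub[of "F \<zeta>" "Qf \<gamma> (yvar \<zeta>)"] by linarith
    then show ?thesis using norm_Qf_le[OF n, of \<gamma>] by (simp add: B_def add_divide_distrib)
  qed
  have contr: "continuous_on {0<..} (\<lambda>k. F (of_real k))" "continuous_on {0<..} (\<lambda>k. F (of_real (- k)))"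
    by (rule continuous_on_compose2[OF F(1)]; auto intro!: continuous_intros)+
  have lim0: "((\<lambda>k. B / k) \<longlongrightarrow> 0) at_top"
    by (rule real_tendsto_divide_at_top[OF tendsto_const filterlim_ident])
  have lim: "((\<lambda>k. F (of_real k)) \<longlongrightarrow> 0) at_top" "((\<lambda>k. F (of_real (- k))) \<longlongrightarrow> 0) at_top"
  proof -
    have "\<forall>\<^sub>F k in at_top. norm (F (of_real k)) \<le> B / k"
    proof (rule eventually_mono[OF eventually_ge_at_top[of R]])
      fix k assume "R \<le> k" then show "norm (F (of_real k)) \<le> B / k" using Finf[of "of_real k"] F(4) by simp
    qed
    then show "((\<lambda>k. F (of_real k)) \<longlongrightarrow> 0) at_top" by (rule Lim_null_comparison[OF _ lim0])
    have "\<forall>\<^sub>F k in at_top. norm (F (of_real (- k))) \<le> B / k"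
    proof (rule eventually_mono[OF eventually_ge_at_top[of R]])
      fix k assume "R \<le> k" then show "norm (F (of_real (- k))) \<le> B / k" using Finf[of "of_real (- k)"] F(4) by simp
    qed
    then show "((\<lambda>k. F (of_real (- k))) \<longlongrightarrow> 0) at_top" by (rule Lim_null_comparison[OF _ lim0])
  qed
  have expF: "exp (F (of_real k)) = Efun \<gamma> (of_real k)" if "k \<noteq> 0" for k
    by (rule F(3)) (use that jzeros_nonzero_real(2)[of k \<gamma>] in auto)
  \<comment> \<open>F(- k) and cnj (F(k)) are logarithms of the same function of k; their difference
    is constant for k > 0 and tends to 0 at infinity.\<close>
  have sym: "F (of_real (- k)) = cnj (F (of_real k))" if "0 < k" for k
  proof -
    let ?D = "\<lambda>k::real. F (of_real (- k)) - cnj (F (of_real k))"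
    have "?D k = ?D x" if "0 < x" for x
    proof (rule constant_if_exp_eq_1[where f = ?D and S = "{0<..}"])
      show "continuous_on {0<..} ?D" by (intro continuous_intros contr)
      fix x :: real assume "x \<in> {0<..}"
      then have x: "x \<noteq> 0" "- x \<noteq> 0" by auto
      have "exp (F (of_real (- x))) = cnj (exp (F (of_real x)))"
        using expF[OF x(1)] expF[OF x(2)] Efun_cnj[of \<gamma> x] by simp
      then show "exp (?D x) = 1" by (simp add: exp_diff exp_cnj)
    qed (use that \<open>0 < k\<close> in auto)
    then have "\<forall>\<^sub>F x in at_top. ?D x = ?D k"
      by (intro eventually_mono[OF eventually_gt_at_top[of 0]]) metis
    then have "(?D \<longlongrightarrow> ?D k) at_top" by (rule tendsto_eventually)
    moreover have "(?D \<longlongrightarrow> 0 - cnj 0) at_top" by (intro tendsto_intros lim)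
    ultimately have "?D k = 0 - cnj 0" by (rule tendsto_unique[OF trivial_limit_at_top_linorder])
    then show ?thesis by simp
  qed
  define Y where "Y \<zeta> = (if \<zeta> = 0 then 0 else \<zeta> * F \<zeta>)" for \<zeta>
  have Y: "norm (Y \<zeta>) \<le> A * sqrt (norm \<zeta>)" if "0 \<le> Im \<zeta>" "norm \<zeta> < d" for \<zeta>
    using A(2)[of \<zeta>] that by (auto simp: Y_def)
  have Y1: "continuous_on closed_uhp Y"
    unfolding continuous_on_def
  proof
    fix x :: complex assume x: "x \<in> closed_uhp"
    show "(Y \<longlongrightarrow> Y x) (at x within closed_uhp)"
    proof (cases "x = 0")
      case True
      have "((\<lambda>\<zeta>. A * sqrt (norm \<zeta>)) \<longlongrightarrow> A * sqrt (norm (0::complex))) (at 0 within closed_uhp)" by (intro tendsto_intros)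
      then have l: "((\<lambda>\<zeta>. A * sqrt (norm \<zeta>)) \<longlongrightarrow> 0) (at (0::complex) within closed_uhp)" by simp
      have "\<forall>\<^sub>F \<zeta> in at 0 within closed_uhp. norm (Y \<zeta>) \<le> A * sqrt (norm \<zeta>)"
        unfolding eventually_at using A(1) Y by (intro exI[of _ d]) auto
      then have "(Y \<longlongrightarrow> 0) (at 0 within closed_uhp)" by (rule Lim_null_comparison[OF _ l])
      then show ?thesis using True by (simp add: Y_def)
    next
      case False
      have "continuous_on (closed_uhp - {0}) (\<lambda>\<zeta>. \<zeta> * F \<zeta>)" by (intro continuous_intros F(1))
      then have "continuous_on (closed_uhp - {0}) Y" by (rule continuous_on_eq) (simp add: Y_def)
      then have "(Y \<longlongrightarrow> Y x) (at x within closed_uhp - {0})" using x False by (simp add: continuous_on_def)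
      moreover have "at x within closed_uhp - {0} = at x within closed_uhp"
        by (rule at_within_nhd[of _ "- {0}"]) (use False in auto)
      ultimately show ?thesis by simp
    qed
  qed
  have Y2: "Y holomorphic_on open_uhp"
  proof (rule holomorphic_transform)
    show "(\<lambda>\<zeta>. \<zeta> * F \<zeta>) holomorphic_on open_uhp" by (intro holomorphic_intros F(2))
  qed (auto simp: Y_def)
  have Y3: "Y (- of_real k) = - cnj (Y (of_real k))" for k
  proof -
    consider "k = 0" | "0 < k" | "0 < - k" by linarith
    then show ?thesis
      using sym[of k] sym[of "- k"] by cases (auto simp: Y_def)
  qed
  let ?p1 = "- c1 \<gamma> / 2" and ?p2 = "- v 0 0 / 4" and ?p3 = "c3 \<gamma> / 8" and ?p4 = "c4 \<gamma> / 16"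
  have Y4: "norm (Y \<zeta> - (\<i> * ?p1 + ?p2 / \<zeta> + \<i> * ?p3 / \<zeta>\<^sup>2 + ?p4 / \<zeta> ^ 3)) \<le> K / norm \<zeta> ^ 4"
    if \<zeta>: "0 \<le> Im \<zeta>" "R \<le> norm \<zeta>" for \<zeta> :: complex
  proof -
    have n: "1 \<le> norm \<zeta>" using \<zeta>(2) F(4) by simp
    then have z: "\<zeta> \<noteq> 0" by auto
    define u where "u = 1 / \<zeta>"
    have u: "\<zeta> * u = 1" using z by (simp add: u_def)
    have y: "yvar \<zeta> = - \<i> / 2 * u" by (simp add: u_def divide_simps)
    have e: "\<zeta> * (a * u ^ Suc n) = a * u ^ n" for a n
      using u by (simp add: mult_ac)
    have "\<zeta> * Qf \<gamma> (yvar \<zeta>) = \<zeta> * (\<i> * ?p1 * u ^ Suc 0 + ?p2 * u ^ Suc 1 + \<i> * ?p3 * u ^ Suc 2 + ?p4 * u ^ Suc 3)"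
      unfolding Qf_def y by (simp add: eval_nat_numeral algebra_simps)
    also have "\<dots> = \<i> * ?p1 * u ^ 0 + ?p2 * u ^ 1 + \<i> * ?p3 * u ^ 2 + ?p4 * u ^ 3"
      unfolding distrib_left e ..
    also have "\<dots> = \<i> * ?p1 + ?p2 / \<zeta> + \<i> * ?p3 / \<zeta>\<^sup>2 + ?p4 / \<zeta> ^ 3"
      by (simp add: u_def power_one_over)
    finally have "Y \<zeta> - (\<i> * ?p1 + ?p2 / \<zeta> + \<i> * ?p3 / \<zeta>\<^sup>2 + ?p4 / \<zeta> ^ 3) = \<zeta> * (F \<zeta> - Qf \<gamma> (yvar \<zeta>))"
      using z by (simp add: Y_def right_diff_distrib)
    also have "norm \<dots> \<le> norm \<zeta> * (K / norm \<zeta> ^ 5)"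
      unfolding norm_mult by (intro mult_left_mono F(6) \<zeta>) auto
    also have "\<dots> = K / norm \<zeta> ^ 4" using z by (simp add: eval_nat_numeral)
    finally show ?thesis .
  qed
  interpret T: trace_setup Y ?p1 ?p2 ?p3 ?p4 K R A d
  proof
    show "norm (Y \<zeta> - (\<i> * complex_of_real ?p1 + complex_of_real ?p2 / \<zeta> + \<i> * complex_of_real ?p3 / \<zeta>\<^sup>2 + complex_of_real ?p4 / \<zeta> ^ 3)) \<le> K / norm \<zeta> ^ 4"
      if "0 \<le> Im \<zeta>" "R \<le> norm \<zeta>" for \<zeta>
      using Y4[OF that] by simp
    show "norm (Y (of_real k)) \<le> A * sqrt k" if "0 < k" "k < d" for k
      using Y[of "of_real k"] that by simp
  qed (use Y1 Y2 Y3 F(4) A(1) in auto)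
  have Yk: "Re (Y (of_real k)) / k = Re (F (of_real k))" "Im (Y (of_real k)) = k * Im (F (of_real k))"
    "Re (Y (of_real k)) = k * Re (F (of_real k))" if "k \<in> {0<..}" for k
    using that by (auto simp: Y_def)
  have tr: "set_integrable lborel {0<..} f \<Longrightarrow> (LINT k:{0<..}|lborel. f k) = a \<Longrightarrow> (\<And>k. k \<in> {0<..} \<Longrightarrow> f k = g k) \<Longrightarrow> a = b \<Longrightarrow>
      set_integrable lborel {0<..} g \<and> (LINT k:{0<..}|lborel. g k) = b" for f g :: "real \<Rightarrow> real" and a b
  proof
    assume a: "set_integrable lborel {0<..} f" "(LINT k:{0<..}|lborel. f k) = a" "\<And>k. k \<in> {0<..} \<Longrightarrow> f k = g k" "a = b"
    show "set_integrable lborel {0<..} g" using a(1) set_integrable_cong[of lborel lborel "{0<..}" "{0<..}" f g] a(3) by auto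
    have "(LINT k:{0<..}|lborel. f k) = (LINT k:{0<..}|lborel. g k)"
      by (intro set_lebesgue_integral_cong) (use a(3) in auto)
    then show "(LINT k:{0<..}|lborel. g k) = b" using a by simp
  qed
  have t1: "set_integrable lborel {0<..} (\<lambda>k. Re (F (of_real k))) \<and>
      (LINT k:{0<..}|lborel. Re (F (of_real k))) = - pi * c1 \<gamma> / 4"
    by (rule tr[OF T.trace1]) (auto simp: Yk)
  have t2: "set_integrable lborel {0<..} (\<lambda>k. k * Im (F (of_real k)) + c1 \<gamma> / 2) \<and>
      (LINT k:{0<..}|lborel. k * Im (F (of_real k)) + c1 \<gamma> / 2) = pi * v 0 0 / 8"
    by (rule tr[OF T.trace2]) (auto simp: Yk)
  have t3: "set_integrable lborel {0<..} (\<lambda>k. k\<^sup>2 * Re (F (of_real k)) + v 0 0 / 4) \<and>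
      (LINT k:{0<..}|lborel. k\<^sup>2 * Re (F (of_real k)) + v 0 0 / 4) = pi * c3 \<gamma> / 16"
    by (rule tr[OF T.trace3]) (auto simp: Yk power2_eq_square)
  have t4: "set_integrable lborel {0<..} (\<lambda>k. k ^ 3 * Im (F (of_real k)) + c1 \<gamma> / 2 * k\<^sup>2 - c3 \<gamma> / 8) \<and>
      (LINT k:{0<..}|lborel. k ^ 3 * Im (F (of_real k)) + c1 \<gamma> / 2 * k\<^sup>2 - c3 \<gamma> / 8) = - pi * c4 \<gamma> / 32"
    by (rule tr[OF T.trace4]) (auto simp: Yk eval_nat_numeral)
  show thesis
    by (rule that[of F, OF contr(1) lim(1) _ conjunct1[OF t1] conjunct2[OF t1] conjunct1[OF t2] conjunct2[OF t2]
        conjunct1[OF t3] conjunct2[OF t3] conjunct1[OF t4] conjunct2[OF t4]]) (use expF in auto)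
qed

end

section \<open>Phases and trace formulas\<close>

lemma set_integral_FTC_Ioi_nonneg:
  fixes f F :: "real \<Rightarrow> real"
  assumes "continuous_on UNIV f" "\<And>x. a \<le> x \<Longrightarrow> DERIV F x :> f x"
    and "\<And>x. a \<le> x \<Longrightarrow> 0 \<le> f x" and "(F \<longlongrightarrow> T) at_top"
  shows "set_integrable lborel {a<..} f" "(LINT x:{a<..}|lborel. f x) = T - F a"
proof -
  note i = set_integral_FTC_atLeast_nonneg[OF assms]
  show 1: "set_integrable lborel {a<..} f" by (rule set_integrable_subset[OF i(1)]) auto
  have "(LINT x:{a<..}|lborel. f x) = (LINT x:{a..}|lborel. f x)"
  proof (rule set_integral_cong_set)
    show "set_borel_measurable lborel {a..} f" "set_borel_measurable lborel {a<..} f"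
      using i(1) 1 by (auto simp: set_integrable_def set_borel_measurable_def)
    show "AE x in lborel. (x \<in> {a..}) = (x \<in> {a<..})"
      by (rule AE_mp[OF AE_lborel_singleton[of a]]) auto
  qed
  then show "(LINT x:{a<..}|lborel. f x) = T - F a" using i(2) by simp
qed

section \<open>Integrals of the phases of the Blaschke factors\<close>

lemma arctan_swap: "0 < x \<Longrightarrow> 0 < y \<Longrightarrow> arctan (x / y) = pi / 2 - arctan (y / x)" for x y :: real
  using arctan_inverse[of "y / x"] by simp

lemma arctan_ge_cubic:
  fixes x :: real
  assumes "0 \<le> x"
  shows "x - x ^ 3 / 3 \<le> arctan x"
proof -
  have "arctan 0 - (0 - 0 ^ 3 / 3) \<le> arctan x - (x - x ^ 3 / 3)"
  proof (rule DERIV_nonneg_imp_nondecreasing[OF assms])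
    fix t :: real
    have "(1 - t\<^sup>2) * (1 + t\<^sup>2) \<le> 1" by (simp add: algebra_simps)
    moreover have p: "0 < 1 + t\<^sup>2" by (simp add: add_pos_nonneg)
    ultimately have "1 - t\<^sup>2 \<le> 1 / (1 + t\<^sup>2)" by (simp add: pos_le_divide_eq)
    then have "0 \<le> inverse (1 + t\<^sup>2) - (1 - t\<^sup>2)" by (simp add: divide_inverse)
    moreover have "((\<lambda>x. arctan x - (x - x ^ 3 / 3)) has_real_derivative inverse (1 + t\<^sup>2) - (1 - t\<^sup>2)) (at t)"
      by (auto intro!: derivative_eq_intros)
    ultimately show "\<exists>y. ((\<lambda>x. arctan x - (x - x ^ 3 / 3)) has_real_derivative y) (at t) \<and> 0 \<le> y" by blast
  qed
  then show ?thesis by simp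
qed

lemma arctan_le_id: "0 \<le> x \<Longrightarrow> arctan x \<le> x" for x :: real
proof -
  assume x: "0 \<le> x"
  have "arctan x - x \<le> arctan 0 - 0"
  proof (rule DERIV_nonpos_imp_nonincreasing[OF x])
    fix t :: real
    have "inverse (1 + t\<^sup>2) \<le> 1" by (simp add: inverse_le_1_iff)
    moreover have "((\<lambda>x. arctan x - x) has_real_derivative inverse (1 + t\<^sup>2) - 1) (at t)"
      by (auto intro!: derivative_eq_intros)
    ultimately show "\<exists>y. ((\<lambda>x. arctan x - x) has_real_derivative y) (at t) \<and> y \<le> 0"
      by (intro exI[of _ "inverse (1 + t\<^sup>2) - 1"]) auto
  qed
  then show ?thesis by simp
qed

lemma DERIV_arctan_scaled:
  fixes t :: real
  assumes "0 < t"
  shows "((\<lambda>k. arctan (k / t)) has_real_derivative t / (t\<^sup>2 + k\<^sup>2)) (at k)"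
proof -
  have "0 < t\<^sup>2 + k\<^sup>2" using assms by (simp add: add_pos_nonneg)
  then have "inverse (1 + (k / t)\<^sup>2) * (1 / t) = t / (t\<^sup>2 + k\<^sup>2)"
  proof -
    have "t \<noteq> 0" using assms by simp
    then have "1 + (k / t)\<^sup>2 = (t\<^sup>2 + k\<^sup>2) / t\<^sup>2" using assms by (simp add: power_divide add_divide_distrib)
    then have "inverse (1 + (k / t)\<^sup>2) * (1 / t) = (t * t) / (t\<^sup>2 + k\<^sup>2) * (1 / t)"
      by (simp add: power2_eq_square)
    then show ?thesis using assms by simp
  qed
  moreover have "((\<lambda>k. arctan (k / t)) has_real_derivative inverse (1 + (k / t)\<^sup>2) * (1 / t)) (at k)"
    by (rule DERIV_chain2[OF DERIV_arctan]) (use assms in \<open>auto intro!: derivative_eq_intros\<close>)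
  ultimately show ?thesis by simp
qed

text \<open>Written with \<pi> / 2 - arctan(k / t) the integrand is smooth at k = 0, so one
  elementary antiderivative serves on the closed half-line. Its sign, which yields integrability, is
  the inequality arctan x \<le> x.\<close>

lemma integral_arctan_1:
  fixes t :: real
  assumes t: "0 < t"
  shows "set_integrable lborel {0<..} (\<lambda>k. k * arctan (t / k) - t)"
    "(LINT k:{0<..}|lborel. k * arctan (t / k) - t) = - pi / 4 * t\<^sup>2"
proof -
  let ?A = "\<lambda>k. pi / 2 - arctan (k / t)"
  let ?f = "\<lambda>k. t - k * ?A k"
  let ?F = "\<lambda>k. t * k / 2 - k\<^sup>2 / 2 * ?A k + t\<^sup>2 / 2 * arctan (k / t)"
  have s: "arctan (t / k) = ?A k" if "0 < k" for k by (rule arctan_swap[OF t that])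
  have F1: "DERIV ?F k :> ?f k" for k
  proof -
    define q where "q = t / (t\<^sup>2 + k\<^sup>2)"
    have p: "0 < t\<^sup>2 + k\<^sup>2" using t by (simp add: add_pos_nonneg)
    have q: "(t\<^sup>2 + k\<^sup>2) * q = t" using p by (simp add: q_def)
    have D: "((\<lambda>k. t * k / 2 - k\<^sup>2 / 2 * (pi / 2 - a k) + t\<^sup>2 / 2 * a k) has_real_derivative
        t / 2 - (k * (pi / 2 - a k) - k\<^sup>2 * q / 2) + t\<^sup>2 * q / 2) (at k)"
      if "(a has_real_derivative q) (at k)" for a
      by (rule derivative_eq_intros that refl | simp add: mult.commute)+
    have "DERIV ?F k :> t / 2 - (k * ?A k - k\<^sup>2 * q / 2) + t\<^sup>2 * q / 2"
      by (rule D) (unfold q_def, rule DERIV_arctan_scaled[OF t])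
    moreover have "t / 2 - (k * ?A k - k\<^sup>2 * q / 2) + t\<^sup>2 * q / 2 = t / 2 - k * ?A k + ((t\<^sup>2 + k\<^sup>2) * q) / 2"
      by (simp add: distrib_right add_divide_distrib)
    ultimately show ?thesis unfolding q by simp
  qed
  have f0: "0 \<le> ?f k" if "0 \<le> k" for k
  proof (cases "k = 0")
    case False
    then have k: "0 < k" using that by simp
    have "k * arctan (t / k) \<le> k * (t / k)" using t k by (intro mult_left_mono arctan_le_id) auto
    then show ?thesis using s[OF k] k by simp
  qed (use t in simp)
  have "(?F \<longlongrightarrow> pi / 4 * t\<^sup>2) at_top" using t by real_asymp
  note I = set_integral_FTC_Ioi_nonneg[of ?f 0 ?F, OF _ F1 f0 this]
  have c: "continuous_on UNIV ?f" using t by (intro continuous_intros) auto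
  have i1: "set_integrable lborel {0<..} (\<lambda>k. - ?f k)"
    using set_integrable_mult_right[of "- 1", OF I(1)[OF c]] by (simp only: mult_minus1)
  have eq: "- ?f k = k * arctan (t / k) - t" if "k \<in> {0<..}" for k using s[of k] that by simp
  show "set_integrable lborel {0<..} (\<lambda>k. k * arctan (t / k) - t)"
    using i1 set_integrable_cong[of lborel lborel "{0<..}" "{0<..}" "\<lambda>k. - ?f k" "\<lambda>k. k * arctan (t / k) - t"] eq by auto
  have "(LINT k:{0<..}|lborel. k * arctan (t / k) - t) = (LINT k:{0<..}|lborel. - ?f k)"
    by (intro set_lebesgue_integral_cong) (use eq in auto)
  also have "\<dots> = - (LINT k:{0<..}|lborel. ?f k)" by (rule set_integral_uminus[OF I(1)[OF c]])
  also have "(LINT k:{0<..}|lborel. ?f k) = pi / 4 * t\<^sup>2 - ?F 0" by (rule I(2)[OF c])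
  also have "- (pi / 4 * t\<^sup>2 - ?F 0) = - pi / 4 * t\<^sup>2" by simp
  finally show "(LINT k:{0<..}|lborel. k * arctan (t / k) - t) = - pi / 4 * t\<^sup>2" .
qed

text \<open>The same method one Taylor step further: the sign of the integrand is now arctan x \<ge>
  x - x^3 / 3.\<close>

lemma integral_arctan_3:
  fixes t :: real
  assumes t: "0 < t"
  shows "set_integrable lborel {0<..} (\<lambda>k. k ^ 3 * arctan (t / k) - t * k\<^sup>2 + t ^ 3 / 3)"
    "(LINT k:{0<..}|lborel. k ^ 3 * arctan (t / k) - t * k\<^sup>2 + t ^ 3 / 3) = pi / 8 * t ^ 4"
proof -
  let ?A = "\<lambda>k. pi / 2 - arctan (k / t)"
  let ?f = "\<lambda>k. k ^ 3 * ?A k - t * k\<^sup>2 + t ^ 3 / 3"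
  let ?F = "\<lambda>k. k ^ 4 / 4 * ?A k + t ^ 4 / 4 * arctan (k / t) - t * k ^ 3 / 4 + t ^ 3 * k / 12"
  have s: "arctan (t / k) = ?A k" if "0 < k" for k by (rule arctan_swap[OF t that])
  have F1: "DERIV ?F k :> ?f k" for k
  proof -
    define q where "q = t / (t\<^sup>2 + k\<^sup>2)"
    have p: "0 < t\<^sup>2 + k\<^sup>2" using t by (simp add: add_pos_nonneg)
    have q: "(t\<^sup>2 + k\<^sup>2) * q = t" using p by (simp add: q_def)
    have D: "((\<lambda>k. k ^ 4 / 4 * (pi / 2 - a k) + t ^ 4 / 4 * a k - t * k ^ 3 / 4 + t ^ 3 * k / 12) has_real_derivative
        (k ^ 3 * (pi / 2 - a k) - k ^ 4 * q / 4) + t ^ 4 * q / 4 - t * (3 * k\<^sup>2) / 4 + t ^ 3 / 12) (at k)"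
      if "(a has_real_derivative q) (at k)" for a
      by (rule derivative_eq_intros that refl | simp add: mult.commute)+
    have "DERIV ?F k :> (k ^ 3 * ?A k - k ^ 4 * q / 4) + t ^ 4 * q / 4 - t * (3 * k\<^sup>2) / 4 + t ^ 3 / 12"
      by (rule D) (unfold q_def, rule DERIV_arctan_scaled[OF t])
    moreover have "(k ^ 3 * ?A k - k ^ 4 * q / 4) + t ^ 4 * q / 4 - t * (3 * k\<^sup>2) / 4 + t ^ 3 / 12
        = k ^ 3 * ?A k + (t\<^sup>2 - k\<^sup>2) * ((t\<^sup>2 + k\<^sup>2) * q) / 4 - t * (3 * k\<^sup>2) / 4 + t ^ 3 / 12"
    proof -
      have "(t\<^sup>2 - k\<^sup>2) * ((t\<^sup>2 + k\<^sup>2) * q) = t ^ 4 * q - k ^ 4 * q"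
        by (simp add: algebra_simps eval_nat_numeral)
      then show ?thesis by (simp add: diff_divide_distrib)
    qed
    also have "\<dots> = ?f k" unfolding q by (simp add: field_simps eval_nat_numeral)
    ultimately show ?thesis by simp
  qed
  have f0: "0 \<le> ?f k" if "0 \<le> k" for k
  proof (cases "k = 0")
    case False
    then have k: "0 < k" using that by simp
    have "k ^ 3 * (t / k - (t / k) ^ 3 / 3) \<le> k ^ 3 * arctan (t / k)"
      using t k by (intro mult_left_mono arctan_ge_cubic) auto
    moreover have "k ^ 3 * (t / k - (t / k) ^ 3 / 3) = t * k\<^sup>2 - t ^ 3 / 3"
      using k by (simp add: field_simps eval_nat_numeral)
    ultimately show ?thesis using s[OF k] by simp
  qed (use t in simp)
  \<comment> \<open>The antiderivative is homogeneous of degree four in k and t together, so its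
    limit is computed for t = 1 and rescaled.\<close>
  let ?h = "\<lambda>k::real. k ^ 4 / 4 * (pi / 2 - arctan k) + arctan k / 4 - k ^ 3 / 4 + k / 12"
  have "(?h \<longlongrightarrow> pi / 8) at_top" by real_asymp
  moreover have "filterlim (\<lambda>k. k / t) at_top at_top" using t by real_asymp
  ultimately have "((\<lambda>k. ?h (k / t)) \<longlongrightarrow> pi / 8) at_top" by (rule filterlim_compose)
  then have "((\<lambda>k. ?h (k / t) * t ^ 4) \<longlongrightarrow> pi / 8 * t ^ 4) at_top" by (intro tendsto_intros)
  moreover have "?h (k / t) * t ^ 4 = ?F k" for k
  proof -
    have "(k / t) ^ 4 * t ^ 4 = k ^ 4" "(k / t) ^ 3 * t ^ 4 = k ^ 3 * t" "k / t * t ^ 4 = k * t ^ 3"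
      using t by (simp_all add: power_divide eval_nat_numeral)
    moreover have "(a / 4 * p + q / 4 - b / 4 + c / 12) * e = (a * e) / 4 * p + e / 4 * q - (b * e) / 4 + (c * e) / 12"
      for a b c e p q :: real by (simp add: field_simps)
    ultimately show ?thesis by (simp only: mult.commute[of _ t] mult.commute[of _ "t ^ 3"])
  qed
  ultimately have "(?F \<longlongrightarrow> pi / 8 * t ^ 4) at_top" by (simp only:)
  note I = set_integral_FTC_Ioi_nonneg[of ?f 0 ?F, OF _ F1 f0 this]
  have c: "continuous_on UNIV ?f" using t by (intro continuous_intros) auto
  have eq: "?f k = k ^ 3 * arctan (t / k) - t * k\<^sup>2 + t ^ 3 / 3" if "k \<in> {0<..}" for k using s[of k] that by simp
  show "set_integrable lborel {0<..} (\<lambda>k. k ^ 3 * arctan (t / k) - t * k\<^sup>2 + t ^ 3 / 3)"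
    using I(1)[OF c] set_integrable_cong[of lborel lborel "{0<..}" "{0<..}" ?f "\<lambda>k. k ^ 3 * arctan (t / k) - t * k\<^sup>2 + t ^ 3 / 3"] eq by auto
  have "(LINT k:{0<..}|lborel. k ^ 3 * arctan (t / k) - t * k\<^sup>2 + t ^ 3 / 3) = (LINT k:{0<..}|lborel. ?f k)"
    by (intro set_lebesgue_integral_cong) (use eq in auto)
  also have "\<dots> = pi / 8 * t ^ 4 - ?F 0" by (rule I(2)[OF c])
  finally show "(LINT k:{0<..}|lborel. k ^ 3 * arctan (t / k) - t * k\<^sup>2 + t ^ 3 / 3) = pi / 8 * t ^ 4"
    by simp
qed

text \<open>Numerator and denominator are conjugate, with arguments arctan(t / k) and - arctan(t /
  k) because k > 0.\<close>

lemma polar_quotient: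
  fixes t k :: real
  assumes "0 < k"
  shows "(of_real k + \<i> * of_real t) / (of_real k - \<i> * of_real t) = exp (2 * \<i> * of_real (arctan (t / k)))"
proof -
  let ?\<phi> = "arctan (t / k)" and ?r = "complex_of_real (k * sqrt (1 + (t / k)\<^sup>2))"
  have p: "0 < 1 + (t / k)\<^sup>2" by (simp add: add_pos_nonneg)
  then have r0: "?r \<noteq> 0" using assms by simp
  have 1: "of_real k + \<i> * of_real t = ?r * cis ?\<phi>" "of_real k - \<i> * of_real t = ?r * cis (- ?\<phi>)"
    using p assms by (auto simp: complex_eq_iff cos_arctan sin_arctan)
  have "(of_real k + \<i> * of_real t) / (of_real k - \<i> * of_real t) = cis ?\<phi> / cis (- ?\<phi>)"
    unfolding 1 using r0 by simp
  also have "\<dots> = cis (2 * ?\<phi>)" by (simp add: cis_divide)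
  also have "\<dots> = exp (2 * \<i> * of_real ?\<phi>)" by (simp add: cis_conv_exp mult_ac)
  finally show ?thesis .
qed

text \<open>Two phases differ by a continuous function with values in 2 \<pi> times the integers,
  hence by a constant, and this is 0 as both tend to 0. Nonvanishing of w allows the amplitude to be
  cancelled.\<close>

lemma limit_phase_eqI:
  assumes \<eta>: "is_limit_phase V \<gamma> \<eta>" and nz: "\<And>k. 0 < k \<Longrightarrow> jost_function V \<gamma> (of_real k) \<noteq> 0" and "0 < k"
  shows "limit_phase V \<gamma> k = \<eta> k"
proof -
  have uniq: "\<eta>1 k = \<eta>2 k" if \<eta>1: "is_limit_phase V \<gamma> \<eta>1" and \<eta>2: "is_limit_phase V \<gamma> \<eta>2" and "0 < k" for \<eta>1 \<eta>2 and k :: real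
  proof -
    let ?D = "\<lambda>k. \<i> * of_real (\<eta>1 k - \<eta>2 k)"
    have "?D k = ?D x" if "0 < x" for x
    proof (rule constant_if_exp_eq_1[where f = ?D and S = "{0<..}"])
      show "continuous_on {0<..} ?D"
        using \<eta>1 \<eta>2 unfolding is_limit_phase_def by (intro continuous_intros) auto
      fix x :: real assume "x \<in> {0<..}"
      then have x: "0 < x" by simp
      let ?a = "complex_of_real (limit_amplitude V \<gamma> x)" and ?b = "of_real \<gamma> - \<i> * complex_of_real x"
      have 1: "jost_function V \<gamma> (of_real x) = ?a * exp (\<i> * of_real (\<eta>1 x)) * ?b"
        and 2: "jost_function V \<gamma> (of_real x) = ?a * exp (\<i> * of_real (\<eta>2 x)) * ?b"
        using \<eta>1 \<eta>2 x unfolding is_limit_phase_def by auto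
      then have "?a \<noteq> 0" "?b \<noteq> 0" using nz[OF x] by auto
      then have "exp (\<i> * of_real (\<eta>1 x)) = exp (\<i> * of_real (\<eta>2 x))" using 1 2 by (metis mult_left_cancel mult_right_cancel)
      then show "exp (?D x) = 1" by (simp add: right_diff_distrib exp_diff)
    qed (use that \<open>0 < k\<close> in auto)
    then have "\<eta>1 k - \<eta>2 k = \<eta>1 x - \<eta>2 x" if "0 < x" for x
      using that by (metis complex_i_not_zero mult_left_cancel of_real_eq_iff)
    then have "\<forall>\<^sub>F x in at_top. \<eta>1 x - \<eta>2 x = \<eta>1 k - \<eta>2 k"
      by (intro eventually_mono[OF eventually_gt_at_top[of 0]]) metis
    then have "((\<lambda>x. \<eta>1 x - \<eta>2 x) \<longlongrightarrow> \<eta>1 k - \<eta>2 k) at_top" by (rule tendsto_eventually)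
    moreover have "((\<lambda>x. \<eta>1 x - \<eta>2 x) \<longlongrightarrow> 0 - 0) at_top"
      using \<eta>1 \<eta>2 unfolding is_limit_phase_def by (intro tendsto_intros) auto
    ultimately have "\<eta>1 k - \<eta>2 k = 0 - 0" by (rule tendsto_unique[OF trivial_limit_at_top_linorder])
    then show ?thesis by simp
  qed
  \<comment> \<open>The default 0 for k \<le> 0 is the one that \<open>limit_phase\<close>
    prescribes to single out one function on the line.\<close>
  define \<eta>0 where "\<eta>0 k = (if 0 < k then \<eta> k else 0)" for k
  have "is_limit_phase V \<gamma> \<eta>0"
    unfolding is_limit_phase_def
  proof (intro conjI)
    have "continuous_on {0<..} \<eta>" using \<eta> by (simp add: is_limit_phase_def)
    then show "continuous_on {0<..} \<eta>0" by (rule continuous_on_eq) (simp add: \<eta>0_def)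
    have "(\<eta> \<longlongrightarrow> 0) at_top" using \<eta> by (simp add: is_limit_phase_def)
    moreover have "\<forall>\<^sub>F k in at_top. \<eta> k = \<eta>0 k"
      by (rule eventually_mono[OF eventually_gt_at_top[of 0]]) (simp add: \<eta>0_def)
    ultimately show "(\<eta>0 \<longlongrightarrow> 0) at_top" by (metis (mono_tags) tendsto_cong)
  qed (use \<eta> in \<open>auto simp: is_limit_phase_def \<eta>0_def\<close>)
  then have 0: "is_limit_phase V \<gamma> \<eta>0 \<and> (\<forall>k\<le>0. \<eta>0 k = 0)" by (simp add: \<eta>0_def)
  have "limit_phase V \<gamma> = \<eta>0"
    unfolding limit_phase_def
  proof (rule the_equality)
    show "is_limit_phase V \<gamma> \<eta>0 \<and> (\<forall>k\<le>0. \<eta>0 k = 0)" by (rule 0)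
    fix \<eta>' assume \<eta>': "is_limit_phase V \<gamma> \<eta>' \<and> (\<forall>k\<le>0. \<eta>' k = 0)"
    show "\<eta>' = \<eta>0"
    proof
      fix k :: real
      show "\<eta>' k = \<eta>0 k" using uniq[of \<eta>' \<eta>0 k] 0 \<eta>' by (cases "0 < k") auto
    qed
  qed
  then show ?thesis using \<open>0 < k\<close> by (simp add: \<eta>0_def)
qed

section \<open>Amplitude, phase and the trace formulas\<close>

context jost_smooth
begin

text \<open>The signed sum of \<open>Smom\<close> for an arbitrary function, needed for powers and
  for arctan(t / k). Its linearity in h transfers the integrals for a single t to the whole
  sum.\<close>

definition jsum :: "real \<Rightarrow> (real \<Rightarrow> real) \<Rightarrow> real" where
  "jsum \<gamma> h = (\<Sum>z\<in>jzeros \<gamma>. h (Im z)) - (if \<gamma> < 0 then h (- \<gamma>) else 0)"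

lemma Smom_jsum: "Smom \<gamma> n = jsum \<gamma> (\<lambda>t. t ^ n)"
  by (simp add: Smom_def jsum_def)

lemma jsum_add: "jsum \<gamma> (\<lambda>t. f t + g t) = jsum \<gamma> f + jsum \<gamma> g"
  and jsum_diff: "jsum \<gamma> (\<lambda>t. f t - g t) = jsum \<gamma> f - jsum \<gamma> g"
  and jsum_mult: "jsum \<gamma> (\<lambda>t. c * f t) = c * jsum \<gamma> f"
  and jsum_mult_right: "jsum \<gamma> (\<lambda>t. f t * c) = jsum \<gamma> f * c"
  and jsum_divide: "jsum \<gamma> (\<lambda>t. f t / c) = jsum \<gamma> f / c"
  by (simp_all add: jsum_def sum.distrib sum_subtractf sum_distrib_left sum_distrib_right sum_divide_distrib
      right_diff_distrib left_diff_distrib diff_divide_distrib)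

lemma set_integral_jsum:
  assumes "\<And>t. 0 < t \<Longrightarrow> set_integrable lborel A (h t)" "\<And>t. 0 < t \<Longrightarrow> (LINT k:A|lborel. h t k) = c t"
  shows "set_integrable lborel A (\<lambda>k. jsum \<gamma> (\<lambda>t. h t k))" "(LINT k:A|lborel. jsum \<gamma> (\<lambda>t. h t k)) = jsum \<gamma> c"
proof -
  have z: "0 < Im z" if "z \<in> jzeros \<gamma>" for z using jzeros_imaginary(2)[OF that] .
  have i1: "set_integrable lborel A (\<lambda>k. \<Sum>z\<in>jzeros \<gamma>. h (Im z) k)"
    using assms(1) z unfolding set_integrable_def scaleR_sum_right
    by (intro Bochner_Integration.integrable_sum) auto
  have i2: "set_integrable lborel A (\<lambda>k. if \<gamma> < 0 then h (- \<gamma>) k else 0)"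
    using assms(1)[of "- \<gamma>"] by (cases "\<gamma> < 0") (simp_all add: set_integrable_def)
  show "set_integrable lborel A (\<lambda>k. jsum \<gamma> (\<lambda>t. h t k))"
    unfolding jsum_def by (rule set_integral_diff(1)[OF i1 i2])
  have "(LINT k:A|lborel. jsum \<gamma> (\<lambda>t. h t k))
      = (LINT k:A|lborel. \<Sum>z\<in>jzeros \<gamma>. h (Im z) k) - (LINT k:A|lborel. if \<gamma> < 0 then h (- \<gamma>) k else 0)"
    unfolding jsum_def by (rule set_integral_diff(2)[OF i1 i2])
  also have "(LINT k:A|lborel. \<Sum>z\<in>jzeros \<gamma>. h (Im z) k) = (\<Sum>z\<in>jzeros \<gamma>. LINT k:A|lborel. h (Im z) k)"
    using assms(1) z unfolding set_lebesgue_integral_def set_integrable_def scaleR_sum_right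
    by (intro Bochner_Integration.integral_sum) auto
  also have "\<dots> = (\<Sum>z\<in>jzeros \<gamma>. c (Im z))" using assms(2) z by (intro sum.cong) auto
  also have "(LINT k:A|lborel. if \<gamma> < 0 then h (- \<gamma>) k else 0) = (if \<gamma> < 0 then c (- \<gamma>) else 0)"
    using assms(2)[of "- \<gamma>"] by (simp add: set_lebesgue_integral_def)
  finally show "(LINT k:A|lborel. jsum \<gamma> (\<lambda>t. h t k)) = jsum \<gamma> c" by (simp add: jsum_def)
qed

text \<open>For real k the Blaschke factors and the passage from \<gamma> to |\<gamma>| have modulus
  1. Undoing them leaves the modulus unchanged and lowers the phase by 2 arctan(\<kappa> / k) for
  each zero, while - \<gamma>, if positive, counts with the opposite sign.\<close>

lemma jostw_Efun:
  assumes k: "0 < k"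
  shows "jostw \<gamma> (of_real k)
    = Efun \<gamma> (of_real k) * exp (- (2 * \<i> * of_real (jsum \<gamma> (\<lambda>t. arctan (t / k))))) * (of_real \<gamma> - \<i> * of_real k)"
proof -
  let ?e = "\<lambda>t. exp (2 * \<i> * complex_of_real (arctan (t / k)))"
  have B: "Bl \<gamma> (of_real k) = (\<Prod>z\<in>jzeros \<gamma>. ?e (Im z))"
    unfolding Bl_def
  proof (rule prod.cong)
    fix z assume z: "z \<in> jzeros \<gamma>"
    show "(of_real k + z) / (of_real k - z) = ?e (Im z)"
      using polar_quotient[OF k, of "Im z"] jzeros_imaginary(1)[OF z] by simp
  qed simp
  have "exp (2 * \<i> * of_real (\<Sum>z\<in>jzeros \<gamma>. arctan (Im z / k))) = (\<Prod>z\<in>jzeros \<gamma>. ?e (Im z))"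
    by (simp add: sum_distrib_left exp_sum[OF finite_jzeros])
  then have B': "Bl \<gamma> (of_real k) = exp (2 * \<i> * of_real (\<Sum>z\<in>jzeros \<gamma>. arctan (Im z / k)))" using B by simp
  define D where "D = (of_real \<bar>\<gamma>\<bar> - \<i> * of_real k)"
  \<comment> \<open>The unimodular quotient of |\<gamma>| - \<i> k and \<gamma> - \<i> k, equal to 1
    unless \<gamma> < 0.\<close>
  define g where "g = (if \<gamma> < 0 then ?e (- \<gamma>) else 1)"
  have D0: "D \<noteq> 0" using k by (auto simp: D_def complex_eq_iff)
  have g: "D = g * (of_real \<gamma> - \<i> * of_real k)"
  proof (cases "\<gamma> < 0")
    case True
    have n: "of_real k - \<i> * of_real (- \<gamma>) \<noteq> 0" using k by (auto simp: complex_eq_iff)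
    have "g * (of_real k - \<i> * of_real (- \<gamma>)) = of_real k + \<i> * of_real (- \<gamma>)"
      using polar_quotient[OF k, of "- \<gamma>"] True n by (simp only: g_def if_True flip: polar_quotient[OF k]) simp
    then have "- \<i> * (g * (of_real k - \<i> * of_real (- \<gamma>))) = - \<i> * (of_real k + \<i> * of_real (- \<gamma>))" by simp
    moreover have "- \<i> * (g * (of_real k - \<i> * of_real (- \<gamma>))) = g * (of_real \<gamma> - \<i> * of_real k)"
      by (simp add: algebra_simps)
    ultimately show ?thesis using True by (simp add: D_def algebra_simps)
  qed (simp add: g_def D_def)
  have "exp (2 * \<i> * of_real (jsum \<gamma> (\<lambda>t. arctan (t / k)))) * g = Bl \<gamma> (of_real k)"
    unfolding B' by (auto simp: jsum_def g_def right_diff_distrib exp_diff)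
  then have "Efun \<gamma> (of_real k) * D = jostw \<gamma> (of_real k) * (exp (2 * \<i> * of_real (jsum \<gamma> (\<lambda>t. arctan (t / k)))) * g)"
    using D0 by (simp add: Efun_Bl D_def)
  then have "Efun \<gamma> (of_real k) * (g * (of_real \<gamma> - \<i> * of_real k))
      = jostw \<gamma> (of_real k) * exp (2 * \<i> * of_real (jsum \<gamma> (\<lambda>t. arctan (t / k)))) * g"
    unfolding g[symmetric] by (simp only: mult.assoc)
  moreover have "g \<noteq> 0" by (simp add: g_def)
  ultimately have "Efun \<gamma> (of_real k) * (of_real \<gamma> - \<i> * of_real k)
      = jostw \<gamma> (of_real k) * exp (2 * \<i> * of_real (jsum \<gamma> (\<lambda>t. arctan (t / k))))"
    by (metis (no_types, lifting) mult.assoc mult.commute mult_left_cancel)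
  then have "jostw \<gamma> (of_real k) * exp (2 * \<i> * of_real (jsum \<gamma> (\<lambda>t. arctan (t / k)))) * exp (- (2 * \<i> * of_real (jsum \<gamma> (\<lambda>t. arctan (t / k)))))
      = Efun \<gamma> (of_real k) * (of_real \<gamma> - \<i> * of_real k) * exp (- (2 * \<i> * of_real (jsum \<gamma> (\<lambda>t. arctan (t / k)))))" by simp
  then show ?thesis by (simp add: mult.assoc exp_minus_inverse mult.commute mult.left_commute)
qed

text \<open>The zeros are \<i> \<kappa> with \<kappa> > 0, so \<kappa>^2 determines them and no
  eigenvalue is hit twice.\<close>

lemma jzeros_sum:
  assumes "neg_eigenvalues U \<gamma> = (\<lambda>z. - (Im z)\<^sup>2) ` jzeros \<gamma>"
  shows "(\<Sum>\<mu>\<in>neg_eigenvalues U \<gamma>. h \<bar>\<mu>\<bar>) = (\<Sum>z\<in>jzeros \<gamma>. h ((Im z)\<^sup>2))"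
proof -
  have "inj_on (\<lambda>z. - (Im z)\<^sup>2) (jzeros \<gamma>)"
  proof
    fix x y assume x: "x \<in> jzeros \<gamma>" and y: "y \<in> jzeros \<gamma>" and "- (Im x)\<^sup>2 = - (Im y)\<^sup>2"
    then have "Im x = Im y" using jzeros_imaginary(2)[OF x] jzeros_imaginary(2)[OF y] by (simp add: power2_eq_iff_nonneg)
    then show "x = y" using jzeros_imaginary(1)[OF x] jzeros_imaginary(1)[OF y] by metis
  qed
  then show ?thesis unfolding assms by (simp add: sum.reindex)
qed

text \<open>ln a is Re F, and the phase is Im F minus the Blaschke phases. In the amplitude formulas
  the eigenvalue moments are those inside \<open>c1\<close> and \<open>c3\<close>. In the phase
  formulas these cancel against the leading terms of the Blaschke phases, which leaves the
  subtracted terms of the statement, and the moments of order 2 and 4 come from the arctan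
  integrals.\<close>

lemma trace_formulas:
  assumes U: "\<And>x. 0 \<le> x \<Longrightarrow> U x = V x" and M: "\<And>x. 0 \<le> x \<Longrightarrow> \<bar>V x\<bar> \<le> M"
  defines "I \<equiv> LINT x:{0..}|lborel. V x" and "J \<equiv> LINT x:{0..}|lborel. v 0 x * v 0 x"
  shows "finite (neg_eigenvalues U \<gamma>)" (is ?fin)
    "set_integrable lborel {0<..} (\<lambda>k. ln (limit_amplitude U \<gamma> k))" (is ?i1)
    "(\<Sum>\<mu>\<in>neg_eigenvalues U \<gamma>. \<bar>\<mu>\<bar> powr (1/2)) - M_term (1/2) \<gamma>
        - 1/pi * (LINT k:{0<..}|lborel. ln (limit_amplitude U \<gamma> k)) = - 1/4 * I" (is ?t1)
    "set_integrable lborel {0<..} (\<lambda>k. (limit_phase U \<gamma> k - I / (2 * k)) * k)" (is ?i2)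
    "(\<Sum>\<mu>\<in>neg_eigenvalues U \<gamma>. \<bar>\<mu>\<bar>) - M_term 1 \<gamma>
        - 2/pi * (LINT k:{0<..}|lborel. (limit_phase U \<gamma> k - I / (2 * k)) * k) = - 1/4 * v 0 0" (is ?t2)
    "set_integrable lborel {0<..} (\<lambda>k. (ln (limit_amplitude U \<gamma> k) + v 0 0 / (2 * k)\<^sup>2) * k\<^sup>2)" (is ?i3)
    "(\<Sum>\<mu>\<in>neg_eigenvalues U \<gamma>. \<bar>\<mu>\<bar> powr (3/2)) - M_term (3/2) \<gamma>
        + 3/pi * (LINT k:{0<..}|lborel. (ln (limit_amplitude U \<gamma> k) + v 0 0 / (2 * k)\<^sup>2) * k\<^sup>2)
      = 3/16 * (J - v 1 0 + 4 * \<gamma> * v 0 0)" (is ?t3)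
    "set_integrable lborel {0<..}
        (\<lambda>k. (limit_phase U \<gamma> k - I / (2 * k) - (J + 4 * \<gamma> * v 0 0 - v 1 0) / (2 * k) ^ 3) * k ^ 3)" (is ?i4)
    "(\<Sum>\<mu>\<in>neg_eigenvalues U \<gamma>. \<bar>\<mu>\<bar>\<^sup>2) - M_term 2 \<gamma>
        + 4/pi * (LINT k:{0<..}|lborel.
            (limit_phase U \<gamma> k - I / (2 * k) - (J + 4 * \<gamma> * v 0 0 - v 1 0) / (2 * k) ^ 3) * k ^ 3)
      = - 1/8 * (v 2 0 + 8 * \<gamma>\<^sup>2 * v 0 0 - 4 * \<gamma> * v 1 0 - 2 * (v 0 0)\<^sup>2)" (is ?t4)
proof -
  obtain F :: "complex \<Rightarrow> complex" where F: "continuous_on {0<..} (\<lambda>k. F (of_real k))"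
    "((\<lambda>k. F (of_real k)) \<longlongrightarrow> 0) at_top" "\<And>k. 0 < k \<Longrightarrow> exp (F (of_real k)) = Efun \<gamma> (of_real k)"
    and F1: "set_integrable lborel {0<..} (\<lambda>k. Re (F (of_real k)))"
      "(LINT k:{0<..}|lborel. Re (F (of_real k))) = - pi * c1 \<gamma> / 4"
    and F2: "set_integrable lborel {0<..} (\<lambda>k. k * Im (F (of_real k)) + c1 \<gamma> / 2)"
      "(LINT k:{0<..}|lborel. k * Im (F (of_real k)) + c1 \<gamma> / 2) = pi * v 0 0 / 8"
    and F3: "set_integrable lborel {0<..} (\<lambda>k. k\<^sup>2 * Re (F (of_real k)) + v 0 0 / 4)"
      "(LINT k:{0<..}|lborel. k\<^sup>2 * Re (F (of_real k)) + v 0 0 / 4) = pi * c3 \<gamma> / 16"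
    and F4: "set_integrable lborel {0<..} (\<lambda>k. k ^ 3 * Im (F (of_real k)) + c1 \<gamma> / 2 * k\<^sup>2 - c3 \<gamma> / 8)"
      "(LINT k:{0<..}|lborel. k ^ 3 * Im (F (of_real k)) + c1 \<gamma> / 2 * k\<^sup>2 - c3 \<gamma> / 8) = - pi * c4 \<gamma> / 32"
    by (rule trace_log_Efun[of \<gamma>]) (rule that)
  have jf: "jost_function U \<gamma> (of_real k) = jostw \<gamma> (of_real k)" if "0 < k" for k
    using that U by (intro jost_function_eq) auto
  have nz: "of_real \<gamma> - \<i> * complex_of_real k \<noteq> 0" if "0 < k" for k using that by (auto simp: complex_eq_iff)
  have sq: "norm (of_real \<gamma> - \<i> * complex_of_real k) = sqrt (\<gamma>\<^sup>2 + k\<^sup>2)" for k by (simp add: cmod_def)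
  have amp: "limit_amplitude U \<gamma> k = exp (Re (F (of_real k)))" if k: "0 < k" for k
  proof -
    have "norm (jostw \<gamma> (of_real k)) = norm (Efun \<gamma> (of_real k)) * sqrt (\<gamma>\<^sup>2 + k\<^sup>2)"
      unfolding jostw_Efun[OF k] norm_mult sq by (simp add: norm_exp_eq_Re)
    moreover have "sqrt (\<gamma>\<^sup>2 + k\<^sup>2) \<noteq> 0" using k by (simp add: sum_power2_eq_zero_iff)
    ultimately show ?thesis unfolding limit_amplitude_def jf[OF k]
      using F(3)[OF k] norm_exp_eq_Re[of "F (of_real k)"] by simp
  qed
  define \<eta> where "\<eta> k = Im (F (of_real k)) - 2 * jsum \<gamma> (\<lambda>t. arctan (t / k))" for k
  have "is_limit_phase U \<gamma> \<eta>"
    unfolding is_limit_phase_def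
  proof (intro conjI allI impI)
    have js: "continuous_on {0<..} (\<lambda>k. jsum \<gamma> (\<lambda>t. arctan (t / k)))"
    proof (cases "\<gamma> < 0")
      case True
      show ?thesis unfolding jsum_def if_P[OF True] by (intro continuous_intros) auto
    next
      case False
      show ?thesis unfolding jsum_def if_not_P[OF False] by (intro continuous_intros) auto
    qed
    show "continuous_on {0<..} \<eta>" unfolding \<eta>_def[abs_def] by (intro continuous_intros F(1) js)
    have at: "((\<lambda>k. arctan (t / k)) \<longlongrightarrow> arctan 0) at_top" for t :: real
      by (intro tendsto_arctan real_tendsto_divide_at_top[OF tendsto_const filterlim_ident])
    have "((\<lambda>k. jsum \<gamma> (\<lambda>t. arctan (t / k))) \<longlongrightarrow> jsum \<gamma> (\<lambda>t. arctan 0)) at_top"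
    proof (cases "\<gamma> < 0")
      case True
      show ?thesis unfolding jsum_def if_P[OF True] by (intro tendsto_intros at)
    next
      case False
      show ?thesis unfolding jsum_def if_not_P[OF False] by (intro tendsto_intros at)
    qed
    then have "(\<eta> \<longlongrightarrow> Im 0 - 2 * jsum \<gamma> (\<lambda>t. arctan 0)) at_top"
      unfolding \<eta>_def[abs_def] by (intro tendsto_intros F(2))
    then show "(\<eta> \<longlongrightarrow> 0) at_top" by (simp add: jsum_def)
    fix k :: real assume k: "0 < k"
    have "F (of_real k) = of_real (Re (F (of_real k))) + \<i> * of_real (Im (F (of_real k)))" by (rule complex_eq)
    then have "exp (F (of_real k)) = of_real (exp (Re (F (of_real k)))) * exp (\<i> * of_real (Im (F (of_real k))))"
      by (metis exp_add exp_of_real)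
    moreover have "exp (\<i> * of_real (Im (F (of_real k)))) * exp (- (2 * \<i> * of_real (jsum \<gamma> (\<lambda>t. arctan (t / k)))))
        = exp (\<i> * of_real (\<eta> k))"
      unfolding \<eta>_def by (simp add: algebra_simps flip: exp_add)
    ultimately show "jost_function U \<gamma> (of_real k) =
        of_real (limit_amplitude U \<gamma> k) * exp (\<i> * of_real (\<eta> k)) * (of_real \<gamma> - \<i> * of_real k)"
      unfolding jf[OF k] jostw_Efun[OF k] F(3)[OF k, symmetric] amp[OF k] by (metis mult.assoc)
  qed
  moreover have "jost_function U \<gamma> (of_real k) \<noteq> 0" if "0 < k" for k
    unfolding jf[OF that] using that by (intro jostw_real_nonzero) auto
  ultimately have phase: "limit_phase U \<gamma> k = \<eta> k" if "0 < k" for k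
    using limit_phase_eqI that by blast
  have tr: "set_integrable lborel {0<..} g \<and> (LINT k:{0<..}|lborel. g k) = b"
    if a: "set_integrable lborel {0<..} f" "(LINT k:{0<..}|lborel. f k) = b" "\<And>k. 0 < k \<Longrightarrow> g k = f k"
    for f g :: "real \<Rightarrow> real" and b
  proof
    show "set_integrable lborel {0<..} g" using a(1) set_integrable_cong[of lborel lborel "{0<..}" "{0<..}" f g] a(3) by auto
    have "(LINT k:{0<..}|lborel. f k) = (LINT k:{0<..}|lborel. g k)"
      by (intro set_lebesgue_integral_cong) (use a(3) in auto)
    then show "(LINT k:{0<..}|lborel. g k) = b" using a by simp
  qed
  have ne: "neg_eigenvalues U \<gamma> = (\<lambda>z. - (Im z)\<^sup>2) ` jzeros \<gamma>"
    unfolding jzeros_def by (rule neg_eigenvalues_eq[OF U M])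
  show ?fin unfolding ne by (intro finite_imageI finite_jzeros)
  have pw: "(t\<^sup>2) powr (real n / 2) = t ^ n" if "0 < t" for t :: real and n
    using that by (simp add: powr_powr powr_realpow flip: powr_numeral)
  have S1: "(\<Sum>\<mu>\<in>neg_eigenvalues U \<gamma>. \<bar>\<mu>\<bar> powr (1/2)) - M_term (1/2) \<gamma> = Smom \<gamma> 1"
    unfolding jzeros_sum[OF ne, of "\<lambda>t. t powr (1/2)"] Smom_def M_term_def
    using pw[of _ 1] jzeros_imaginary(2)[of _ \<gamma>] by (simp add: abs_of_pos cong: sum.cong)
  have S2: "(\<Sum>\<mu>\<in>neg_eigenvalues U \<gamma>. \<bar>\<mu>\<bar>) - M_term 1 \<gamma> = Smom \<gamma> 2"
    unfolding jzeros_sum[OF ne, of "\<lambda>t. t"] Smom_def M_term_def by (simp add: powr_numeral)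
  have S3: "(\<Sum>\<mu>\<in>neg_eigenvalues U \<gamma>. \<bar>\<mu>\<bar> powr (3/2)) - M_term (3/2) \<gamma> = Smom \<gamma> 3"
    unfolding jzeros_sum[OF ne, of "\<lambda>t. t powr (3/2)"] Smom_def M_term_def
    using pw[of _ 3] jzeros_imaginary(2)[of _ \<gamma>] by (simp add: powr_numeral cong: sum.cong)
  have S4: "(\<Sum>\<mu>\<in>neg_eigenvalues U \<gamma>. \<bar>\<mu>\<bar>\<^sup>2) - M_term 2 \<gamma> = Smom \<gamma> 4"
    unfolding jzeros_sum[OF ne, of "\<lambda>t. t\<^sup>2"] Smom_def M_term_def by (simp add: powr_numeral flip: power_mult)
  have a1: "set_integrable lborel {0<..} (\<lambda>k. jsum \<gamma> (\<lambda>t. k * arctan (t / k) - t))"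
    "(LINT k:{0<..}|lborel. jsum \<gamma> (\<lambda>t. k * arctan (t / k) - t)) = - pi / 4 * Smom \<gamma> 2"
    using set_integral_jsum[of "{0<..}" "\<lambda>t k. k * arctan (t / k) - t" "\<lambda>t. - pi / 4 * t\<^sup>2" \<gamma>] integral_arctan_1
    by (auto simp only: jsum_mult Smom_jsum)
  have a3: "set_integrable lborel {0<..} (\<lambda>k. jsum \<gamma> (\<lambda>t. k ^ 3 * arctan (t / k) - t * k\<^sup>2 + t ^ 3 / 3))"
    "(LINT k:{0<..}|lborel. jsum \<gamma> (\<lambda>t. k ^ 3 * arctan (t / k) - t * k\<^sup>2 + t ^ 3 / 3)) = pi / 8 * Smom \<gamma> 4"
    using set_integral_jsum[of "{0<..}" "\<lambda>t k. k ^ 3 * arctan (t / k) - t * k\<^sup>2 + t ^ 3 / 3" "\<lambda>t. pi / 8 * t ^ 4" \<gamma>] integral_arctan_3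
    by (auto simp only: jsum_mult Smom_jsum)
  have L1: "set_integrable lborel {0<..} (\<lambda>k. ln (limit_amplitude U \<gamma> k)) \<and>
      (LINT k:{0<..}|lborel. ln (limit_amplitude U \<gamma> k)) = - pi * c1 \<gamma> / 4"
    by (rule tr[OF F1]) (simp add: amp)
  have L3: "set_integrable lborel {0<..} (\<lambda>k. (ln (limit_amplitude U \<gamma> k) + v 0 0 / (2 * k)\<^sup>2) * k\<^sup>2) \<and>
      (LINT k:{0<..}|lborel. (ln (limit_amplitude U \<gamma> k) + v 0 0 / (2 * k)\<^sup>2) * k\<^sup>2) = pi * c3 \<gamma> / 16"
    by (rule tr[OF F3]) (simp add: amp field_simps)
  have s1: "jsum \<gamma> (\<lambda>t. k * arctan (t / k) - t) = k * jsum \<gamma> (\<lambda>t. arctan (t / k)) - Smom \<gamma> 1" for k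
    by (simp add: jsum_diff jsum_mult Smom_jsum)
  have s3: "jsum \<gamma> (\<lambda>t. k ^ 3 * arctan (t / k) - t * k\<^sup>2 + t ^ 3 / 3)
      = k ^ 3 * jsum \<gamma> (\<lambda>t. arctan (t / k)) - Smom \<gamma> 1 * k\<^sup>2 + Smom \<gamma> 3 / 3" for k
    by (simp add: jsum_diff jsum_add jsum_mult jsum_mult_right jsum_divide Smom_jsum)
  have L2: "set_integrable lborel {0<..} (\<lambda>k. (limit_phase U \<gamma> k - I / (2 * k)) * k) \<and>
      (LINT k:{0<..}|lborel. (limit_phase U \<gamma> k - I / (2 * k)) * k) = pi * v 0 0 / 8 - 2 * (- pi / 4 * Smom \<gamma> 2)"
  proof (rule tr)
    have m: "set_integrable lborel {0<..} (\<lambda>k. 2 * jsum \<gamma> (\<lambda>t. k * arctan (t / k) - t))"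
      using a1(1) by simp
    show "set_integrable lborel {0<..} (\<lambda>k. (k * Im (F (of_real k)) + c1 \<gamma> / 2) - 2 * jsum \<gamma> (\<lambda>t. k * arctan (t / k) - t))"
      by (rule set_integral_diff(1)[OF F2(1) m])
    show "(LINT k:{0<..}|lborel. (k * Im (F (of_real k)) + c1 \<gamma> / 2) - 2 * jsum \<gamma> (\<lambda>t. k * arctan (t / k) - t))
        = pi * v 0 0 / 8 - 2 * (- pi / 4 * Smom \<gamma> 2)"
      unfolding set_integral_diff(2)[OF F2(1) m] F2(2) set_integral_mult_right a1(2) ..
    show "(limit_phase U \<gamma> k - I / (2 * k)) * k
        = (k * Im (F (of_real k)) + c1 \<gamma> / 2) - 2 * jsum \<gamma> (\<lambda>t. k * arctan (t / k) - t)" if "0 < k" for k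
      unfolding s1 phase[OF that] \<eta>_def c1_def I_def using that by (simp add: field_simps)
  qed
  have L4: "set_integrable lborel {0<..} (\<lambda>k. (limit_phase U \<gamma> k - I / (2 * k) - (J + 4 * \<gamma> * v 0 0 - v 1 0) / (2 * k) ^ 3) * k ^ 3) \<and>
      (LINT k:{0<..}|lborel. (limit_phase U \<gamma> k - I / (2 * k) - (J + 4 * \<gamma> * v 0 0 - v 1 0) / (2 * k) ^ 3) * k ^ 3)
        = - pi * c4 \<gamma> / 32 - 2 * (pi / 8 * Smom \<gamma> 4)"
  proof (rule tr)
    have m: "set_integrable lborel {0<..} (\<lambda>k. 2 * jsum \<gamma> (\<lambda>t. k ^ 3 * arctan (t / k) - t * k\<^sup>2 + t ^ 3 / 3))"
      using a3(1) by simp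
    show "set_integrable lborel {0<..} (\<lambda>k. (k ^ 3 * Im (F (of_real k)) + c1 \<gamma> / 2 * k\<^sup>2 - c3 \<gamma> / 8)
        - 2 * jsum \<gamma> (\<lambda>t. k ^ 3 * arctan (t / k) - t * k\<^sup>2 + t ^ 3 / 3))"
      by (rule set_integral_diff(1)[OF F4(1) m])
    show "(LINT k:{0<..}|lborel. (k ^ 3 * Im (F (of_real k)) + c1 \<gamma> / 2 * k\<^sup>2 - c3 \<gamma> / 8)
        - 2 * jsum \<gamma> (\<lambda>t. k ^ 3 * arctan (t / k) - t * k\<^sup>2 + t ^ 3 / 3)) = - pi * c4 \<gamma> / 32 - 2 * (pi / 8 * Smom \<gamma> 4)"
      unfolding set_integral_diff(2)[OF F4(1) m] F4(2) set_integral_mult_right a3(2) ..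
    fix k :: real assume k: "0 < k"
    define a where "a = jsum \<gamma> (\<lambda>t. arctan (t / k))"
    let ?P = "J + 4 * \<gamma> * v 0 0 - v 1 0"
    have "(\<eta> k - I / (2 * k) - ?P / (2 * k) ^ 3) * k ^ 3 = \<eta> k * k ^ 3 - I / 2 * k\<^sup>2 - ?P / 8"
    proof -
      have "I / (2 * k) * k ^ 3 = I / 2 * k\<^sup>2" "?P / (2 * k) ^ 3 * k ^ 3 = ?P / 8"
        using k by (simp_all add: power_mult_distrib eval_nat_numeral)
      then show ?thesis by (simp only: left_diff_distrib)
    qed
    also have "\<dots> = (k ^ 3 * Im (F (of_real k)) + c1 \<gamma> / 2 * k\<^sup>2 - c3 \<gamma> / 8) - 2 * (k ^ 3 * a - Smom \<gamma> 1 * k\<^sup>2 + Smom \<gamma> 3 / 3)"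
      unfolding \<eta>_def a_def[symmetric] c1_def c3_def I_def[symmetric] J_def[symmetric] by (simp add: field_simps)
    finally show "(limit_phase U \<gamma> k - I / (2 * k) - ?P / (2 * k) ^ 3) * k ^ 3
        = (k ^ 3 * Im (F (of_real k)) + c1 \<gamma> / 2 * k\<^sup>2 - c3 \<gamma> / 8) - 2 * jsum \<gamma> (\<lambda>t. k ^ 3 * arctan (t / k) - t * k\<^sup>2 + t ^ 3 / 3)"
      unfolding s3 phase[OF k] a_def .
  qed
  show ?i1 ?i2 ?i3 ?i4 using L1 L2 L3 L4 by blast+
  show ?t1 unfolding S1 conjunct2[OF L1] c1_def I_def[symmetric] by (simp add: field_simps)
  show ?t2 unfolding S2 conjunct2[OF L2] by (simp add: field_simps)
  show ?t3 unfolding S3 conjunct2[OF L3] c3_def J_def[symmetric] by (simp add: field_simps)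
  show ?t4 unfolding S4 conjunct2[OF L4] c4_def by (simp add: field_simps)
qed

end

lemma hderiv_has_real_derivative:
  assumes "smooth_half_line V" "0 \<le> x"
  shows "((hderiv ^^ j) V has_real_derivative (hderiv ^^ Suc j) V x) (at x within {0..})"
proof -
  have "(hderiv ^^ j) V differentiable (at x within {0..})" using assms by (simp add: smooth_half_line_def)
  then show ?thesis
    by (simp add: has_real_derivative_iff_has_vector_derivative hderiv_def flip: vector_derivative_works)
qed

theorem corollary5p4:
  fixes V :: "real \<Rightarrow> real" and \<gamma> \<rho> :: real and C :: "nat \<Rightarrow> real"
  assumes smooth: "smooth_half_line V"
    and moment: "set_integrable lborel {0..} (\<lambda>x. (1 + x) * \<bar>V x\<bar>)"
    and rho: "1 < \<rho>" "\<rho> \<le> 2"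
    and decay: "\<And>j x. 0 \<le> x \<Longrightarrow> \<bar>(hderiv ^^ j) V x\<bar> \<le> C j * (1 + x) powr (- \<rho> - real j)"
  shows "finite (neg_eigenvalues V \<gamma>) \<and>
     set_integrable lborel {0<..} (\<lambda>k. ln (limit_amplitude V \<gamma> k)) \<and>
     ((\<Sum>\<mu>\<in>neg_eigenvalues V \<gamma>. \<bar>\<mu>\<bar> powr (1/2)) - M_term (1/2) \<gamma>
           - 1/pi * (LINT k:{0<..}|lborel. ln (limit_amplitude V \<gamma> k))
         = - 1/4 * (LINT x:{0..}|lborel. V x)) \<and>
     set_integrable lborel {0<..}
           (\<lambda>k. (limit_phase V \<gamma> k - (LINT x:{0..}|lborel. V x) / (2 * k)) * k) \<and>
     ((\<Sum>\<mu>\<in>neg_eigenvalues V \<gamma>. \<bar>\<mu>\<bar>) - M_term 1 \<gamma>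
           - 2/pi * (LINT k:{0<..}|lborel.
               (limit_phase V \<gamma> k - (LINT x:{0..}|lborel. V x) / (2 * k)) * k)
         = - 1/4 * V 0) \<and>
     set_integrable lborel {0<..}
           (\<lambda>k. (ln (limit_amplitude V \<gamma> k) + V 0 / (2 * k)\<^sup>2) * k\<^sup>2) \<and>
     ((\<Sum>\<mu>\<in>neg_eigenvalues V \<gamma>. \<bar>\<mu>\<bar> powr (3/2)) - M_term (3/2) \<gamma>
           + 3/pi * (LINT k:{0<..}|lborel.
               (ln (limit_amplitude V \<gamma> k) + V 0 / (2 * k)\<^sup>2) * k\<^sup>2)
         = 3/16 * ((LINT x:{0..}|lborel. (V x)\<^sup>2) - hderiv V 0 + 4 * \<gamma> * V 0)) \<and>
     set_integrable lborel {0<..}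
           (\<lambda>k. (limit_phase V \<gamma> k - (LINT x:{0..}|lborel. V x) / (2 * k)
                 - ((LINT x:{0..}|lborel. (V x)\<^sup>2) + 4 * \<gamma> * V 0 - hderiv V 0) / (2 * k) ^ 3) * k ^ 3) \<and>
     ((\<Sum>\<mu>\<in>neg_eigenvalues V \<gamma>. \<bar>\<mu>\<bar>\<^sup>2) - M_term 2 \<gamma>
           + 4/pi * (LINT k:{0<..}|lborel.
               (limit_phase V \<gamma> k - (LINT x:{0..}|lborel. V x) / (2 * k)
                 - ((LINT x:{0..}|lborel. (V x)\<^sup>2) + 4 * \<gamma> * V 0 - hderiv V 0) / (2 * k) ^ 3) * k ^ 3)
         = - 1/8 * ((hderiv ^^ 2) V 0 + 8 * \<gamma>\<^sup>2 * V 0 - 4 * \<gamma> * hderiv V 0 - 2 * (V 0)\<^sup>2))"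
proof -
  \<comment> \<open>Continuation by the value at 0 makes every derivative continuous on the line,
    while the derivative relations are kept within {0..}.\<close>
  define v where "v j x = (hderiv ^^ j) V (max 0 x)" for j x
  define U where "U = v 0"
  define D where "D = (\<Sum>j\<le>5. \<bar>C j\<bar>)"
  have v: "v j x = (hderiv ^^ j) V x" if "0 \<le> x" for j x using that by (simp add: v_def)
  have U: "U x = V x" if "0 \<le> x" for x using v[OF that, of 0] by (simp add: U_def)
  have bound: "\<bar>v j x\<bar> \<le> D * (1 + x) powr (- \<rho> - real j)" if "0 \<le> x" "j \<le> 5" for j x
  proof -
    have "\<bar>C j\<bar> \<le> D" unfolding D_def using that(2) by (intro member_le_sum) auto
    then have "C j * (1 + x) powr (- \<rho> - real j) \<le> D * (1 + x) powr (- \<rho> - real j)"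
      by (intro mult_right_mono) auto
    then show ?thesis using decay[OF that(1), of j] v[OF that(1)] by simp
  qed
  interpret J: jost_smooth U v \<rho> D
  proof
    have c: "continuous_on {0..} ((hderiv ^^ j) V)" for j
      using smooth by (auto simp: smooth_half_line_def continuous_on_eq_continuous_within
          intro!: differentiable_imp_continuous_within)
    show cv: "continuous_on UNIV (v j)" for j
      unfolding v_def[abs_def] by (rule continuous_on_compose2[OF c]) (auto intro!: continuous_intros)
    show "continuous_on UNIV U" unfolding U_def by (rule cv)
    show "set_integrable lborel {0..} (\<lambda>x. (1 + x) * \<bar>U x\<bar>)"
      using moment U set_integrable_cong[of lborel lborel "{0..}" "{0..}" "\<lambda>x. (1 + x) * \<bar>V x\<bar>" "\<lambda>x. (1 + x) * \<bar>U x\<bar>"]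
      by auto
    show "v 0 = U" by (simp add: U_def)
    show "(v j has_real_derivative v (Suc j) x) (at x within {0..})" if "0 \<le> x" for j x
      unfolding v[OF that]
      using hderiv_has_real_derivative[OF smooth that, of j] that v
      unfolding has_real_derivative_iff_has_vector_derivative
      by (intro has_vector_derivative_transform[of x "{0..}" "v j" "(hderiv ^^ j) V"]) auto
  qed (use rho bound in auto)
  have M: "\<bar>U x\<bar> \<le> D" if "0 \<le> x" for x
  proof -
    have "(1 + x) powr (- \<rho> - real 0) \<le> (1 + x) powr 0" using that rho by (intro powr_mono) auto
    moreover have "0 \<le> D" by (simp add: D_def sum_nonneg)
    ultimately have "D * (1 + x) powr (- \<rho> - real 0) \<le> D * 1" using that by (intro mult_left_mono) auto
    then show ?thesis using bound[OF that, of 0] by (simp add: U_def)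
  qed
  have I: "(LINT x:{0..}|lborel. U x) = (LINT x:{0..}|lborel. V x)"
    by (intro set_lebesgue_integral_cong) (auto simp: U)
  have I2: "(LINT x:{0..}|lborel. v 0 x * v 0 x) = (LINT x:{0..}|lborel. (V x)\<^sup>2)"
    by (intro set_lebesgue_integral_cong) (auto simp: v power2_eq_square)
  have v0: "v 0 0 = V 0" "v 1 0 = hderiv V 0" "v 2 0 = (hderiv ^^ 2) V 0" by (simp_all only: v order_refl) simp_all
  \<comment> \<open>The locale was instantiated with the continued potential; the given V takes the
    place of \<open>U\<close> in its results.\<close>
  note t = J.trace_formulas[of V D \<gamma>, OF U[symmetric] M, unfolded I I2 v0]
  show ?thesis by (intro conjI t)
qed

end
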